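(* Let $(\xi_t)_{t\in\mathbb{Z}}$ be a real-valued strictly stationary time series, let $(r_n)$ be positive integers and $k_n=\lfloor n/r_n\rfloor$, with $r_n\to\infty$ and $k_n\to\infty$ as $n\to\infty$. Write $M_{r,i}=\max(\xi_{(i-1)r+1},\ldots,\xi_{ir})$ and $M_r=M_{r,1}$. Suppose that all of the following hold: (a) (Domain of attraction) There exist positive numbers $\sigma_n\to\infty$ and $\alpha_0>0$ such that $M_n/\sigma_n\rightsquigarrow\text{Fr\'echet}(\alpha_0,1)$ as $n\to\infty$; moreover $\sigma_{m_n}/\sigma_n\to1$ for every integer sequence $(m_n)$ with $m_n/n\to1$. (b) (All block maxima diverge) For every $c\in(0,\infty)$, $\lim_{n\to\infty}\Pr[\min(M_{r_n,1},\ldots,M_{r_n,k_n})\le c]=0$. (c) ($\alpha$-mixing with rate) $\lim_{\ell\to\infty}\alpha(\ell)=0$, and there exists $\omega>0$ such that $k_n^{1+\omega}\alpha(r_n)\to0$ as $n\to\infty$. (d) (Moments) There exists $\nu>2/\omega$, with $\omega$ from (c), such that $\limsup_{n\to\infty}\mathrm{E}\bigl[g_{\nu,\alpha_0}\bigl((M_n\vee1)/\sigma_n\bigr)\bigr]<\infty$, where $g_{\nu,\alpha_0}(x)=\{x^{-\alpha_0}\mathbf{1}(x\le e)+\log(x)\mathbf{1}(x>e)\}^{2+\nu}$. (e) (Bias) There exists $c\in(0,\infty)$ such that for each of the functions $f\in\{f_1,f_2,f_3\}$, where $f_1(x)=x^{-\alpha_0}\log x$, $f_2(x)=x^{-\alpha_0}$,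 $f_3(x)=\log x$, the following limit exists: $$B(f)=\lim_{n\to\infty}\sqrt{k_n}\left(\mathrm{E}\bigl[f\bigl((M_{r_n}\vee c)/\sigma_{r_n}\bigr)\bigr]-\int_0^\infty f(x)\,p_{\alpha_0,1}(x)\,\mathrm{d}x\right).$$ Fix $c$ as in (e). Then, with probability tending to one, there exists a unique maximizer $(\hat\alpha_n,\hat\sigma_n)$ over $(0,\infty)^2$ of the Fr\'echet log-likelihood based on the block maxima $M_{r_n,1},\ldots,M_{r_n,k_n}$, and, as $n\to\infty$, $$\begin{pmatrix}\sqrt{k_n}(\hat\alpha_n-\alpha_0)\\ \sqrt{k_n}(\hat\sigma_n/\sigma_{r_n}-1)\end{pmatrix}=M(\alpha_0)\begin{pmatrix}\mathbb{G}_nf_1\\ \mathbb{G}_nf_2\\ \mathbb{G}_nf_3\end{pmatrix}+o_p(1)\rightsquigarrow\mathcal{N}_2\bigl(M(\alpha_0)B,\;I_{(\alpha_0,1)}^{-1}\bigr),$$ where $B=(B(f_1),B(f_2),B(f_3))^T$ and $$\mathbb{G}_nf=\sqrt{k_n}\left(\frac1{k_n}\sum_{i=1}^{k_n}f\bigl((M_{r_n,i}\vee c)/\sigma_{r_n}\bigr)-\int_0^\infty f(x)\,p_{\alpha_0,1}(x)\,\mathrm{d}x\right).$$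
   Context: $\rightsquigarrow$ denotes weak convergence; $a\vee b=\max(a,b)$. For $(\alpha,\sigma)\in(0,\infty)^2$, $\text{Fr\'echet}(\alpha,\sigma)$ has cdf $\exp\{-(x/\sigma)^{-\alpha}\}$ and density $p_{\alpha,\sigma}(x)=\frac\alpha\sigma\exp\{-(x/\sigma)^{-\alpha}\}(x/\sigma)^{-\alpha-1}$, $x>0$. The Fr\'echet log-likelihood of a sample $x_1,\ldots,x_k\in(0,\infty)$ is $(\alpha,\sigma)\mapsto\sum_{i=1}^k\{\log(\alpha/\sigma)-(x_i/\sigma)^{-\alpha}-(\alpha+1)\log(x_i/\sigma)\}$. Rosenblatt mixing coefficients: $\alpha(\ell)=\sup\{|\Pr(A\cap B)-\Pr(A)\Pr(B)|:A\in\sigma(\xi_t:t\le0),\,B\in\sigma(\xi_t:t\ge\ell)\}$, where $\sigma(\,\cdot\,)$ is the generated $\sigma$-field. With $\Gamma$ the gamma function, $\gamma=-\Gamma'(1)$ the Euler--Mascheroni constant and $\Gamma''(2)=(1-\gamma)^2+\pi^2/6-1$, $$M(\alpha_0)=\frac{6}{\pi^2}\begin{pmatrix}\alpha_0^2 & \alpha_0(1-\gamma) & -\alpha_0^2\\ \gamma-1 & -(\Gamma''(2)+1)/\alpha_0 & 1-\gamma\end{pmatrix},$$ $$I_{(\alpha_0,1)}^{-1}=\frac6{\pi^2}\begin{pmatrix}\alpha_0^2&\gamma-1\\ \gamma-1&\alpha_0^{-2}\{(1-\gamma)^2+\pi^2/6\}\end{pmatrix},$$ the latter being the inverse of the Fisher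 information matrix of the Fr\'echet family at $(\alpha_0,1)$. $\mathcal{N}_2(\mu,\Sigma)$ is the bivariate normal distribution with mean $\mu$ and covariance matrix $\Sigma$. *)

theory Defs
  imports "HOL-Probability.Probability"
begin

section \<open>Time series, block maxima and mixing\<close>

definition strictly_stationary :: "'a measure \<Rightarrow> (int \<Rightarrow> 'a \<Rightarrow> real) \<Rightarrow> bool" where
  "strictly_stationary M \<xi> \<longleftrightarrow>
     (\<forall>J h. finite J \<longrightarrow>
        distr M (PiM J (\<lambda>_. borel)) (\<lambda>w. \<lambda>t\<in>J. \<xi> (t + h) w) =
        distr M (PiM J (\<lambda>_. borel)) (\<lambda>w. \<lambda>t\<in>J. \<xi> t w))"

text \<open>Blocks are numbered from \<open>i = 1\<close>, and the block length \<open>r\<close> has to be positive.\<close>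

definition block_max :: "(int \<Rightarrow> 'a \<Rightarrow> real) \<Rightarrow> nat \<Rightarrow> nat \<Rightarrow> 'a \<Rightarrow> real" where
  "block_max \<xi> r i w = Max ((\<lambda>t. \<xi> t w) ` {(int i - 1) * int r + 1 .. int i * int r})"

definition generated_events :: "'a measure \<Rightarrow> (int \<Rightarrow> 'a \<Rightarrow> real) \<Rightarrow> int set \<Rightarrow> 'a set set" where
  "generated_events M \<xi> T =
     sigma_sets (space M) (\<Union>t\<in>T. {\<xi> t -` A \<inter> space M | A. A \<in> sets borel})"

definition mixing_coeff :: "'a measure \<Rightarrow> (int \<Rightarrow> 'a \<Rightarrow> real) \<Rightarrow> nat \<Rightarrow> real" where
  "mixing_coeff M \<xi> l =
     Sup {\<bar>measure M (A \<inter> B) - measure M A * measure M B\<bar> | A B.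
            A \<in> generated_events M \<xi> {..0} \<and> B \<in> generated_events M \<xi> {int l..}}"

section \<open>Modes of convergence\<close>

text \<open>The library's \<^const>\<open>weak_conv_m\<close> is restricted to measures on the real line; this is the
  corresponding notion on a general topological space.\<close>

definition weak_conv_bounded ::
    "(nat \<Rightarrow> 'b::topological_space measure) \<Rightarrow> 'b measure \<Rightarrow> bool" where
  "weak_conv_bounded \<mu> \<nu> \<longleftrightarrow>
     (\<forall>f :: 'b \<Rightarrow> real. continuous_on UNIV f \<longrightarrow> bounded (range f) \<longrightarrow>
        (\<lambda>n. \<integral>x. f x \<partial>\<mu> n) \<longlonglongrightarrow> (\<integral>x. f x \<partial>\<nu>))"

definition small_o_p :: "'a measure \<Rightarrow> (nat \<Rightarrow> 'a \<Rightarrow> 'b::real_normed_vector) \<Rightarrow> bool" where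
  "small_o_p M X \<longleftrightarrow>
     (\<forall>\<epsilon>>0. (\<lambda>n. measure M {w \<in> space M. norm (X n w) > \<epsilon>}) \<longlonglongrightarrow> 0)"

section \<open>Distributions\<close>

definition frechet_density :: "real \<Rightarrow> real \<Rightarrow> real \<Rightarrow> real" where
  "frechet_density \<alpha> \<sigma> x =
     (if 0 < x then \<alpha> / \<sigma> * exp (- ((x / \<sigma>) powr (- \<alpha>))) * (x / \<sigma>) powr (- \<alpha> - 1) else 0)"

definition frechet :: "real \<Rightarrow> real \<Rightarrow> real measure" where
  "frechet \<alpha> \<sigma> = density lborel (\<lambda>x. ennreal (frechet_density \<alpha> \<sigma> x))"

definition frechet_integral :: "real \<Rightarrow> (real \<Rightarrow> real) \<Rightarrow> real" where
  "frechet_integral \<alpha> f = (LINT x:{0<..}|lborel. f x * frechet_density \<alpha> 1 x)"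

text \<open>Multivariate normal law, given by its Lebesgue density; this is meaningful only for
  symmetric positive definite \<open>\<Sigma>\<close>.\<close>

definition normal_law :: "real^'n \<Rightarrow> real^'n^'n \<Rightarrow> (real^'n) measure" where
  "normal_law \<mu> \<Sigma> = density lborel (\<lambda>x. ennreal
     (exp (- ((x - \<mu>) \<bullet> (matrix_inv \<Sigma> *v (x - \<mu>))) / 2) / sqrt ((2 * pi) ^ CARD('n) * det \<Sigma>)))"

section \<open>Frechet likelihood\<close>

definition frechet_loglik :: "nat \<Rightarrow> (nat \<Rightarrow> real) \<Rightarrow> real \<times> real \<Rightarrow> real" where
  "frechet_loglik k x = (\<lambda>(\<alpha>, \<sigma>).
     \<Sum>i=1..k. ln (\<alpha> / \<sigma>) - (x i / \<sigma>) powr (- \<alpha>) - (\<alpha> + 1) * ln (x i / \<sigma>))"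

text \<open>The likelihood is only defined for samples in \<open>(0, \<infinity>)\<close>, so positivity of
  the sample is part of being a maximizer.\<close>

definition frechet_maximizer :: "nat \<Rightarrow> (nat \<Rightarrow> real) \<Rightarrow> real \<times> real \<Rightarrow> bool" where
  "frechet_maximizer k x \<theta> \<longleftrightarrow>
     (\<forall>i\<in>{1..k}. 0 < x i) \<and> \<theta> \<in> {0<..} \<times> {0<..} \<and>
     (\<forall>\<theta>'\<in>{0<..} \<times> {0<..}. frechet_loglik k x \<theta>' \<le> frechet_loglik k x \<theta>)"

text \<open>\<open>x n 1 w, \<dots>, x n (k n) w\<close> is the \<open>n\<close>-th sample. With probability tending to one, its
  likelihood has a unique maximizer, and this maximizer is \<open>(a n w, s n w)\<close>; off the events \<open>E n\<close>
  the random variables \<open>a n\<close> and \<open>s n\<close> are arbitrary.\<close>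

definition asymptotic_frechet_mle ::
    "'a measure \<Rightarrow> (nat \<Rightarrow> nat) \<Rightarrow> (nat \<Rightarrow> nat \<Rightarrow> 'a \<Rightarrow> real) \<Rightarrow>
     (nat \<Rightarrow> 'a \<Rightarrow> real) \<Rightarrow> (nat \<Rightarrow> 'a \<Rightarrow> real) \<Rightarrow> bool" where
  "asymptotic_frechet_mle M k x a s \<longleftrightarrow>
     (\<forall>n. a n \<in> borel_measurable M \<and> s n \<in> borel_measurable M) \<and>
     (\<exists>E. (\<forall>n. E n \<in> sets M) \<and> (\<lambda>n. measure M (E n)) \<longlonglongrightarrow> 1 \<and>
        (\<forall>n. \<forall>w\<in>E n. \<forall>\<theta>.
           frechet_maximizer (k n) (\<lambda>i. x n i w) \<theta> \<longleftrightarrow> \<theta> = (a n w, s n w)))"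

section \<open>Test functions, empirical process and limit matrices\<close>

definition g_mom :: "real \<Rightarrow> real \<Rightarrow> real \<Rightarrow> real" where
  "g_mom \<nu> \<alpha> x =
     (x powr (- \<alpha>) * indicator {..exp 1} x + ln x * indicator {exp 1<..} x) powr (2 + \<nu>)"

definition f1 :: "real \<Rightarrow> real \<Rightarrow> real" where "f1 \<alpha> x = x powr (- \<alpha>) * ln x"
definition f2 :: "real \<Rightarrow> real \<Rightarrow> real" where "f2 \<alpha> x = x powr (- \<alpha>)"
definition f3 :: "real \<Rightarrow> real" where "f3 x = ln x"

definition emp_proc ::
    "(int \<Rightarrow> 'a \<Rightarrow> real) \<Rightarrow> (nat \<Rightarrow> nat) \<Rightarrow> (nat \<Rightarrow> nat) \<Rightarrow> (nat \<Rightarrow> real) \<Rightarrow> real \<Rightarrow> real \<Rightarrow>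
     nat \<Rightarrow> (real \<Rightarrow> real) \<Rightarrow> 'a \<Rightarrow> real" where
  "emp_proc \<xi> r k \<sigma> \<alpha>\<^sub>0 c n f w =
     sqrt (real (k n)) *
       (1 / real (k n) * (\<Sum>i=1..k n. f (max (block_max \<xi> (r n) i w) c / \<sigma> (r n)))
        - frechet_integral \<alpha>\<^sub>0 f)"

definition M_mat :: "real \<Rightarrow> real^3^2" where
  "M_mat \<alpha>\<^sub>0 = (6 / pi^2) *\<^sub>R vector
     [vector [\<alpha>\<^sub>0^2, \<alpha>\<^sub>0 * (1 - euler_mascheroni), - (\<alpha>\<^sub>0^2)],
      vector [euler_mascheroni - 1, - (((deriv ^^ 2) Gamma 2 + 1) / \<alpha>\<^sub>0), 1 - euler_mascheroni]]"

definition I_inv :: "real \<Rightarrow> real^2^2" where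
  "I_inv \<alpha>\<^sub>0 = (6 / pi^2) *\<^sub>R vector
     [vector [\<alpha>\<^sub>0^2, euler_mascheroni - 1],
      vector [euler_mascheroni - 1, ((1 - euler_mascheroni)^2 + pi^2 / 6) / \<alpha>\<^sub>0^2]]"

end

theory Submission imports Defs begin

text \<open>
  The proof separates a deterministic analysis of the likelihood from the probability theory of
  sums over blocks.

  For a fixed shape \<open>a\<close> the Frechet log-likelihood of a positive sample is maximal in the scale at
  \<open>(mean of x_i powr (- a)) powr (- 1 / a)\<close>. Up to the factor \<open>k\<close>, the derivative in \<open>a\<close> of the
  profile that remains is
  \<open>1 / a + (mean of x_i powr (- a) * ln x_i) / (mean of x_i powr (- a)) - (mean of ln x_i)\<close>.
  By the Cauchy-Schwarz inequality this score is strictly decreasing, even with slope at most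
  \<open>- 1 / a^2\<close>; therefore any positive zero of it gives the unique maximizer
  (\<open>frechet_maximizer_unique\<close>), and a small score at \<open>\<alpha>\<^sub>0\<close> forces a zero close to \<open>\<alpha>\<^sub>0\<close>
  (\<open>profile_score_root_localized\<close>). Expanding the score and the scale around \<open>\<alpha>\<^sub>0\<close> expresses both
  estimation errors through the three means that define \<open>G f\<^sub>1\<close>, \<open>G f\<^sub>2\<close> and \<open>G f\<^sub>3\<close>
  (\<open>maximizer_expansion\<close>). This part holds pointwise, along a filter of pairs \<open>(n, w)\<close> for which
  those means deviate by at most \<open>C n / sqrt (k n)\<close> from their limits, where \<open>C n\<close> tends to infinity
  so slowly that all remainders vanish. The coefficients of the expansion are Frechet moments; under
  \<open>y = x powr (- \<alpha>)\<close> they become logarithmic moments of the exponential law, that is, derivatives of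
  the Gamma function (\<open>frechet_moments\<close>).

  The stochastic part is a central limit theorem for sums over the block maxima
  (\<open>centered_sum_clt\<close>). Blocks that are not adjacent are separated by a whole block, so truncation
  at a level balancing the moment condition against the mixing rate makes the sum of all their
  covariances negligible. Adjacent blocks have no gap between them, but leaving out the last few
  observations of the first block rarely changes its maximum, and this opens a gap; so their
  covariance tends to zero as well. The sums consequently have the limiting variance of independent
  blocks, and the same bound gives, by Chebyshev's inequality, the events of probability tending to
  one on which the deterministic part operates. For normality, indices are grouped into runs of
  bounded length separated by one omitted index; by mixing the characteristic function nearly
  factorizes over the runs, and a second-order Taylor expansion of each factor gives the Gaussian
  limit (\<open>clt_weakly_dependent_array\<close>).

  Finally, every linear combination of the two estimation errors is, up to a negligible term, the
  empirical process at one linear combination of the \<open>f\<^sub>i\<close>. This identifies the limiting bivariate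
  characteristic function: the bias conditions give the mean and \<open>frechet_moments\<close> the covariance.
  Convergence of bivariate characteristic functions implies weak convergence
  (\<open>weak_conv_bounded_real2I\<close>), which is reduced to the one-dimensional continuity theorem by
  weighting the laws with functions of one coordinate.
\<close>

section \<open>Weak convergence in the plane from characteristic functions\<close>

text \<open>A weight \<open>w \<ge> 1\<close> turns weighted integrals of functions of \<open>l\<close> into integrals against a
  probability measure on the line, to which the one-dimensional theory applies. The lower bound
  keeps the normalizing constant away from zero.\<close>

lemma tilted_distribution:
  fixes w l :: "'b \<Rightarrow> real"
  assumes "prob_space \<mu>" and [measurable]: "w \<in> borel_measurable \<mu>" "l \<in> borel_measurable \<mu>"
    and w: "\<And>x. 1 \<le> w x" "\<And>x. w x \<le> b"
  defines "m \<equiv> \<integral>x. w x \<partial>\<mu>"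
  defines "P \<equiv> distr (density \<mu> (\<lambda>x. ennreal (w x / m))) borel l"
  shows "1 \<le> m" "real_distribution P"
    "\<And>g :: real \<Rightarrow> 'c::{banach, second_countable_topology}.
       g \<in> borel_measurable borel \<Longrightarrow>
       (\<integral>x. g x \<partial>P) = (1 / m) *\<^sub>R (\<integral>x. w x *\<^sub>R g (l x) \<partial>\<mu>)"
proof -
  interpret prob_space \<mu> by fact
  have wi: "integrable \<mu> w"
    by (rule integrable_const_bound[where B=b]) (use w in \<open>auto intro!: AE_I2 simp: abs_le_iff intro: order_trans[of _ 1]\<close>, smt (verit) w)
  have "(\<integral>x. 1 \<partial>\<mu>) \<le> m" unfolding m_def
    by (rule integral_mono) (use wi w in auto)
  then show m: "1 \<le> m" by (simp add: prob_space)
  have w0: "0 \<le> w x" for x using w(1)[of x] by linarith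
  have "(\<integral>\<^sup>+x. ennreal (w x / m) \<partial>\<mu>) = ennreal (\<integral>x. w x / m \<partial>\<mu>)"
    by (rule nn_integral_eq_integral) (use wi w0 m in auto)
  also have "\<dots> = 1" using m by (simp add: m_def[symmetric])
  finally have "prob_space (density \<mu> (\<lambda>x. ennreal (w x / m)))"
    by (intro prob_spaceI) (simp add: emeasure_density cong: nn_integral_cong)
  then have "prob_space P" unfolding P_def by (rule prob_space.prob_space_distr) simp
  then show "real_distribution P"
    unfolding P_def by (intro real_distribution.intro real_distribution_axioms.intro) auto
  fix g :: "real \<Rightarrow> 'c" assume [measurable]: "g \<in> borel_measurable borel"
  have "(\<integral>x. g x \<partial>P) = (\<integral>x. (w x / m) *\<^sub>R g (l x) \<partial>\<mu>)"
    unfolding P_def by (subst integral_distr, simp, simp, subst integral_density) (use w0 m in auto)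
  also have "\<dots> = (\<integral>x. (1 / m) *\<^sub>R (w x *\<^sub>R g (l x)) \<partial>\<mu>)" by simp
  also have "\<dots> = (1 / m) *\<^sub>R (\<integral>x. w x *\<^sub>R g (l x) \<partial>\<mu>)" by (rule integral_scaleR_right)
  finally show "(\<integral>x. g x \<partial>P) = (1 / m) *\<^sub>R (\<integral>x. w x *\<^sub>R g (l x) \<partial>\<mu>)" .
qed

text \<open>Levy's continuity theorem for the tilted distributions of \<open>l\<close>; the convergence of their
  normalizing constants is the case \<open>t = 0\<close> of the hypothesis.\<close>

lemma weighted_levy_continuity:
  fixes w l :: "'b \<Rightarrow> real" and \<mu> :: "nat \<Rightarrow> 'b measure"
  assumes P: "\<And>n. prob_space (\<mu> n)" "prob_space \<nu>"
    and [simp]: "\<And>n. sets (\<mu> n) = sets N" "sets \<nu> = sets N"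
    and meas [measurable]: "w \<in> borel_measurable N" "l \<in> borel_measurable N"
    and w: "\<And>x. 1 \<le> w x" "\<And>x. w x \<le> b"
    and char_conv: "\<And>t. (\<lambda>n. \<integral>x. w x *\<^sub>R iexp (t * l x) \<partial>\<mu> n) \<longlonglongrightarrow> (\<integral>x. w x *\<^sub>R iexp (t * l x) \<partial>\<nu>)"
    and f: "continuous_on UNIV f" "\<And>x::real. \<bar>f x\<bar> \<le> (B::real)"
  shows "(\<lambda>n. \<integral>x. w x * f (l x) \<partial>\<mu> n) \<longlonglongrightarrow> (\<integral>x. w x * f (l x) \<partial>\<nu>)"
proof -
  define m where "m n = (\<integral>x. w x \<partial>\<mu> n)" for n
  define m' where "m' = (\<integral>x. w x \<partial>\<nu>)"
  define Q where "Q n = distr (density (\<mu> n) (\<lambda>x. ennreal (w x / m n))) borel l" for n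
  define Q' where "Q' = distr (density \<nu> (\<lambda>x. ennreal (w x / m'))) borel l"
  have ms [measurable]: "w \<in> borel_measurable (\<mu> n)" "l \<in> borel_measurable (\<mu> n)"
    "w \<in> borel_measurable \<nu>" "l \<in> borel_measurable \<nu>" for n
    using meas by (simp_all cong: measurable_cong_sets)
  note T = tilted_distribution[OF P(1) ms(1,2) w, folded m_def, folded Q_def]
  note T' = tilted_distribution[OF P(2) ms(3,4) w, folded m'_def, folded Q'_def]
  have fm: "f \<in> borel_measurable borel" using f(1) by (rule borel_measurable_continuous_onI)
  have "(\<lambda>n. Re (\<integral>x. w x *\<^sub>R iexp (0 * l x) \<partial>\<mu> n)) \<longlonglongrightarrow> Re (\<integral>x. w x *\<^sub>R iexp (0 * l x) \<partial>\<nu>)"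
    by (intro tendsto_Re char_conv)
  moreover have "(\<integral>x. w x *\<^sub>R iexp (0 * l x) \<partial>\<mu> n) = of_real (m n)" for n
    by (simp add: m_def scaleR_conv_of_real)
  moreover have "(\<integral>x. w x *\<^sub>R iexp (0 * l x) \<partial>\<nu>) = of_real m'"
    by (simp add: m'_def scaleR_conv_of_real)
  ultimately have mc: "m \<longlonglongrightarrow> m'" by simp
  have imt [measurable]: "(\<lambda>x. iexp (t * x)) \<in> borel_measurable borel" for t :: real
    by (intro borel_measurable_continuous_onI continuous_intros)
  have "weak_conv_m Q Q'"
  proof (rule levy_continuity)
    show "real_distribution (Q n)" "real_distribution Q'" for n using T(2) T'(2) by auto
    fix t
    have "(\<lambda>n. (1 / m n) *\<^sub>R (\<integral>x. w x *\<^sub>R iexp (t * l x) \<partial>\<mu> n)) \<longlonglongrightarrow> (1 / m') *\<^sub>R (\<integral>x. w x *\<^sub>R iexp (t * l x) \<partial>\<nu>)"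
      using T'(1) by (intro tendsto_scaleR char_conv tendsto_divide mc tendsto_const) auto
    then show "(\<lambda>n. char (Q n) t) \<longlonglongrightarrow> char Q' t"
      unfolding char_def by (subst T(3) T'(3); measurable)+
  qed
  then have "(\<lambda>n. \<integral>x. f x \<partial>Q n) \<longlonglongrightarrow> (\<integral>x. f x \<partial>Q')"
    by (intro weak_conv_imp_integral_bdd_continuous_conv[where B=B] T(2) T'(2))
       (use f in \<open>auto simp: continuous_on_eq_continuous_at\<close>)
  then have "(\<lambda>n. m n *\<^sub>R (\<integral>x. f x \<partial>Q n)) \<longlonglongrightarrow> m' *\<^sub>R (\<integral>x. f x \<partial>Q')"
    by (intro tendsto_scaleR mc)
  moreover have "m n *\<^sub>R (\<integral>x. f x \<partial>Q n) = (\<integral>x. w x * f (l x) \<partial>\<mu> n)" for n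
    using T(1)[of n] by (subst T(3)[OF fm]) auto
  moreover have "m' *\<^sub>R (\<integral>x. f x \<partial>Q') = (\<integral>x. w x * f (l x) \<partial>\<nu>)"
    using T'(1) by (subst T'(3)[OF fm]) auto
  ultimately show ?thesis by simp
qed

text \<open>Finite sums of products of functions of one coordinate. They contain all polynomials, so that
  the Stone-Weierstrass theorem reduces convergence of integrals to such products.\<close>

inductive tensor :: "(real^2 \<Rightarrow> real) \<Rightarrow> bool" where
  prod: "continuous_on UNIV f \<Longrightarrow> continuous_on UNIV g \<Longrightarrow> tensor (\<lambda>x. f (x $ 1) * g (x $ 2))"
| add: "tensor h \<Longrightarrow> tensor h' \<Longrightarrow> tensor (\<lambda>x. h x + h' x)"

lemma tensor_mult: "tensor h \<Longrightarrow> tensor h' \<Longrightarrow> tensor (\<lambda>x. h x * h' x)"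
proof (induction rule: tensor.induct)
  case (prod f g)
  note fg = prod(1,2)
  from prod(3) show ?case
  proof (induction rule: tensor.induct)
    case (prod f' g')
    have "tensor (\<lambda>x. (f (x $ 1) * f' (x $ 1)) * (g (x $ 2) * g' (x $ 2)))"
      using fg prod by (intro tensor.prod[where f="\<lambda>y. f y * f' y" and g="\<lambda>y. g y * g' y"] continuous_intros)
    then show ?case by (simp add: mult_ac)
  next
    case (add h h')
    then show ?case using tensor.add[OF add.IH] by (simp add: algebra_simps)
  qed
next
  case (add h1 h2)
  then show ?case using tensor.add[OF add.IH(1,2)] by (simp add: algebra_simps)
qed

lemma tensor_real_polynomial_function: "real_polynomial_function p \<Longrightarrow> tensor p"
proof (induction rule: real_polynomial_function.induct)
  case (linear f)
  interpret bounded_linear f by fact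
  have "f = (\<lambda>x. (f (axis 1 1) * x $ 1) * 1 + 1 * (f (axis 2 1) * x $ 2))"
  proof
    fix x :: "real^2"
    have "x = (x $ 1) *\<^sub>R axis 1 1 + (x $ 2) *\<^sub>R axis 2 1"
      by (simp add: vec_eq_iff forall_2 axis_def)
    then have "f x = f ((x $ 1) *\<^sub>R axis 1 1 + (x $ 2) *\<^sub>R axis 2 1)" by simp
    then show "f x = (f (axis 1 1) * x $ 1) * 1 + 1 * (f (axis 2 1) * x $ 2)"
      by (simp only: add scaleR real_scaleR_def mult_1_right mult_1_left mult.commute)
  qed
  moreover have "tensor (\<lambda>x. (f (axis 1 1) * x $ 1) * 1 + 1 * (f (axis 2 1) * x $ 2))"
    by (intro tensor.add tensor.prod[where f="\<lambda>y. f (axis 1 1) * y" and g="\<lambda>_. 1"]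
        tensor.prod[where f="\<lambda>_. 1" and g="\<lambda>y. f (axis 2 1) * y"] continuous_intros)
  ultimately show ?case by (simp only:)
next
  case (const c)
  show ?case using tensor.prod[of "\<lambda>_. c" "\<lambda>_. 1"] by simp
next
  case (add f g)
  then show ?case by (intro tensor.add)
next
  case (mult f g)
  then show ?case by (intro tensor_mult)
qed

text \<open>Weights that are trigonometric in the first coordinate have weighted characteristic functions
  in the second coordinate that combine finitely many values of the bivariate one. Continuity in the
  second coordinate follows, then continuity in the first with weights depending on the second, so
  that integrals of products converge. Polynomials composed with the projection onto a large box
  approximate any bounded continuous function there, and the mass outside is controlled by
  functions of a single coordinate.\<close>

lemma weak_conv_bounded_real2I:
  fixes \<mu> :: "nat \<Rightarrow> (real^2) measure"
  assumes P: "\<And>n. prob_space (\<mu> n)" "prob_space \<nu>"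
    and S: "\<And>n. sets (\<mu> n) = sets borel" "sets \<nu> = sets borel"
    and char_conv: "\<And>s t. (\<lambda>n. \<integral>x. iexp (s * x $ 1 + t * x $ 2) \<partial>\<mu> n)
        \<longlonglongrightarrow> (\<integral>x. iexp (s * x $ 1 + t * x $ 2) \<partial>\<nu>)"
  shows "weak_conv_bounded \<mu> \<nu>"
proof -
  define conv where "conv h \<longleftrightarrow> (\<lambda>n. \<integral>x. h x \<partial>\<mu> n) \<longlonglongrightarrow> (\<integral>x. h x \<partial>\<nu>)" for h :: "real^2 \<Rightarrow> real"
  define bcm where "bcm h \<longleftrightarrow> h \<in> borel_measurable borel \<and> (\<exists>b. \<forall>x. \<bar>h x\<bar> \<le> b)" for h :: "real^2 \<Rightarrow> real"
  have mc: "h \<in> borel_measurable (\<mu> n)" "h \<in> borel_measurable \<nu>"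
    if "h \<in> borel_measurable borel" for h :: "real^2 \<Rightarrow> 'c::topological_space" and n
    using that S by (simp_all cong: measurable_cong_sets)
  have int: "integrable (\<mu> n) h" "integrable \<nu> h" if bh: "bcm h" for h n
  proof -
    obtain b where h: "h \<in> borel_measurable borel" "\<And>x. \<bar>h x\<bar> \<le> b" using bh unfolding bcm_def by blast
    interpret A: prob_space "\<mu> n" by (rule P)
    interpret B: prob_space \<nu> by (rule P)
    show "integrable (\<mu> n) h" "integrable \<nu> h"
      using h mc by (auto intro!: A.integrable_const_bound[where B=b] B.integrable_const_bound[where B=b])
  qed
  have intc: "integrable (\<mu> n) h" "integrable \<nu> h"
    if "h \<in> borel_measurable borel" "\<And>x. norm (h x) \<le> ub" for h :: "real^2 \<Rightarrow> complex" and n ub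
  proof -
    interpret A: prob_space "\<mu> n" by (rule P)
    interpret B: prob_space \<nu> by (rule P)
    show "integrable (\<mu> n) h" "integrable \<nu> h"
      using that mc by (auto intro!: A.integrable_const_bound[where B=ub] B.integrable_const_bound[where B=ub])
  qed
  have conv_add: "conv (\<lambda>x. h x + h' x)" if "conv h" "conv h'" "bcm h" "bcm h'" for h h'
    using that tendsto_add[of "\<lambda>n. \<integral>x. h x \<partial>\<mu> n" _ _ "\<lambda>n. \<integral>x. h' x \<partial>\<mu> n"] int by (simp add: conv_def)
  have conv_const: "conv (\<lambda>x. c)" for c
    using P by (simp add: conv_def prob_space.prob_space)
  have conv_cmult: "conv (\<lambda>x. c * h x)" if "conv h" for c h
    using that by (auto simp: conv_def intro!: tendsto_mult)
  have nth [measurable]: "(\<lambda>x::real^2. x $ i) \<in> borel_measurable borel" for i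
    by (intro borel_measurable_continuous_onI continuous_intros)
  have bcm1: "bcm (\<lambda>x. f (x $ i))" if "continuous_on UNIV f" "\<And>y. \<bar>f y\<bar> \<le> b" for f i b
    using that borel_measurable_continuous_onI[OF that(1)] unfolding bcm_def
    by (auto intro: measurable_compose[OF nth])
  have cs: "bcm (\<lambda>x. cos (s * x $ i))" "bcm (\<lambda>x. sin (s * x $ i))" for s i
    by (rule bcm1[of "\<lambda>y. cos (s * y)" 1], (intro continuous_intros, simp))
       (rule bcm1[of "\<lambda>y. sin (s * y)" 1], (intro continuous_intros, simp))
  have bcm_add: "bcm (\<lambda>x. h x + h' x)" if bh: "bcm h" "bcm h'" for h h'
  proof -
    obtain b b' where *: "\<And>x. \<bar>h x\<bar> \<le> b" "\<And>x. \<bar>h' x\<bar> \<le> b'" using bh unfolding bcm_def by blast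
    have "\<bar>h x + h' x\<bar> \<le> b + b'" for x using *(1)[of x] *(2)[of x] by linarith
    then show ?thesis using that by (auto simp: bcm_def)
  qed
  have bcm_mult: "bcm (\<lambda>x. h x * h' x)" if bh: "bcm h" "bcm h'" for h h'
  proof -
    obtain b b' where *: "\<And>x. \<bar>h x\<bar> \<le> b" "\<And>x. \<bar>h' x\<bar> \<le> b'" using bh unfolding bcm_def by blast
    have "\<bar>h x * h' x\<bar> \<le> b * b'" for x using *(1)[of x] *(2)[of x] by (simp add: abs_mult mult_mono)
    then show ?thesis using that by (auto simp: bcm_def)
  qed
  have bcm_const: "bcm (\<lambda>x. c)" for c by (auto simp: bcm_def)
  have weighted: "conv (\<lambda>x. w x * f (x $ i))"
    if w: "w \<in> borel_measurable borel" "\<And>x. 1 \<le> w x" "\<And>x. w x \<le> ub"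
      and c: "\<And>t. (\<lambda>n. \<integral>x. w x *\<^sub>R iexp (t * x $ i) \<partial>\<mu> n) \<longlonglongrightarrow> (\<integral>x. w x *\<^sub>R iexp (t * x $ i) \<partial>\<nu>)"
      and f: "continuous_on UNIV f" "\<And>x. \<bar>f x\<bar> \<le> ub'" for w f ub ub' i
    unfolding conv_def
    by (rule weighted_levy_continuity[where N=borel and b=ub and B=ub']) (use P S w c f in auto)
  have e_m [measurable]: "(\<lambda>x::real^2. iexp (s * x $ 1 + t * x $ 2)) \<in> borel_measurable borel" for s t
    by (intro borel_measurable_continuous_onI continuous_intros)
  have e_i: "integrable (\<mu> n) (\<lambda>x. iexp (s * x $ 1 + t * x $ 2))" "integrable \<nu> (\<lambda>x. iexp (s * x $ 1 + t * x $ 2))" for n s t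
    by (rule intc[where ?ub1=1]; simp)+
  have lin3: "(\<integral>x. c1 * iexp (s1 * x $ 1 + t1 * x $ 2) + c2 * iexp (s2 * x $ 1 + t2 * x $ 2)
        + c3 * iexp (s3 * x $ 1 + t3 * x $ 2) \<partial>\<rho>)
      = c1 * (\<integral>x. iexp (s1 * x $ 1 + t1 * x $ 2) \<partial>\<rho>) + c2 * (\<integral>x. iexp (s2 * x $ 1 + t2 * x $ 2) \<partial>\<rho>)
        + c3 * (\<integral>x. iexp (s3 * x $ 1 + t3 * x $ 2) \<partial>\<rho>)"
    if "\<rho> = \<nu> \<or> \<rho> \<in> range \<mu>" for c1 c2 c3 s1 s2 s3 t1 t2 t3 \<rho>
  proof -
    have I: "integrable \<rho> (\<lambda>x. iexp (s * x $ 1 + t * x $ 2))" for s t using that e_i by auto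
    have J: "integrable \<rho> (\<lambda>x. c * iexp (s * x $ 1 + t * x $ 2))" for c s t by (intro integrable_mult_right I)
    show ?thesis
      by (simp only: Bochner_Integration.integral_add Bochner_Integration.integrable_add J integral_mult_right_zero)
  qed
  note lin3 = lin3[OF disjI1[OF refl]] lin3[OF disjI2[OF rangeI]]
  \<comment> \<open>Adding 2 makes the sine and cosine weights at least 1; the constant part is subtracted afterwards.\<close>
  have trig2: "conv (\<lambda>x. cos (s * x $ 1) * f (x $ 2))" "conv (\<lambda>x. sin (s * x $ 1) * f (x $ 2))"
    and only2: "conv (\<lambda>x. f (x $ 2))"
    if f: "continuous_on UNIV f" "\<And>y. \<bar>f y\<bar> \<le> B" for s f B
  proof -
    have bounds: "1 \<le> 2 + cos y" "2 + cos y \<le> 3" "1 \<le> 2 + sin y" "2 + sin y \<le> 3" for y :: real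
      using cos_ge_minus_one[of y] cos_le_one[of y] sin_ge_minus_one[of y] sin_le_one[of y] by linarith+
    have one: "conv (\<lambda>x. 1 * f (x $ 2))"
      by (rule weighted[where ?ub1=1 and ?ub'1=B]) (use f char_conv[of 0] in auto)
    then show f2: "conv (\<lambda>x. f (x $ 2))" by simp
    have c: "conv (\<lambda>x. (2 + cos (s * x $ 1)) * f (x $ 2))"
    proof (rule weighted[where ?ub1=3 and ?ub'1=B])
      fix t
      have eq: "(2 + cos (s * x $ 1)) *\<^sub>R iexp (t * x $ 2) = 2 * iexp (0 * x $ 1 + t * x $ 2)
          + (1/2) * iexp (s * x $ 1 + t * x $ 2) + (1/2) * iexp ((-s) * x $ 1 + t * x $ 2)" for x :: "real^2"
        by (simp add: scaleR_conv_of_real complex_eq_iff Re_exp Im_exp cos_add sin_add algebra_simps cos_diff sin_diff)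
          (auto simp: field_simps)
      have "(\<lambda>n. 2 * (\<integral>x. iexp (0 * x $ 1 + t * x $ 2) \<partial>\<mu> n) + (1/2) * (\<integral>x. iexp (s * x $ 1 + t * x $ 2) \<partial>\<mu> n)
            + (1/2) * (\<integral>x. iexp ((-s) * x $ 1 + t * x $ 2) \<partial>\<mu> n))
         \<longlonglongrightarrow> 2 * (\<integral>x. iexp (0 * x $ 1 + t * x $ 2) \<partial>\<nu>) + (1/2) * (\<integral>x. iexp (s * x $ 1 + t * x $ 2) \<partial>\<nu>)
            + (1/2) * (\<integral>x. iexp ((-s) * x $ 1 + t * x $ 2) \<partial>\<nu>)"
        by (intro tendsto_intros char_conv)
      then show "(\<lambda>n. \<integral>x. (2 + cos (s * x $ 1)) *\<^sub>R iexp (t * x $ 2) \<partial>\<mu> n)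
          \<longlonglongrightarrow> (\<integral>x. (2 + cos (s * x $ 1)) *\<^sub>R iexp (t * x $ 2) \<partial>\<nu>)"
        unfolding eq lin3 .
    qed (use f bounds in auto)
    have "conv (\<lambda>x. (2 + cos (s * x $ 1)) * f (x $ 2) + (-2) * f (x $ 2))"
      by (rule conv_add[OF c conv_cmult[OF f2]]) (intro bcm_mult bcm_add bcm_const cs bcm1[OF f])+
    then show "conv (\<lambda>x. cos (s * x $ 1) * f (x $ 2))" by (simp add: algebra_simps)
    have c: "conv (\<lambda>x. (2 + sin (s * x $ 1)) * f (x $ 2))"
    proof (rule weighted[where ?ub1=3 and ?ub'1=B])
      fix t
      have eq: "(2 + sin (s * x $ 1)) *\<^sub>R iexp (t * x $ 2) = 2 * iexp (0 * x $ 1 + t * x $ 2)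
          + (-\<i>/2) * iexp (s * x $ 1 + t * x $ 2) + (\<i>/2) * iexp ((-s) * x $ 1 + t * x $ 2)" for x :: "real^2"
        by (simp add: scaleR_conv_of_real complex_eq_iff Re_exp Im_exp cos_add sin_add algebra_simps cos_diff sin_diff)
          (auto simp: field_simps)
      have "(\<lambda>n. 2 * (\<integral>x. iexp (0 * x $ 1 + t * x $ 2) \<partial>\<mu> n) + (-\<i>/2) * (\<integral>x. iexp (s * x $ 1 + t * x $ 2) \<partial>\<mu> n)
            + (\<i>/2) * (\<integral>x. iexp ((-s) * x $ 1 + t * x $ 2) \<partial>\<mu> n))
         \<longlonglongrightarrow> 2 * (\<integral>x. iexp (0 * x $ 1 + t * x $ 2) \<partial>\<nu>) + (-\<i>/2) * (\<integral>x. iexp (s * x $ 1 + t * x $ 2) \<partial>\<nu>)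
            + (\<i>/2) * (\<integral>x. iexp ((-s) * x $ 1 + t * x $ 2) \<partial>\<nu>)"
        by (intro tendsto_intros char_conv)
      then show "(\<lambda>n. \<integral>x. (2 + sin (s * x $ 1)) *\<^sub>R iexp (t * x $ 2) \<partial>\<mu> n)
          \<longlonglongrightarrow> (\<integral>x. (2 + sin (s * x $ 1)) *\<^sub>R iexp (t * x $ 2) \<partial>\<nu>)"
        unfolding eq lin3 .
    qed (use f bounds in auto)
    have "conv (\<lambda>x. (2 + sin (s * x $ 1)) * f (x $ 2) + (-2) * f (x $ 2))"
      by (rule conv_add[OF c conv_cmult[OF f2]]) (intro bcm_mult bcm_add bcm_const cs bcm1[OF f])+
    then show "conv (\<lambda>x. sin (s * x $ 1) * f (x $ 2))" by (simp add: algebra_simps)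
  qed
  have only1: "conv (\<lambda>x. f (x $ 1))" if f: "continuous_on UNIV f" "\<And>y. \<bar>f y\<bar> \<le> B" for f B
  proof -
    have one: "conv (\<lambda>x. 1 * f (x $ 1))"
      by (rule weighted[where ?ub1=1 and ?ub'1=B]) (use f char_conv[of _ 0] in auto)
    then show ?thesis by simp
  qed
  have product: "conv (\<lambda>x. g (x $ 1) * f (x $ 2))"
    if f: "continuous_on UNIV f" "\<And>y. \<bar>f y\<bar> \<le> B" and g: "continuous_on UNIV g" "\<And>y. \<bar>g y\<bar> \<le> B'" for f g B B'
  proof -
    \<comment> \<open>the shift makes the weight at least 1\<close>
    define f' where "f' y = f y + (B + 1)" for y
    have B0: "0 \<le> B" using f(2)[of 0] by linarith
    have f': "continuous_on UNIV f'" "\<And>y. 1 \<le> f' y" "\<And>y. f' y \<le> 2 * B + 1"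
      unfolding f'_def
    proof -
      show "continuous_on UNIV (\<lambda>y. f y + (B + 1))" by (intro continuous_intros f)
      fix y show "1 \<le> f y + (B + 1)" "f y + (B + 1) \<le> 2 * B + 1" using f(2)[of y] by linarith+
    qed
    have f'b: "\<bar>f' y\<bar> \<le> 2 * B + 1" for y using f'(2,3)[of y] by linarith
    have "conv (\<lambda>x. f' (x $ 2) * g (x $ 1))"
    proof (rule weighted[where ?ub1="2 * B + 1" and ?ub'1=B'])
      show "(\<lambda>x::real^2. f' (x $ 2)) \<in> borel_measurable borel" using bcm1[OF f'(1) f'b] by (simp add: bcm_def)
      fix t
      have eq: "f' (x $ 2) *\<^sub>R iexp (t * x $ 1) = of_real (cos (t * x $ 1) * f' (x $ 2))
          + \<i> * of_real (sin (t * x $ 1) * f' (x $ 2))" for x :: "real^2"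
        by (simp add: scaleR_conv_of_real complex_eq_iff Re_exp Im_exp)
      have b: "bcm (\<lambda>x. cos (t * x $ 1) * f' (x $ 2))" "bcm (\<lambda>x. sin (t * x $ 1) * f' (x $ 2))"
        by (intro bcm_mult cs bcm1[OF f'(1) f'b])+
      show "(\<lambda>n. \<integral>x. f' (x $ 2) *\<^sub>R iexp (t * x $ 1) \<partial>\<mu> n) \<longlonglongrightarrow> (\<integral>x. f' (x $ 2) *\<^sub>R iexp (t * x $ 1) \<partial>\<nu>)"
      proof -
        have lin: "(\<integral>x. f' (x $ 2) *\<^sub>R iexp (t * x $ 1) \<partial>\<rho>) = of_real (\<integral>x. cos (t * x $ 1) * f' (x $ 2) \<partial>\<rho>)
            + \<i> * of_real (\<integral>x. sin (t * x $ 1) * f' (x $ 2) \<partial>\<rho>)" if "\<rho> = \<nu> \<or> \<rho> \<in> range \<mu>" for \<rho>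
        proof -
          have i: "integrable \<rho> (\<lambda>x. cos (t * x $ 1) * f' (x $ 2))" "integrable \<rho> (\<lambda>x. sin (t * x $ 1) * f' (x $ 2))"
            using that int[OF b(1)] int[OF b(2)] by auto
          show ?thesis unfolding eq
            by (subst Bochner_Integration.integral_add)
               (use i in \<open>auto simp del: of_real_mult intro!: integrable_mult_right integrable_of_real\<close>)
        qed
        show ?thesis
          using trig2[OF f'(1) f'b, of t] unfolding lin[OF disjI1[OF refl]] lin[OF disjI2[OF rangeI]] conv_def
          by (intro tendsto_intros)
      qed
    qed (use f' g in auto)
    then have "conv (\<lambda>x. f' (x $ 2) * g (x $ 1) + (-(B+1)) * g (x $ 1))"
      by (intro conv_add conv_cmult only1[OF g] bcm_mult bcm_const bcm1[OF g] bcm1[OF f'(1) f'b])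
    then show ?thesis by (simp add: f'_def algebra_simps)
  qed
  \<comment> \<open>Composition with the projection onto a box makes every polynomial bounded.\<close>
  define cl where "cl L y = max (- L) (min L y)" for L y :: real
  define cl2 where "cl2 L x = (vector [cl L (x $ 1), cl L (x $ 2)] :: real^2)" for L and x :: "real^2"
  have tensor: "conv (\<lambda>x. h (cl2 L x)) \<and> bcm (\<lambda>x. h (cl2 L x))" if "tensor h" "L \<ge> 0" for h L
    using that
  proof (induction rule: tensor.induct)
    case (prod f g)
    have *: "continuous_on UNIV (\<lambda>y. f (cl L y)) \<and> (\<exists>b. \<forall>y. \<bar>f (cl L y)\<bar> \<le> b)"
      if fc: "continuous_on UNIV f" for f :: "real \<Rightarrow> real"
    proof -
      have "compact (f ` {-L..L})"
        using fc by (intro compact_continuous_image) (auto intro: continuous_on_subset)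
      then have "bounded (f ` {-L..L})" by (rule compact_imp_bounded)
      then obtain b where b: "\<forall>y\<in>f ` {-L..L}. norm y \<le> b" unfolding bounded_iff by (elim exE)
      have "cl L y \<in> {-L..L}" for y using prod(3) by (auto simp: cl_def)
      then have "\<bar>f (cl L y)\<bar> \<le> b" for y using b by auto
      moreover have "continuous_on UNIV (\<lambda>y. f (cl L y))"
        unfolding cl_def by (intro continuous_on_compose2[OF fc] continuous_intros) auto
      ultimately show ?thesis by blast
    qed
    obtain b b' where b: "\<And>y. \<bar>f (cl L y)\<bar> \<le> b" "\<And>y. \<bar>g (cl L y)\<bar> \<le> b'" using *[OF prod(1)] *[OF prod(2)] by metis
    have c: "continuous_on UNIV (\<lambda>y. f (cl L y))" "continuous_on UNIV (\<lambda>y. g (cl L y))"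
      using *[OF prod(1)] *[OF prod(2)] by auto
    show ?case unfolding cl2_def
      using product[OF c(2) b(2) c(1) b(1)] bcm_mult[OF bcm1[OF c(1) b(1), of 1] bcm1[OF c(2) b(2), of 2]] by simp
  next
    case (add h h')
    then show ?case by (auto intro: conv_add bcm_add)
  qed
  show ?thesis
    unfolding weak_conv_bounded_def
  proof (intro allI impI)
    fix h :: "real^2 \<Rightarrow> real"
    assume h: "continuous_on UNIV h" "bounded (range h)"
    obtain K where K: "\<And>x. \<bar>h x\<bar> \<le> K" using h(2) unfolding bounded_iff by (metis rangeI real_norm_def)
    have K0: "K \<ge> 0" using K[of 0] by linarith
    have hb: "bcm h" using K borel_measurable_continuous_onI[OF h(1)] by (auto simp: bcm_def)
    \<comment> \<open>A continuous majorant of the indicator of leaving \<open>[- (L + 1), L + 1]\<close>, so that the laws far out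
      can be compared by the convergence already proved.\<close>
    define out where "out L y = min 1 (max 0 (\<bar>y\<bar> - L))" for L y :: real
    have out: "continuous_on UNIV (out L)" "\<bar>out L y\<bar> \<le> 1" "0 \<le> out L y" for L y
      unfolding out_def by (auto intro!: continuous_intros)
    interpret N: prob_space \<nu> by (rule P)
    have out_lim: "(\<lambda>m. \<integral>x. out (real m) (x $ i) \<partial>\<nu>) \<longlonglongrightarrow> 0" for i
    proof -
      have "(\<lambda>m. \<integral>x. out (real m) (x $ i) \<partial>\<nu>) \<longlonglongrightarrow> (\<integral>x. 0 \<partial>\<nu>)"
      proof (rule integral_dominated_convergence[where w="\<lambda>_. 1"])
        show "AE x in \<nu>. (\<lambda>m. out (real m) (x $ i)) \<longlonglongrightarrow> 0"
        proof (rule AE_I2)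
          fix x :: "real^2"
          obtain m0 :: nat where "\<bar>x $ i\<bar> \<le> real m0" using real_arch_simple by blast
          then have "eventually (\<lambda>m. out (real m) (x $ i) = 0) sequentially"
            by (intro eventually_sequentiallyI[of m0]) (auto simp: out_def)
          then show "(\<lambda>m. out (real m) (x $ i)) \<longlonglongrightarrow> 0" by (rule tendsto_eventually)
        qed
      qed (use out int(2)[OF bcm1[OF out(1,2)]] in auto)
      then show ?thesis by simp
    qed
    have "\<forall>\<^sub>F n in sequentially. \<bar>(\<integral>x. h x \<partial>\<mu> n) - (\<integral>x. h x \<partial>\<nu>)\<bar> < e" if e: "e > 0" for e
    proof -
      define d where "d = e / (16 * (K + 1))"
      have d: "d > 0" using e K0 by (simp add: d_def)
      have "\<forall>\<^sub>F m in sequentially. (\<integral>x. out (real m) (x $ 1) \<partial>\<nu>) < d \<and> (\<integral>x. out (real m) (x $ 2) \<partial>\<nu>) < d"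
        using order_tendstoD(2)[OF out_lim d] by (intro eventually_conj) auto
      then obtain m :: nat where m: "(\<integral>x. out (real m) (x $ 1) \<partial>\<nu>) < d" "(\<integral>x. out (real m) (x $ 2) \<partial>\<nu>) < d"
        by (auto simp: eventually_sequentially)
      define L where "L = real m"
      define box where "box = {x::real^2. \<forall>i. x $ i \<in> {-(L+1)..L+1}}"
      have "box = cbox (vec (-(L+1))) (vec (L+1))" by (auto simp: box_def mem_box_cart)
      then have "compact box" by simp
      then obtain p where p: "real_polynomial_function p" "\<And>x. x \<in> box \<Longrightarrow> \<bar>h x - p x\<bar> < e/16"
        using Stone_Weierstrass_real_polynomial_function[of box h "e/16"] e h(1)
        by (auto intro: continuous_on_subset)
      define q where "q x = p (cl2 (L+1) x)" for x
      have L: "L + 1 \<ge> 0" by (simp add: L_def)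
      have q: "conv q" "bcm q"
        using tensor[OF tensor_real_polynomial_function[OF p(1)] L] by (auto simp: q_def[abs_def])
      have bound: "\<bar>h x - q x\<bar> \<le> e/16 + 2 * K * (out L (x $ 1) + out L (x $ 2))" for x
      proof -
        have in_box: "cl2 (L+1) x \<in> box" using L by (auto simp: box_def cl2_def forall_2 cl_def)
        show ?thesis
        proof (cases "x \<in> box")
          case True
          then have "cl2 (L+1) x = x" by (simp add: box_def cl2_def forall_2 cl_def vec_eq_iff)
          then have "\<bar>h x - q x\<bar> < e/16" using p(2)[OF True] by (simp add: q_def)
          moreover have "0 \<le> 2 * K * (out L (x $ 1) + out L (x $ 2))" using K0 out(3) by (intro mult_nonneg_nonneg add_nonneg_nonneg) auto
          ultimately show ?thesis by linarith
        next
          case False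
          then have "out L (x $ 1) = 1 \<or> out L (x $ 2) = 1" by (auto simp: box_def forall_2 out_def)
          then have "1 \<le> out L (x $ 1) + out L (x $ 2)" using out(3)[of L "x$1"] out(3)[of L "x$2"] by linarith
          then have "2 * K \<le> 2 * K * (out L (x $ 1) + out L (x $ 2))" using K0 by (simp add: mult_le_cancel_left1)
          moreover have "\<bar>h x - q x\<bar> \<le> 2 * K + e/16"
            using p(2)[OF in_box] K[of x] K[of "cl2 (L+1) x"] unfolding q_def by linarith
          ultimately show ?thesis by linarith
        qed
      qed
      define o1 o2 where "o1 = (\<lambda>x::real^2. out L (x $ 1))" and "o2 = (\<lambda>x::real^2. out L (x $ 2))"
      have o: "conv o1" "bcm o1" "conv o2" "bcm o2"
        unfolding o1_def o2_def using only1[OF out(1,2)] only2[OF out(1,2)] bcm1[OF out(1,2)] by auto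
      have I: "\<bar>(\<integral>x. h x \<partial>\<rho>) - (\<integral>x. q x \<partial>\<rho>)\<bar> \<le> e/16 + 2 * K * ((\<integral>x. o1 x \<partial>\<rho>) + (\<integral>x. o2 x \<partial>\<rho>))"
        if "prob_space \<rho>" and i: "integrable \<rho> h" "integrable \<rho> q" "integrable \<rho> o1" "integrable \<rho> o2" for \<rho>
      proof -
        interpret prob_space \<rho> by fact
        have "\<bar>(\<integral>x. h x \<partial>\<rho>) - (\<integral>x. q x \<partial>\<rho>)\<bar> \<le> (\<integral>x. \<bar>h x - q x\<bar> \<partial>\<rho>)"
          using integral_abs_bound[of \<rho> "\<lambda>x. h x - q x"] i by simp
        also have "\<dots> \<le> (\<integral>x. e/16 + 2 * K * (o1 x + o2 x) \<partial>\<rho>)"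
          by (rule integral_mono) (use i bound in \<open>auto simp: o1_def o2_def\<close>)
        also have "\<dots> = e/16 + 2 * K * ((\<integral>x. o1 x \<partial>\<rho>) + (\<integral>x. o2 x \<partial>\<rho>))"
          using i by (simp add: prob_space)
        finally show ?thesis .
      qed
      have sm: "2 * K * (a + b) \<le> e/4" if "a < d" "b < d" for a b
      proof -
        have "2 * K * (a + b) \<le> 2 * K * (2 * d)" using that K0 by (intro mult_left_mono) auto
        also have "\<dots> \<le> 2 * (K + 1) * (2 * d)" using d by (intro mult_right_mono) auto
        also have "\<dots> = e/4" using K0 by (simp add: d_def field_simps)
        finally show ?thesis .
      qed
      have "\<forall>\<^sub>F n in sequentially. (\<integral>x. o1 x \<partial>\<mu> n) < d" "\<forall>\<^sub>F n in sequentially. (\<integral>x. o2 x \<partial>\<mu> n) < d"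
        using o(1,3) m unfolding conv_def by (auto intro: order_tendstoD(2) simp: o1_def o2_def L_def)
      moreover have "\<forall>\<^sub>F n in sequentially. dist (\<integral>x. q x \<partial>\<mu> n) (\<integral>x. q x \<partial>\<nu>) < e/16"
        using q(1) e unfolding conv_def by (intro tendstoD) auto
      ultimately show ?thesis
      proof eventually_elim
        case (elim n)
        have "2 * K * ((\<integral>x. o1 x \<partial>\<nu>) + (\<integral>x. o2 x \<partial>\<nu>)) \<le> e/4"
          using m by (intro sm) (auto simp: o1_def o2_def L_def)
        moreover have "2 * K * ((\<integral>x. o1 x \<partial>\<mu> n) + (\<integral>x. o2 x \<partial>\<mu> n)) \<le> e/4"
          using elim by (intro sm) auto
        ultimately show ?case
          using I[OF P(1)[of n] int(1)[OF hb] int(1)[OF q(2)] int(1)[OF o(2)] int(1)[OF o(4)]]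
            I[OF P(2) int(2)[OF hb] int(2)[OF q(2)] int(2)[OF o(2)] int(2)[OF o(4)]] elim(3) e
          unfolding dist_real_def by linarith
      qed
    qed
    then show "(\<lambda>n. \<integral>x. h x \<partial>\<mu> n) \<longlonglongrightarrow> (\<integral>x. h x \<partial>\<nu>)"
      unfolding tendsto_iff dist_real_def by blast
  qed
qed

section \<open>The bivariate normal law\<close>

lemma vector2_nth [simp]: "(vector [a, b] :: 'c::zero^2) $ 1 = a" "(vector [a, b] :: 'c::zero^2) $ 2 = b"
  by simp_all

lemma measurable_vector2 [measurable]:
  fixes f g :: "'b \<Rightarrow> real"
  assumes [measurable]: "f \<in> borel_measurable N" "g \<in> borel_measurable N"
  shows "(\<lambda>x. vector [f x, g x] :: real^2) \<in> borel_measurable N"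
proof -
  have "(vector [f x, g x] :: real^2) = f x *\<^sub>R axis 1 1 + g x *\<^sub>R axis 2 1" for x
    by (simp add: vec_eq_iff forall_2 axis_def)
  then show ?thesis by simp
qed

lemma Basis_real2: "(Basis :: (real^2) set) = {axis 1 1, axis 2 1}"
  by (auto simp: Basis_vec_def UNIV_2)

text \<open>Turns planar Lebesgue integrals into iterated ones, through the product measure on pairs.\<close>

lemma lborel_real2:
  "(lborel :: (real^2) measure) = distr (lborel \<Otimes>\<^sub>M lborel) borel (\<lambda>(x, y). vector [x, y])"
proof (rule lborel_eqI)
  fix l u :: "real^2" assume *: "\<And>b. b \<in> Basis \<Longrightarrow> l \<bullet> b \<le> u \<bullet> b"
  have le: "l $ 1 \<le> u $ 1" "l $ 2 \<le> u $ 2"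
    using *[of "axis 1 1"] *[of "axis 2 1"] by (auto simp: Basis_real2 inner_axis)
  have "(\<lambda>(x, y). vector [x, y]) -` box l u \<inter> space (lborel \<Otimes>\<^sub>M lborel)
      = {l $ 1<..<u $ 1} \<times> {l $ 2<..<u $ 2}"
    by (auto simp: mem_box_cart forall_2 space_pair_measure)
  then show "emeasure (distr (lborel \<Otimes>\<^sub>M lborel) borel (\<lambda>(x, y). vector [x, y])) (box l u)
      = ennreal (\<Prod>b\<in>Basis. (u - l) \<bullet> b)"
    using le by (subst emeasure_distr)
      (simp_all add: lborel.emeasure_pair_measure_Times Basis_real2 inner_axis axis_eq_axis ennreal_mult)
qed simp

lemma normal_density_char:
  assumes "0 < \<sigma>"
  shows "(\<integral>x. normal_density m \<sigma> x *\<^sub>R iexp (t * x) \<partial>lborel) = iexp (t * m) * exp (- (\<sigma>^2 * t^2) / 2)"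
proof -
  have "(\<integral>x. normal_density m \<sigma> x *\<^sub>R iexp (t * x) \<partial>lborel)
      = \<bar>\<sigma>\<bar> *\<^sub>R (\<integral>z. normal_density m \<sigma> (m + \<sigma> * z) *\<^sub>R iexp (t * (m + \<sigma> * z)) \<partial>lborel)"
    using assms by (intro lborel_integral_real_affine) auto
  also have "\<dots> = (\<integral>z. \<sigma> *\<^sub>R (normal_density m \<sigma> (m + \<sigma> * z) *\<^sub>R iexp (t * (m + \<sigma> * z))) \<partial>lborel)"
    using assms by (simp only: abs_of_pos integral_scaleR_right)
  also have "\<dots> = (\<integral>z. iexp (t * m) * (std_normal_density z *\<^sub>R iexp ((t * \<sigma>) * z)) \<partial>lborel)"
  proof (intro Bochner_Integration.integral_cong refl)
    fix z
    have "\<sigma> * normal_density m \<sigma> (m + \<sigma> * z) = std_normal_density z"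
      using assms by (simp add: normal_density_def real_sqrt_mult power_mult_distrib)
    moreover have "iexp (t * (m + \<sigma> * z)) = iexp (t * m) * iexp ((t * \<sigma>) * z)"
      by (simp add: exp_add[symmetric] algebra_simps)
    ultimately show "\<sigma> *\<^sub>R (normal_density m \<sigma> (m + \<sigma> * z) *\<^sub>R iexp (t * (m + \<sigma> * z)))
        = iexp (t * m) * (std_normal_density z *\<^sub>R iexp ((t * \<sigma>) * z))"
      by (simp del: of_real_mult)
  qed
  also have "\<dots> = iexp (t * m) * (\<integral>z. std_normal_density z *\<^sub>R iexp ((t * \<sigma>) * z) \<partial>lborel)"
    by (rule integral_mult_right_zero)
  also have "(\<integral>z. std_normal_density z *\<^sub>R iexp ((t * \<sigma>) * z) \<partial>lborel) = char std_normal_distribution (t * \<sigma>)"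
    unfolding char_def by (subst integral_density) (auto simp: normal_density_nonneg)
  also have "\<dots> = exp (- (\<sigma>^2 * t^2) / 2)"
    by (simp add: char_std_normal_distribution power_mult_distrib exp_of_real mult.commute)
  finally show ?thesis .
qed

text \<open>The density factorizes into a normal density of the first coordinate, with mean depending
  linearly on the second and variance \<open>D / r\<close> where \<open>D\<close> is the determinant, times the normal
  density of the second coordinate; then both integrals are one-dimensional.\<close>

lemma normal_law_real2:
  fixes \<mu> :: "real^2" and p q r :: real
  defines "\<Sigma> \<equiv> (vector [vector [p, q], vector [q, r]] :: real^2^2)"
  assumes pos: "0 < r" "0 < p * r - q^2"
  shows "prob_space (normal_law \<mu> \<Sigma>)" "sets (normal_law \<mu> \<Sigma>) = sets borel"
    "(\<integral>x. iexp (s * x $ 1 + t * x $ 2) \<partial>normal_law \<mu> \<Sigma>)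
      = iexp (s * \<mu> $ 1 + t * \<mu> $ 2) * exp (- (p * s^2 + 2 * q * s * t + r * t^2) / 2)"
proof -
  define D where "D = p * r - q^2"
  have D: "D > 0" using pos by (simp add: D_def)
  define m where "m y = \<mu> $ 1 + (q / r) * (y - \<mu> $ 2)" for y
  define h where "h x y = normal_density (m y) (sqrt (D / r)) x * normal_density (\<mu> $ 2) (sqrt r) y" for x y
  have det: "det \<Sigma> = D" by (simp add: \<Sigma>_def det_2 D_def power2_eq_square)
  have inv: "matrix_inv \<Sigma> = vector [vector [r / D, - q / D], vector [- q / D, p / D]]"
  proof -
    define \<Lambda> :: "real^2^2" where "\<Lambda> = vector [vector [r / D, - q / D], vector [- q / D, p / D]]"
    have "p * r / D - q * q / D = 1"
      using D by (simp add: diff_divide_distrib[symmetric] D_def power2_eq_square)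
    then have 1: "\<Sigma> ** \<Lambda> = mat 1" "\<Lambda> ** \<Sigma> = mat 1"
      by (simp_all add: \<Sigma>_def \<Lambda>_def vec_eq_iff forall_2 matrix_matrix_mult_def sum_2 mat_def mult.commute)
    then have "invertible \<Sigma>" unfolding invertible_def by blast
    then have "matrix_inv \<Sigma> ** \<Sigma> = mat 1"
      unfolding invertible_def matrix_inv_def by (rule someI2_ex) blast
    then have "matrix_inv \<Sigma> = \<Lambda>" using 1(1) by (metis matrix_mul_assoc matrix_mul_lid matrix_mul_rid)
    then show ?thesis by (simp add: \<Lambda>_def)
  qed
  define d where "d x = exp (- ((x - \<mu>) \<bullet> (matrix_inv \<Sigma> *v (x - \<mu>))) / 2) / sqrt ((2 * pi) ^ CARD(2) * det \<Sigma>)" for x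
  have law: "normal_law \<mu> \<Sigma> = density lborel (\<lambda>x. ennreal (d x))"
    by (simp add: normal_law_def d_def[abs_def])
  have dm [measurable]: "d \<in> borel_measurable borel"
    unfolding d_def by (intro borel_measurable_continuous_onI continuous_intros matrix_vector_mult_linear_continuous_on
        continuous_on_compose2[OF matrix_vector_mult_linear_continuous_on[of UNIV "matrix_inv \<Sigma>"]]) (use D det in auto)
  have d0: "0 \<le> d x" for x using D by (simp add: d_def det)
  have dh: "d (vector [x, y]) = h x y" for x y
  proof -
    define u v where "u = x - \<mu> $ 1" and "v = y - \<mu> $ 2"
    have Q: "((vector [x, y] - \<mu>) \<bullet> (matrix_inv \<Sigma> *v (vector [x, y] - \<mu>))) = (r * u^2 - 2 * q * u * v + p * v^2) / D"
      by (simp add: inv inner_vec_def sum_2 matrix_vector_mult_def u_def v_def power2_eq_square algebra_simps add_divide_distrib diff_divide_distrib)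
    have "(x - m y)^2 / (D / r) + v^2 / r = (r * u^2 - 2 * q * u * v + p * v^2) / D"
    proof -
      have xm: "x - m y = (r * u - q * v) / r" using pos by (simp add: m_def u_def v_def field_simps)
      have "(x - m y)^2 / (D / r) + v^2 / r = ((r * u - q * v)^2 + D * v^2) / (r * D)"
        unfolding xm using pos D by (simp add: power_divide add_divide_distrib power2_eq_square)
      also have "(r * u - q * v)^2 + D * v^2 = r * (r * u^2 - 2 * q * u * v + p * v^2)"
        by (simp add: D_def algebra_simps power2_eq_square)
      finally show ?thesis using pos D by simp
    qed
    moreover have "sqrt ((2 * pi) ^ CARD(2) * det \<Sigma>) = sqrt (2 * pi * (D / r)) * sqrt (2 * pi * r)"
      using pos D by (simp add: real_sqrt_mult[symmetric] det power2_eq_square)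
    ultimately show ?thesis
      using pos D unfolding d_def h_def normal_density_def Q
      by (simp add: v_def mult_exp_exp[symmetric] exp_add[symmetric] add_divide_distrib[symmetric] field_simps)
  qed
  have hm [measurable]: "(\<lambda>(x, y). h x y) \<in> borel_measurable (lborel \<Otimes>\<^sub>M lborel)"
    unfolding h_def normal_density_def m_def by measurable
  have h0: "0 \<le> h x y" for x y by (simp add: h_def)
  have tot: "(\<integral>\<^sup>+x. ennreal (d x) \<partial>lborel) = 1"
  proof -
    have "(\<integral>\<^sup>+x. ennreal (d x) \<partial>lborel) = (\<integral>\<^sup>+z. ennreal ((\<lambda>(x, y). h x y) z) \<partial>(lborel \<Otimes>\<^sub>M lborel))"
      by (subst lborel_real2, subst nn_integral_distr) (auto simp: split_beta' dh intro!: nn_integral_cong)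
    also have "\<dots> = (\<integral>\<^sup>+y. \<integral>\<^sup>+x. ennreal (h x y) \<partial>lborel \<partial>lborel)"
      by (subst lborel_pair.nn_integral_snd[symmetric]) auto
    also have "\<dots> = (\<integral>\<^sup>+y. ennreal (normal_density (\<mu> $ 2) (sqrt r) y) * (\<integral>\<^sup>+x. ennreal (normal_density (m y) (sqrt (D / r)) x) \<partial>lborel) \<partial>lborel)"
      by (intro nn_integral_cong, subst nn_integral_cmult[symmetric])
         (auto simp: h_def ennreal_mult mult.commute intro!: nn_integral_cong)
    also have "\<dots> = 1" using pos D by (simp add: nn_integral_eq_integral)
    finally show ?thesis .
  qed
  show "sets (normal_law \<mu> \<Sigma>) = sets borel" by (simp add: law)
  show "prob_space (normal_law \<mu> \<Sigma>)"
    by (intro prob_spaceI) (simp add: law emeasure_density tot)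
  have e_m [measurable]: "(\<lambda>x::real^2. iexp (s * x $ 1 + t * x $ 2)) \<in> borel_measurable borel"
    by (intro borel_measurable_continuous_onI continuous_intros)
  have "(\<integral>x. iexp (s * x $ 1 + t * x $ 2) \<partial>normal_law \<mu> \<Sigma>) = (\<integral>x. d x *\<^sub>R iexp (s * x $ 1 + t * x $ 2) \<partial>lborel)"
    unfolding law by (subst integral_density) (auto simp: d0)
  also have "\<dots> = (\<integral>z. (\<lambda>(x, y). h x y *\<^sub>R iexp (s * x + t * y)) z \<partial>(lborel \<Otimes>\<^sub>M lborel))"
    by (subst lborel_real2, subst integral_distr) (auto simp: split_beta' dh intro!: Bochner_Integration.integral_cong)
  also have "\<dots> = (\<integral>y. \<integral>x. h x y *\<^sub>R iexp (s * x + t * y) \<partial>lborel \<partial>lborel)"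
  proof (subst lborel_pair.integral_snd[symmetric])
    have "integrable (lborel \<Otimes>\<^sub>M lborel) (\<lambda>(x, y). h x y)"
    proof (rule integrableI_nonneg)
      have "(\<integral>\<^sup>+z. ennreal ((\<lambda>(x, y). h x y) z) \<partial>(lborel \<Otimes>\<^sub>M lborel)) = (\<integral>\<^sup>+x. ennreal (d x) \<partial>lborel)"
        by (subst lborel_real2, subst nn_integral_distr) (auto simp: split_beta' dh intro!: nn_integral_cong)
      then show "(\<integral>\<^sup>+z. ennreal ((\<lambda>(x, y). h x y) z) \<partial>(lborel \<Otimes>\<^sub>M lborel)) < \<infinity>" by (simp add: tot)
    qed (use h0 in auto)
    then show "integrable (lborel \<Otimes>\<^sub>M lborel) (\<lambda>(x, y). h x y *\<^sub>R iexp (s * x + t * y))"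
      by (rule Bochner_Integration.integrable_bound)
         (auto simp: h0 split_beta' intro!: borel_measurable_scaleR)
  qed simp
  also have "\<dots> = (\<integral>y. (iexp (s * \<mu> $ 1 - s * (q / r) * \<mu> $ 2) * exp (- ((D / r) * s^2) / 2)) *
      (normal_density (\<mu> $ 2) (sqrt r) y *\<^sub>R iexp ((s * q / r + t) * y)) \<partial>lborel)"
  proof (intro Bochner_Integration.integral_cong refl)
    fix y
    have "(\<integral>x. h x y *\<^sub>R iexp (s * x + t * y) \<partial>lborel)
      = (\<integral>x. (normal_density (\<mu> $ 2) (sqrt r) y *\<^sub>R iexp (t * y)) * (normal_density (m y) (sqrt (D / r)) x *\<^sub>R iexp (s * x)) \<partial>lborel)"
      by (simp add: h_def scaleR_conv_of_real exp_add ring_distribs mult_ac)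
    also have "\<dots> = (normal_density (\<mu> $ 2) (sqrt r) y *\<^sub>R iexp (t * y)) * (iexp (s * m y) * exp (- ((D / r) * s^2) / 2))"
      using pos D by (subst integral_mult_right_zero, subst normal_density_char) simp_all
    also have "iexp (t * y) * iexp (s * m y) = iexp (s * \<mu> $ 1 - s * (q / r) * \<mu> $ 2) * iexp ((s * q / r + t) * y)"
      unfolding exp_add[symmetric] by (simp add: m_def algebra_simps)
    then have "(normal_density (\<mu> $ 2) (sqrt r) y *\<^sub>R iexp (t * y)) * (iexp (s * m y) * exp (- ((D / r) * s^2) / 2))
      = iexp (s * \<mu> $ 1 - s * (q / r) * \<mu> $ 2) * exp (- ((D / r) * s^2) / 2) * (normal_density (\<mu> $ 2) (sqrt r) y *\<^sub>R iexp ((s * q / r + t) * y))"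
      by (simp add: scaleR_conv_of_real mult_ac)
    finally show "(\<integral>x. h x y *\<^sub>R iexp (s * x + t * y) \<partial>lborel)
      = iexp (s * \<mu> $ 1 - s * (q / r) * \<mu> $ 2) * exp (- ((D / r) * s^2) / 2) * (normal_density (\<mu> $ 2) (sqrt r) y *\<^sub>R iexp ((s * q / r + t) * y))" .
  qed
  also have "\<dots> = (iexp (s * \<mu> $ 1 - s * (q / r) * \<mu> $ 2) * exp (- ((D / r) * s^2) / 2)) *
      (iexp ((s * q / r + t) * \<mu> $ 2) * exp (- (r * (s * q / r + t)^2) / 2))"
    using pos by (subst integral_mult_right_zero, subst normal_density_char) simp_all
  also have "\<dots> = (iexp (s * \<mu> $ 1 - s * (q / r) * \<mu> $ 2) * iexp ((s * q / r + t) * \<mu> $ 2)) *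
      (exp (- ((D / r) * s^2) / 2) * exp (- (r * (s * q / r + t)^2) / 2))" by (simp add: mult_ac)
  also have "iexp (s * \<mu> $ 1 - s * (q / r) * \<mu> $ 2) * iexp ((s * q / r + t) * \<mu> $ 2) = iexp (s * \<mu> $ 1 + t * \<mu> $ 2)"
    unfolding exp_add[symmetric] by (simp add: algebra_simps)
  also have "exp (- ((D / r) * s^2) / 2) * exp (- (r * (s * q / r + t)^2) / 2) = exp (- (p * s^2 + 2 * q * s * t + r * t^2) / 2)"
  proof -
    have "(D / r) * s^2 + r * (s * q / r + t)^2 = p * s^2 + 2 * q * s * t + r * t^2"
      using pos by (simp add: D_def field_simps power2_eq_square)
    moreover have "a + b = c \<Longrightarrow> - a / 2 + - b / 2 = - c / 2" for a b c :: real by simp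
    ultimately have "- ((D / r) * s^2) / 2 + - (r * (s * q / r + t)^2) / 2 = - (p * s^2 + 2 * q * s * t + r * t^2) / 2"
      by blast
    then show ?thesis unfolding exp_add[symmetric] by (rule arg_cong)
  qed
  finally show "(\<integral>x. iexp (s * x $ 1 + t * x $ 2) \<partial>normal_law \<mu> \<Sigma>)
      = iexp (s * \<mu> $ 1 + t * \<mu> $ 2) * exp (- (p * s^2 + 2 * q * s * t + r * t^2) / 2)"
    by simp
qed

section \<open>A central limit theorem for weakly dependent arrays\<close>

lemma norm_iexp_diff_le: "cmod (iexp x - iexp y) \<le> \<bar>x - y\<bar>"
proof -
  have "iexp x - iexp y = iexp y * (iexp (x - y) - 1)"
    by (simp add: right_diff_distrib' mult_exp_exp)
  then have "cmod (iexp x - iexp y) = cmod (iexp (x - y) - 1)" by (simp add: norm_mult)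
  also have "\<dots> \<le> \<bar>x - y\<bar>" using iexp_approx1[of "x - y" 0] by simp
  finally show ?thesis .
qed

text \<open>The third-order bound is the better one for small \<open>x\<close> and the second-order bound for large \<open>x\<close>;
  together they need only a moment of order \<open>p\<close> between 2 and 3.\<close>

lemma iexp_quadratic_approx:
  assumes "2 \<le> p" "p \<le> 3"
  shows "cmod (iexp x - (1 + \<i> * x - x^2 / 2)) \<le> \<bar>x\<bar> powr p"
proof -
  have e: "(\<Sum>k\<le>2. (\<i> * complex_of_real x)^k / fact k) = 1 + \<i> * x - x^2 / 2"
    by (simp add: numeral_2_eq_2 power2_eq_square) (simp add: complex_eq_iff)
  show ?thesis
  proof (cases "\<bar>x\<bar> \<le> 1")
    case True
    have "cmod (iexp x - (1 + \<i> * x - x^2 / 2)) \<le> \<bar>x\<bar>^3 / 6"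
      using iexp_approx1[of x 2] unfolding e by (simp add: numeral_eq_Suc)
    also have "\<dots> \<le> \<bar>x\<bar> powr 3"
    proof (cases "x = 0")
      case False
      then show ?thesis using powr_realpow[of "\<bar>x\<bar>" 3] by simp
    qed simp
    also have "\<dots> \<le> \<bar>x\<bar> powr p" using True assms by (intro powr_mono') auto
    finally show ?thesis .
  next
    case False
    have "cmod (iexp x - (1 + \<i> * x - x^2 / 2)) \<le> \<bar>x\<bar>^2"
      using iexp_approx2[of x 2] unfolding e by (simp add: numeral_eq_Suc)
    also have "\<dots> = \<bar>x\<bar> powr 2" using False powr_realpow[of "\<bar>x\<bar>" 2] by simp
    also have "\<dots> \<le> \<bar>x\<bar> powr p" using False assms by (intro powr_mono) auto
    finally show ?thesis .
  qed
qed

text \<open>Replaces the factor \<open>1 - x\<close> of a run of indices by \<open>exp (- x)\<close>, so that the product over the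
  runs becomes a single exponential.\<close>

lemma exp_minus_approx:
  assumes "0 \<le> (x::real)"
  shows "\<bar>(1 - x) - exp (- x)\<bar> \<le> x^2"
proof -
  have "exp (- x) \<le> 1 / (1 + x)"
    using exp_ge_add_one_self[of x] assms by (simp add: exp_minus field_simps)
  also have "\<dots> \<le> 1 - x + x^2"
  proof -
    have "(1 - x + x^2) * (1 + x) = 1 + x^3" by (simp add: algebra_simps power2_eq_square power3_eq_cube)
    then show ?thesis using assms by (simp add: divide_le_eq)
  qed
  finally show ?thesis using exp_ge_add_one_self[of "-x"] by simp
qed

lemma abs_powr_le:
  fixes y s p :: real
  assumes "0 \<le> s" "s \<le> p"
  shows "\<bar>y\<bar> powr s \<le> 1 + \<bar>y\<bar> powr p"
proof (cases "\<bar>y\<bar> \<le> 1")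
  case True
  then have "\<bar>y\<bar> powr s \<le> 1 powr s" using assms by (intro powr_mono2) auto
  then show ?thesis by (simp add: add_increasing2)
next
  case False
  then have "\<bar>y\<bar> powr s \<le> \<bar>y\<bar> powr p" using assms by (intro powr_mono) auto
  then show ?thesis by simp
qed

lemma abs_le_powr: "1 \<le> p \<Longrightarrow> \<bar>y\<bar> \<le> 1 + \<bar>y\<bar> powr p" for y p :: real
  using abs_powr_le[of 1 p y] by simp

lemma square_le_powr: "2 \<le> p \<Longrightarrow> (y::real)^2 \<le> 1 + \<bar>y\<bar> powr p"
  using abs_powr_le[of 2 p y] powr_realpow[of "\<bar>y\<bar>" 2] by (cases "y = 0") simp_all

lemma sum_powr_le:
  fixes y :: "'i \<Rightarrow> real"
  assumes "finite A" "0 \<le> p"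
  shows "\<bar>\<Sum>i\<in>A. y i\<bar> powr p \<le> real (card A) powr p * (\<Sum>i\<in>A. \<bar>y i\<bar> powr p)"
proof (cases "A = {}")
  case False
  define m where "m = Max ((\<lambda>i. \<bar>y i\<bar>) ` A)"
  have m: "\<bar>y i\<bar> \<le> m" if "i \<in> A" for i using that assms by (auto simp: m_def)
  have "m \<in> (\<lambda>i. \<bar>y i\<bar>) ` A" unfolding m_def using assms False by (intro Max_in) auto
  then obtain j where j: "j \<in> A" "m = \<bar>y j\<bar>" by auto
  have "\<bar>\<Sum>i\<in>A. y i\<bar> \<le> (\<Sum>i\<in>A. \<bar>y i\<bar>)" by simp
  also have "\<dots> \<le> real (card A) * m" using sum_bounded_above[of A "\<lambda>i. \<bar>y i\<bar>" m] m by simp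
  finally have "\<bar>\<Sum>i\<in>A. y i\<bar> powr p \<le> (real (card A) * m) powr p"
    using assms by (intro powr_mono2) auto
  also have "\<dots> = real (card A) powr p * \<bar>y j\<bar> powr p" using j by (simp add: powr_mult)
  also have "\<bar>y j\<bar> powr p \<le> (\<Sum>i\<in>A. \<bar>y i\<bar> powr p)" using j assms by (intro member_le_sum) auto
  finally show ?thesis by (simp add: mult_left_mono)
qed simp

lemma tendsto_div_ratio:
  assumes "0 < q"
  shows "(\<lambda>n. real (n div q) / real n) \<longlonglongrightarrow> 1 / real q"
proof (rule tendsto_sandwich)
  have "real n / real q - 1 \<le> real (n div q)" "real (n div q) \<le> real n / real q" for n
  proof -
    have "n div q = nat \<lfloor>real n / real q\<rfloor>" by (simp add: floor_divide_of_nat_eq)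
    then have "real (n div q) = of_int \<lfloor>real n / real q\<rfloor>" by simp
    then show "real n / real q - 1 \<le> real (n div q)" "real (n div q) \<le> real n / real q" by linarith+
  qed
  then have "(real n / real q - 1) / real n \<le> real (n div q) / real n"
    "real (n div q) / real n \<le> (real n / real q) / real n" for n
    by (intro divide_right_mono; simp)+
  then show "\<forall>\<^sub>F n in sequentially. (real n / real q - 1) / real n \<le> real (n div q) / real n"
    "\<forall>\<^sub>F n in sequentially. real (n div q) / real n \<le> (real n / real q) / real n"
    by auto
  have ev: "\<forall>\<^sub>F n in sequentially. (n::nat) > 0" by (rule eventually_gt_at_top)
  have "(\<lambda>n. 1 / real q - 1 / real n) \<longlonglongrightarrow> 1 / real q - 0"
    by (intro tendsto_diff tendsto_const lim_1_over_n)
  then have "(\<lambda>n. 1 / real q - 1 / real n) \<longlonglongrightarrow> 1 / real q" by simp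
  then show "(\<lambda>n. (real n / real q - 1) / real n) \<longlonglongrightarrow> 1 / real q"
    by (rule Lim_transform_eventually[OF _ eventually_mono[OF ev]]) (use assms in \<open>simp_all add: diff_divide_distrib\<close>)
  show "(\<lambda>n. (real n / real q) / real n) \<longlonglongrightarrow> 1 / real q"
    by (rule tendsto_eventually[OF eventually_mono[OF ev]]) auto
qed

context prob_space
begin

lemma abs_expectation_le_sqrt:
  assumes "X \<in> borel_measurable M" "integrable M (\<lambda>w. (X w)^2)"
  shows "integrable M X" "expectation (\<lambda>w. \<bar>X w\<bar>) \<le> sqrt (expectation (\<lambda>w. (X w)^2))"
proof -
  show i: "integrable M X"
    by (rule square_integrable_imp_integrable) (use assms in auto)
  have "0 \<le> variance (\<lambda>w. \<bar>X w\<bar>)" by (rule variance_positive)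
  also have "variance (\<lambda>w. \<bar>X w\<bar>) = expectation (\<lambda>w. (X w)^2) - (expectation (\<lambda>w. \<bar>X w\<bar>))^2"
    using i assms by (subst variance_eq) auto
  finally show "expectation (\<lambda>w. \<bar>X w\<bar>) \<le> sqrt (expectation (\<lambda>w. (X w)^2))"
    by (intro real_le_rsqrt) simp
qed

lemma integrable_mult_of_squares:
  fixes X Y :: "'a \<Rightarrow> real"
  assumes [measurable]: "X \<in> borel_measurable M" "Y \<in> borel_measurable M"
    and i: "integrable M (\<lambda>w. (X w)^2)" "integrable M (\<lambda>w. (Y w)^2)"
  shows "integrable M (\<lambda>w. X w * Y w)"
proof (rule Bochner_Integration.integrable_bound[of M "\<lambda>w. (X w)^2 + (Y w)^2"])
  have "\<bar>x * y\<bar> \<le> x^2 + y^2" for x y :: real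
    using sum_squares_bound[of x y] sum_squares_bound[of x "-y"] zero_le_power2[of x] zero_le_power2[of y]
    by (auto simp: abs_le_iff)
  then show "AE w in M. norm (X w * Y w) \<le> norm ((X w)^2 + (Y w)^2)" by auto
qed (use i in auto)

text \<open>Each row of the covariance matrix has at most \<open>k\<close> entries of size \<open>e / k\<close> and at most three
  neighbouring ones of size \<open>e\<close>, which costs \<open>4 * e\<close> per row.\<close>

lemma expectation_sum_square:
  fixes Y :: "nat \<Rightarrow> 'a \<Rightarrow> real"
  assumes A: "A \<subseteq> {1..k}" and "0 \<le> e"
    and int: "\<And>i j. i \<in> A \<Longrightarrow> j \<in> A \<Longrightarrow> integrable M (\<lambda>w. Y i w * Y j w)"
    and cov: "\<And>i j. i \<in> A \<Longrightarrow> j \<in> A \<Longrightarrow>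
       \<bar>expectation (\<lambda>w. Y i w * Y j w) - (if i = j then v else 0)\<bar>
         \<le> e / real k + (if j \<in> {i - 1, i, Suc i} then e else 0)"
  shows "integrable M (\<lambda>w. (\<Sum>i\<in>A. Y i w)^2)"
    "\<bar>expectation (\<lambda>w. (\<Sum>i\<in>A. Y i w)^2) - real (card A) * v\<bar> \<le> 4 * real (card A) * e"
proof -
  have fin: "finite A" using A finite_subset by blast
  have sq: "(\<Sum>i\<in>A. Y i w)^2 = (\<Sum>i\<in>A. \<Sum>j\<in>A. Y i w * Y j w)" for w
    by (simp add: power2_eq_square sum_product)
  show "integrable M (\<lambda>w. (\<Sum>i\<in>A. Y i w)^2)" unfolding sq by (intro Bochner_Integration.integrable_sum int)
  have "expectation (\<lambda>w. (\<Sum>i\<in>A. Y i w)^2) - real (card A) * v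
      = (\<Sum>i\<in>A. (\<Sum>j\<in>A. expectation (\<lambda>w. Y i w * Y j w)) - v)"
    unfolding sq using int by (simp add: sum_subtractf)
  also have "\<dots> = (\<Sum>i\<in>A. \<Sum>j\<in>A. expectation (\<lambda>w. Y i w * Y j w) - (if i = j then v else 0))"
    using fin by (intro sum.cong refl) (simp add: sum_subtractf)
  also have "\<bar>\<dots>\<bar> \<le> (\<Sum>i\<in>A. \<Sum>j\<in>A. \<bar>expectation (\<lambda>w. Y i w * Y j w) - (if i = j then v else 0)\<bar>)"
    by (rule order_trans[OF sum_abs]) (intro sum_mono sum_abs)
  also have "\<dots> \<le> (\<Sum>i\<in>A. \<Sum>j\<in>A. e / real k + (if j \<in> {i - 1, i, Suc i} then e else 0))"
    by (intro sum_mono cov)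
  also have "\<dots> \<le> (\<Sum>i\<in>A. 4 * e)"
  proof (intro sum_mono)
    fix i assume i: "i \<in> A"
    have c: "card A \<le> k" using card_mono[OF _ A] by simp
    have k: "k > 0" using i A by auto
    have "(\<Sum>j\<in>A. e / real k + (if j \<in> {i - 1, i, Suc i} then e else 0))
        = real (card A) * (e / real k) + (\<Sum>j\<in>A. if j \<in> {i - 1, i, Suc i} then e else 0)"
      by (simp add: sum.distrib)
    also have "(\<Sum>j\<in>A. if j \<in> {i - 1, i, Suc i} then e else 0) = (\<Sum>j\<in>A \<inter> {i - 1, i, Suc i}. e)"
      using fin by (subst sum.inter_restrict) auto
    also have "\<dots> = real (card (A \<inter> {i - 1, i, Suc i})) * e" by simp
    also have "card (A \<inter> {i - 1, i, Suc i}) \<le> card {i - 1, i, Suc i}" by (intro card_mono) auto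
    then have "card (A \<inter> {i - 1, i, Suc i}) \<le> 3"
      using card_length[of "[i - 1, i, Suc i]"] by simp
    then have "real (card (A \<inter> {i - 1, i, Suc i})) * e \<le> 3 * e" using assms(2) by (intro mult_right_mono) auto
    also have "real (card A) * (e / real k) \<le> real k * (e / real k)"
      using c assms(2) by (intro mult_right_mono) auto
    also have "real k * (e / real k) = e" using k by simp
    finally show "(\<Sum>j\<in>A. e / real k + (if j \<in> {i - 1, i, Suc i} then e else 0)) \<le> 4 * e" by simp
  qed
  finally show "\<bar>expectation (\<lambda>w. (\<Sum>i\<in>A. Y i w)^2) - real (card A) * v\<bar> \<le> 4 * real (card A) * e" by simp
qed

lemma square_integrable_of_moment:
  assumes "X \<in> borel_measurable M" "2 \<le> p" "integrable M (\<lambda>w. \<bar>X w\<bar> powr p)"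
  shows "integrable M (\<lambda>w. (X w :: real)^2)"
  by (rule Bochner_Integration.integrable_bound[of M "\<lambda>w. 1 + \<bar>X w\<bar> powr p"])
     (use assms square_le_powr[OF assms(2)] in auto)

text \<open>A Bernstein blocking argument. For a fixed \<open>q\<close> the indices form \<open>k n div q\<close> runs of length
  \<open>q - 1\<close>, each followed by one omitted index. The omitted indices contribute a variance of order
  \<open>1 / q\<close>; across an omitted index the characteristic function factorizes up to \<open>a n\<close>; and each run
  has characteristic function \<open>exp (- (q - 1) * v / (2 * k n))\<close> up to \<open>o (1 / k n)\<close>. The limit is
  taken first in \<open>n\<close> and then in \<open>q\<close>.\<close>

theorem clt_weakly_dependent_array:
  fixes Y :: "nat \<Rightarrow> nat \<Rightarrow> 'a \<Rightarrow> real" and k :: "nat \<Rightarrow> nat" and e a :: "nat \<Rightarrow> real"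
  defines "S \<equiv> \<lambda>n A w. (\<Sum>i\<in>A. Y n i w) / sqrt (real (k n))"
  assumes k_lim: "filterlim k at_top sequentially"
    and rv [measurable]: "\<And>n i. Y n i \<in> borel_measurable M"
    and p: "2 < p" "p \<le> 3"
    and mom: "\<And>n i. i \<in> {1..k n} \<Longrightarrow> integrable M (\<lambda>w. \<bar>Y n i w\<bar> powr p)"
      "\<And>n i. i \<in> {1..k n} \<Longrightarrow> expectation (\<lambda>w. \<bar>Y n i w\<bar> powr p) \<le> K"
    and mean0: "\<And>n i. i \<in> {1..k n} \<Longrightarrow> expectation (Y n i) = 0"
    and v: "0 \<le> v" and e: "\<And>n. 0 \<le> e n" "e \<longlonglongrightarrow> 0"
    and cov: "\<And>n i j. i \<in> {1..k n} \<Longrightarrow> j \<in> {1..k n} \<Longrightarrow>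
       \<bar>expectation (\<lambda>w. Y n i w * Y n j w) - (if i = j then v else 0)\<bar>
         \<le> e n / real (k n) + (if j \<in> {i - 1, i, Suc i} then e n else 0)"
    and mix: "\<And>n A B b. A \<subseteq> {1..<b} \<Longrightarrow> B \<subseteq> {Suc b..k n} \<Longrightarrow>
       cmod (expectation (\<lambda>w. iexp (S n (A \<union> B) w))
         - expectation (\<lambda>w. iexp (S n A w)) * expectation (\<lambda>w. iexp (S n B w))) \<le> a n"
    and a: "(\<lambda>n. real (k n) * a n) \<longlonglongrightarrow> 0"
  shows "(\<lambda>n. expectation (\<lambda>w. iexp (S n {1..k n} w))) \<longlonglongrightarrow> exp (- v / 2)"
proof -
  define \<phi> where "\<phi> n A = expectation (\<lambda>w. iexp (S n A w))" for n A
  have Sm [measurable]: "S n A \<in> borel_measurable M" for n A unfolding S_def by measurable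
  have ei: "integrable M (\<lambda>w. iexp (S n A w))" for n A
    by (rule integrable_iexp[where f="\<lambda>w. complex_of_real (S n A w)"]) auto
  have \<phi>_le: "cmod (\<phi> n A) \<le> 1" for n A
  proof -
    have "cmod (\<phi> n A) \<le> expectation (\<lambda>w. cmod (iexp (S n A w)))" unfolding \<phi>_def by (rule integral_norm_bound)
    then show ?thesis by (simp add: prob_space)
  qed
  have K0: "0 \<le> K" if "k n > 0" for n
  proof -
    have "0 \<le> expectation (\<lambda>w. \<bar>Y n 1 w\<bar> powr p)" by (intro integral_nonneg_AE) auto
    also have "\<dots> \<le> K" using mom(2)[of 1 n] that by auto
    finally show ?thesis .
  qed
  have sqi: "integrable M (\<lambda>w. (Y n i w)^2)" if "i \<in> {1..k n}" for n i
    using square_integrable_of_moment[OF rv _ mom(1)[OF that]] p by simp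
  have int2: "integrable M (\<lambda>w. Y n i w * Y n j w)" if "i \<in> {1..k n}" "j \<in> {1..k n}" for n i j
    by (rule integrable_mult_of_squares[OF rv rv]; use sqi that in blast)
  have V: "integrable M (\<lambda>w. (S n A w)^2)"
    "\<bar>expectation (\<lambda>w. (S n A w)^2) - real (card A) * v / real (k n)\<bar> \<le> 4 * real (card A) * e n / real (k n)"
    if A: "A \<subseteq> {1..k n}" for n A
  proof -
    note E = expectation_sum_square[OF A e(1)[of n], of "Y n" v]
    have 1: "integrable M (\<lambda>w. (\<Sum>i\<in>A. Y n i w)^2)"
      "\<bar>expectation (\<lambda>w. (\<Sum>i\<in>A. Y n i w)^2) - real (card A) * v\<bar> \<le> 4 * real (card A) * e n"
      by (rule E; use A int2 cov in blast)+
    have eq: "(S n A w)^2 = (\<Sum>i\<in>A. Y n i w)^2 / real (k n)" for w by (simp add: S_def power_divide)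
    show "integrable M (\<lambda>w. (S n A w)^2)" unfolding eq using 1(1) by (rule integrable_divide_zero)
    have "expectation (\<lambda>w. (S n A w)^2) - real (card A) * v / real (k n)
       = (expectation (\<lambda>w. (\<Sum>i\<in>A. Y n i w)^2) - real (card A) * v) / real (k n)"
      unfolding eq integral_divide_zero by (rule diff_divide_distrib[symmetric])
    then show "\<bar>expectation (\<lambda>w. (S n A w)^2) - real (card A) * v / real (k n)\<bar> \<le> 4 * real (card A) * e n / real (k n)"
      using 1(2) by (simp add: abs_divide divide_right_mono)
  qed
  have S1: "integrable M (S n A)" "expectation (S n A) = 0" if A: "A \<subseteq> {1..k n}" for n A
  proof -
    show "integrable M (S n A)" by (rule abs_expectation_le_sqrt(1)[OF Sm V(1)[OF A]])
    have "integrable M (Y n i)" if "i \<in> A" for i using abs_expectation_le_sqrt(1)[OF rv sqi] that A by blast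
    then have "expectation (S n A) = (\<Sum>i\<in>A. expectation (Y n i)) / sqrt (real (k n))"
      unfolding S_def by simp
    also have "(\<Sum>i\<in>A. expectation (Y n i)) = 0" using mean0 A by (intro sum.neutral) blast
    finally show "expectation (S n A) = 0" by simp
  qed
  have block: "cmod (\<phi> n A - exp (- (real (card A) * v / (2 * real (k n)))))
      \<le> real (card A) powr p * real (card A) * K * real (k n) powr (- p / 2)
        + 2 * real (card A) * e n / real (k n) + (real (card A) * v / (2 * real (k n)))^2"
    if A: "A \<subseteq> {1..k n}" and k: "k n > 0" for n A
  proof -
    have fin: "finite A" using A finite_subset by blast
    define x where "x = real (card A) * v / (2 * real (k n))"
    have x0: "0 \<le> x" using v by (simp add: x_def)
    have pm: "integrable M (\<lambda>w. \<bar>S n A w\<bar> powr p) \<and> expectation (\<lambda>w. \<bar>S n A w\<bar> powr p)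
       \<le> real (card A) powr p * real (card A) * K * real (k n) powr (- p / 2)"
    proof -
      define c where "c = real (card A) powr p * real (k n) powr (- p / 2)"
      have le: "\<bar>S n A w\<bar> powr p \<le> c * (\<Sum>i\<in>A. \<bar>Y n i w\<bar> powr p)" for w
      proof -
        have "sqrt (real (k n)) powr p = real (k n) powr (p / 2)"
          using k by (simp add: powr_half_sqrt[symmetric] powr_powr)
        moreover have "\<bar>S n A w\<bar> powr p = \<bar>\<Sum>i\<in>A. Y n i w\<bar> powr p / sqrt (real (k n)) powr p"
          unfolding S_def abs_divide by (subst powr_divide) auto
        ultimately have "\<bar>S n A w\<bar> powr p = \<bar>\<Sum>i\<in>A. Y n i w\<bar> powr p * real (k n) powr (- p / 2)"
          using powr_minus_divide[of "real (k n)" "p / 2"] by simp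
        then have "\<bar>S n A w\<bar> powr p \<le> (real (card A) powr p * (\<Sum>i\<in>A. \<bar>Y n i w\<bar> powr p)) * real (k n) powr (- p / 2)"
          using sum_powr_le[OF fin, of p "\<lambda>i. Y n i w"] p by (simp add: mult_right_mono)
        then show ?thesis by (simp add: c_def mult_ac)
      qed
      have i: "integrable M (\<lambda>w. c * (\<Sum>i\<in>A. \<bar>Y n i w\<bar> powr p))"
        using mom(1) A by (intro integrable_mult_right Bochner_Integration.integrable_sum) blast
      have i': "integrable M (\<lambda>w. \<bar>S n A w\<bar> powr p)"
      proof (rule Bochner_Integration.integrable_bound[OF i])
        have "norm (\<bar>S n A w\<bar> powr p) \<le> norm (c * (\<Sum>i\<in>A. \<bar>Y n i w\<bar> powr p))" for w
          unfolding real_norm_def by (rule order_trans[OF _ abs_ge_self]) (simp add: le)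
        then show "AE w in M. norm (\<bar>S n A w\<bar> powr p) \<le> norm (c * (\<Sum>i\<in>A. \<bar>Y n i w\<bar> powr p))" by simp
      qed measurable
      have "expectation (\<lambda>w. \<bar>S n A w\<bar> powr p) \<le> expectation (\<lambda>w. c * (\<Sum>i\<in>A. \<bar>Y n i w\<bar> powr p))"
        by (rule integral_mono[OF i' i le])
      also have "\<dots> = c * (\<Sum>i\<in>A. expectation (\<lambda>w. \<bar>Y n i w\<bar> powr p))"
        using mom(1) A by (subst integral_mult_right_zero, subst Bochner_Integration.integral_sum) auto
      also have "\<dots> \<le> c * (\<Sum>i\<in>A. K)"
        using mom(2) A by (intro mult_left_mono sum_mono) (auto simp: c_def)
      finally show ?thesis using i' by (simp add: c_def mult_ac)
    qed
    define s2 where "s2 = expectation (\<lambda>w. (S n A w)^2)"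
    have s2: "\<bar>(1 - s2 / 2) - (1 - x)\<bar> \<le> 2 * real (card A) * e n / real (k n)"
    proof -
      have "real (card A) * v / real (k n) = 2 * x"
        "4 * real (card A) * e n / real (k n) = 2 * (2 * real (card A) * e n / real (k n))" by (simp_all add: x_def)
      then have "\<bar>s2 - 2 * x\<bar> \<le> 2 * (2 * real (card A) * e n / real (k n))"
        using V(2)[OF A] unfolding s2_def by (simp only:)
      then show ?thesis by linarith
    qed
    have E: "expectation (\<lambda>w. 1 + \<i> * S n A w - (S n A w)^2 / 2) = 1 - s2 / 2"
    proof -
      have "integrable M (\<lambda>w. complex_of_real ((S n A w)^2))" using V(1)[OF A] by (rule integrable_of_real)
      moreover have "integrable M (\<lambda>w. complex_of_real (S n A w))" using S1(1)[OF A] by (rule integrable_of_real)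
      ultimately have "expectation (\<lambda>w. 1 + \<i> * S n A w - complex_of_real ((S n A w)^2) / 2)
         = 1 + \<i> * complex_of_real (expectation (S n A)) - complex_of_real s2 / 2"
        unfolding s2_def by (simp add: prob_space del: of_real_power)
      then show ?thesis using S1(2)[OF A] by simp
    qed
    have i3: "integrable M (\<lambda>w. 1 + \<i> * complex_of_real (S n A w) - complex_of_real ((S n A w)^2 / 2))"
    proof -
      have "integrable M (\<lambda>w. complex_of_real ((S n A w)^2))" using V(1)[OF A] by (rule integrable_of_real)
      moreover have "integrable M (\<lambda>w. complex_of_real (S n A w))" using S1(1)[OF A] by (rule integrable_of_real)
      ultimately show ?thesis by simp
    qed
    have "\<phi> n A - (1 - s2 / 2) = expectation (\<lambda>w. iexp (S n A w) - (1 + \<i> * S n A w - (S n A w)^2 / 2))"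
      unfolding E[symmetric] \<phi>_def by (rule Bochner_Integration.integral_diff[symmetric, OF ei i3])
    also have "cmod \<dots> \<le> expectation (\<lambda>w. cmod (iexp (S n A w) - (1 + \<i> * S n A w - (S n A w)^2 / 2)))"
      by (rule integral_norm_bound)
    also have "\<dots> \<le> expectation (\<lambda>w. \<bar>S n A w\<bar> powr p)"
      using p pm by (intro integral_mono integrable_norm Bochner_Integration.integrable_diff ei i3 iexp_quadratic_approx) auto
    also have "\<dots> \<le> real (card A) powr p * real (card A) * K * real (k n) powr (- p / 2)" using pm by simp
    finally have 1: "cmod (\<phi> n A - (1 - s2 / 2)) \<le> real (card A) powr p * real (card A) * K * real (k n) powr (- p / 2)" .
    have 2: "cmod (complex_of_real (1 - s2 / 2) - complex_of_real (1 - x)) \<le> 2 * real (card A) * e n / real (k n)"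
      using s2 unfolding of_real_diff[symmetric] norm_of_real .
    have 3: "cmod (complex_of_real (1 - x) - complex_of_real (exp (- x))) \<le> x^2"
      using exp_minus_approx[OF x0] unfolding of_real_diff[symmetric] norm_of_real .
    have "\<phi> n A - complex_of_real (exp (- x)) = (\<phi> n A - (1 - s2 / 2))
        + (complex_of_real (1 - s2 / 2) - complex_of_real (1 - x)) + (complex_of_real (1 - x) - complex_of_real (exp (- x)))"
      by simp
    then have "cmod (\<phi> n A - complex_of_real (exp (- x))) \<le> cmod (\<phi> n A - (1 - s2 / 2))
        + cmod (complex_of_real (1 - s2 / 2) - complex_of_real (1 - x)) + cmod (complex_of_real (1 - x) - complex_of_real (exp (- x)))"
      by (metis norm_triangle_mono norm_triangle_ineq order_refl)
    then show ?thesis using 1 2 3 unfolding x_def[symmetric] by (simp add: exp_of_real)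
  qed
  have main: "\<forall>\<^sub>F n in sequentially. cmod (\<phi> n {1..k n} - exp (- v / 2)) \<le> g n \<and> 0 \<le> K"
    if q: "2 \<le> (q::nat)" and g: "g = (\<lambda>n. sqrt ((real (k n div q) / real (k n) + real q / real (k n)) * (v + 4 * e n))
        + \<bar>real (k n) * a n\<bar>
        + (real q powr p * real q * K * real (k n) powr (1 - p / 2) + 2 * real q * e n + (real q * v)^2 / real (k n))
        + \<bar>exp (- (real (k n div q) / real (k n) * (real (q - 1) * v / 2))) - exp (- v / 2)\<bar>)" for q g
  proof -
    have "\<forall>\<^sub>F n in sequentially. k n \<ge> q"
      using k_lim unfolding filterlim_at_top by blast
    then show ?thesis
    proof eventually_elim
      case (elim n)
      have k: "k n > 0" using elim q by simp
      \<comment> \<open>\<open>big j\<close> is the \<open>j\<close>-th run, \<open>U j\<close> the union of the first \<open>j\<close> runs; index \<open>j * q\<close> is omitted.\<close>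
      define m where "m = k n div q"
      have mk: "m * q \<le> k n" "m \<le> k n" by (auto simp: m_def)
      define big where "big j = {j * q + 1..<j * q + q}" for j
      define U where "U j = (\<Union>i<j. big i)" for j
      have Uj: "U j \<subseteq> {1..<j * q}" for j
      proof (cases j)
        case (Suc j')
        have "big i \<subseteq> {1..<j * q}" if "i < j" for i
        proof -
          have "(i + 1) * q \<le> j * q" using that by (intro mult_right_mono) auto
          then show ?thesis by (auto simp: big_def)
        qed
        then show ?thesis by (auto simp: U_def)
      qed (simp add: U_def)
      have bigk: "big j \<subseteq> {Suc (j * q)..k n}" if "j < m" for j
      proof -
        have "(j + 1) * q \<le> m * q" using that by (intro mult_right_mono) auto
        then show ?thesis using mk by (auto simp: big_def)
      qed
      have card_big: "card (big j) = q - 1" for j by (simp add: big_def)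
      have Uk: "U j \<subseteq> {1..k n}" if "j \<le> m" for j
      proof -
        have "j * q \<le> m * q" using that by simp
        then have "j * q \<le> k n" using mk(1) by (rule le_trans)
        then have "{1..<j * q} \<subseteq> {1..k n}" by auto
        then show ?thesis using Uj[of j] by blast
      qed
      have cardU: "card (U j) = j * (q - 1)" for j
      proof (induction j)
        case (Suc j)
        have "U (Suc j) = U j \<union> big j" by (auto simp: U_def less_Suc_eq)
        moreover have "U j \<inter> big j = {}" using Uj[of j] by (auto simp: big_def)
        moreover have "finite (U j)" using Uj[of j] finite_subset by blast
        ultimately show ?case using Suc by (simp add: card_Un_disjoint card_big big_def)
      qed (simp add: U_def)
      have a0: "0 \<le> a n" using mix[of "{}" 1 "{}" n] norm_ge_zero order_trans by blast
      have prod: "cmod (\<phi> n (U j) - (\<Prod>i<j. \<phi> n (big i))) \<le> real j * a n" if "j \<le> m" for j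
        using that
      proof (induction j)
        case 0
        then show ?case by (simp add: U_def \<phi>_def S_def prob_space)
      next
        case (Suc j)
        have eq: "U (Suc j) = U j \<union> big j" by (auto simp: U_def less_Suc_eq)
        have "\<phi> n (U (Suc j)) - (\<Prod>i<Suc j. \<phi> n (big i))
           = (\<phi> n (U j \<union> big j) - \<phi> n (U j) * \<phi> n (big j)) + (\<phi> n (U j) - (\<Prod>i<j. \<phi> n (big i))) * \<phi> n (big j)"
          by (simp add: eq algebra_simps)
        also have "cmod \<dots> \<le> a n + real j * a n * 1"
        proof (intro norm_triangle_mono)
          show "cmod (\<phi> n (U j \<union> big j) - \<phi> n (U j) * \<phi> n (big j)) \<le> a n"
            unfolding \<phi>_def using Uj[of j] bigk[of j] Suc.prems by (intro mix[of "U j" "j * q" "big j" n]) auto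
          show "cmod ((\<phi> n (U j) - (\<Prod>i<j. \<phi> n (big i))) * \<phi> n (big j)) \<le> real j * a n * 1"
            unfolding norm_mult using Suc \<phi>_le a0 by (intro mult_mono) auto
        qed
        finally show ?case by (simp add: algebra_simps)
      qed
      define x where "x = real (q - 1) * v / (2 * real (k n))"
      have x0: "x \<ge> 0" using v by (simp add: x_def)
      define E where "E = real q powr p * real q * K * real (k n) powr (- p / 2) + 2 * real q * e n / real (k n) + (real q * v / (2 * real (k n)))^2"
      have bigE: "cmod (\<phi> n (big i) - exp (- x)) \<le> E" if "i < m" for i
      proof -
        have "big i \<subseteq> {1..k n}" using bigk[OF that] by auto
        note block[OF this k, unfolded card_big]
        also have "real (q - 1) powr p * real (q - 1) * K * real (k n) powr (- p / 2) + 2 * real (q - 1) * e n / real (k n) + (real (q - 1) * v / (2 * real (k n)))^2 \<le> E"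
          unfolding E_def using K0[OF k] v e(1)[of n] p
          by (intro add_mono mult_right_mono mult_mono divide_right_mono power_mono powr_mono2) auto
        finally show ?thesis by (simp add: x_def)
      qed
      have "cmod ((\<Prod>i<m. \<phi> n (big i)) - (\<Prod>i<m. complex_of_real (exp (- x)))) \<le> (\<Sum>i<m. cmod (\<phi> n (big i) - complex_of_real (exp (- x))))"
        by (intro norm_prod_diff) (use \<phi>_le x0 in auto)
      also have "\<dots> \<le> (\<Sum>i<m. E)" using bigE by (intro sum_mono) (auto simp: exp_of_real)
      also have "\<dots> = real m * E" by simp
      also have "\<dots> \<le> real (k n) * E"
        using mk K0[OF k] e(1)[of n] v by (intro mult_right_mono) (auto simp: E_def)
      also have "\<dots> \<le> real q powr p * real q * K * real (k n) powr (1 - p / 2) + 2 * real q * e n + (real q * v)^2 / real (k n)"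
      proof -
        have "real (k n) * real (k n) powr (- p / 2) = real (k n) powr (1 - p / 2)"
          using k powr_add[of "real (k n)" 1 "- p / 2"] by simp
        moreover have "real (k n) * (real q * v / (2 * real (k n)))^2 \<le> (real q * v)^2 / real (k n)"
          using k v by (simp add: power2_eq_square field_simps)
        moreover have "real (k n) * E = real q powr p * real q * K * (real (k n) * real (k n) powr (- p / 2))
            + 2 * real q * e n + real (k n) * (real q * v / (2 * real (k n)))^2"
          using k by (simp add: E_def distrib_left)
        ultimately show ?thesis by simp
      qed
      finally have P2': "cmod ((\<Prod>i<m. \<phi> n (big i)) - (\<Prod>i<m. complex_of_real (exp (- x))))
         \<le> real q powr p * real q * K * real (k n) powr (1 - p / 2) + 2 * real q * e n + (real q * v)^2 / real (k n)" .
      have P2: "cmod ((\<Prod>i<m. \<phi> n (big i)) - complex_of_real (exp (- (real m / real (k n) * (real (q - 1) * v / 2)))))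
         \<le> real q powr p * real q * K * real (k n) powr (1 - p / 2) + 2 * real q * e n + (real q * v)^2 / real (k n)"
      proof -
        have "exp (- x) ^ m = exp (- (real m / real (k n) * (real (q - 1) * v / 2)))"
          by (simp add: exp_of_nat_mult[symmetric] x_def mult.commute)
        then have "(\<Prod>i<m. complex_of_real (exp (- x))) = complex_of_real (exp (- (real m / real (k n) * (real (q - 1) * v / 2))))"
          by (simp only: prod_constant card_lessThan of_real_power[symmetric])
        then show ?thesis using P2' by (simp only:)
      qed
      have P1: "cmod (\<phi> n (U m) - (\<Prod>i<m. \<phi> n (big i))) \<le> \<bar>real (k n) * a n\<bar>"
      proof -
        have "real m * a n \<le> real (k n) * a n" using mk a0 by (intro mult_right_mono) auto
        then show ?thesis using prod[of m] by simp
      qed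
      have P0: "cmod (\<phi> n {1..k n} - \<phi> n (U m)) \<le> sqrt ((real m / real (k n) + real q / real (k n)) * (v + 4 * e n))"
      proof -
        \<comment> \<open>one omitted index per run and an incomplete last run: at most \<open>m + q\<close> indices\<close>
        define R where "R = {1..k n} - U m"
        have R: "R \<subseteq> {1..k n}" by (auto simp: R_def)
        have "card R = k n - m * (q - 1)"
          unfolding R_def using Uk[of m] by (subst card_Diff_subset) (auto simp: cardU intro: finite_subset)
        moreover have "k n < (m + 1) * q" using q by (simp add: m_def dividend_less_div_times)
        ultimately have cR: "card R \<le> m + q" using q
          by (simp add: algebra_simps)
        have diff: "S n {1..k n} w - S n (U m) w = S n R w" for w
          unfolding S_def R_def using Uk[of m] by (simp add: sum_diff diff_divide_distrib)
        have "\<phi> n {1..k n} - \<phi> n (U m) = expectation (\<lambda>w. iexp (S n {1..k n} w) - iexp (S n (U m) w))"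
          unfolding \<phi>_def by (rule Bochner_Integration.integral_diff[symmetric, OF ei ei])
        also have "cmod \<dots> \<le> expectation (\<lambda>w. cmod (iexp (S n {1..k n} w) - iexp (S n (U m) w)))"
          by (rule integral_norm_bound)
        also have "\<dots> \<le> expectation (\<lambda>w. \<bar>S n R w\<bar>)"
          by (intro integral_mono integrable_norm Bochner_Integration.integrable_diff ei integrable_abs S1(1)[OF R])
             (use norm_iexp_diff_le diff in metis)
        also have "\<dots> \<le> sqrt (expectation (\<lambda>w. (S n R w)^2))"
          by (rule abs_expectation_le_sqrt(2)[OF Sm V(1)[OF R]])
        also have "\<dots> \<le> sqrt ((real m / real (k n) + real q / real (k n)) * (v + 4 * e n))"
        proof (intro real_sqrt_le_mono)
          have "expectation (\<lambda>w. (S n R w)^2) \<le> real (card R) * v / real (k n) + 4 * real (card R) * e n / real (k n)"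
            using V(2)[OF R] by linarith
          also have "\<dots> = (real (card R) / real (k n)) * (v + 4 * e n)" by (simp add: add_divide_distrib algebra_simps)
          also have "\<dots> \<le> ((real m + real q) / real (k n)) * (v + 4 * e n)"
            using cR v e(1)[of n] by (intro mult_right_mono divide_right_mono) auto
          finally show "expectation (\<lambda>w. (S n R w)^2) \<le> (real m / real (k n) + real q / real (k n)) * (v + 4 * e n)"
            by (simp add: add_divide_distrib)
        qed
        finally show ?thesis .
      qed
      have P3: "cmod (complex_of_real (exp (- (real m / real (k n) * (real (q - 1) * v / 2)))) - complex_of_real (exp (- v / 2)))
          = \<bar>exp (- (real m / real (k n) * (real (q - 1) * v / 2))) - exp (- v / 2)\<bar>"
        unfolding of_real_diff[symmetric] norm_of_real ..
      have tri: "cmod (x0 - x4) \<le> b1 + b2 + b3 + b4" if "cmod (x0 - x1) \<le> b1" "cmod (x1 - x2) \<le> b2" "cmod (x2 - x3) \<le> b3" "cmod (x3 - x4) = b4"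
        for x0 x1 x2 x3 x4 :: complex and b1 b2 b3 b4
        using that norm_triangle_ineq[of "x0 - x1" "x1 - x2"] norm_triangle_ineq[of "x0 - x2" "x2 - x3"] norm_triangle_ineq[of "x0 - x3" "x3 - x4"]
        by simp
      show ?case using tri[OF P0 P1 P2 P3] K0[OF k] unfolding g m_def by (simp add: exp_of_real)
    qed
  qed
  have kr: "filterlim (\<lambda>n. real (k n)) at_top sequentially"
    by (rule filterlim_compose[OF filterlim_real_sequentially k_lim])
  have inv: "(\<lambda>n. 1 / real (k n)) \<longlonglongrightarrow> 0"
    using tendsto_inverse_0_at_top[OF kr] by (simp add: inverse_eq_divide)
  have pw: "(\<lambda>n. real (k n) powr (1 - p / 2)) \<longlonglongrightarrow> 0"
    by (rule tendsto_neg_powr[OF _ kr]) (use p in simp)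
  \<comment> \<open>\<open>lim q\<close> is the limit in \<open>n\<close> of the error bound for runs of length \<open>q - 1\<close>.\<close>
  define lim where "lim q = sqrt ((1 / real q) * v) + \<bar>exp (- (1 / real q * (real (q - 1) * v / 2))) - exp (- v / 2)\<bar>" for q :: nat
  have lim0: "lim \<longlonglongrightarrow> 0"
  proof -
    have "lim \<longlonglongrightarrow> sqrt (0 * v) + \<bar>exp (- ((1 - 0) * v / 2)) - exp (- v / 2)\<bar>"
    proof -
      have iq: "(\<lambda>q. 1 / real q) \<longlonglongrightarrow> 0" by (rule lim_1_over_n)
      have "(\<lambda>q. sqrt ((1 / real q) * v) + \<bar>exp (- ((1 - 1 / real q) * v / 2)) - exp (- v / 2)\<bar>)
        \<longlonglongrightarrow> sqrt (0 * v) + \<bar>exp (- ((1 - 0) * v / 2)) - exp (- v / 2)\<bar>"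
        by (intro tendsto_intros iq) auto
      moreover have "\<forall>\<^sub>F q in sequentially. sqrt ((1 / real q) * v) + \<bar>exp (- ((1 - 1 / real q) * v / 2)) - exp (- v / 2)\<bar> = lim q"
        using eventually_gt_at_top[of 0]
        by eventually_elim (simp add: lim_def of_nat_diff field_simps)
      ultimately show ?thesis by (rule Lim_transform_eventually)
    qed
    then show ?thesis by simp
  qed
  have "\<forall>\<^sub>F n in sequentially. dist (\<phi> n {1..k n}) (exp (- v / 2)) < \<epsilon>" if eps: "\<epsilon> > 0" for \<epsilon>
  proof -
    have "\<forall>\<^sub>F q in sequentially. lim q < \<epsilon> \<and> 2 \<le> q"
      using order_tendstoD(2)[OF lim0 eps] eventually_ge_at_top[of 2] by (rule eventually_conj)
    then obtain q where q: "lim q < \<epsilon>" "2 \<le> q" by (auto simp: eventually_sequentially)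
    define g where "g = (\<lambda>n. sqrt ((real (k n div q) / real (k n) + real q / real (k n)) * (v + 4 * e n))
        + \<bar>real (k n) * a n\<bar>
        + (real q powr p * real q * K * real (k n) powr (1 - p / 2) + 2 * real q * e n + (real q * v)^2 / real (k n))
        + \<bar>exp (- (real (k n div q) / real (k n) * (real (q - 1) * v / 2))) - exp (- v / 2)\<bar>)"
    have r: "(\<lambda>n. real (k n div q) / real (k n)) \<longlonglongrightarrow> 1 / real q"
      using filterlim_compose[OF tendsto_div_ratio[of q] k_lim] q by simp
    have inv': "(\<lambda>n. c / real (k n)) \<longlonglongrightarrow> 0" for c
      using tendsto_mult[OF tendsto_const[of c] inv] by simp
    have "g \<longlonglongrightarrow> sqrt ((1 / real q + 0) * (v + 4 * 0)) + \<bar>0\<bar> + (real q powr p * real q * K * 0 + 2 * real q * 0 + 0)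
        + \<bar>exp (- (1 / real q * (real (q - 1) * v / 2))) - exp (- v / 2)\<bar>"
      unfolding g_def by (intro tendsto_intros r inv' e(2) a pw) auto
    then have "g \<longlonglongrightarrow> lim q" by (simp add: lim_def)
    then have "\<forall>\<^sub>F n in sequentially. g n < \<epsilon>" using q(1) by (rule order_tendstoD(2))
    with main[OF q(2) g_def] show ?thesis
      by eventually_elim (auto simp: dist_norm)
  qed
  then show ?thesis unfolding tendsto_iff \<phi>_def by blast
qed

end

section \<open>Covariances of truncated and of bounded random variables\<close>

definition trunc :: "real \<Rightarrow> real \<Rightarrow> real" where
  "trunc T x = max (- T) (min T x)"

lemma trunc_measurable [measurable]: "trunc T \<in> borel_measurable borel"
  unfolding trunc_def[abs_def] by measurable

lemma abs_trunc_le: "\<bar>trunc T x\<bar> \<le> T" "\<bar>trunc T x\<bar> \<le> \<bar>x\<bar>" if "0 \<le> T" for T x :: real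
  using that by (auto simp: trunc_def)

lemma trunc_diff_le:
  assumes "1 < p" "0 < T"
  shows "\<bar>x - trunc T x\<bar> \<le> \<bar>x\<bar> powr p * T powr (1 - p)"
proof (cases "\<bar>x\<bar> \<le> T")
  case True
  then have "x - trunc T x = 0" using assms by (auto simp: trunc_def)
  then show ?thesis by simp
next
  case False
  have "\<bar>x - trunc T x\<bar> \<le> \<bar>x\<bar>" using False assms by (auto simp: trunc_def)
  also have "\<bar>x\<bar> = \<bar>x\<bar> powr p * \<bar>x\<bar> powr (1 - p)" using False assms by (simp add: powr_add[symmetric])
  also have "\<dots> \<le> \<bar>x\<bar> powr p * T powr (1 - p)"
    using False assms by (intro mult_left_mono powr_mono2') auto
  finally show ?thesis .
qed

lemma trunc_mult_diff_le:
  assumes "2 < p" "0 < T"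
  shows "\<bar>x * y - trunc T x * trunc T y\<bar> \<le> 2 * (\<bar>x\<bar> powr p + \<bar>y\<bar> powr p) * T powr (2 - p)"
proof (cases "\<bar>x\<bar> \<le> T \<and> \<bar>y\<bar> \<le> T")
  case True
  then have "trunc T x = x" "trunc T y = y" using assms by (auto simp: trunc_def)
  then show ?thesis by simp
next
  case False
  define z where "z = max \<bar>x\<bar> \<bar>y\<bar>"
  have z: "z > T" "\<bar>x\<bar> \<le> z" "\<bar>y\<bar> \<le> z" using False by (auto simp: z_def)
  have "\<bar>x * y - trunc T x * trunc T y\<bar> \<le> \<bar>x\<bar> * \<bar>y\<bar> + \<bar>trunc T x\<bar> * \<bar>trunc T y\<bar>"
    by (metis abs_mult abs_triangle_ineq4)
  also have "\<dots> \<le> z * z + z * z"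
    using z assms abs_trunc_le(2)[of T x] abs_trunc_le(2)[of T y] by (intro add_mono mult_mono) auto
  also have "\<dots> = 2 * (z powr p * z powr (2 - p))"
    using z assms powr_realpow[of z 2] by (simp add: powr_add[symmetric] power2_eq_square)
  also have "\<dots> \<le> 2 * (z powr p * T powr (2 - p))"
    using z assms by (intro mult_left_mono powr_mono2') auto
  also have "\<dots> \<le> 2 * ((\<bar>x\<bar> powr p + \<bar>y\<bar> powr p) * T powr (2 - p))"
    by (intro mult_left_mono mult_right_mono) (auto simp: z_def max_def)
  finally show ?thesis by (simp only: mult.assoc)
qed

lemma floor_as_count:
  fixes x :: real
  assumes "0 \<le> x" "x \<le> real m"
  shows "(\<Sum>j=1..m. if real j \<le> x then 1 else 0) = real_of_int \<lfloor>x\<rfloor>"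
proof -
  have "{j\<in>{1..m}. real j \<le> x} = {1..nat \<lfloor>x\<rfloor>}"
  proof (intro set_eqI iffI)
    fix j assume "j \<in> {1..nat \<lfloor>x\<rfloor>}"
    then have "1 \<le> j" "int j \<le> \<lfloor>x\<rfloor>" by auto
    then have "real j \<le> x" by linarith
    then show "j \<in> {j\<in>{1..m}. real j \<le> x}" using \<open>1 \<le> j\<close> assms by auto
  next
    fix j assume "j \<in> {j\<in>{1..m}. real j \<le> x}"
    then have "1 \<le> j" "int j \<le> \<lfloor>x\<rfloor>" by (auto simp: le_floor_iff)
    then show "j \<in> {1..nat \<lfloor>x\<rfloor>}" by auto
  qed
  then have "(\<Sum>j=1..m. if real j \<le> x then 1 else 0) = real (card {1..nat \<lfloor>x\<rfloor>})"
    by (simp add: sum.inter_filter[symmetric])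
  then show ?thesis using assms by simp
qed

context prob_space
begin

text \<open>Up to \<open>1 / m\<close>, a function with values in \<open>[0, 1]\<close> is the average of the indicators of its level
  sets at \<open>j / m\<close>. Covariance is bilinear, so it is an average of covariances of events.\<close>

lemma covariance_le_of_level_sets:
  assumes [measurable]: "U \<in> borel_measurable M" "V \<in> borel_measurable M"
    and U: "\<And>w. 0 \<le> U w" "\<And>w. U w \<le> 1" and V: "\<And>w. 0 \<le> V w" "\<And>w. V w \<le> (1::real)"
    and ev: "\<And>s t. \<bar>prob {w\<in>space M. s \<le> U w \<and> t \<le> V w} - prob {w\<in>space M. s \<le> U w} * prob {w\<in>space M. t \<le> V w}\<bar> \<le> \<alpha>"
  shows "\<bar>expectation (\<lambda>w. U w * V w) - expectation U * expectation V\<bar> \<le> \<alpha>"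
proof -
  have main: "\<bar>expectation (\<lambda>w. U w * V w) - expectation U * expectation V\<bar> \<le> \<alpha> + 4 * (1 / real (Suc m'))" for m'
  proof -
    define m where "m = Suc m'"
    define ap where "ap X w = (\<Sum>j=1..m. indicator {w\<in>space M. real j / real m \<le> X w} w / real m)" for X :: "'a \<Rightarrow> real" and w
    have ap: "ap X w \<le> X w" "X w \<le> ap X w + 1 / real m" "0 \<le> ap X w"
      if "0 \<le> X w" "X w \<le> 1" "w \<in> space M" for X w
    proof -
      have "ap X w = (\<Sum>j=1..m. if real j \<le> real m * X w then 1 else 0) / real m"
        unfolding ap_def sum_divide_distrib using that
        by (intro sum.cong refl) (auto simp: indicator_def m_def field_simps)
      also have "(\<Sum>j=1..m. if real j \<le> real m * X w then 1 else 0) = real_of_int \<lfloor>real m * X w\<rfloor>"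
        using that by (intro floor_as_count) (auto simp: m_def mult_le_cancel_left1)
      finally have eq: "ap X w = real_of_int \<lfloor>real m * X w\<rfloor> / real m" .
      have "0 \<le> \<lfloor>real m * X w\<rfloor>" using that by simp
      then show "0 \<le> ap X w" by (simp add: eq)
      have "real_of_int \<lfloor>real m * X w\<rfloor> \<le> real m * X w" by linarith
      then have "ap X w \<le> (real m * X w) / real m" unfolding eq by (intro divide_right_mono) auto
      then show "ap X w \<le> X w" by (simp add: m_def)
      have "real m * X w \<le> real_of_int \<lfloor>real m * X w\<rfloor> + 1" by linarith
      then have "(real m * X w) / real m \<le> (real_of_int \<lfloor>real m * X w\<rfloor> + 1) / real m" by (intro divide_right_mono) auto
      then show "X w \<le> ap X w + 1 / real m" by (simp add: eq m_def add_divide_distrib)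
    qed
    have apm [measurable]: "ap U \<in> borel_measurable M" "ap V \<in> borel_measurable M"
      unfolding ap_def[abs_def] by measurable
    have apU: "ap U w \<le> U w" "U w \<le> ap U w + 1 / real m" "0 \<le> ap U w"
      and apV: "ap V w \<le> V w" "V w \<le> ap V w + 1 / real m" "0 \<le> ap V w" if "w \<in> space M" for w
      using ap[of U w] ap[of V w] U[of w] V[of w] that by auto
    have int: "integrable M U" "integrable M V" "integrable M (\<lambda>w. U w * V w)"
      using U V by (auto intro!: integrable_const_bound[where B=1] simp: abs_mult mult_le_one)
    have api: "integrable M (ap U)" "integrable M (ap V)" "integrable M (\<lambda>w. ap U w * ap V w)"
    proof -
      have "\<bar>ap U w\<bar> \<le> 1" "\<bar>ap V w\<bar> \<le> 1" if "w \<in> space M" for w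
        using apU[OF that] apV[OF that] U(2)[of w] V(2)[of w] by auto
      then show "integrable M (ap U)" "integrable M (ap V)" "integrable M (\<lambda>w. ap U w * ap V w)"
        by (auto intro!: integrable_const_bound[where B=1] AE_I2 simp: abs_mult mult_le_one)
    qed
    have eU: "expectation (ap U) = (\<Sum>j=1..m. prob {w\<in>space M. real j / real m \<le> U w}) / real m"
      "expectation (ap V) = (\<Sum>j=1..m. prob {w\<in>space M. real j / real m \<le> V w}) / real m"
      unfolding ap_def by (subst Bochner_Integration.integral_sum; simp add: sum_divide_distrib emeasure_eq_measure)+
    have eUV: "expectation (\<lambda>w. ap U w * ap V w)
      = (\<Sum>i=1..m. \<Sum>j=1..m. prob {w\<in>space M. real i / real m \<le> U w \<and> real j / real m \<le> V w}) / (real m * real m)"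
    proof -
      have "ap U w * ap V w = (\<Sum>i=1..m. \<Sum>j=1..m. indicator {w\<in>space M. real i / real m \<le> U w \<and> real j / real m \<le> V w} w / (real m * real m))" for w
        unfolding ap_def sum_product by (intro sum.cong refl) (auto simp: indicator_def)
      then show ?thesis
        by (simp add: sum_divide_distrib emeasure_eq_measure)
    qed
    have "expectation (\<lambda>w. ap U w * ap V w) - expectation (ap U) * expectation (ap V)
      = (\<Sum>i=1..m. \<Sum>j=1..m. prob {w\<in>space M. real i / real m \<le> U w \<and> real j / real m \<le> V w}
          - prob {w\<in>space M. real i / real m \<le> U w} * prob {w\<in>space M. real j / real m \<le> V w}) / (real m * real m)"
      unfolding eU eUV by (simp add: sum_subtractf sum_product diff_divide_distrib)
    also have "\<bar>\<dots>\<bar> \<le> (\<Sum>i=1..m. \<Sum>j=1..m. \<alpha>) / (real m * real m)"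
    proof -
      have "\<bar>\<Sum>i=1..m. \<Sum>j=1..m. prob {w\<in>space M. real i / real m \<le> U w \<and> real j / real m \<le> V w}
          - prob {w\<in>space M. real i / real m \<le> U w} * prob {w\<in>space M. real j / real m \<le> V w}\<bar>
          \<le> (\<Sum>i=1..m. \<Sum>j=1..m. \<alpha>)"
        by (rule order_trans[OF sum_abs], rule sum_mono, rule order_trans[OF sum_abs], rule sum_mono, rule ev)
      then show ?thesis unfolding abs_divide abs_mult abs_of_nat by (rule divide_right_mono) simp
    qed
    also have "\<dots> = \<alpha>" by (simp add: m_def)
    finally have 1: "\<bar>expectation (\<lambda>w. ap U w * ap V w) - expectation (ap U) * expectation (ap V)\<bar> \<le> \<alpha>" .
    have prod: "\<bar>x * y - x' * y'\<bar> \<le> 2 * d" if "\<bar>x - x'\<bar> \<le> d" "\<bar>y - y'\<bar> \<le> d" "\<bar>y\<bar> \<le> 1" "\<bar>x'\<bar> \<le> 1" for x y x' y' d :: real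
    proof -
      have "x * y - x' * y' = (x - x') * y + x' * (y - y')" by (simp add: algebra_simps)
      also have "\<bar>\<dots>\<bar> \<le> \<bar>x - x'\<bar> * \<bar>y\<bar> + \<bar>x'\<bar> * \<bar>y - y'\<bar>" by (metis abs_mult abs_triangle_ineq)
      also have "\<dots> \<le> d * 1 + 1 * d" using that by (intro add_mono mult_mono) auto
      finally show ?thesis by simp
    qed
    have d: "\<bar>U w - ap U w\<bar> \<le> 1 / real m" "\<bar>V w - ap V w\<bar> \<le> 1 / real m" "\<bar>U w\<bar> \<le> 1" "\<bar>V w\<bar> \<le> 1" "\<bar>ap U w\<bar> \<le> 1" "\<bar>ap V w\<bar> \<le> 1"
      if "w \<in> space M" for w
      using apU[OF that] apV[OF that] U[of w] V[of w] by auto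
    have E_le: "\<bar>expectation X - expectation Y\<bar> \<le> c" if "integrable M X" "integrable M Y" "\<And>w. w \<in> space M \<Longrightarrow> \<bar>X w - Y w\<bar> \<le> c" for X Y :: "'a \<Rightarrow> real" and c
    proof -
      have "\<bar>expectation X - expectation Y\<bar> = \<bar>expectation (\<lambda>w. X w - Y w)\<bar>" using that by simp
      also have "\<dots> \<le> expectation (\<lambda>w. \<bar>X w - Y w\<bar>)" by (rule integral_abs_bound)
      also have "\<dots> \<le> expectation (\<lambda>w. c)" using that by (intro integral_mono) auto
      finally show ?thesis by (simp add: prob_space)
    qed
    have E1: "\<bar>expectation X\<bar> \<le> 1" if "integrable M X" "\<And>w. w \<in> space M \<Longrightarrow> \<bar>X w\<bar> \<le> 1" for X :: "'a \<Rightarrow> real"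
      using E_le[of X "\<lambda>_. 0" 1] that by simp
    have 2: "\<bar>expectation (\<lambda>w. U w * V w) - expectation (\<lambda>w. ap U w * ap V w)\<bar> \<le> 2 * (1 / real m)"
      using d int api by (intro E_le prod) auto
    have 3: "\<bar>expectation U * expectation V - expectation (ap U) * expectation (ap V)\<bar> \<le> 2 * (1 / real m)"
      using d int api by (intro prod E_le E1) auto
    show ?thesis using 1 2 3 unfolding m_def by linarith
  qed
  have "(\<lambda>m. \<alpha> + 4 * (1 / real (Suc m))) \<longlonglongrightarrow> \<alpha> + 4 * 0"
    by (intro tendsto_intros LIMSEQ_Suc[OF lim_1_over_n])
  then show ?thesis by (intro LIMSEQ_le_const[where X="\<lambda>m. \<alpha> + 4 * (1 / real (Suc m))"]) (use main in auto)
qed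

text \<open>An affine change of variables maps \<open>[- a, a]\<close> onto \<open>[0, 1]\<close>; the two factors \<open>2\<close> give the
  constant \<open>4\<close>.\<close>

lemma covariance_bounded_le_of_level_sets:
  assumes [measurable]: "U \<in> borel_measurable M" "V \<in> borel_measurable M"
    and U: "\<And>w. \<bar>U w\<bar> \<le> a" and V: "\<And>w. \<bar>V w\<bar> \<le> b" and ab: "0 < a" "0 < (b::real)"
    and ev: "\<And>s t. \<bar>prob {w\<in>space M. s \<le> U w \<and> t \<le> V w} - prob {w\<in>space M. s \<le> U w} * prob {w\<in>space M. t \<le> V w}\<bar> \<le> \<alpha>"
  shows "\<bar>expectation (\<lambda>w. U w * V w) - expectation U * expectation V\<bar> \<le> 4 * a * b * \<alpha>"
proof -
  define U' V' where "U' w = (U w + a) / (2 * a)" and "V' w = (V w + b) / (2 * b)" for w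
  have "\<bar>expectation (\<lambda>w. U' w * V' w) - expectation U' * expectation V'\<bar> \<le> \<alpha>"
  proof (rule covariance_le_of_level_sets)
    show "U' \<in> borel_measurable M" "V' \<in> borel_measurable M" unfolding U'_def[abs_def] V'_def[abs_def] by measurable
    fix w show "0 \<le> U' w" "U' w \<le> 1" "0 \<le> V' w" "V' w \<le> 1"
      using U[of w] V[of w] ab by (auto simp: U'_def V'_def field_simps abs_le_iff)
  next
    fix s t
    have "s \<le> U' w \<longleftrightarrow> s * (2 * a) - a \<le> U w" "t \<le> V' w \<longleftrightarrow> t * (2 * b) - b \<le> V w" for w
      using ab by (auto simp: U'_def V'_def field_simps)
    then show "\<bar>prob {w\<in>space M. s \<le> U' w \<and> t \<le> V' w} - prob {w\<in>space M. s \<le> U' w} * prob {w\<in>space M. t \<le> V' w}\<bar> \<le> \<alpha>"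
      using ev by simp
  qed
  moreover have "expectation (\<lambda>w. U' w * V' w) - expectation U' * expectation V'
     = (expectation (\<lambda>w. U w * V w) - expectation U * expectation V) / (4 * a * b)"
  proof -
    have i: "integrable M U" "integrable M V" using U V by (auto intro: integrable_const_bound[where B=a] integrable_const_bound[where B=b])
    have "\<bar>U w * V w\<bar> \<le> a * b" for w using U[of w] V[of w] by (simp add: abs_mult mult_mono)
    then have i2: "integrable M (\<lambda>w. U w * V w)" by (auto intro!: integrable_const_bound[where B="a * b"])
    have "U' w * V' w = (U w * V w + b * U w + a * V w + a * b) / (4 * a * b)" for w
      using ab by (simp add: U'_def V'_def field_simps)
    then have "expectation (\<lambda>w. U' w * V' w) = (expectation (\<lambda>w. U w * V w) + b * expectation U + a * expectation V + a * b) / (4 * a * b)"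
      using i i2 by (simp add: prob_space)
    moreover have "expectation U' = (expectation U + a) / (2 * a)" "expectation V' = (expectation V + b) / (2 * b)"
      unfolding U'_def[abs_def] V'_def[abs_def] using i by (simp_all add: prob_space)
    ultimately show ?thesis using ab by (simp only:) (simp add: field_simps)
  qed
  ultimately show ?thesis using ab by (simp add: abs_divide pos_divide_le_eq mult_ac)
qed

text \<open>Moments of order \<open>p > 2\<close> make the part of a covariance that truncation removes decay like a power
  of the truncation level.\<close>

lemma covariance_truncation:
  assumes [measurable]: "U \<in> borel_measurable M" "V \<in> borel_measurable M"
    and p: "2 < p" and T: "1 \<le> T"
    and U: "integrable M (\<lambda>w. \<bar>U w\<bar> powr p)" "expectation (\<lambda>w. \<bar>U w\<bar> powr p) \<le> K"
    and V: "integrable M (\<lambda>w. \<bar>V w\<bar> powr p)" "expectation (\<lambda>w. \<bar>V w\<bar> powr p) \<le> K"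
  defines "U' \<equiv> \<lambda>w. trunc T (U w)" and "V' \<equiv> \<lambda>w. trunc T (V w)"
  shows "\<bar>(expectation (\<lambda>w. U w * V w) - expectation U * expectation V)
     - (expectation (\<lambda>w. U' w * V' w) - expectation U' * expectation V')\<bar> \<le> (4 * K + 2 * K * (1 + K)) * T powr (2 - p)"
proof -
  have [measurable]: "U' \<in> borel_measurable M" "V' \<in> borel_measurable M" unfolding U'_def V'_def by measurable
  have K0: "0 \<le> K" by (rule order_trans[OF _ U(2)]) simp
  have le1: "\<bar>x\<bar> \<le> 1 + \<bar>x\<bar> powr p" for x using p by (intro abs_le_powr) simp
  have mom: "integrable M X" "expectation (\<lambda>w. \<bar>X w\<bar>) \<le> 1 + K" "integrable M (\<lambda>w. (X w)^2)"
    "\<bar>expectation X - expectation (\<lambda>w. trunc T (X w))\<bar> \<le> K * T powr (2 - p)"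
    "\<bar>expectation (\<lambda>w. trunc T (X w))\<bar> \<le> 1 + K" "\<bar>expectation X\<bar> \<le> 1 + K"
    if [measurable]: "X \<in> borel_measurable M" and X: "integrable M (\<lambda>w. \<bar>X w\<bar> powr p)" "expectation (\<lambda>w. \<bar>X w\<bar> powr p) \<le> K" for X :: "'a \<Rightarrow> real"
  proof -
    have b: "integrable M (\<lambda>w. 1 + \<bar>X w\<bar> powr p)" using X by simp
    show i: "integrable M X"
      by (rule Bochner_Integration.integrable_bound[OF b]) (use le1 in \<open>auto intro: order_trans\<close>)
    show "integrable M (\<lambda>w. (X w)^2)"
      by (rule Bochner_Integration.integrable_bound[OF b]) (use square_le_powr[of p] p in \<open>auto intro: order_trans\<close>)
    have "expectation (\<lambda>w. \<bar>X w\<bar>) \<le> expectation (\<lambda>w. 1 + \<bar>X w\<bar> powr p)"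
      using i b le1 by (intro integral_mono) auto
    then show a: "expectation (\<lambda>w. \<bar>X w\<bar>) \<le> 1 + K" using X by (simp add: prob_space)
    have it: "integrable M (\<lambda>w. trunc T (X w))"
      by (rule integrable_const_bound[where B=T]) (use T abs_trunc_le in auto)
    have "\<bar>expectation X - expectation (\<lambda>w. trunc T (X w))\<bar> = \<bar>expectation (\<lambda>w. X w - trunc T (X w))\<bar>"
      using i it by simp
    also have "\<dots> \<le> expectation (\<lambda>w. \<bar>X w - trunc T (X w)\<bar>)" by (rule integral_abs_bound)
    also have "\<dots> \<le> expectation (\<lambda>w. \<bar>X w\<bar> powr p * T powr (1 - p))"
      using i it X p T by (intro integral_mono trunc_diff_le) auto
    also have "\<dots> = expectation (\<lambda>w. \<bar>X w\<bar> powr p) * T powr (1 - p)" by simp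
    also have "\<dots> \<le> K * T powr (2 - p)" using X K0 T by (intro mult_mono powr_mono) auto
    finally show "\<bar>expectation X - expectation (\<lambda>w. trunc T (X w))\<bar> \<le> K * T powr (2 - p)" .
    have "\<bar>expectation (\<lambda>w. trunc T (X w))\<bar> \<le> expectation (\<lambda>w. \<bar>trunc T (X w)\<bar>)" by (rule integral_abs_bound)
    also have "\<dots> \<le> expectation (\<lambda>w. \<bar>X w\<bar>)" using i it T abs_trunc_le by (intro integral_mono) auto
    finally show "\<bar>expectation (\<lambda>w. trunc T (X w))\<bar> \<le> 1 + K" using a by simp
    show "\<bar>expectation X\<bar> \<le> 1 + K" by (rule order_trans[OF integral_abs_bound a])
  qed
  note mU = mom[OF assms(1) U, folded U'_def] and mV = mom[OF assms(2) V, folded V'_def]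
  have ip: "integrable M (\<lambda>w. U w * V w)"
    by (rule integrable_mult_of_squares) (use mU mV in auto)
  have "\<bar>U' w * V' w\<bar> \<le> T * T" for w
    unfolding abs_mult U'_def V'_def using T by (intro mult_mono abs_trunc_le) auto
  then have it: "integrable M (\<lambda>w. U' w * V' w)" by (auto intro!: integrable_const_bound[where B="T * T"])
  have "\<bar>expectation (\<lambda>w. U w * V w) - expectation (\<lambda>w. U' w * V' w)\<bar> = \<bar>expectation (\<lambda>w. U w * V w - U' w * V' w)\<bar>"
    using ip it by simp
  also have "\<dots> \<le> expectation (\<lambda>w. \<bar>U w * V w - U' w * V' w\<bar>)" by (rule integral_abs_bound)
  also have "\<dots> \<le> expectation (\<lambda>w. 2 * (\<bar>U w\<bar> powr p + \<bar>V w\<bar> powr p) * T powr (2 - p))"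
    using ip it U V p T trunc_mult_diff_le unfolding U'_def V'_def by (intro integral_mono) auto
  also have "\<dots> = 2 * (expectation (\<lambda>w. \<bar>U w\<bar> powr p) + expectation (\<lambda>w. \<bar>V w\<bar> powr p)) * T powr (2 - p)"
    using U V by simp
  also have "\<dots> \<le> 4 * K * T powr (2 - p)" using U V by (intro mult_right_mono) auto
  finally have 1: "\<bar>expectation (\<lambda>w. U w * V w) - expectation (\<lambda>w. U' w * V' w)\<bar> \<le> 4 * K * T powr (2 - p)" .
  have "expectation U * expectation V - expectation U' * expectation V'
    = (expectation U - expectation U') * expectation V + expectation U' * (expectation V - expectation V')"
    by (simp add: algebra_simps)
  also have "\<bar>\<dots>\<bar> \<le> \<bar>expectation U - expectation U'\<bar> * \<bar>expectation V\<bar> + \<bar>expectation U'\<bar> * \<bar>expectation V - expectation V'\<bar>"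
    by (metis abs_mult abs_triangle_ineq)
  also have "\<dots> \<le> (K * T powr (2 - p)) * (1 + K) + (1 + K) * (K * T powr (2 - p))"
    using mU mV K0 by (intro add_mono mult_mono) auto
  finally have 2: "\<bar>expectation U * expectation V - expectation U' * expectation V'\<bar> \<le> 2 * K * (1 + K) * T powr (2 - p)"
    by (simp add: algebra_simps)
  have "(4 * K + 2 * K * (1 + K)) * T powr (2 - p) = 4 * K * T powr (2 - p) + 2 * K * (1 + K) * T powr (2 - p)"
    by (simp add: algebra_simps)
  then show ?thesis using 1 2 by linarith
qed

end

section \<open>Stationarity, mixing and windows of observations\<close>

definition block :: "nat \<Rightarrow> nat \<Rightarrow> int set" where
  "block r i = {(int i - 1) * int r + 1 .. int i * int r}"

text \<open>The finite family \<open>\<xi> (t + h)\<close>, \<open>t \<in> J\<close>, as a point of the product space over \<open>J\<close>: stationarity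
  says that its law does not depend on \<open>h\<close>.\<close>

definition window :: "(int \<Rightarrow> 'a \<Rightarrow> real) \<Rightarrow> int set \<Rightarrow> int \<Rightarrow> 'a \<Rightarrow> int \<Rightarrow> real" where
  "window \<xi> J h w = (\<lambda>t\<in>J. \<xi> (t + h) w)"

lemma window_measurable:
  assumes "\<And>t. \<xi> t \<in> borel_measurable N"
  shows "window \<xi> J h \<in> measurable N (PiM J (\<lambda>_. borel))"
  unfolding window_def by (rule measurable_restrict) (use assms in auto)

lemma stationary_window:
  assumes "strictly_stationary M \<xi>" "finite J"
  shows "distr M (PiM J (\<lambda>_. borel)) (window \<xi> J h) = distr M (PiM J (\<lambda>_. borel)) (window \<xi> J 0)"
  using assms unfolding strictly_stationary_def window_def by simp

lemma stationary_window_prob: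
  assumes st: "strictly_stationary M \<xi>" and rv: "\<And>t. \<xi> t \<in> borel_measurable M" and "finite J"
    and S: "S \<in> sets (PiM J (\<lambda>_. borel))"
  shows "measure M {w\<in>space M. window \<xi> J h w \<in> S} = measure M {w\<in>space M. window \<xi> J 0 w \<in> S}"
proof -
  have *: "measure M {w\<in>space M. window \<xi> J h w \<in> S} = measure (distr M (PiM J (\<lambda>_. borel)) (window \<xi> J h)) S" for h
    using S window_measurable[OF rv] by (subst measure_distr) (auto simp: vimage_def Int_def conj_commute)
  show ?thesis unfolding * stationary_window[OF st \<open>finite J\<close>, of h] ..
qed

lemma window_in_generated_events:
  assumes J: "\<And>t. t \<in> J \<Longrightarrow> t + h \<in> T" and S: "S \<in> sets (PiM J (\<lambda>_. borel))"
  shows "{w\<in>space M. window \<xi> J h w \<in> S} \<in> generated_events M \<xi> T"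
proof -
  define G where "G = (\<Union>t\<in>T. {\<xi> t -` A \<inter> space M | A. A \<in> sets borel})"
  define N where "N = sigma (space M) G"
  have G: "G \<subseteq> Pow (space M)" by (auto simp: G_def)
  have [simp]: "space N = space M" "sets N = generated_events M \<xi> T"
    using G by (simp_all add: N_def generated_events_def G_def)
  have m: "\<xi> t \<in> borel_measurable N" if "t \<in> T" for t
  proof (rule measurableI)
    fix A :: "real set" assume "A \<in> sets borel"
    then have "\<xi> t -` A \<inter> space M \<in> G" using that by (auto simp: G_def)
    then have "\<xi> t -` A \<inter> space M \<in> sets N" unfolding N_def using G by (simp add: sigma_sets.Basic)
    then show "\<xi> t -` A \<inter> space N \<in> sets N" by simp
  qed simp
  have "window \<xi> J h \<in> measurable N (PiM J (\<lambda>_. borel))"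
    unfolding window_def by (rule measurable_restrict) (use J m in auto)
  from measurable_sets[OF this S] show ?thesis by (simp add: vimage_def Int_def conj_commute)
qed

lemma (in prob_space) mixing_coeff_upper:
  assumes "A \<in> generated_events M \<xi> {..0}" "B \<in> generated_events M \<xi> {int l..}"
  shows "\<bar>prob (A \<inter> B) - prob A * prob B\<bar> \<le> mixing_coeff M \<xi> l"
  unfolding mixing_coeff_def
proof (rule cSup_upper)
  have "\<bar>prob (A \<inter> B) - prob A * prob B\<bar> \<le> 1" for A B
  proof -
    have "prob A * prob B \<le> 1" by (intro mult_le_one) auto
    moreover have "0 \<le> prob A * prob B" by simp
    moreover have "0 \<le> prob (A \<inter> B)" "prob (A \<inter> B) \<le> 1" by auto
    ultimately show ?thesis by linarith
  qed
  then show "bdd_above {\<bar>prob (A \<inter> B) - prob A * prob B\<bar> | A B.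
      A \<in> generated_events M \<xi> {..0} \<and> B \<in> generated_events M \<xi> {int l..}}"
    by (intro bdd_aboveI[where M=1]) auto
qed (use assms in blast)

text \<open>Shifting time by \<open>- m\<close> moves the first window into the past of \<open>0\<close> and the second into the
  future of \<open>l\<close>, where the mixing coefficient bounds the covariances of all level sets.\<close>

lemma (in prob_space) mixing_covariance:
  assumes st: "strictly_stationary M \<xi>" and rv: "\<And>t. \<xi> t \<in> borel_measurable M"
    and J: "finite J" "J \<subseteq> {..m}" and J': "finite J'" "J' \<subseteq> {m + int l..}"
    and u: "u \<in> borel_measurable (PiM J (\<lambda>_. borel))" "\<And>z. \<bar>u z\<bar> \<le> a"
    and v: "v \<in> borel_measurable (PiM J' (\<lambda>_. borel))" "\<And>z. \<bar>v z\<bar> \<le> b" and ab: "0 < a" "0 < (b::real)"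
  shows "\<bar>expectation (\<lambda>w. u (window \<xi> J 0 w) * v (window \<xi> J' 0 w))
     - expectation (\<lambda>w. u (window \<xi> J 0 w)) * expectation (\<lambda>w. v (window \<xi> J' 0 w))\<bar> \<le> 4 * a * b * mixing_coeff M \<xi> l"
proof (rule covariance_bounded_le_of_level_sets)
  show "(\<lambda>w. u (window \<xi> J 0 w)) \<in> borel_measurable M" "(\<lambda>w. v (window \<xi> J' 0 w)) \<in> borel_measurable M"
    using measurable_compose[OF window_measurable[OF rv] u(1)] measurable_compose[OF window_measurable[OF rv] v(1)] by auto
next
  fix s t
  define S where "S = {z\<in>space (PiM J (\<lambda>_. borel)). s \<le> u z}"
  define S' where "S' = {z\<in>space (PiM J' (\<lambda>_. borel)). t \<le> v z}"
  have S: "S \<in> sets (PiM J (\<lambda>_. borel))" "S' \<in> sets (PiM J' (\<lambda>_. borel))"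
    using u(1) v(1) unfolding S_def S'_def by measurable
  have sp: "window \<xi> K h w \<in> space (PiM K (\<lambda>_. borel))" for K h w by (simp add: window_def space_PiM)
  define Q where "Q = {z\<in>space (PiM (J \<union> J') (\<lambda>_. borel)). restrict z J \<in> S \<and> restrict z J' \<in> S'}"
  have Q: "Q \<in> sets (PiM (J \<union> J') (\<lambda>_. borel))"
  proof -
    have 1: "(\<lambda>z. restrict z J) \<in> measurable (PiM (J \<union> J') (\<lambda>_. borel)) (PiM J (\<lambda>_. borel))"
      "(\<lambda>z. restrict z J') \<in> measurable (PiM (J \<union> J') (\<lambda>_. borel)) (PiM J' (\<lambda>_. borel))"
      by (rule measurable_restrict_subset; simp)+
    have "Q = ((\<lambda>z. restrict z J) -` S \<inter> space (PiM (J \<union> J') (\<lambda>_. borel)))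
      \<inter> ((\<lambda>z. restrict z J') -` S' \<inter> space (PiM (J \<union> J') (\<lambda>_. borel)))" by (auto simp: Q_def)
    then show ?thesis using measurable_sets[OF 1(1) S(1)] measurable_sets[OF 1(2) S(2)] by auto
  qed
  have wQ: "window \<xi> (J \<union> J') h w \<in> Q \<longleftrightarrow> window \<xi> J h w \<in> S \<and> window \<xi> J' h w \<in> S'" for h w
  proof -
    have "restrict (window \<xi> (J \<union> J') h w) J = window \<xi> J h w" "restrict (window \<xi> (J \<union> J') h w) J' = window \<xi> J' h w"
      by (auto simp: window_def fun_eq_iff)
    then show ?thesis using sp by (simp add: Q_def)
  qed
  have joint: "prob {w\<in>space M. window \<xi> J h w \<in> S \<and> window \<xi> J' h w \<in> S'} = prob {w\<in>space M. window \<xi> J 0 w \<in> S \<and> window \<xi> J' 0 w \<in> S'}" for h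
    using stationary_window_prob[OF st rv _ Q, of h] J(1) J'(1) unfolding wQ by simp
  \<comment> \<open>the level sets after the time shift\<close>
  define A where "A = {w\<in>space M. window \<xi> J (-m) w \<in> S}"
  define B where "B = {w\<in>space M. window \<xi> J' (-m) w \<in> S'}"
  have "A \<in> generated_events M \<xi> {..0}" "B \<in> generated_events M \<xi> {int l..}"
    unfolding A_def B_def using J J' S by (auto intro!: window_in_generated_events)
  from mixing_coeff_upper[OF this] have "\<bar>prob (A \<inter> B) - prob A * prob B\<bar> \<le> mixing_coeff M \<xi> l" .
  moreover have "prob (A \<inter> B) = prob {w\<in>space M. window \<xi> J 0 w \<in> S \<and> window \<xi> J' 0 w \<in> S'}"
    unfolding joint[of "-m", symmetric] A_def B_def by (intro arg_cong[where f=prob]) auto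
  moreover have "prob A = prob {w\<in>space M. window \<xi> J 0 w \<in> S}" "prob B = prob {w\<in>space M. window \<xi> J' 0 w \<in> S'}"
    unfolding A_def B_def using J J' S by (intro stationary_window_prob[OF st rv]; simp)+
  ultimately show "\<bar>prob {w\<in>space M. s \<le> u (window \<xi> J 0 w) \<and> t \<le> v (window \<xi> J' 0 w)}
      - prob {w\<in>space M. s \<le> u (window \<xi> J 0 w)} * prob {w\<in>space M. t \<le> v (window \<xi> J' 0 w)}\<bar> \<le> mixing_coeff M \<xi> l"
    using sp by (simp add: S_def S'_def)
qed (use u v ab in auto)

section \<open>Block maxima\<close>

lemma finite_block [simp]: "finite (block r i)" by (simp add: block_def)

text \<open>Viewing a block maximum as a function on the product space makes laws and mixing bounds of windows
  available for it.\<close>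

lemma block_max_window:
  assumes "block r i \<subseteq> J"
  shows "block_max \<xi> r i w = block_max (\<lambda>t z. z t) r i (window \<xi> J 0 w)"
  using assms unfolding block_max_def block_def window_def by (intro arg_cong[where f=Max] image_cong) auto

lemma block_max_coordinates_measurable:
  assumes "block r i \<subseteq> J"
  shows "block_max (\<lambda>t z. z t) r i \<in> borel_measurable (PiM J (\<lambda>_. borel :: real measure))"
  unfolding block_max_def[abs_def]
  by (rule borel_measurable_Max) (use assms in \<open>auto simp: block_def\<close>)

lemma block_max_measurable:
  assumes "\<And>t. \<xi> t \<in> borel_measurable M"
  shows "block_max \<xi> r i \<in> borel_measurable M"
  unfolding block_max_def[abs_def] by (rule borel_measurable_Max) (use assms in auto)

lemma block_max_shift:
  "block_max (\<lambda>t. \<xi> (t + int i * int r)) r j w = block_max \<xi> r (i + j) w"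
proof -
  have "(\<lambda>t. \<xi> (t + int i * int r) w) ` {(int j - 1) * int r + 1..int j * int r}
    = (\<lambda>t. \<xi> t w) ` ((\<lambda>t. t + int i * int r) ` {(int j - 1) * int r + 1..int j * int r})"
    by (simp only: image_image)
  also have "(\<lambda>t. t + int i * int r) ` {(int j - 1) * int r + 1..int j * int r}
    = {(int (i + j) - 1) * int r + 1..int (i + j) * int r}"
    by (subst image_add_atLeastAtMost') (simp add: algebra_simps)
  finally show ?thesis by (simp add: block_max_def)
qed

lemma block_max_pair_law:
  assumes st: "strictly_stationary M \<xi>" and rv: "\<And>t. \<xi> t \<in> borel_measurable M"
  shows "distr M (borel \<Otimes>\<^sub>M borel) (\<lambda>w. (block_max \<xi> r (i + 1) w, block_max \<xi> r (i + 2) w))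
    = distr M (borel \<Otimes>\<^sub>M borel) (\<lambda>w. (block_max \<xi> r 1 w, block_max \<xi> r 2 w))"
proof -
  define J where "J = block r 1 \<union> block r 2"
  define u where "u z = (block_max (\<lambda>t z. z t) r 1 z, block_max (\<lambda>t z. z t) r 2 z)" for z :: "int \<Rightarrow> real"
  have um: "u \<in> measurable (PiM J (\<lambda>_. borel)) (borel \<Otimes>\<^sub>M borel)"
    unfolding u_def by (intro measurable_Pair block_max_coordinates_measurable) (auto simp: J_def)
  have w: "u (window \<xi> J (int i * int r) w) = (block_max \<xi> r (i + 1) w, block_max \<xi> r (i + 2) w)" for i w
  proof -
    have "window \<xi> J (int i * int r) w = window (\<lambda>t. \<xi> (t + int i * int r)) J 0 w" by (simp add: window_def)
    then have "u (window \<xi> J (int i * int r) w)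
      = (block_max (\<lambda>t. \<xi> (t + int i * int r)) r 1 w, block_max (\<lambda>t. \<xi> (t + int i * int r)) r 2 w)"
      unfolding u_def by (subst (1 2) block_max_window[of _ _ J]) (auto simp: J_def)
    then show ?thesis by (simp add: block_max_shift)
  qed
  have *: "distr M (borel \<Otimes>\<^sub>M borel) (\<lambda>w. u (window \<xi> J h w)) = distr (distr M (PiM J (\<lambda>_. borel)) (window \<xi> J h)) (borel \<Otimes>\<^sub>M borel) u" for h
    using um window_measurable[OF rv] by (subst distr_distr) (auto simp: comp_def)
  have fin: "finite J" by (simp add: J_def)
  have "distr M (borel \<Otimes>\<^sub>M borel) (\<lambda>w. u (window \<xi> J (int i * int r) w)) = distr M (borel \<Otimes>\<^sub>M borel) (\<lambda>w. u (window \<xi> J (int 0 * int r) w))"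
    unfolding * stationary_window[OF st fin, of "int i * int r"] stationary_window[OF st fin, of "int 0 * int r"] ..
  then show ?thesis unfolding w by (simp add: numeral_2_eq_2)
qed

lemma block_max_law:
  assumes st: "strictly_stationary M \<xi>" and rv: "\<And>t. \<xi> t \<in> borel_measurable M" and i: "1 \<le> i"
    and g: "g \<in> borel_measurable borel"
  shows "distr M borel (\<lambda>w. g (block_max \<xi> r i w)) = distr M borel (\<lambda>w. g (block_max \<xi> r 1 w) :: real)"
proof -
  have "distr M borel (\<lambda>w. g (block_max \<xi> r (i + 1) w)) = distr (distr M (borel \<Otimes>\<^sub>M borel) (\<lambda>w. (block_max \<xi> r (i + 1) w, block_max \<xi> r (i + 2) w))) borel (\<lambda>p. g (fst p))" for i
    using g block_max_measurable[OF rv] by (subst distr_distr) (auto simp: comp_def)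
  from this[of "i - 1"] this[of 0] show ?thesis using i block_max_pair_law[OF st rv, of r "i - 1"] block_max_pair_law[OF st rv, of r 0] by simp
qed

section \<open>Logarithmic moments of the exponential law\<close>

lemma abs_ln_power_le:
  assumes "0 < y" "0 < \<delta>"
  shows "\<bar>ln y\<bar> ^ j \<le> (y powr (real j * \<delta>) + y powr (- (real j * \<delta>))) / \<delta> ^ j"
proof (cases "1 \<le> y")
  case True
  have "\<bar>ln y\<bar> ^ j \<le> (y powr \<delta> / \<delta>) ^ j"
    using True assms ln_powr_bound[of y \<delta>] by (intro power_mono) auto
  also have "\<dots> = y powr (real j * \<delta>) / \<delta> ^ j"
    using assms by (simp add: power_divide powr_power mult.commute)
  also have "\<dots> \<le> (y powr (real j * \<delta>) + y powr (- (real j * \<delta>))) / \<delta> ^ j"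
    using assms by (intro divide_right_mono) auto
  finally show ?thesis .
next
  case False
  have "\<bar>ln y\<bar> ^ j \<le> ((1 / y) powr \<delta> / \<delta>) ^ j"
    using False assms ln_powr_bound[of "1 / y" \<delta>] by (intro power_mono) (auto simp: ln_div)
  also have "\<dots> = y powr (- (real j * \<delta>)) / \<delta> ^ j"
  proof -
    have "(1 / y) powr \<delta> = y powr (- \<delta>)" using assms by (simp add: powr_divide powr_minus_divide)
    then show ?thesis using assms by (simp add: power_divide powr_power mult.commute)
  qed
  also have "\<dots> \<le> (y powr (real j * \<delta>) + y powr (- (real j * \<delta>))) / \<delta> ^ j"
    using assms by (intro divide_right_mono) auto
  finally show ?thesis .
qed

text \<open>Bounds the remainder when powers are differentiated in the exponent under the integral; a power
  of \<open>y\<close> absorbs the factor \<open>exp \<bar>x\<bar>\<close> at \<open>x = h * ln y\<close>.\<close>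

lemma exp_taylor1_le: "\<bar>exp x - 1 - x\<bar> \<le> x^2 * exp \<bar>x\<bar>" for x :: real
proof -
  have l: "1 + x \<le> exp x" by (simp add: exp_ge_add_one_self)
  have u: "exp x * (1 - x) \<le> 1"
  proof -
    have "1 - x \<le> exp (- x)" using exp_ge_add_one_self[of "-x"] by simp
    then have "exp x * (1 - x) \<le> exp x * exp (- x)" by (intro mult_left_mono) auto
    then show ?thesis by (simp add: exp_minus)
  qed
  show ?thesis
  proof (cases "0 \<le> x")
    case True
    have "exp x - 1 - x \<le> x * (exp x - 1)" using u by (simp add: algebra_simps)
    also have "\<dots> \<le> x * (x * exp x)" using u True by (intro mult_left_mono) (auto simp: algebra_simps)
    finally have "exp x - 1 - x \<le> x^2 * exp x" by (simp only: power2_eq_square mult.assoc)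
    then have "exp x - 1 - x \<le> x^2 * exp \<bar>x\<bar>" using True by simp
    then show ?thesis using l by linarith
  next
    case False
    have e: "exp x \<le> 1" using False by simp
    have "exp x - 1 - x \<le> x * (exp x - 1)" using u by (simp add: algebra_simps)
    also have "\<dots> = (- x) * (1 - exp x)" by (simp add: algebra_simps)
    also have "\<dots> \<le> (- x) * (- x)" using False by (intro mult_left_mono) (use l in linarith, simp)
    also have "\<dots> = x^2 * 1" by (simp add: power2_eq_square)
    also have "\<dots> \<le> x^2 * exp \<bar>x\<bar>" by (intro mult_left_mono) auto
    finally show ?thesis using l by linarith
  qed
qed

lemma has_real_derivative_quadratic:
  fixes F :: "real \<Rightarrow> real"
  assumes "0 < \<delta>" and q: "\<And>h. \<bar>h\<bar> \<le> \<delta> \<Longrightarrow> \<bar>F (s + h) - F s - h * D\<bar> \<le> C * h^2"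
  shows "(F has_real_derivative D) (at s)"
  unfolding DERIV_def
proof (rule Lim_null[THEN iffD2], rule Lim_null_comparison)
  show "\<forall>\<^sub>F h in at 0. norm ((F (s + h) - F s) / h - D) \<le> C * \<bar>h\<bar>"
    unfolding eventually_at
  proof (intro exI[of _ \<delta>] conjI ballI impI assms)
    fix h :: real assume h: "h \<noteq> 0 \<and> dist h 0 < \<delta>"
    have "norm ((F (s + h) - F s) / h - D) = \<bar>F (s + h) - F s - h * D\<bar> / \<bar>h\<bar>"
      using h by (simp add: abs_divide[symmetric] diff_divide_distrib)
    also have "\<dots> \<le> C * h^2 / \<bar>h\<bar>" using q[of h] h by (intro divide_right_mono) (auto simp: dist_real_def)
    also have "\<dots> = C * \<bar>h\<bar>" using h by (simp add: power2_eq_square abs_if)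
    finally show "norm ((F (s + h) - F s) / h - D) \<le> C * \<bar>h\<bar>" .
  qed
  show "((\<lambda>h. C * \<bar>h\<bar>) \<longlongrightarrow> 0) (at 0)" by (auto intro!: tendsto_eq_intros)
qed

definition std_exp :: "real measure" where
  "std_exp = density lborel (\<lambda>y. ennreal (indicator {0..} y * exp (- y)))"

lemma space_std_exp [simp]: "space std_exp = UNIV" and sets_std_exp [simp, measurable_cong]: "sets std_exp = sets borel"
  by (simp_all add: std_exp_def)

lemma AE_std_exp: "AE y in std_exp. 0 < y"
proof -
  have "AE y in lborel. (y::real) \<noteq> 0" by (rule AE_lborel_singleton)
  then show ?thesis unfolding std_exp_def by (subst AE_density) (auto elim!: eventually_mono simp: indicator_def)
qed

lemma nn_integral_std_exp_powr:
  assumes "0 < s"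
  shows "(\<integral>\<^sup>+y. ennreal (y powr (s - 1)) \<partial>std_exp) = ennreal (Gamma s)"
  unfolding std_exp_def Gamma_conv_nn_integral_real[OF assms]
  by (subst nn_integral_density, measurable)
     (intro nn_integral_cong, auto simp: ennreal_mult[symmetric] indicator_def exp_minus divide_inverse mult.commute)

lemma
  assumes "0 < s"
  shows integrable_std_exp_powr: "integrable std_exp (\<lambda>y. y powr (s - 1))"
    and integral_std_exp_powr: "(\<integral>y. y powr (s - 1) \<partial>std_exp) = Gamma s"
proof -
  have "has_bochner_integral std_exp (\<lambda>y. y powr (s - 1)) (Gamma s)"
    by (rule has_bochner_integral_nn_integral)
       (use assms nn_integral_std_exp_powr[OF assms] Gamma_real_pos[OF assms] in auto)
  then show "integrable std_exp (\<lambda>y. y powr (s - 1))" "(\<integral>y. y powr (s - 1) \<partial>std_exp) = Gamma s"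
    by (auto simp: has_bochner_integral_iff)
qed

lemma prob_space_std_exp: "prob_space std_exp"
proof (rule prob_spaceI)
  have "AE y in std_exp. ennreal (y powr (1 - 1)) = 1" using AE_std_exp by eventually_elim simp
  then have "(\<integral>\<^sup>+y. ennreal (y powr (1 - 1)) \<partial>std_exp) = (\<integral>\<^sup>+y. 1 \<partial>std_exp)" by (rule nn_integral_cong_AE)
  then show "emeasure std_exp (space std_exp) = 1" using nn_integral_std_exp_powr[of 1] by simp
qed

lemma integrable_std_exp_ln_powr:
  assumes "0 < s"
  shows "integrable std_exp (\<lambda>y. y powr (s - 1) * ln y ^ j)"
proof -
  define \<delta> where "\<delta> = s / (2 * (real j + 1))"
  have \<delta>: "0 < \<delta>" using assms by (simp add: \<delta>_def)
  have "real j * \<delta> < s"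
  proof -
    have "s * real j < s * (2 * real j + 2)" using assms by (intro mult_strict_left_mono) auto
    then show ?thesis by (simp add: \<delta>_def field_simps)
  qed
  then have pos: "0 < s - real j * \<delta>" by simp
  have pos': "0 < s + real j * \<delta>" using \<delta> assms by (intro add_pos_nonneg mult_nonneg_nonneg) auto
  show ?thesis
  proof (rule Bochner_Integration.integrable_bound[of _ "\<lambda>y. (y powr (s + real j * \<delta> - 1) + y powr (s - real j * \<delta> - 1)) / \<delta> ^ j"])
    show "integrable std_exp (\<lambda>y. (y powr (s + real j * \<delta> - 1) + y powr (s - real j * \<delta> - 1)) / \<delta> ^ j)"
      by (intro integrable_divide_zero Bochner_Integration.integrable_add integrable_std_exp_powr pos pos')
    show "AE y in std_exp. norm (y powr (s - 1) * ln y ^ j) \<le> norm ((y powr (s + real j * \<delta> - 1) + y powr (s - real j * \<delta> - 1)) / \<delta> ^ j)"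
      using AE_std_exp
    proof eventually_elim
      case (elim y)
      have "norm (y powr (s - 1) * ln y ^ j) = y powr (s - 1) * \<bar>ln y\<bar> ^ j" by (simp add: abs_mult power_abs)
      also have "\<dots> \<le> y powr (s - 1) * ((y powr (real j * \<delta>) + y powr (- (real j * \<delta>))) / \<delta> ^ j)"
        by (intro mult_left_mono abs_ln_power_le elim \<delta>) auto
      also have "\<dots> = (y powr (s + real j * \<delta> - 1) + y powr (s - real j * \<delta> - 1)) / \<delta> ^ j"
      proof -
        have "y powr (s + real j * \<delta> - 1) = y powr (s - 1) * y powr (real j * \<delta>)"
          "y powr (s - real j * \<delta> - 1) = y powr (s - 1) * y powr (- (real j * \<delta>))"
          using powr_add[of y "s - 1" "real j * \<delta>"] powr_add[of y "s - 1" "- (real j * \<delta>)"] by (simp_all add: algebra_simps)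
        then show ?thesis by (simp only: distrib_left times_divide_eq_right)
      qed
      also have "\<dots> \<le> norm ((y powr (s + real j * \<delta> - 1) + y powr (s - real j * \<delta> - 1)) / \<delta> ^ j)"
        unfolding real_norm_def by (rule abs_ge_self)
      finally show ?case .
    qed
  qed measurable
qed

text \<open>The \<open>j\<close>-th derivative of the Gamma function at \<open>s\<close>, in its integral form.\<close>

definition log_Gamma_moment :: "nat \<Rightarrow> real \<Rightarrow> real" where
  "log_Gamma_moment j s = (\<integral>y. y powr (s - 1) * ln y ^ j \<partial>std_exp)"

lemma log_Gamma_moment_0: "0 < s \<Longrightarrow> log_Gamma_moment 0 s = Gamma s"
  by (simp add: log_Gamma_moment_def integral_std_exp_powr)

text \<open>Differentiation under the integral sign. For \<open>\<bar>h\<bar> \<le> s / 2\<close> the second-order remainder is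
  dominated by \<open>h^2\<close> times an integrable function.\<close>

lemma log_Gamma_moment_deriv:
  assumes s: "0 < s"
  shows "(log_Gamma_moment j has_real_derivative log_Gamma_moment (Suc j) s) (at s)"
proof -
  define \<delta> where "\<delta> = s / 2"
  have \<delta>: "0 < \<delta>" "0 < s - \<delta>" "0 < s + \<delta>" using s by (auto simp: \<delta>_def)
  define b where "b y = \<bar>y powr (s + \<delta> - 1) * ln y ^ (j + 2)\<bar> + \<bar>y powr (s - \<delta> - 1) * ln y ^ (j + 2)\<bar>" for y
  have bi: "integrable std_exp b"
    unfolding b_def by (intro Bochner_Integration.integrable_add integrable_abs integrable_std_exp_ln_powr \<delta>)
  show ?thesis
  proof (rule has_real_derivative_quadratic[OF \<delta>(1), where C="integral\<^sup>L std_exp b"])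
    fix h assume h: "\<bar>h\<bar> \<le> \<delta>"
    have sh: "0 < s + h" using h s by (auto simp: \<delta>_def abs_le_iff)
    note i = integrable_std_exp_ln_powr[OF sh, of j] integrable_std_exp_ln_powr[OF s, of j] integrable_std_exp_ln_powr[OF s, of "Suc j"]
    have eq: "log_Gamma_moment j (s + h) - log_Gamma_moment j s - h * log_Gamma_moment (Suc j) s
      = (\<integral>y. y powr (s + h - 1) * ln y ^ j - y powr (s - 1) * ln y ^ j - h * (y powr (s - 1) * ln y ^ Suc j) \<partial>std_exp)"
      unfolding log_Gamma_moment_def using i by simp
    have "\<bar>log_Gamma_moment j (s + h) - log_Gamma_moment j s - h * log_Gamma_moment (Suc j) s\<bar>
      \<le> (\<integral>y. \<bar>y powr (s + h - 1) * ln y ^ j - y powr (s - 1) * ln y ^ j - h * (y powr (s - 1) * ln y ^ Suc j)\<bar> \<partial>std_exp)"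
      unfolding eq by (rule integral_abs_bound)
    also have "\<dots> \<le> (\<integral>y. h^2 * b y \<partial>std_exp)"
    proof (rule integral_mono_AE)
      show "AE y in std_exp. \<bar>y powr (s + h - 1) * ln y ^ j - y powr (s - 1) * ln y ^ j - h * (y powr (s - 1) * ln y ^ Suc j)\<bar> \<le> h^2 * b y"
        using AE_std_exp
      proof eventually_elim
        case (elim y)
        have hy: "y powr (s + h - 1) = y powr (s - 1) * exp (h * ln y)"
        proof -
          have "y powr (s + h - 1) = y powr ((s - 1) + h)" by (simp add: algebra_simps)
          also have "\<dots> = y powr (s - 1) * y powr h" by (rule powr_add)
          also have "y powr h = exp (h * ln y)" using elim by (simp add: powr_def)
          finally show ?thesis .
        qed
        have eq: "y powr (s + h - 1) * ln y ^ j - y powr (s - 1) * ln y ^ j - h * (y powr (s - 1) * ln y ^ Suc j)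
           = y powr (s - 1) * ln y ^ j * (exp (h * ln y) - 1 - h * ln y)"
          unfolding hy by (simp add: algebra_simps)
        have "\<bar>y powr (s + h - 1) * ln y ^ j - y powr (s - 1) * ln y ^ j - h * (y powr (s - 1) * ln y ^ Suc j)\<bar>
            = y powr (s - 1) * \<bar>ln y\<bar> ^ j * \<bar>exp (h * ln y) - 1 - h * ln y\<bar>"
          unfolding eq by (simp add: abs_mult power_abs)
        also have "\<dots> \<le> y powr (s - 1) * \<bar>ln y\<bar> ^ j * ((h * ln y)^2 * exp \<bar>h * ln y\<bar>)"
          by (intro mult_left_mono exp_taylor1_le) auto
        also have "\<dots> \<le> y powr (s - 1) * \<bar>ln y\<bar> ^ j * ((h * ln y)^2 * (y powr \<delta> + y powr (- \<delta>)))"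
        proof (intro mult_left_mono)
          have "\<bar>h * ln y\<bar> \<le> \<delta> * \<bar>ln y\<bar>" using h by (simp add: abs_mult mult_right_mono)
          then have "exp \<bar>h * ln y\<bar> \<le> exp (\<delta> * \<bar>ln y\<bar>)" by simp
          also have "\<dots> \<le> y powr \<delta> + y powr (- \<delta>)" using elim by (auto simp: powr_def abs_if)
          finally show "exp \<bar>h * ln y\<bar> \<le> y powr \<delta> + y powr (- \<delta>)" .
        qed auto
        also have "\<dots> = h^2 * b y"
        proof -
          have "b y = (y powr (s + \<delta> - 1) + y powr (s - \<delta> - 1)) * (\<bar>ln y\<bar> ^ j * (ln y)^2)"
          proof -
            have "\<bar>ln y\<bar> ^ (j + 2) = \<bar>ln y\<bar> ^ j * (ln y)^2" by (simp only: power_add power2_abs)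
            then show ?thesis by (simp add: b_def abs_mult power_abs distrib_right del: add_2_eq_Suc')
          qed
          moreover have "y powr (s + \<delta> - 1) = y powr (s - 1) * y powr \<delta>" "y powr (s - \<delta> - 1) = y powr (s - 1) * y powr (- \<delta>)"
            using powr_add[of y "s - 1" \<delta>] powr_add[of y "s - 1" "- \<delta>"] by (simp_all add: algebra_simps)
          ultimately show ?thesis by (simp add: power_mult_distrib algebra_simps)
        qed
        finally show ?case .
      qed
    qed (use i bi in auto)
    finally show "\<bar>log_Gamma_moment j (s + h) - log_Gamma_moment j s - h * log_Gamma_moment (Suc j) s\<bar> \<le> integral\<^sup>L std_exp b * h^2"
      by (simp add: mult.commute)
  qed
qed

lemma pos_not_nonpos_Int: "0 < (s::real) \<Longrightarrow> s \<notin> \<int>\<^sub>\<le>\<^sub>0"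
  by (auto elim!: nonpos_Ints_cases)

lemma log_Gamma_moment_1:
  assumes s: "0 < s" shows "log_Gamma_moment 1 s = Gamma s * Digamma s"
proof (rule DERIV_unique)
  have "(Gamma has_real_derivative log_Gamma_moment 1 s) (at s)"
  proof (rule has_field_derivative_transform_within_open[of _ _ _ "{0<..}"])
    show "(log_Gamma_moment 0 has_real_derivative log_Gamma_moment 1 s) (at s)"
      using log_Gamma_moment_deriv[OF s, of 0] by simp
  qed (use s log_Gamma_moment_0 in auto)
  then show "(Gamma has_real_derivative log_Gamma_moment 1 s) (at s)" .
  show "(Gamma has_real_derivative Gamma s * Digamma s) (at s)"
    by (rule has_field_derivative_Gamma) (rule pos_not_nonpos_Int[OF s])
qed

lemma Gamma_Digamma_deriv:
  assumes s: "0 < (s::real)"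
  shows "((\<lambda>s. Gamma s * Digamma s) has_real_derivative Gamma s * ((Digamma s)^2 + Polygamma 1 s)) (at s)"
  using pos_not_nonpos_Int[OF s]
  by (auto intro!: derivative_eq_intros simp: power2_eq_square algebra_simps)

lemma log_Gamma_moment_2:
  assumes s: "0 < s" shows "log_Gamma_moment 2 s = Gamma s * ((Digamma s)^2 + Polygamma 1 s)"
proof (rule DERIV_unique)
  show "((\<lambda>s. Gamma s * Digamma s) has_real_derivative log_Gamma_moment 2 s) (at s)"
  proof (rule has_field_derivative_transform_within_open[of _ _ _ "{0<..}"])
    show "(log_Gamma_moment 1 has_real_derivative log_Gamma_moment 2 s) (at s)"
      using log_Gamma_moment_deriv[OF s, of 1] by (simp add: numeral_2_eq_2)
  qed (use s log_Gamma_moment_1 in auto)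
qed (rule Gamma_Digamma_deriv[OF s])

lemma Digamma_values: "Digamma (1::real) = - euler_mascheroni" "Digamma (2::real) = 1 - euler_mascheroni"
  "Digamma (3::real) = 3/2 - euler_mascheroni"
  using Digamma_plus1[of "1::real"] Digamma_plus1[of "2::real"] by simp_all

lemma Polygamma_1_values: "Polygamma 1 (1::real) = pi^2 / 6" "Polygamma 1 (2::real) = pi^2 / 6 - 1"
  "Polygamma 1 (3::real) = pi^2 / 6 - 5/4"
proof -
  have "(\<lambda>k. inverse ((1 + real k)^2)) sums (pi^2 / 6)"
    using inverse_squares_sums by (simp add: inverse_eq_divide add.commute)
  then have "(\<Sum>k. inverse ((1 + real k)^2)) = pi^2 / 6" by (rule sums_unique[symmetric])
  then show 1: "Polygamma 1 (1::real) = pi^2 / 6" by (simp add: Polygamma_def numeral_2_eq_2)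
  then show 2: "Polygamma 1 (2::real) = pi^2 / 6 - 1" using Polygamma_plus1[of "1::real" 1] by simp
  then show "Polygamma 1 (3::real) = pi^2 / 6 - 5/4" using Polygamma_plus1[of "2::real" 1] by (simp add: power2_eq_square)
qed

lemma deriv2_Gamma_2: "(deriv ^^ 2) Gamma (2::real) = (1 - euler_mascheroni)^2 + pi^2 / 6 - 1"
proof -
  have d: "deriv Gamma s = Gamma s * Digamma s" if "0 < (s::real)" for s
    by (rule DERIV_imp_deriv, rule has_field_derivative_Gamma, rule pos_not_nonpos_Int[OF that])
  have "(deriv Gamma has_real_derivative Gamma 2 * ((Digamma 2)^2 + Polygamma 1 2)) (at 2)"
    by (rule has_field_derivative_transform_within_open[OF Gamma_Digamma_deriv, of _ "{0<..}"]) (use d in auto)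
  then have "deriv (deriv Gamma) 2 = Gamma 2 * ((Digamma 2)^2 + Polygamma 1 (2::real))" by (rule DERIV_imp_deriv)
  moreover have "Gamma (2::real) = 1" using Gamma_fact[of 1, where 'a=real] by simp
  moreover have "(deriv ^^ 2) Gamma = deriv (deriv (Gamma :: real \<Rightarrow> real))" by (simp add: numeral_2_eq_2)
  ultimately show ?thesis unfolding Digamma_values Polygamma_1_values by simp
qed

lemma log_Gamma_moment_values:
  "log_Gamma_moment 0 1 = 1" "log_Gamma_moment 0 2 = 1" "log_Gamma_moment 0 3 = 2"
  "log_Gamma_moment 1 1 = - euler_mascheroni" "log_Gamma_moment 1 2 = 1 - euler_mascheroni"
  "log_Gamma_moment 1 3 = 3 - 2 * euler_mascheroni"
  "log_Gamma_moment 2 1 = euler_mascheroni^2 + pi^2 / 6"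
  "log_Gamma_moment 2 2 = (1 - euler_mascheroni)^2 + pi^2 / 6 - 1"
  "log_Gamma_moment 2 3 = 2 * ((3/2 - euler_mascheroni)^2 + pi^2 / 6 - 5/4)"
proof -
  have G: "Gamma (1::real) = 1" "Gamma (2::real) = 1" "Gamma (3::real) = 2"
    using Gamma_fact[of 1, where 'a=real] Gamma_fact[of 2, where 'a=real] by (simp_all add: numeral_2_eq_2)
  note v = G Digamma_values Polygamma_1_values
  show "log_Gamma_moment 0 1 = 1" "log_Gamma_moment 0 2 = 1" "log_Gamma_moment 0 3 = 2"
    using G by (simp_all add: log_Gamma_moment_0)
  show "log_Gamma_moment 1 1 = - euler_mascheroni" "log_Gamma_moment 1 2 = 1 - euler_mascheroni"
    "log_Gamma_moment 1 3 = 3 - 2 * euler_mascheroni"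
    using log_Gamma_moment_1[of 1] log_Gamma_moment_1[of 2] log_Gamma_moment_1[of 3] unfolding v by simp_all
  show "log_Gamma_moment 2 1 = euler_mascheroni^2 + pi^2 / 6"
    "log_Gamma_moment 2 2 = (1 - euler_mascheroni)^2 + pi^2 / 6 - 1"
    "log_Gamma_moment 2 3 = 2 * ((3/2 - euler_mascheroni)^2 + pi^2 / 6 - 5/4)"
    using log_Gamma_moment_2[of 1] log_Gamma_moment_2[of 2] log_Gamma_moment_2[of 3] unfolding v by simp_all
qed

section \<open>Moments of the Frechet distribution\<close>

lemma frechet_density_measurable [measurable]: "frechet_density \<alpha> \<sigma> \<in> borel_measurable borel"
  unfolding frechet_density_def[abs_def] by measurable

lemma frechet_density_nonneg: "0 < \<alpha> \<Longrightarrow> 0 < \<sigma> \<Longrightarrow> 0 \<le> frechet_density \<alpha> \<sigma> x"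
  by (simp add: frechet_density_def)

text \<open>If \<open>y\<close> is standard exponential, then \<open>y powr (- 1 / \<alpha>)\<close> is Frechet, by the change of variables
  \<open>y = x powr (- \<alpha>)\<close>; all Frechet moments reduce to exponential ones.\<close>

lemma frechet_eq_distr_std_exp:
  assumes \<alpha>: "0 < \<alpha>"
  shows "frechet \<alpha> 1 = distr std_exp borel (\<lambda>y. y powr (- (1 / \<alpha>)))"
proof (rule measure_eqI)
  fix A assume "A \<in> sets (frechet \<alpha> 1)"
  then have A [measurable]: "A \<in> sets borel" by (simp add: frechet_def)
  interpret E: prob_space std_exp by (rule prob_space_std_exp)
  define g where "g y = y powr (- (1 / \<alpha>))" for y
  define g' where "g' y = - (1 / \<alpha>) * y powr (- (1 / \<alpha>) - 1)" for y
  define f where "f x = indicator A x * frechet_density \<alpha> 1 x" for x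
  define b where "b = measure std_exp (g -` A)"
  have gm [measurable]: "g \<in> borel_measurable borel" unfolding g_def[abs_def] by measurable
  have gA [measurable]: "g -` A \<in> sets borel" using measurable_sets[OF gm A] by simp
  have conv: "\<bar>g' y\<bar> * f (g y) = indicator (g -` A) y * exp (- y)" if "0 < y" for y
  proof -
    have "g y powr (- \<alpha>) = y" using that \<alpha> by (simp add: g_def powr_powr)
    moreover have "g y powr (- \<alpha> - 1) = y * y powr (1 / \<alpha>)"
    proof -
      have "- (1 / \<alpha>) * (- \<alpha> - 1) = 1 + 1 / \<alpha>" using \<alpha> by (simp add: field_simps)
      then have "g y powr (- \<alpha> - 1) = y powr (1 + 1 / \<alpha>)" by (simp only: g_def powr_powr)
      then show ?thesis using that by (simp add: powr_add)
    qed
    moreover have "y powr (- (1 / \<alpha>) - 1) * (y * y powr (1 / \<alpha>)) = 1"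
    proof -
      have "y powr (- (1 / \<alpha>) - 1) * (y * y powr (1 / \<alpha>)) = y powr (- (1 / \<alpha>) - 1 + (1 + 1 / \<alpha>))"
        using that by (simp only: powr_add powr_one mult.assoc)
      then show ?thesis using that by simp
    qed
    moreover have "0 < g y" using that by (simp add: g_def)
    ultimately show ?thesis using that \<alpha>
      by (simp add: f_def frechet_density_def g'_def indicator_def abs_mult mult_ac)
  qed
  have img: "g ` {0<..} = {0<..}"
  proof (intro set_eqI iffI)
    fix x :: real assume "x \<in> {0<..}"
    then have "x = g (x powr (- \<alpha>))" using \<alpha> by (simp add: g_def powr_powr)
    then show "x \<in> g ` {0<..}" using \<open>x \<in> {0<..}\<close> by (intro image_eqI[of _ _ "x powr (- \<alpha>)"]) auto
  qed (auto simp: g_def)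
  have inj: "inj_on g {0<..}"
  proof (rule inj_on_inverseI[where g="\<lambda>x. x powr (- \<alpha>)"])
    fix y :: real assume "y \<in> {0<..}" then show "g y powr (- \<alpha>) = y" using \<alpha> by (simp add: g_def powr_powr)
  qed
  have der: "(g has_field_derivative g' y) (at y within {0<..})" if "y \<in> {0<..}" for y
    unfolding g_def[abs_def] g'_def using that by (auto intro!: derivative_eq_intros)
  have hb: "has_bochner_integral lborel (\<lambda>y. indicator {0<..} y *\<^sub>R (indicator (g -` A) y * exp (- y))) b"
  proof (rule has_bochner_integral_nn_integral)
    have "(\<integral>\<^sup>+y. ennreal (indicator {0<..} y *\<^sub>R (indicator (g -` A) y * exp (- y))) \<partial>lborel)
      = (\<integral>\<^sup>+y. ennreal (indicator {0..} y * exp (- y)) * indicator (g -` A) y \<partial>lborel)"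
      by (rule nn_integral_cong_AE) (use AE_lborel_singleton[of 0] in \<open>eventually_elim, auto simp: indicator_def\<close>)
    also have "\<dots> = emeasure std_exp (g -` A)" unfolding std_exp_def by (subst emeasure_density) auto
    finally show "(\<integral>\<^sup>+y. ennreal (indicator {0<..} y *\<^sub>R (indicator (g -` A) y * exp (- y))) \<partial>lborel) = ennreal b"
      by (simp add: b_def E.emeasure_eq_measure)
  qed (auto simp: b_def)
  have si: "set_integrable lebesgue {0<..} (\<lambda>y. \<bar>g' y\<bar> * f (g y)) \<and> integral {0<..} (\<lambda>y. \<bar>g' y\<bar> * f (g y)) = b"
  proof -
    have s: "set_integrable lborel {0<..} (\<lambda>y. indicator (g -` A) y * exp (- y) :: real)"
      using hb by (simp add: set_integrable_def has_bochner_integral_iff)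
    have "set_integrable lebesgue {0<..} (\<lambda>y. indicator (g -` A) y * exp (- y) :: real)"
      using s unfolding set_integrable_def by (subst integrable_completion) auto
    moreover have "integral {0<..} (\<lambda>y. indicator (g -` A) y * exp (- y) :: real) = b"
      using set_borel_integral_eq_integral(2)[OF s] hb by (simp add: set_lebesgue_integral_def has_bochner_integral_iff)
    moreover have "set_integrable lebesgue {0<..} (\<lambda>y. indicator (g -` A) y * exp (- y) :: real)
        = set_integrable lebesgue {0<..} (\<lambda>y. \<bar>g' y\<bar> * f (g y))"
      by (rule set_integrable_cong) (auto simp: conv)
    moreover have "integral {0<..} (\<lambda>y. indicator (g -` A) y * exp (- y) :: real) = integral {0<..} (\<lambda>y. \<bar>g' y\<bar> * f (g y))"
      by (rule integral_cong) (auto simp: conv)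
    ultimately show ?thesis by simp
  qed
  then have f: "set_integrable lebesgue {0<..} f" "integral {0<..} f = b"
    using has_absolute_integral_change_of_variables_1'[OF _ der inj, of f b] unfolding img by auto
  have fm [measurable]: "f \<in> borel_measurable borel" unfolding f_def[abs_def] by measurable
  have f0: "0 \<le> f x" "x \<le> 0 \<Longrightarrow> f x = 0" for x
    using frechet_density_nonneg[OF \<alpha>, of 1 x] by (auto simp: f_def frechet_density_def)
  have fi: "set_integrable lborel {0<..} f"
    using f(1) unfolding set_integrable_def by (subst (asm) integrable_completion) auto
  have feq: "indicator {0<..} x *\<^sub>R f x = f x" for x using f0(2)[of x] by (auto simp: indicator_def)
  have "integrable lborel f" "integral\<^sup>L lborel f = b"
    using fi set_borel_integral_eq_integral(2)[OF fi] f(2) unfolding set_integrable_def set_lebesgue_integral_def feq by simp_all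
  then have "(\<integral>\<^sup>+x. ennreal (f x) \<partial>lborel) = ennreal b" using f0 by (subst nn_integral_eq_integral) auto
  moreover have "emeasure (frechet \<alpha> 1) A = (\<integral>\<^sup>+x. ennreal (f x) \<partial>lborel)"
    unfolding frechet_def f_def by (subst emeasure_density) (auto intro!: nn_integral_cong simp: indicator_def)
  ultimately show "emeasure (frechet \<alpha> 1) A = emeasure (distr std_exp borel (\<lambda>y. y powr (- (1 / \<alpha>)))) A"
    by (subst emeasure_distr) (auto simp: b_def g_def[abs_def] E.emeasure_eq_measure)
qed (simp add: frechet_def)

lemma real_distribution_frechet: "0 < \<alpha> \<Longrightarrow> real_distribution (frechet \<alpha> 1)"
  unfolding frechet_eq_distr_std_exp
  by (intro real_distribution.intro real_distribution_axioms.intro prob_space.prob_space_distr prob_space_std_exp) auto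

lemma frechet_null: "emeasure (frechet \<alpha> 1) {..0} = 0" "emeasure (frechet \<alpha> 1) {x} = 0"
proof -
  show "emeasure (frechet \<alpha> 1) {..0} = 0"
    unfolding frechet_def by (subst emeasure_density) (auto simp: frechet_density_def indicator_def intro!: nn_integral_zero')
  show "emeasure (frechet \<alpha> 1) {x} = 0"
    unfolding frechet_def by (subst emeasure_density) (auto intro!: nn_integral_null_set)
qed

lemma
  assumes \<alpha>: "0 < \<alpha>" and f [measurable]: "f \<in> borel_measurable borel"
  shows frechet_integral_eq: "frechet_integral \<alpha> f = (\<integral>x. f x \<partial>frechet \<alpha> 1)"
    and integral_frechet_std_exp: "(\<integral>x. f x \<partial>frechet \<alpha> 1) = (\<integral>y. f (y powr (- (1 / \<alpha>))) \<partial>std_exp)"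
    and integrable_frechet_std_exp: "integrable (frechet \<alpha> 1) f \<longleftrightarrow> integrable std_exp (\<lambda>y. f (y powr (- (1 / \<alpha>))))"
proof -
  have "(\<integral>x. f x \<partial>frechet \<alpha> 1) = (\<integral>x. frechet_density \<alpha> 1 x *\<^sub>R f x \<partial>lborel)"
    unfolding frechet_def by (subst integral_density) (auto simp: frechet_density_nonneg \<alpha>)
  then show "frechet_integral \<alpha> f = (\<integral>x. f x \<partial>frechet \<alpha> 1)"
    unfolding frechet_integral_def set_lebesgue_integral_def
    by (auto intro!: Bochner_Integration.integral_cong simp: frechet_density_def indicator_def)
  show "(\<integral>x. f x \<partial>frechet \<alpha> 1) = (\<integral>y. f (y powr (- (1 / \<alpha>))) \<partial>std_exp)"
    unfolding frechet_eq_distr_std_exp[OF \<alpha>] by (subst integral_distr) auto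
  show "integrable (frechet \<alpha> 1) f \<longleftrightarrow> integrable std_exp (\<lambda>y. f (y powr (- (1 / \<alpha>))))"
    unfolding frechet_eq_distr_std_exp[OF \<alpha>] by (subst integrable_distr_eq) auto
qed

lemma integrable_frechet_powr:
  assumes "0 < \<alpha>" "- \<alpha> < \<beta>"
  shows "integrable (frechet \<alpha> 1) (\<lambda>x. x powr (- \<beta>))"
proof -
  have "0 < \<beta> / \<alpha> + 1" using assms by (simp add: field_simps)
  from integrable_std_exp_powr[OF this] show ?thesis
    using assms(1) by (subst integrable_frechet_std_exp) (simp_all add: powr_powr)
qed

text \<open>With \<open>y = x powr (- \<alpha>)\<close> the functions \<open>f1\<close>, \<open>f2\<close> and \<open>f3\<close> become \<open>- y * ln y / \<alpha>\<close>, \<open>y\<close> and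
  \<open>- ln y / \<alpha>\<close>, so that all integrals are logarithmic moments at \<open>1\<close>, \<open>2\<close> and \<open>3\<close>. Only linear
  combinations with opposite coefficients at \<open>f1\<close> and \<open>f3\<close> occur in the rows of \<open>M_mat\<close>.\<close>

lemma frechet_moments:
  assumes \<alpha>: "0 < \<alpha>"
  shows "frechet_integral \<alpha> (f1 \<alpha>) = - (1 - euler_mascheroni) / \<alpha>"
    and "frechet_integral \<alpha> (f2 \<alpha>) = 1"
    and "frechet_integral \<alpha> f3 = euler_mascheroni / \<alpha>"
    and "frechet_integral \<alpha> (\<lambda>x. x powr (- \<alpha>) * (ln x)^2) = ((1 - euler_mascheroni)^2 + pi^2 / 6 - 1) / \<alpha>^2"
    and "frechet_integral \<alpha> (\<lambda>x. (a * (f1 \<alpha> x - f3 x) + b * f2 \<alpha> x)^2)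
      - (frechet_integral \<alpha> (\<lambda>x. a * (f1 \<alpha> x - f3 x) + b * f2 \<alpha> x))^2
      = a^2 * ((1 - euler_mascheroni)^2 + pi^2 / 6) / \<alpha>^2 - 2 * a * b * (1 - euler_mascheroni) / \<alpha> + b^2"
proof -
  note lv = log_Gamma_moment_values log_Gamma_moment_values[unfolded One_nat_def]
  define P where "P j s y = y powr (s - 1) * ln y ^ j" for j and s y :: real
  have Pi: "integrable std_exp (P j s)" if "0 < s" for j s
    unfolding P_def[abs_def] by (rule integrable_std_exp_ln_powr[OF that])
  have PI: "(\<integral>y. P j s y \<partial>std_exp) = log_Gamma_moment j s" for j s by (simp add: P_def log_Gamma_moment_def)
  have fm [measurable]: "f1 \<alpha> \<in> borel_measurable borel" "f2 \<alpha> \<in> borel_measurable borel" "f3 \<in> borel_measurable borel"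
    unfolding f1_def[abs_def] f2_def[abs_def] f3_def[abs_def] by measurable
  have pw: "(y powr (- (1 / \<alpha>))) powr (- \<alpha>) = P 0 2 y" "ln (y powr (- (1 / \<alpha>))) = - P 1 1 y / \<alpha>" if "0 < y" for y
    using that \<alpha> by (simp_all add: P_def powr_powr ln_powr)
  have mult: "P i s y * P j t y = P (i + j) (s + t - 1) y" if "0 < y" for i j s t y
    using that by (simp add: P_def powr_add[symmetric] power_add algebra_simps)
  have mult': "(y powr (- (1 / \<alpha>))) powr (- \<alpha>) * ln (y powr (- (1 / \<alpha>))) = - P 1 2 y / \<alpha>" if "0 < y" for y
    unfolding pw[OF that] using mult[OF that, of 0 2 1 1] by simp
  have F: "f1 \<alpha> (y powr (- (1 / \<alpha>))) = - P 1 2 y / \<alpha>" "f2 \<alpha> (y powr (- (1 / \<alpha>))) = P 0 2 y"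
    "f3 (y powr (- (1 / \<alpha>))) = - P 1 1 y / \<alpha>" if "0 < y" for y
    unfolding f1_def f2_def f3_def mult'[OF that] pw[OF that] using mult[OF that, of 0 2 1 1] by simp_all
  have transfer: "frechet_integral \<alpha> f = (\<integral>y. h y \<partial>std_exp)"
    if [measurable]: "f \<in> borel_measurable borel" "h \<in> borel_measurable borel" and "\<And>y. 0 < y \<Longrightarrow> f (y powr (- (1 / \<alpha>))) = h y" for f h
  proof -
    have "frechet_integral \<alpha> f = (\<integral>y. f (y powr (- (1 / \<alpha>))) \<partial>std_exp)"
      by (subst frechet_integral_eq[OF \<alpha>], simp) (rule integral_frechet_std_exp[OF \<alpha>], simp)
    also have "\<dots> = (\<integral>y. h y \<partial>std_exp)"
      by (rule integral_cong_AE) (use AE_std_exp that(3) in auto)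
    finally show ?thesis .
  qed
  have Pm [measurable]: "P j s \<in> borel_measurable borel" for j s unfolding P_def[abs_def] by measurable
  have "frechet_integral \<alpha> (f1 \<alpha>) = (\<integral>y. - P 1 2 y / \<alpha> \<partial>std_exp)"
    by (rule transfer) (simp_all add: F)
  then show "frechet_integral \<alpha> (f1 \<alpha>) = - (1 - euler_mascheroni) / \<alpha>"
    using \<alpha> by (simp add: PI lv field_simps)
  have "frechet_integral \<alpha> (f2 \<alpha>) = (\<integral>y. P 0 2 y \<partial>std_exp)"
    by (rule transfer) (simp_all add: F)
  then show "frechet_integral \<alpha> (f2 \<alpha>) = 1"
    by (simp add: PI lv)
  have "frechet_integral \<alpha> f3 = (\<integral>y. - P 1 1 y / \<alpha> \<partial>std_exp)"
    by (rule transfer) (simp_all add: F)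
  then show "frechet_integral \<alpha> f3 = euler_mascheroni / \<alpha>"
    by (simp add: PI lv)
  have "frechet_integral \<alpha> (\<lambda>x. x powr (- \<alpha>) * (ln x)^2) = (\<integral>y. P 2 2 y / \<alpha>^2 \<partial>std_exp)"
  proof (rule transfer)
    fix y :: real assume y: "0 < y"
    have "(y powr (- (1 / \<alpha>))) powr (- \<alpha>) * (ln (y powr (- (1 / \<alpha>))))^2 = P 0 2 y * (P 1 1 y * P 1 1 y) / \<alpha>^2"
      unfolding pw[OF y] by (simp add: power2_eq_square)
    also have "P 0 2 y * (P 1 1 y * P 1 1 y) = P 2 2 y" by (simp add: mult[OF y] numeral_2_eq_2)
    finally show "(y powr (- (1 / \<alpha>))) powr (- \<alpha>) * (ln (y powr (- (1 / \<alpha>))))^2 = P 2 2 y / \<alpha>^2" .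
  qed simp_all
  then show "frechet_integral \<alpha> (\<lambda>x. x powr (- \<alpha>) * (ln x)^2) = ((1 - euler_mascheroni)^2 + pi^2 / 6 - 1) / \<alpha>^2"
    by (simp add: PI lv)
  have "frechet_integral \<alpha> (\<lambda>x. a * (f1 \<alpha> x - f3 x) + b * f2 \<alpha> x)
     = (\<integral>y. (a / \<alpha>) * P 1 1 y - (a / \<alpha>) * P 1 2 y + b * P 0 2 y \<partial>std_exp)"
    by (rule transfer) (simp_all add: F, simp add: algebra_simps diff_divide_distrib)
  also have "\<dots> = (a / \<alpha>) * log_Gamma_moment 1 1 - (a / \<alpha>) * log_Gamma_moment 1 2 + b * log_Gamma_moment 0 2"
    using Pi by (simp add: PI)
  finally have 1: "frechet_integral \<alpha> (\<lambda>x. a * (f1 \<alpha> x - f3 x) + b * f2 \<alpha> x) = - a / \<alpha> + b"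
    using \<alpha> by (simp add: lv field_simps)
  have "frechet_integral \<alpha> (\<lambda>x. (a * (f1 \<alpha> x - f3 x) + b * f2 \<alpha> x)^2)
     = (\<integral>y. (a / \<alpha>)^2 * (P 2 1 y - 2 * P 2 2 y + P 2 3 y) + 2 * (a / \<alpha>) * b * (P 1 2 y - P 1 3 y) + b^2 * P 0 3 y \<partial>std_exp)"
  proof (rule transfer)
    fix y :: real assume y: "0 < y"
    have "(a * (f1 \<alpha> (y powr (- (1 / \<alpha>))) - f3 (y powr (- (1 / \<alpha>)))) + b * f2 \<alpha> (y powr (- (1 / \<alpha>))))^2
       = ((a / \<alpha>) * (P 1 1 y - P 1 2 y) + b * P 0 2 y)^2"
      unfolding F[OF y] by (simp add: algebra_simps diff_divide_distrib)
    also have "\<dots> = (a / \<alpha>)^2 * (P 1 1 y * P 1 1 y - 2 * (P 1 1 y * P 1 2 y) + P 1 2 y * P 1 2 y)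
        + 2 * (a / \<alpha>) * b * (P 1 1 y * P 0 2 y - P 1 2 y * P 0 2 y) + b^2 * (P 0 2 y * P 0 2 y)"
      by (simp add: power2_eq_square algebra_simps)
    also have "\<dots> = (a / \<alpha>)^2 * (P 2 1 y - 2 * P 2 2 y + P 2 3 y) + 2 * (a / \<alpha>) * b * (P 1 2 y - P 1 3 y) + b^2 * P 0 3 y"
      unfolding mult[OF y] by (simp add: numeral_2_eq_2[symmetric])
    finally show "(a * (f1 \<alpha> (y powr (- (1 / \<alpha>))) - f3 (y powr (- (1 / \<alpha>)))) + b * f2 \<alpha> (y powr (- (1 / \<alpha>))))^2
       = (a / \<alpha>)^2 * (P 2 1 y - 2 * P 2 2 y + P 2 3 y) + 2 * (a / \<alpha>) * b * (P 1 2 y - P 1 3 y) + b^2 * P 0 3 y" .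
  qed simp_all
  also have "\<dots> = (a / \<alpha>)^2 * (log_Gamma_moment 2 1 - 2 * log_Gamma_moment 2 2 + log_Gamma_moment 2 3)
     + 2 * (a / \<alpha>) * b * (log_Gamma_moment 1 2 - log_Gamma_moment 1 3) + b^2 * log_Gamma_moment 0 3"
    using Pi by (simp add: PI)
  finally have 2: "frechet_integral \<alpha> (\<lambda>x. (a * (f1 \<alpha> x - f3 x) + b * f2 \<alpha> x)^2)
     = (a / \<alpha>)^2 * (log_Gamma_moment 2 1 - 2 * log_Gamma_moment 2 2 + log_Gamma_moment 2 3)
     + 2 * (a / \<alpha>) * b * (log_Gamma_moment 1 2 - log_Gamma_moment 1 3) + b^2 * log_Gamma_moment 0 3" .
  show "frechet_integral \<alpha> (\<lambda>x. (a * (f1 \<alpha> x - f3 x) + b * f2 \<alpha> x)^2)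
      - (frechet_integral \<alpha> (\<lambda>x. a * (f1 \<alpha> x - f3 x) + b * f2 \<alpha> x))^2
      = a^2 * ((1 - euler_mascheroni)^2 + pi^2 / 6) / \<alpha>^2 - 2 * a * b * (1 - euler_mascheroni) / \<alpha> + b^2"
    unfolding 1 2 lv using \<alpha> by (simp add: field_simps power2_eq_square)
qed

section \<open>The profile likelihood\<close>

definition log_power_mean :: "nat \<Rightarrow> (nat \<Rightarrow> real) \<Rightarrow> nat \<Rightarrow> real \<Rightarrow> real" where
  "log_power_mean k x j a = (\<Sum>i=1..k. x i powr (- a) * ln (x i) ^ j) / real k"

definition log_mean :: "nat \<Rightarrow> (nat \<Rightarrow> real) \<Rightarrow> real" where
  "log_mean k x = (\<Sum>i=1..k. ln (x i)) / real k"

text \<open>The derivative in \<open>a\<close> of the log-likelihood per observation after maximization over the scale,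
  whose maximizer for fixed \<open>a\<close> is the profile scale defined next.\<close>

definition profile_score :: "nat \<Rightarrow> (nat \<Rightarrow> real) \<Rightarrow> real \<Rightarrow> real" where
  "profile_score k x a = 1 / a + log_power_mean k x 1 a / log_power_mean k x 0 a - log_mean k x"

definition profile_scale :: "nat \<Rightarrow> (nat \<Rightarrow> real) \<Rightarrow> real \<Rightarrow> real" where
  "profile_scale k x a = log_power_mean k x 0 a powr (- (1 / a))"

context
  fixes k :: nat and x :: "nat \<Rightarrow> real"
  assumes k: "0 < k" and x: "\<And>i. i \<in> {1..k} \<Longrightarrow> 0 < x i"
begin

lemma log_power_mean_pos: "0 < log_power_mean k x 0 a"
  unfolding log_power_mean_def
proof (intro divide_pos_pos sum_pos)
  fix i assume "i \<in> {1..k}" then show "0 < x i powr (- a) * ln (x i) ^ 0" using x[of i] by auto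
qed (use k in auto)

lemma log_power_mean_deriv:
  "(log_power_mean k x j has_real_derivative - log_power_mean k x (Suc j) a) (at a)"
proof -
  have "((\<lambda>a. (\<Sum>i=1..k. x i powr (- a) * ln (x i) ^ j) / real k) has_real_derivative
      (\<Sum>i=1..k. - (x i powr (- a) * ln (x i) ^ Suc j)) / real k) (at a)"
  proof (intro DERIV_cdivide DERIV_sum)
    fix i assume "i \<in> {1..k}"
    then have "0 < x i" by (rule x)
    then show "((\<lambda>a. x i powr (- a) * ln (x i) ^ j) has_real_derivative - (x i powr (- a) * ln (x i) ^ Suc j)) (at a)"
      by (auto intro!: derivative_eq_intros simp: algebra_simps)
  qed
  then show ?thesis by (simp add: log_power_mean_def[abs_def] sum_negf)
qed

text \<open>The weighted variance of \<open>ln (x i)\<close> with weights \<open>x i powr (- a)\<close> is nonnegative.\<close>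

lemma log_power_mean_cauchy_schwarz:
  "(log_power_mean k x 1 a)^2 \<le> log_power_mean k x 0 a * log_power_mean k x 2 a"
proof -
  define A where "A j = log_power_mean k x j a" for j
  have A0: "0 < A 0" using log_power_mean_pos by (simp add: A_def)
  define t where "t = A 1 / A 0"
  have "0 \<le> (\<Sum>i=1..k. x i powr (- a) * (ln (x i) - t)^2) / real k"
    by (intro divide_nonneg_nonneg sum_nonneg mult_nonneg_nonneg) auto
  also have "\<dots> = A 2 - 2 * t * A 1 + t^2 * A 0"
  proof -
    have "x i powr (- a) * (ln (x i) - t)^2 = x i powr (- a) * ln (x i) ^ 2 - 2 * t * (x i powr (- a) * ln (x i) ^ 1) + t^2 * (x i powr (- a) * ln (x i) ^ 0)" for i
      by (simp add: power2_eq_square algebra_simps)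
    then have "(\<Sum>i=1..k. x i powr (- a) * (ln (x i) - t)^2) = (\<Sum>i=1..k. x i powr (- a) * ln (x i) ^ 2)
       - 2 * t * (\<Sum>i=1..k. x i powr (- a) * ln (x i) ^ 1) + t^2 * (\<Sum>i=1..k. x i powr (- a) * ln (x i) ^ 0)"
      by (simp only: sum.distrib sum_subtractf sum_distrib_left)
    then show ?thesis unfolding A_def log_power_mean_def by (simp only: add_divide_distrib diff_divide_distrib times_divide_eq_right)
  qed
  also have "\<dots> = A 2 - (A 1)^2 / A 0" using A0 by (simp add: t_def power2_eq_square field_simps)
  finally have "(A 1)^2 \<le> A 0 * A 2" using A0 by (simp add: field_simps)
  then show ?thesis by (simp add: A_def)
qed

lemma profile_score_deriv:
  assumes "0 < a"
  shows "(profile_score k x has_real_derivative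
    - (1 / a^2 + (log_power_mean k x 2 a * log_power_mean k x 0 a - (log_power_mean k x 1 a)^2) / (log_power_mean k x 0 a)^2)) (at a)"
proof -
  have "log_power_mean k x 0 a \<noteq> 0" using log_power_mean_pos[of a] by simp
  moreover have "(log_power_mean k x 1 has_real_derivative - log_power_mean k x 2 a) (at a)"
    using log_power_mean_deriv[of 1 a] by (simp add: numeral_2_eq_2)
  moreover have "(log_power_mean k x 0 has_real_derivative - log_power_mean k x 1 a) (at a)"
    using log_power_mean_deriv[of 0 a] by simp
  ultimately have "((\<lambda>a. 1 / a + log_power_mean k x 1 a / log_power_mean k x 0 a - log_mean k x) has_real_derivative
     (- (1 / (a * a)) + ((- log_power_mean k x 2 a) * log_power_mean k x 0 a - log_power_mean k x 1 a * (- log_power_mean k x 1 a)) / (log_power_mean k x 0 a * log_power_mean k x 0 a) - 0)) (at a)"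
    using assms by (intro DERIV_diff DERIV_add DERIV_divide DERIV_const) (auto intro!: derivative_eq_intros)
  then show ?thesis unfolding profile_score_def[abs_def]
    by (rule DERIV_cong) (simp add: power2_eq_square diff_divide_distrib)
qed

text \<open>Besides the term \<open>1 / a\<close>, the derivative of the score is minus a weighted variance, hence
  nonpositive. The quantitative form is what localizes the zero.\<close>

lemma profile_score_decrease:
  assumes "0 < a" "a \<le> b"
  shows "profile_score k x b \<le> profile_score k x a + (1 / b - 1 / a)"
proof -
  have "profile_score k x b - 1 / b \<le> profile_score k x a - 1 / a"
  proof (rule DERIV_nonpos_imp_nonincreasing[OF \<open>a \<le> b\<close>])
    fix c assume c: "a \<le> c" "c \<le> b"
    then have c0: "0 < c" using assms by simp
    define d where "d = (log_power_mean k x 2 c * log_power_mean k x 0 c - (log_power_mean k x 1 c)^2) / (log_power_mean k x 0 c)^2"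
    have d: "0 \<le> d" unfolding d_def using log_power_mean_cauchy_schwarz[of c]
      by (intro divide_nonneg_nonneg) (auto simp: mult.commute)
    have "((\<lambda>a. 1 / a) has_real_derivative - (1 / c^2)) (at c)"
      using c0 by (auto intro!: derivative_eq_intros simp: power2_eq_square)
    from DERIV_diff[OF profile_score_deriv[OF c0] this]
    have "((\<lambda>a. profile_score k x a - 1 / a) has_real_derivative - d) (at c)"
      unfolding d_def[symmetric] by (rule DERIV_cong) simp
    then show "\<exists>y. ((\<lambda>a. profile_score k x a - 1 / a) has_real_derivative y) (at c) \<and> y \<le> 0"
      using d by (intro exI[of _ "- d"]) auto
  qed
  then show ?thesis by simp
qed

lemma profile_score_strict_decrease:
  assumes "0 < a" "a < b"
  shows "profile_score k x b < profile_score k x a"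
proof -
  have "1 / b < 1 / a" using assms by (simp add: frac_less2)
  then show ?thesis using profile_score_decrease[of a b] assms by linarith
qed

lemma profile_score_continuous: "continuous_on {0<..} (profile_score k x)"
  by (intro continuous_at_imp_continuous_on ballI DERIV_isCont[OF profile_score_deriv]) auto

text \<open>For fixed \<open>a\<close> the scale enters only through \<open>y = s powr a * (mean of x i powr (- a))\<close> in the term
  \<open>ln y - y\<close>, which is maximal exactly at \<open>y = 1\<close>.\<close>

lemma frechet_loglik_profile:
  assumes a: "0 < a" and s: "0 < s"
  shows "frechet_loglik k x (a, s) = real k * (ln a - ln (log_power_mean k x 0 a) - (a + 1) * log_mean k x
    + (ln (s powr a * log_power_mean k x 0 a) - s powr a * log_power_mean k x 0 a))"
proof -
  have step: "ln (a / s) - (x i / s) powr (- a) - (a + 1) * ln (x i / s)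
     = (ln a + a * ln s) - s powr a * (x i powr (- a) * ln (x i) ^ 0) - (a + 1) * ln (x i)" if "i \<in> {1..k}" for i
    using x[OF that] a s by (simp add: ln_div powr_divide powr_minus divide_simps algebra_simps)
  have "frechet_loglik k x (a, s) = (\<Sum>i=1..k. (ln a + a * ln s) - s powr a * (x i powr (- a) * ln (x i) ^ 0) - (a + 1) * ln (x i))"
    unfolding frechet_loglik_def prod.case by (intro sum.cong refl step)
  also have "\<dots> = real k * (ln a + a * ln s) - s powr a * (\<Sum>i=1..k. x i powr (- a) * ln (x i) ^ 0) - (a + 1) * (\<Sum>i=1..k. ln (x i))"
    by (simp only: sum_subtractf sum_distrib_left[symmetric] sum_constant card_atLeastAtMost) simp
  also have "(\<Sum>i=1..k. x i powr (- a) * ln (x i) ^ 0) = real k * log_power_mean k x 0 a" using k by (simp add: log_power_mean_def)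
  also have "(\<Sum>i=1..k. ln (x i)) = real k * log_mean k x" using k by (simp add: log_mean_def)
  also have "real k * (ln a + a * ln s) - s powr a * (real k * log_power_mean k x 0 a) - (a + 1) * (real k * log_mean k x)
     = real k * (ln a - ln (log_power_mean k x 0 a) - (a + 1) * log_mean k x
        + (ln (s powr a * log_power_mean k x 0 a) - s powr a * log_power_mean k x 0 a))"
    using s log_power_mean_pos[of a] by (simp add: ln_mult ln_powr algebra_simps)
  finally show ?thesis .
qed

lemma profile_loglik_less:
  assumes "0 < ah" "profile_score k x ah = 0" "0 < a" "a \<noteq> ah"
  shows "ln a - ln (log_power_mean k x 0 a) - (a + 1) * log_mean k x
    < ln ah - ln (log_power_mean k x 0 ah) - (ah + 1) * log_mean k x"
proof -
  define P where "P a = ln a - ln (log_power_mean k x 0 a) - (a + 1) * log_mean k x" for a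
  have P: "(P has_real_derivative profile_score k x a) (at a)" if "0 < a" for a
  proof -
    have "(log_power_mean k x 0 has_real_derivative - log_power_mean k x 1 a) (at a)"
      using log_power_mean_deriv[of 0 a] by simp
    then show ?thesis unfolding P_def[abs_def] profile_score_def
      using that log_power_mean_pos[of a] by (auto intro!: derivative_eq_intros)
  qed
  show ?thesis
  proof (cases "a < ah")
    case True
    then obtain z where z: "a < z" "z < ah" "P ah - P a = (ah - a) * profile_score k x z"
      using MVT2[of a ah P "profile_score k x"] P assms by force
    then have "0 < profile_score k x z" using profile_score_strict_decrease[of z ah] assms by simp
    then have "0 < (ah - a) * profile_score k x z" using True by simp
    then show ?thesis using z by (simp add: P_def)
  next
    case False
    then have "ah < a" using assms by simp
    then obtain z where z: "ah < z" "z < a" "P a - P ah = (a - ah) * profile_score k x z"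
      using MVT2[of ah a P "profile_score k x"] P assms by force
    then have "profile_score k x z < 0" using profile_score_strict_decrease[of ah z] assms by simp
    then have "(a - ah) * profile_score k x z < 0" using \<open>ah < a\<close> by (simp add: mult_pos_neg)
    then show ?thesis using z by (simp add: P_def)
  qed
qed

lemma frechet_maximizer_unique:
  assumes ah: "0 < ah" "profile_score k x ah = 0"
  shows "frechet_maximizer k x \<theta> \<longleftrightarrow> \<theta> = (ah, profile_scale k x ah)"
proof -
  define sh where "sh = profile_scale k x ah"
  define P where "P a = ln a - ln (log_power_mean k x 0 a) - (a + 1) * log_mean k x" for a
  define Y where "Y a s = s powr a * log_power_mean k x 0 a" for a s
  have sh: "0 < sh" using log_power_mean_pos[of ah] by (simp add: sh_def profile_scale_def)
  have Ypos: "0 < Y a s" if "0 < s" for a s using that log_power_mean_pos[of a] by (simp add: Y_def)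
  have Ysh: "Y ah sh = 1"
  proof -
    have "- (1 / ah) * ah = - 1" using ah by simp
    then have "sh powr ah = log_power_mean k x 0 ah powr (- 1)" by (simp only: sh_def profile_scale_def powr_powr)
    then show ?thesis using log_power_mean_pos[of ah] by (simp add: Y_def powr_minus)
  qed
  have l: "frechet_loglik k x (a, s) = real k * (P a + (ln (Y a s) - Y a s))" if "0 < a" "0 < s" for a s
    using frechet_loglik_profile[OF that] by (simp add: P_def Y_def)
  have lY: "ln (Y a s) - Y a s \<le> -1" if "0 < s" for a s using ln_le_minus_one[OF Ypos[OF that, of a]] by linarith
  have lh: "frechet_loglik k x (ah, sh) = real k * (P ah - 1)" using l[OF ah(1) sh] by (simp add: Ysh)
  have strict: "frechet_loglik k x (a, s) < frechet_loglik k x (ah, sh)" if as: "0 < a" "0 < s" "(a, s) \<noteq> (ah, sh)" for a s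
  proof (cases "a = ah")
    case True
    have "Y a s \<noteq> 1"
    proof
      assume "Y a s = 1"
      then have "s powr ah * log_power_mean k x 0 ah = sh powr ah * log_power_mean k x 0 ah"
        using Ysh True by (simp add: Y_def)
      then have "s powr ah = sh powr ah" using log_power_mean_pos[of ah] by simp
      then have "ln (s powr ah) = ln (sh powr ah)" by (simp only:)
      then have "ah * ln s = ah * ln sh" using as sh by (simp add: ln_powr)
      then have "s = sh" using as sh ah by simp
      then show False using True as by simp
    qed
    then have "ln (Y a s) \<noteq> Y a s - 1" using ln_eq_minus_one[OF Ypos[OF as(2)]] by auto
    then have "ln (Y a s) - Y a s < -1" using lY[OF as(2), of a] by linarith
    then show ?thesis unfolding l[OF as(1,2)] lh using True k by simp
  next
    case False
    then have "P a < P ah" unfolding P_def using ah as by (intro profile_loglik_less) auto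
    then show ?thesis unfolding l[OF as(1,2)] lh using k lY[OF as(2), of a] by simp
  qed
  show ?thesis
  proof
    assume m: "frechet_maximizer k x \<theta>"
    obtain a s where \<theta>: "\<theta> = (a, s)" by (cases \<theta>)
    have as: "0 < a" "0 < s" using m by (auto simp: frechet_maximizer_def \<theta>)
    have "frechet_loglik k x (ah, sh) \<le> frechet_loglik k x (a, s)"
      using m ah sh by (auto simp: frechet_maximizer_def \<theta>)
    then show "\<theta> = (ah, profile_scale k x ah)" using strict[OF as] \<theta> sh_def by fastforce
  next
    assume \<theta>: "\<theta> = (ah, profile_scale k x ah)"
    show "frechet_maximizer k x \<theta>"
      unfolding frechet_maximizer_def \<theta> sh_def[symmetric]
    proof (intro conjI ballI)
      fix \<theta>' :: "real \<times> real" assume "\<theta>' \<in> {0<..} \<times> {0<..}"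
      then obtain a s where \<theta>': "\<theta>' = (a, s)" "0 < a" "0 < s" by auto
      show "frechet_loglik k x \<theta>' \<le> frechet_loglik k x (ah, sh)"
        using strict[OF \<theta>'(2,3)] \<theta>'(1) by (cases "(a, s) = (ah, sh)") auto
    qed (use x ah sh in auto)
  qed
qed

text \<open>Since the score falls at least as fast as \<open>1 / a\<close>, a score at \<open>a0\<close> of absolute value below \<open>h / (2 * a0^2)\<close> becomes
  negative at \<open>a0 + h\<close> and positive at \<open>a0 - h\<close>.\<close>

lemma profile_score_root_localized:
  assumes h: "0 < h" "h < a0" and e: "\<bar>profile_score k x a0\<bar> < h / (2 * a0^2)"
  shows "\<exists>a>0. profile_score k x a = 0"
    and "0 < a \<Longrightarrow> profile_score k x a = 0 \<Longrightarrow> \<bar>a - a0\<bar> \<le> h"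
proof -
  have a0: "0 < a0" using h by simp
  have up: "profile_score k x (a0 + h) < 0"
  proof -
    have "h / (2 * a0^2) \<le> h / (a0 * (a0 + h))"
      using h a0 by (intro frac_le) (simp_all add: power2_eq_square algebra_simps add_pos_pos)
    also have "\<dots> = 1 / a0 - 1 / (a0 + h)" using h a0 by (simp add: field_simps)
    finally show ?thesis using profile_score_decrease[of a0 "a0 + h"] e h a0 by (simp add: abs_less_iff)
  qed
  have low: "0 < profile_score k x (a0 - h)"
  proof -
    have "h / (2 * a0^2) \<le> h / (a0 * (a0 - h))"
      using h a0 by (intro frac_le) (simp_all add: power2_eq_square algebra_simps add_pos_pos)
    also have "\<dots> = 1 / (a0 - h) - 1 / a0" using h a0 by (simp add: field_simps)
    finally show ?thesis using profile_score_decrease[of "a0 - h" a0] e h a0 by (simp add: abs_less_iff)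
  qed
  have "continuous_on {a0 - h..a0 + h} (profile_score k x)"
    by (rule continuous_on_subset[OF profile_score_continuous]) (use h in auto)
  then obtain r where "a0 - h \<le> r" "r \<le> a0 + h" "profile_score k x r = 0"
    using IVT2'[of "profile_score k x" "a0 + h" 0 "a0 - h"] up low h by auto
  then show "\<exists>a>0. profile_score k x a = 0" using h by (intro exI[of _ r]) auto
  assume a: "0 < a" "profile_score k x a = 0"
  have "a \<le> a0 + h"
  proof (rule ccontr)
    assume "\<not> a \<le> a0 + h"
    then show False using profile_score_strict_decrease[of "a0 + h" a] up a h a0 by simp
  qed
  moreover have "a0 - h \<le> a"
  proof (rule ccontr)
    assume "\<not> a0 - h \<le> a"
    then show False using profile_score_strict_decrease[of a "a0 - h"] low a h by simp
  qed
  ultimately show "\<bar>a - a0\<bar> \<le> h" by (simp add: abs_le_iff)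
qed

text \<open>The derivative of the \<open>j\<close>-th mean is minus the next one, so the means move no faster than a
  common envelope of their summands allows.\<close>

lemma log_power_mean_lipschitz:
  assumes env: "\<And>y a. 0 < y \<Longrightarrow> \<bar>a - a0\<bar> \<le> \<epsilon> \<Longrightarrow> y powr (- a) * \<bar>ln y\<bar> ^ Suc j \<le> H y"
    and a: "\<bar>a - a0\<bar> \<le> \<epsilon>"
  shows "\<bar>log_power_mean k x j a - log_power_mean k x j a0\<bar> \<le> \<bar>a - a0\<bar> * ((\<Sum>i=1..k. H (x i)) / real k)"
proof -
  define m where "m = (\<Sum>i=1..k. H (x i)) / real k"
  have b: "\<bar>log_power_mean k x (Suc j) b\<bar> \<le> m" if "\<bar>b - a0\<bar> \<le> \<epsilon>" for b
  proof -
    have "\<bar>log_power_mean k x (Suc j) b\<bar> \<le> (\<Sum>i=1..k. \<bar>x i powr (- b) * ln (x i) ^ Suc j\<bar>) / real k"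
      unfolding log_power_mean_def abs_divide by (simp add: divide_right_mono sum_abs del: power_Suc)
    also have "\<dots> \<le> m" unfolding m_def
      by (intro divide_right_mono sum_mono) (use env that x in \<open>auto simp: abs_mult power_abs\<close>)
    finally show ?thesis .
  qed
  have "norm (log_power_mean k x j a - log_power_mean k x j a0) \<le> m * norm (a - a0)"
  proof (rule field_differentiable_bound[of "cball a0 \<epsilon>" _ "\<lambda>b. - log_power_mean k x (Suc j) b"])
    fix b assume "b \<in> cball a0 \<epsilon>"
    then have "\<bar>b - a0\<bar> \<le> \<epsilon>" by (simp add: dist_real_def abs_minus_commute)
    then show "norm (- log_power_mean k x (Suc j) b) \<le> m" using b by simp
    show "(log_power_mean k x j has_field_derivative - log_power_mean k x (Suc j) b) (at b within cball a0 \<epsilon>)"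
      by (rule has_field_derivative_at_within[OF log_power_mean_deriv])
  qed (use a in \<open>auto simp: dist_real_def abs_minus_commute\<close>)
  then show ?thesis by (simp add: m_def mult.commute)
qed

end

text \<open>Rescaling the sample rescales the scale parameter and changes the log-likelihood by a constant, so
  the block maxima may be divided by \<open>\<sigma> (r n)\<close> first.\<close>

lemma frechet_maximizer_scale:
  assumes c: "0 < c" and x: "\<And>i. i \<in> {1..k} \<Longrightarrow> 0 < x i"
  shows "frechet_maximizer k x (a, s) \<longleftrightarrow> frechet_maximizer k (\<lambda>i. x i / c) (a, s / c)"
proof -
  have l: "frechet_loglik k x (a, s) = frechet_loglik k (\<lambda>i. x i / c) (a, s / c) - real k * ln c" if "0 < a" "0 < s" for a s
  proof -
    have step: "ln (a / s) - (x i / s) powr (- a) - (a + 1) * ln (x i / s)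
      = (ln (a / (s / c)) - (x i / c / (s / c)) powr (- a) - (a + 1) * ln (x i / c / (s / c))) - ln c" for i
      using that c by (simp add: ln_div ln_mult)
    show ?thesis unfolding frechet_loglik_def prod.case step
      by (simp only: sum_subtractf sum_constant card_atLeastAtMost) simp
  qed
  have "(\<forall>\<theta>'\<in>{0<..} \<times> {0<..}. frechet_loglik k x \<theta>' \<le> frechet_loglik k x (a, s))
    \<longleftrightarrow> (\<forall>\<theta>'\<in>{0<..} \<times> {0<..}. frechet_loglik k (\<lambda>i. x i / c) \<theta>' \<le> frechet_loglik k (\<lambda>i. x i / c) (a, s / c))"
    if as: "0 < a" "0 < s"
  proof (intro iffI ballI)
    fix \<theta>' :: "real \<times> real" assume *: "\<forall>\<theta>'\<in>{0<..} \<times> {0<..}. frechet_loglik k x \<theta>' \<le> frechet_loglik k x (a, s)" "\<theta>' \<in> {0<..} \<times> {0<..}"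
    obtain a' s' where \<theta>': "\<theta>' = (a', s')" "0 < a'" "0 < s'" using *(2) by auto
    have "frechet_loglik k x (a', s' * c) \<le> frechet_loglik k x (a, s)" using *(1) \<theta>' c by auto
    then show "frechet_loglik k (\<lambda>i. x i / c) \<theta>' \<le> frechet_loglik k (\<lambda>i. x i / c) (a, s / c)"
      using l[of a' "s' * c"] l[OF as] \<theta>' c by simp
  next
    fix \<theta>' :: "real \<times> real" assume *: "\<forall>\<theta>'\<in>{0<..} \<times> {0<..}. frechet_loglik k (\<lambda>i. x i / c) \<theta>' \<le> frechet_loglik k (\<lambda>i. x i / c) (a, s / c)" "\<theta>' \<in> {0<..} \<times> {0<..}"
    obtain a' s' where \<theta>': "\<theta>' = (a', s')" "0 < a'" "0 < s'" using *(2) by auto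
    have "frechet_loglik k (\<lambda>i. x i / c) (a', s' / c) \<le> frechet_loglik k (\<lambda>i. x i / c) (a, s / c)" using *(1) \<theta>' c by auto
    then show "frechet_loglik k x \<theta>' \<le> frechet_loglik k x (a, s)"
      using l[of a' s'] l[OF as] \<theta>' by simp
  qed
  then show ?thesis using c x unfolding frechet_maximizer_def
    by (auto simp: zero_less_divide_iff)
qed

text \<open>The sum \<open>y powr (- \<delta>) + y powr \<delta>\<close> bounds \<open>\<delta> * \<bar>ln y\<bar>\<close>. Since \<open>a\<close> stays away from \<open>0\<close> and from \<open>b\<close>, up to
  three such factors can be absorbed while the exponent remains between \<open>- b\<close> and \<open>0\<close>.\<close>

lemma log_power_envelope:
  fixes a0 b :: real
  assumes "0 < a0" "a0 < b"
  obtains \<epsilon> C where "0 < \<epsilon>" "0 < C"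
    "\<And>y a j. 0 < y \<Longrightarrow> \<bar>a - a0\<bar> \<le> \<epsilon> \<Longrightarrow> j \<le> 3 \<Longrightarrow> y powr (- a) * \<bar>ln y\<bar> ^ j \<le> C * (1 + y powr (- b))"
proof -
  \<comment> \<open>\<open>\<epsilon>\<close> uses half of the distance of \<open>a0\<close> to \<open>0\<close> and to \<open>b\<close>; the other half pays for \<open>3 * \<delta>\<close>.\<close>
  define \<epsilon> where "\<epsilon> = min (a0 / 2) ((b - a0) / 2)"
  define \<delta> where "\<delta> = min 1 (min (a0 / 6) ((b - a0) / 6))"
  have \<epsilon>: "0 < \<epsilon>" and \<delta>: "0 < \<delta>" "\<delta> \<le> 1" using assms by (auto simp: \<epsilon>_def \<delta>_def)
  have "y powr (- a) * \<bar>ln y\<bar> ^ j \<le> (2 / \<delta> ^ 3) * (1 + y powr (- b))"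
    if y: "0 < y" and a: "\<bar>a - a0\<bar> \<le> \<epsilon>" and j: "j \<le> 3" for y a and j :: nat
  proof -
    have jd: "0 \<le> real j * \<delta>" "real j * \<delta> \<le> 3 * \<delta>" using \<delta> j by (auto intro!: mult_right_mono)
    have bnd: "y powr t \<le> 1 + y powr (- b)" if t: "- b \<le> t" "t \<le> 0" for t
    proof (cases "1 \<le> y")
      case True
      then have "y powr t \<le> y powr 0" using t by (intro powr_mono) auto
      also have "\<dots> = 1" using y by simp
      also have "1 \<le> 1 + y powr (- b)" by simp
      finally show ?thesis .
    next
      case False
      then have "y powr t \<le> y powr (- b)" using t y by (intro powr_mono') auto
      then show ?thesis by simp
    qed
    have "\<delta> \<le> a0 / 6" unfolding \<delta>_def by (rule min.coboundedI2, rule min.cobounded1)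
    moreover have "\<delta> \<le> (b - a0) / 6" unfolding \<delta>_def by (rule min.coboundedI2, rule min.cobounded2)
    moreover have "\<epsilon> \<le> a0 / 2" "\<epsilon> \<le> (b - a0) / 2" unfolding \<epsilon>_def by (rule min.cobounded1, rule min.cobounded2)
    ultimately have e: "- b \<le> - a + real j * \<delta>" "- a + real j * \<delta> \<le> 0" "- b \<le> - a - real j * \<delta>" "- a - real j * \<delta> \<le> 0"
      using jd a assms by (auto simp: abs_le_iff)
    have "y powr (- a) * \<bar>ln y\<bar> ^ j \<le> y powr (- a) * ((y powr (real j * \<delta>) + y powr (- (real j * \<delta>))) / \<delta> ^ j)"
      by (intro mult_left_mono abs_ln_power_le y \<delta>) auto
    also have "\<dots> = (y powr (- a + real j * \<delta>) + y powr (- a - real j * \<delta>)) / \<delta> ^ j"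
      using powr_add[of y "- a" "real j * \<delta>"] powr_add[of y "- a" "- (real j * \<delta>)"] by (simp add: distrib_left)
    also have "\<dots> \<le> ((1 + y powr (- b)) + (1 + y powr (- b))) / \<delta> ^ j"
      using \<delta> by (intro divide_right_mono add_mono bnd e) auto
    also have "\<dots> \<le> ((1 + y powr (- b)) + (1 + y powr (- b))) / \<delta> ^ 3"
      using \<delta> j by (intro divide_left_mono power_decreasing mult_pos_pos) (auto intro!: add_nonneg_nonneg)
    finally show ?thesis by (simp add: field_simps)
  qed
  then show thesis using that[of \<epsilon> "2 / \<delta> ^ 3"] \<epsilon> \<delta> by auto
qed

section \<open>Expansion of the maximizer along a filter of samples\<close>

text \<open>The points of \<open>F\<close> index samples \<open>x b\<close> of size \<open>k b\<close>. The locale collects what a sample has to satisfy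
  for the maximizer to be expanded: the three means in the score are within \<open>C / sqrt k\<close> of their
  limits \<open>m1\<close>, \<open>1\<close>, \<open>m3\<close>, and the mean in its derivative converges faster than \<open>1 / C\<close>. The bound \<open>C\<close>
  diverges, because the scaled deviations are only bounded in probability, but slowly enough for
  the remainders, which involve powers of \<open>C\<close> up to the fifth, to be negligible against \<open>sqrt k\<close>. The identity \<open>rel\<close> says
  that the score vanishes in the limit at \<open>a0\<close>, and \<open>D\<close> is minus its limiting slope.\<close>

locale mle_asymptotics =
  fixes F :: "'b filter" and k :: "'b \<Rightarrow> nat" and x :: "'b \<Rightarrow> nat \<Rightarrow> real" and C :: "'b \<Rightarrow> real"
    and a0 \<beta> m1 m2 m3 D :: real
  assumes a0: "0 < a0" and \<beta>: "a0 < \<beta>"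
    and pos: "\<forall>\<^sub>F b in F. 0 < k b \<and> (\<forall>i\<in>{1..k b}. 0 < x b i)"
    and C_lim: "filterlim C at_top F" and C5: "((\<lambda>b. C b ^ 5 / sqrt (real (k b))) \<longlongrightarrow> 0) F"
    and G1: "\<forall>\<^sub>F b in F. \<bar>sqrt (real (k b)) * (log_power_mean (k b) (x b) 1 a0 - m1)\<bar> \<le> C b"
    and G2: "\<forall>\<^sub>F b in F. \<bar>sqrt (real (k b)) * (log_power_mean (k b) (x b) 0 a0 - 1)\<bar> \<le> C b"
    and G3: "\<forall>\<^sub>F b in F. \<bar>sqrt (real (k b)) * (log_mean (k b) (x b) - m3)\<bar> \<le> C b"
    and A2: "((\<lambda>b. C b * (log_power_mean (k b) (x b) 2 a0 - m2)) \<longlongrightarrow> 0) F"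
    and H: "\<forall>\<^sub>F b in F. (\<Sum>i=1..k b. 1 + x b i powr (- \<beta>)) / real (k b) \<le> C b"
    and rel: "1 / a0 + m1 - m3 = 0" and D: "D = 1 / a0^2 + m2 - m1^2" "0 < D"
begin

abbreviation sq where "sq b \<equiv> sqrt (real (k b))"
abbreviation A where "A j a b \<equiv> log_power_mean (k b) (x b) j a"
abbreviation lbar where "lbar b \<equiv> log_mean (k b) (x b)"
abbreviation g1 where "g1 b \<equiv> sq b * (A 1 a0 b - m1)"
abbreviation g2 where "g2 b \<equiv> sq b * (A 0 a0 b - 1)"
abbreviation g3 where "g3 b \<equiv> sq b * (lbar b - m3)"

lemma C1: "\<forall>\<^sub>F b in F. c \<le> C b"
  using C_lim unfolding filterlim_at_top by blast

lemma sq_pos: "\<forall>\<^sub>F b in F. 0 < sq b"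
  using pos by eventually_elim simp

lemma C_power: "i \<le> 5 \<Longrightarrow> ((\<lambda>b. c * C b ^ i / sq b) \<longlongrightarrow> 0) F"
proof (rule Lim_null_comparison)
  assume "i \<le> 5"
  show "\<forall>\<^sub>F b in F. norm (c * C b ^ i / sq b) \<le> \<bar>c\<bar> * (C b ^ 5 / sq b)"
    using C1[of 1] sq_pos
  proof eventually_elim
    case (elim b)
    have "C b ^ i \<le> C b ^ 5" using elim \<open>i \<le> 5\<close> by (intro power_increasing) auto
    then have "\<bar>c\<bar> * (C b ^ i / sq b) \<le> \<bar>c\<bar> * (C b ^ 5 / sq b)"
      by (intro mult_left_mono divide_right_mono) auto
    then show ?case using elim by (simp add: abs_mult)
  qed
  show "((\<lambda>b. \<bar>c\<bar> * (C b ^ 5 / sq b)) \<longlongrightarrow> 0) F" by (rule tendsto_mult_right_zero[OF C5])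
qed

text \<open>The accounting device of the expansion: a deviation of order \<open>C ^ i / sqrt k\<close> survives
  multiplication by up to \<open>5 - i\<close> further factors \<open>C\<close>.\<close>

lemma bounded_over_sq:
  assumes "\<forall>\<^sub>F b in F. \<bar>sq b * f b\<bar> \<le> c * C b ^ i" "i + j \<le> 5"
  shows "((\<lambda>b. C b ^ j * f b) \<longlongrightarrow> 0) F"
proof (rule Lim_null_comparison)
  show "\<forall>\<^sub>F b in F. norm (C b ^ j * f b) \<le> c * C b ^ (i + j) / sq b"
    using assms(1) C1[of 0] sq_pos
  proof eventually_elim
    case (elim b)
    have "sq b * \<bar>f b\<bar> \<le> c * C b ^ i" using elim by (simp add: abs_mult)
    then have "\<bar>f b\<bar> \<le> c * C b ^ i / sq b" using elim by (simp add: field_simps)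
    then have "C b ^ j * \<bar>f b\<bar> \<le> C b ^ j * (c * C b ^ i / sq b)" using elim by (intro mult_left_mono) auto
    then show ?case using elim by (simp add: abs_mult power_add mult_ac)
  qed
qed (rule C_power[OF assms(2)])

lemma CA0: "((\<lambda>b. C b * (A 0 a0 b - 1)) \<longlongrightarrow> 0) F"
  using bounded_over_sq[of "\<lambda>b. A 0 a0 b - 1" 1 1 1] G2 by simp

lemma CA1: "((\<lambda>b. C b * (A 1 a0 b - m1)) \<longlongrightarrow> 0) F"
  using bounded_over_sq[of "\<lambda>b. A 1 a0 b - m1" 1 1 1] G1 by simp

lemma rate_imp_tendsto: "((\<lambda>b. C b * (f b - l)) \<longlongrightarrow> 0) F \<Longrightarrow> (f \<longlongrightarrow> l) F"
proof (rule LIM_zero_cancel, rule Lim_null_comparison)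
  assume *: "((\<lambda>b. C b * (f b - l)) \<longlongrightarrow> 0) F"
  show "\<forall>\<^sub>F b in F. norm (f b - l) \<le> \<bar>C b * (f b - l)\<bar>"
    using C1[of 1]
  proof eventually_elim
    case (elim b)
    then have "1 * \<bar>f b - l\<bar> \<le> \<bar>C b\<bar> * \<bar>f b - l\<bar>" by (intro mult_right_mono) auto
    then show ?case by (simp add: abs_mult)
  qed
  show "((\<lambda>b. \<bar>C b * (f b - l)\<bar>) \<longlongrightarrow> 0) F" using tendsto_rabs[OF *] by simp
qed

lemma A0_lim: "(A 0 a0 \<longlongrightarrow> 1) F" by (rule rate_imp_tendsto[OF CA0])

lemma A0_pos: "\<forall>\<^sub>F b in F. 1 / 2 < A 0 a0 b"
  using order_tendstoD(1)[OF A0_lim, of "1/2"] by simp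

lemma score_expand:
  assumes "A 0 a0 b \<noteq> 0"
  shows "sq b * profile_score (k b) (x b) a0 = (g1 b - m1 * g2 b) / A 0 a0 b - g3 b"
proof -
  have "profile_score (k b) (x b) a0 = ((A 1 a0 b - m1) - m1 * (A 0 a0 b - 1)) / A 0 a0 b - (lbar b - m3)"
  proof -
    have m3: "m3 = 1 / a0 + m1" using rel by simp
    show ?thesis unfolding profile_score_def m3 using assms a0 by (simp add: field_simps)
  qed
  moreover have "s * ((p - m * q) / u - r) = (s * p - m * (s * q)) / u - s * r" for s p m q u r :: real
    by (simp add: algebra_simps diff_divide_distrib)
  ultimately show ?thesis by (simp only:)
qed

lemma score_bound:
  "\<forall>\<^sub>F b in F. \<bar>sq b * profile_score (k b) (x b) a0\<bar> \<le> (3 + 2 * \<bar>m1\<bar>) * C b"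
  using A0_pos G1 G2 G3
proof eventually_elim
  case (elim b)
  have "\<bar>g1 b - m1 * g2 b\<bar> \<le> \<bar>g1 b\<bar> + \<bar>m1\<bar> * \<bar>g2 b\<bar>" by (metis abs_mult abs_triangle_ineq4)
  also have "\<dots> \<le> C b + \<bar>m1\<bar> * C b" using elim by (intro add_mono mult_left_mono) auto
  finally have 1: "\<bar>g1 b - m1 * g2 b\<bar> \<le> C b + \<bar>m1\<bar> * C b" .
  have "\<bar>(g1 b - m1 * g2 b) / A 0 a0 b\<bar> = \<bar>g1 b - m1 * g2 b\<bar> * (1 / A 0 a0 b)"
    using elim by (simp add: abs_divide)
  also have "\<dots> \<le> (C b + \<bar>m1\<bar> * C b) * 2"
    using 1 elim by (intro mult_mono) (auto simp: field_simps)
  finally have "\<bar>(g1 b - m1 * g2 b) / A 0 a0 b - g3 b\<bar> \<le> (C b + \<bar>m1\<bar> * C b) * 2 + C b"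
    by (rule order_trans[OF abs_triangle_ineq4 add_mono[OF _ elim(4)]])
  then show ?case using score_expand[of b] elim(1) by (simp add: algebra_simps)
qed

text \<open>The radius of a neighbourhood of \<open>a0\<close> that contains the maximizer; one more factor \<open>C\<close> than the size
  of the score dominates the constants.\<close>

definition h where "h b = C b ^ 2 / sq b"

lemma h_lim: "(h \<longlongrightarrow> 0) F" using C_power[of 2 1] by (simp add: h_def[abs_def])

lemma localized:
  "\<forall>\<^sub>F b in F. 0 < h b \<and> h b < a0 \<and> \<bar>profile_score (k b) (x b) a0\<bar> < h b / (2 * a0^2)"
  using order_tendstoD(2)[OF h_lim a0] score_bound sq_pos C1[of 1] C1[of "2 * a0^2 * (3 + 2 * \<bar>m1\<bar>) + 1"]
proof eventually_elim
  case (elim b)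
  have "sq b * \<bar>profile_score (k b) (x b) a0\<bar> \<le> (3 + 2 * \<bar>m1\<bar>) * C b" using elim by (simp add: abs_mult)
  also have "\<dots> < C b ^ 2 / (2 * a0^2)"
  proof -
    have "(2 * a0^2 * (3 + 2 * \<bar>m1\<bar>)) * C b < C b * C b" using elim by (intro mult_strict_right_mono) auto
    then show ?thesis using a0 by (simp add: field_simps power2_eq_square)
  qed
  finally have "\<bar>profile_score (k b) (x b) a0\<bar> < h b / (2 * a0^2)"
    using elim(3) pos_less_divide_eq[of "sq b" "\<bar>profile_score (k b) (x b) a0\<bar>" "C b ^ 2 / (2 * a0^2)"]
    by (simp add: h_def mult_ac)
  then show ?case using elim by (simp add: h_def)
qed

lemma root_exists: "\<forall>\<^sub>F b in F. \<exists>a>0. profile_score (k b) (x b) a = 0"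
  using localized pos
proof eventually_elim
  case (elim b)
  then show ?case using profile_score_root_localized(1)[of "k b" "x b" "h b" a0] by auto
qed

context
  fixes ah :: "'b \<Rightarrow> real"
  assumes root: "\<forall>\<^sub>F b in F. 0 < ah b \<and> profile_score (k b) (x b) (ah b) = 0"
begin

lemma root_near: "\<forall>\<^sub>F b in F. \<bar>ah b - a0\<bar> \<le> h b"
  using localized pos root
proof eventually_elim
  case (elim b)
  then show ?case using profile_score_root_localized(2)[of "k b" "x b" "h b" a0 "ah b"] by auto
qed

text \<open>In this neighbourhood the means move by at most \<open>C ^ 3 / sqrt k\<close>: the radius contributes
  \<open>C ^ 2\<close> and the Lipschitz constant \<open>C\<close>.\<close>

lemma near_rate:
  assumes "\<forall>\<^sub>F b in F. \<bar>\<xi> b - a0\<bar> \<le> h b"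
  shows "((\<lambda>b. C b * (\<xi> b - a0)) \<longlongrightarrow> 0) F" "(\<xi> \<longlongrightarrow> a0) F"
    "j \<le> 2 \<Longrightarrow> ((\<lambda>b. C b ^ 2 * (A j (\<xi> b) b - A j a0 b)) \<longlongrightarrow> 0) F"
    "j \<le> 2 \<Longrightarrow> ((\<lambda>b. C b * (A j (\<xi> b) b - A j a0 b)) \<longlongrightarrow> 0) F"
proof -
  have 1: "\<forall>\<^sub>F b in F. \<bar>sq b * (\<xi> b - a0)\<bar> \<le> 1 * C b ^ 2"
    using assms sq_pos by eventually_elim (simp add: h_def abs_mult pos_le_divide_eq mult.commute)
  show r: "((\<lambda>b. C b * (\<xi> b - a0)) \<longlongrightarrow> 0) F" using bounded_over_sq[OF 1, of 1] by simp
  show "(\<xi> \<longlongrightarrow> a0) F" by (rule rate_imp_tendsto[OF r])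
  obtain \<epsilon> K where env: "0 < \<epsilon>" "0 < K"
    "\<And>y a j. 0 < y \<Longrightarrow> \<bar>a - a0\<bar> \<le> \<epsilon> \<Longrightarrow> j \<le> 3 \<Longrightarrow> y powr (- a) * \<bar>ln y\<bar> ^ j \<le> K * (1 + y powr (- \<beta>))"
    using log_power_envelope[OF a0 \<beta>] by blast
  have A: "\<forall>\<^sub>F b in F. \<bar>sq b * (A j (\<xi> b) b - A j a0 b)\<bar> \<le> K * C b ^ 3" if j: "j \<le> 2" for j
    using 1 order_tendstoD(2)[OF h_lim env(1)] assms pos H
  proof eventually_elim
    case (elim b)
    have "\<bar>A j (\<xi> b) b - A j a0 b\<bar> \<le> \<bar>\<xi> b - a0\<bar> * ((\<Sum>i=1..k b. K * (1 + x b i powr (- \<beta>))) / real (k b))"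
      by (rule log_power_mean_lipschitz[where \<epsilon>=\<epsilon>]) (use env(3)[of _ _ "Suc j"] j elim in auto)
    also have "(\<Sum>i=1..k b. K * (1 + x b i powr (- \<beta>))) / real (k b) = K * ((\<Sum>i=1..k b. 1 + x b i powr (- \<beta>)) / real (k b))"
      by (simp only: sum_distrib_left[symmetric] times_divide_eq_right)
    also have "\<bar>\<xi> b - a0\<bar> * \<dots> \<le> \<bar>\<xi> b - a0\<bar> * (K * C b)"
      using elim env by (intro mult_left_mono) auto
    finally have "sq b * \<bar>A j (\<xi> b) b - A j a0 b\<bar> \<le> sq b * (\<bar>\<xi> b - a0\<bar> * (K * C b))" by (intro mult_left_mono) auto
    also have "\<dots> = \<bar>sq b * (\<xi> b - a0)\<bar> * (K * C b)" by (simp add: abs_mult)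
    also have "\<dots> \<le> C b ^ 2 * (K * C b)"
    proof (rule mult_right_mono)
      have "0 \<le> (\<Sum>i=1..k b. 1 + x b i powr (- \<beta>)) / real (k b)" by (intro divide_nonneg_nonneg sum_nonneg add_nonneg_nonneg) auto
      then show "0 \<le> K * C b" using elim(5) env(2) by (intro mult_nonneg_nonneg) linarith+
    qed (use elim in auto)
    finally show ?case by (simp add: abs_mult power2_eq_square power3_eq_cube mult_ac)
  qed
  show "j \<le> 2 \<Longrightarrow> ((\<lambda>b. C b ^ 2 * (A j (\<xi> b) b - A j a0 b)) \<longlongrightarrow> 0) F"
    "j \<le> 2 \<Longrightarrow> ((\<lambda>b. C b * (A j (\<xi> b) b - A j a0 b)) \<longlongrightarrow> 0) F"
    using bounded_over_sq[OF A, of j 2] bounded_over_sq[OF A, of j 1] by auto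
qed

definition W where "W b = sq b * (ah b - a0)"
definition T where "T b = (g1 b - m1 * g2 b - g3 b) / D"

text \<open>By the mean value theorem the score at \<open>a0\<close> is the estimation error times minus the slope \<open>Q\<close> at
  an intermediate point. The slope tends to \<open>D\<close> faster than \<open>1 / C\<close>, and the scaled score at \<open>a0\<close> is
  \<open>g1 - m1 * g2 - g3\<close> up to a vanishing term.\<close>

lemma shape_expansion: "((\<lambda>b. W b - T b) \<longlongrightarrow> 0) F"
proof -
  define Q where "Q b z = 1 / z^2 + (A 2 z b * A 0 z b - (A 1 z b)^2) / (A 0 z b)^2" for b z
  have "\<forall>\<^sub>F b in F. \<exists>z. \<bar>z - a0\<bar> \<le> h b \<and> (ah b - a0) * Q b z = profile_score (k b) (x b) a0"
    using localized root root_near pos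
  proof eventually_elim
    case (elim b)
    have d: "(profile_score (k b) (x b) has_real_derivative - Q b z) (at z)" if "0 < z" for z
      unfolding Q_def using elim that by (intro profile_score_deriv) auto
    have s0: "profile_score (k b) (x b) (ah b) = 0" using elim by simp
    consider "ah b = a0" | "a0 < ah b" | "ah b < a0" by linarith
    then show ?case
    proof cases
      case 1
      then show ?thesis using elim by (intro exI[of _ a0]) auto
    next
      case 2
      then obtain z where z: "a0 < z" "z < ah b" "profile_score (k b) (x b) (ah b) - profile_score (k b) (x b) a0 = (ah b - a0) * - Q b z"
        using MVT2[of a0 "ah b" "profile_score (k b) (x b)" "\<lambda>z. - Q b z"] d a0 by force
      then show ?thesis using elim s0 by (intro exI[of _ z]) (auto simp: abs_le_iff)
    next
      case 3
      then obtain z where z: "ah b < z" "z < a0" "profile_score (k b) (x b) a0 - profile_score (k b) (x b) (ah b) = (a0 - ah b) * - Q b z"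
        using MVT2[of "ah b" a0 "profile_score (k b) (x b)" "\<lambda>z. - Q b z"] d elim by force
      then show ?thesis using elim s0 by (intro exI[of _ z]) (auto simp: abs_le_iff algebra_simps)
    qed
  qed
  then obtain z where z: "\<forall>\<^sub>F b in F. \<bar>z b - a0\<bar> \<le> h b \<and> (ah b - a0) * Q b (z b) = profile_score (k b) (x b) a0"
    unfolding eventually_ex by blast
  then have zn: "\<forall>\<^sub>F b in F. \<bar>z b - a0\<bar> \<le> h b" and zQ: "\<forall>\<^sub>F b in F. (ah b - a0) * Q b (z b) = profile_score (k b) (x b) a0"
    by (auto elim: eventually_mono)
  have zr: "((\<lambda>b. C b * (z b - a0)) \<longlongrightarrow> 0) F" "(z \<longlongrightarrow> a0) F" by (rule near_rate[OF zn])+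
  have CB: "((\<lambda>b. C b * (A j (z b) b - m)) \<longlongrightarrow> 0) F"
    if "j \<le> 2" "((\<lambda>b. C b * (A j a0 b - m)) \<longlongrightarrow> 0) F" for j m
    using tendsto_add[OF near_rate(4)[OF zn that(1)] that(2)] by (simp add: algebra_simps)
  have B: "((\<lambda>b. C b * (A 0 (z b) b - 1)) \<longlongrightarrow> 0) F" "((\<lambda>b. C b * (A 1 (z b) b - m1)) \<longlongrightarrow> 0) F"
    "((\<lambda>b. C b * (A 2 (z b) b - m2)) \<longlongrightarrow> 0) F"
    by (intro CB CA0 CA1 A2; simp)+
  note L = B[THEN rate_imp_tendsto]
  have "((\<lambda>b. - (C b * (z b - a0)) * (z b + a0) / ((z b)^2 * a0^2)
      + (A 0 (z b) b * (C b * (A 2 (z b) b - m2) - m2 * (C b * (A 0 (z b) b - 1)))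
        - (C b * (A 1 (z b) b - m1) - m1 * (C b * (A 0 (z b) b - 1))) * (A 1 (z b) b + m1 * A 0 (z b) b)) / (A 0 (z b) b)^2)
     \<longlongrightarrow> - 0 * (a0 + a0) / (a0^2 * a0^2) + (1 * (0 - m2 * 0) - (0 - m1 * 0) * (m1 + m1 * 1)) / 1^2) F"
    using a0 by (intro tendsto_intros zr B L) auto
  then have lim0: "((\<lambda>b. - (C b * (z b - a0)) * (z b + a0) / ((z b)^2 * a0^2)
      + (A 0 (z b) b * (C b * (A 2 (z b) b - m2) - m2 * (C b * (A 0 (z b) b - 1)))
        - (C b * (A 1 (z b) b - m1) - m1 * (C b * (A 0 (z b) b - 1))) * (A 1 (z b) b + m1 * A 0 (z b) b)) / (A 0 (z b) b)^2)
     \<longlongrightarrow> 0) F" by simp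
  have nz: "\<forall>\<^sub>F b in F. 0 < z b \<and> 0 < A 0 (z b) b"
    using order_tendstoD(1)[OF zr(2) a0] order_tendstoD(1)[OF L(1) zero_less_one] by eventually_elim auto
  have CQ: "((\<lambda>b. C b * (Q b (z b) - D)) \<longlongrightarrow> 0) F"
  proof (rule Lim_transform_eventually[OF lim0])
    show "\<forall>\<^sub>F b in F. - (C b * (z b - a0)) * (z b + a0) / ((z b)^2 * a0^2)
      + (A 0 (z b) b * (C b * (A 2 (z b) b - m2) - m2 * (C b * (A 0 (z b) b - 1)))
        - (C b * (A 1 (z b) b - m1) - m1 * (C b * (A 0 (z b) b - 1))) * (A 1 (z b) b + m1 * A 0 (z b) b)) / (A 0 (z b) b)^2
      = C b * (Q b (z b) - D)"
      using nz
    proof eventually_elim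
      case (elim b)
      define u0 u1 u2 \<zeta> c where "u0 = A 0 (z b) b" and "u1 = A 1 (z b) b" and "u2 = A 2 (z b) b" and "\<zeta> = z b" and "c = C b"
      have p: "0 < u0" "0 < \<zeta>" using elim by (auto simp: u0_def \<zeta>_def)
      have e1: "- (c * (\<zeta> - a0)) * (\<zeta> + a0) / (\<zeta>^2 * a0^2) = c * (1 / \<zeta>^2 - 1 / a0^2)"
        using p a0 by (simp add: field_simps power2_eq_square)
      have e2: "(u0 * (c * (u2 - m2) - m2 * (c * (u0 - 1))) - (c * (u1 - m1) - m1 * (c * (u0 - 1))) * (u1 + m1 * u0)) / u0^2
        = c * ((u2 * u0 - u1^2) / u0^2 - (m2 - m1^2))"
        using p by (simp add: field_simps power2_eq_square)
      show ?case unfolding Q_def D(1) unfolding u0_def[symmetric] u1_def[symmetric] u2_def[symmetric]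
        unfolding \<zeta>_def[symmetric] c_def[symmetric] e1 e2
        by (simp add: algebra_simps)
    qed
  qed
  have QD: "((\<lambda>b. Q b (z b)) \<longlongrightarrow> D) F" by (rule rate_imp_tendsto[OF CQ])
  define S where "S b = sq b * profile_score (k b) (x b) a0" for b
  have "((\<lambda>b. S b * (D - Q b (z b)) / (Q b (z b) * D)) \<longlongrightarrow> 0) F"
  proof (rule Lim_null_comparison)
    have "((\<lambda>b. (3 + 2 * \<bar>m1\<bar>) * \<bar>C b * (Q b (z b) - D)\<bar> / \<bar>Q b (z b) * D\<bar>) \<longlongrightarrow> (3 + 2 * \<bar>m1\<bar>) * \<bar>0\<bar> / \<bar>D * D\<bar>) F"
      using D by (intro tendsto_intros CQ QD) auto
    then show "((\<lambda>b. (3 + 2 * \<bar>m1\<bar>) * \<bar>C b * (Q b (z b) - D)\<bar> / \<bar>Q b (z b) * D\<bar>) \<longlongrightarrow> 0) F" by simp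
    show "\<forall>\<^sub>F b in F. norm (S b * (D - Q b (z b)) / (Q b (z b) * D)) \<le> (3 + 2 * \<bar>m1\<bar>) * \<bar>C b * (Q b (z b) - D)\<bar> / \<bar>Q b (z b) * D\<bar>"
      using score_bound C1[of 0]
    proof eventually_elim
      case (elim b)
      have "\<bar>S b\<bar> * \<bar>D - Q b (z b)\<bar> \<le> ((3 + 2 * \<bar>m1\<bar>) * C b) * \<bar>D - Q b (z b)\<bar>"
        using elim by (intro mult_right_mono) (auto simp: S_def)
      also have "\<dots> = (3 + 2 * \<bar>m1\<bar>) * \<bar>C b * (Q b (z b) - D)\<bar>" using elim by (simp add: abs_mult abs_minus_commute)
      finally show ?case by (simp add: abs_mult divide_right_mono)
    qed
  qed
  moreover have "\<forall>\<^sub>F b in F. S b * (D - Q b (z b)) / (Q b (z b) * D) = W b - S b / D"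
    using zQ order_tendstoD(1)[OF QD D(2)]
  proof eventually_elim
    case (elim b)
    have "S b = W b * Q b (z b)" using elim(1) by (simp add: S_def W_def mult_ac)
    then show ?case using elim(2) D(2) by (simp add: field_simps)
  qed
  ultimately have 1: "((\<lambda>b. W b - S b / D) \<longlongrightarrow> 0) F" by (rule Lim_transform_eventually)
  have "((\<lambda>b. (g1 b - m1 * g2 b) * (1 - A 0 a0 b) / A 0 a0 b) \<longlongrightarrow> 0) F"
  proof (rule Lim_null_comparison)
    have "((\<lambda>b. (1 + \<bar>m1\<bar>) * \<bar>C b * (A 0 a0 b - 1)\<bar> / \<bar>A 0 a0 b\<bar>) \<longlongrightarrow> (1 + \<bar>m1\<bar>) * \<bar>0\<bar> / \<bar>1\<bar>) F"
      by (intro tendsto_intros CA0 A0_lim) auto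
    then show "((\<lambda>b. (1 + \<bar>m1\<bar>) * \<bar>C b * (A 0 a0 b - 1)\<bar> / \<bar>A 0 a0 b\<bar>) \<longlongrightarrow> 0) F" by simp
    show "\<forall>\<^sub>F b in F. norm ((g1 b - m1 * g2 b) * (1 - A 0 a0 b) / A 0 a0 b) \<le> (1 + \<bar>m1\<bar>) * \<bar>C b * (A 0 a0 b - 1)\<bar> / \<bar>A 0 a0 b\<bar>"
      using G1 G2 C1[of 0]
    proof eventually_elim
      case (elim b)
      have "\<bar>g1 b - m1 * g2 b\<bar> \<le> \<bar>g1 b\<bar> + \<bar>m1\<bar> * \<bar>g2 b\<bar>" by (metis abs_mult abs_triangle_ineq4)
      also have "\<dots> \<le> C b + \<bar>m1\<bar> * C b" using elim by (intro add_mono mult_left_mono) auto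
      finally have "\<bar>g1 b - m1 * g2 b\<bar> * \<bar>1 - A 0 a0 b\<bar> \<le> (C b + \<bar>m1\<bar> * C b) * \<bar>1 - A 0 a0 b\<bar>"
        by (intro mult_right_mono) auto
      also have "\<dots> = (1 + \<bar>m1\<bar>) * \<bar>C b * (A 0 a0 b - 1)\<bar>"
      proof -
        have "\<bar>C b\<bar> = C b" "\<bar>1 - A 0 a0 b\<bar> = \<bar>A 0 a0 b - 1\<bar>" using elim by auto
        then show ?thesis unfolding abs_mult by (simp only: distrib_right mult_1 mult.assoc)
      qed
      finally show ?case by (simp add: abs_mult divide_right_mono)
    qed
  qed
  moreover have "\<forall>\<^sub>F b in F. (g1 b - m1 * g2 b) * (1 - A 0 a0 b) / A 0 a0 b = S b - D * T b"
    using A0_pos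
  proof eventually_elim
    case (elim b)
    then have "S b = (g1 b - m1 * g2 b) / A 0 a0 b - g3 b" unfolding S_def by (intro score_expand) auto
    moreover have "D * T b = g1 b - m1 * g2 b - g3 b" using D(2) by (simp add: T_def)
    moreover have "u * (1 - v) / v = u / v - u" if "v \<noteq> 0" for u v :: real using that by (simp add: field_simps)
    ultimately show ?case using elim by simp
  qed
  ultimately have "((\<lambda>b. S b - D * T b) \<longlongrightarrow> 0) F" by (rule Lim_transform_eventually)
  then have "((\<lambda>b. (S b - D * T b) / D) \<longlongrightarrow> 0 / D) F" using D(2) by (intro tendsto_divide tendsto_const) auto
  from tendsto_add[OF 1 this] show ?thesis using D(2) by (simp add: diff_divide_distrib)
qed

text \<open>The logarithm of the profile scale is \<open>- ln (1 + \<delta>) / ah\<close> with \<open>\<delta>\<close> the deviation of the power mean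
  at \<open>ah\<close> from \<open>1\<close>. Moving from \<open>a0\<close> to \<open>ah\<close> changes this mean by \<open>- m1\<close> times the shape error to
  first order.\<close>

lemma scale_expansion:
  "((\<lambda>b. sq b * (profile_scale (k b) (x b) (ah b) - 1) + (g2 b - m1 * T b) / a0) \<longlongrightarrow> 0) F"
proof -
  have ar: "((\<lambda>b. C b * (ah b - a0)) \<longlongrightarrow> 0) F" "(ah \<longlongrightarrow> a0) F" by (rule near_rate[OF root_near])+
  have Wb: "\<forall>\<^sub>F b in F. \<bar>W b\<bar> \<le> C b ^ 2"
    using root_near sq_pos by eventually_elim (simp add: W_def h_def abs_mult pos_le_divide_eq mult.commute)
  define \<delta> where "\<delta> b = A 0 (ah b) b - 1" for b
  define y where "y b = sq b * \<delta> b" for b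
  have \<delta>lim: "(\<delta> \<longlongrightarrow> 0) F"
  proof -
    have "(A 0 a0 \<longlongrightarrow> 1) F" by (rule A0_lim)
    moreover have "((\<lambda>b. A 0 (ah b) b - A 0 a0 b) \<longlongrightarrow> 0) F"
      using rate_imp_tendsto[of "\<lambda>b. A 0 (ah b) b - A 0 a0 b" 0] near_rate(4)[OF root_near, of 0] by simp
    ultimately have "((\<lambda>b. (A 0 (ah b) b - A 0 a0 b) + A 0 a0 b - 1) \<longlongrightarrow> 0 + 1 - 1) F" by (intro tendsto_intros)
    then show ?thesis by (simp add: \<delta>_def[abs_def])
  qed
  have "\<forall>\<^sub>F b in F. \<exists>z. \<bar>z - a0\<bar> \<le> h b \<and> A 0 (ah b) b - A 0 a0 b = - (ah b - a0) * A 1 z b"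
    using root_near localized pos
  proof eventually_elim
    case (elim b)
    have d: "(log_power_mean (k b) (x b) 0 has_real_derivative - A 1 z b) (at z)" for z
      using log_power_mean_deriv[of "k b" "x b" 0 z] elim by simp
    consider "ah b = a0" | "a0 < ah b" | "ah b < a0" by linarith
    then show ?case
    proof cases
      case 1
      then show ?thesis using elim by (intro exI[of _ a0]) auto
    next
      case 2
      then obtain z where z: "a0 < z" "z < ah b" "A 0 (ah b) b - A 0 a0 b = (ah b - a0) * - A 1 z b"
        using MVT2[of a0 "ah b" "log_power_mean (k b) (x b) 0" "\<lambda>z. - A 1 z b"] d by force
      then show ?thesis using elim by (intro exI[of _ z]) (auto simp: abs_le_iff algebra_simps)
    next
      case 3
      then obtain z where z: "ah b < z" "z < a0" "A 0 a0 b - A 0 (ah b) b = (a0 - ah b) * - A 1 z b"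
        using MVT2[of "ah b" a0 "log_power_mean (k b) (x b) 0" "\<lambda>z. - A 1 z b"] d by force
      then show ?thesis using elim by (intro exI[of _ z]) (auto simp: abs_le_iff algebra_simps)
    qed
  qed
  then obtain z where z: "\<forall>\<^sub>F b in F. \<bar>z b - a0\<bar> \<le> h b \<and> A 0 (ah b) b - A 0 a0 b = - (ah b - a0) * A 1 (z b) b"
    unfolding eventually_ex by blast
  then have zn: "\<forall>\<^sub>F b in F. \<bar>z b - a0\<bar> \<le> h b" and zA: "\<forall>\<^sub>F b in F. A 0 (ah b) b - A 0 a0 b = - (ah b - a0) * A 1 (z b) b"
    by (auto elim: eventually_mono)
  have C2: "((\<lambda>b. C b ^ 2 * (A 1 (z b) b - m1)) \<longlongrightarrow> 0) F"
  proof -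
    have "((\<lambda>b. C b ^ 2 * (A 1 a0 b - m1)) \<longlongrightarrow> 0) F"
      using bounded_over_sq[of "\<lambda>b. A 1 a0 b - m1" 1 1 2] G1 by simp
    from tendsto_add[OF near_rate(3)[OF zn, of 1] this] show ?thesis by (simp add: algebra_simps)
  qed
  have y1: "((\<lambda>b. y b - (g2 b - m1 * W b)) \<longlongrightarrow> 0) F"
  proof (rule Lim_null_comparison)
    show "((\<lambda>b. \<bar>C b ^ 2 * (A 1 (z b) b - m1)\<bar>) \<longlongrightarrow> 0) F" using tendsto_rabs[OF C2] by simp
    show "\<forall>\<^sub>F b in F. norm (y b - (g2 b - m1 * W b)) \<le> \<bar>C b ^ 2 * (A 1 (z b) b - m1)\<bar>"
      using zA Wb
    proof eventually_elim
      case (elim b)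
      have "y b - g2 b = sq b * (A 0 (ah b) b - A 0 a0 b)" by (simp add: y_def \<delta>_def algebra_simps)
      also have "\<dots> = - W b * A 1 (z b) b" unfolding elim(1) by (simp only: W_def mult.assoc mult_minus_left mult_minus_right)
      finally have "y b - (g2 b - m1 * W b) = - W b * (A 1 (z b) b - m1)" by (simp add: algebra_simps)
      then have "norm (y b - (g2 b - m1 * W b)) = \<bar>W b\<bar> * \<bar>A 1 (z b) b - m1\<bar>" by (simp add: abs_mult)
      also have "\<dots> \<le> C b ^ 2 * \<bar>A 1 (z b) b - m1\<bar>" using elim by (intro mult_right_mono) auto
      finally show ?case by (simp add: abs_mult)
    qed
  qed
  have yb: "\<forall>\<^sub>F b in F. \<bar>y b\<bar> \<le> (2 + \<bar>m1\<bar>) * C b ^ 2"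
    using tendstoD[OF y1 zero_less_one] G2 Wb C1[of 2]
  proof eventually_elim
    case (elim b)
    have "C b \<le> C b ^ 2 - 1"
    proof -
      have "2 * C b \<le> C b * C b" using elim by (intro mult_right_mono) auto
      then have "2 * C b \<le> C b ^ 2" by (simp only: power2_eq_square)
      then show ?thesis using elim(4) by linarith
    qed
    moreover have "\<bar>m1 * W b\<bar> \<le> \<bar>m1\<bar> * C b ^ 2" using elim by (simp add: abs_mult mult_left_mono)
    moreover have "\<bar>y b\<bar> \<le> 1 + \<bar>g2 b\<bar> + \<bar>m1 * W b\<bar>" using elim(1) unfolding dist_real_def by linarith
    ultimately have "\<bar>y b\<bar> \<le> C b ^ 2 + \<bar>m1\<bar> * C b ^ 2" using elim(2) by linarith
    also have "\<dots> \<le> (2 + \<bar>m1\<bar>) * C b ^ 2" by (simp add: algebra_simps)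
    finally show ?case .
  qed
  have y2: "((\<lambda>b. c * (y b ^ 2 / sq b)) \<longlongrightarrow> 0) F" for c
  proof -
    have "((\<lambda>b. y b ^ 2 / sq b) \<longlongrightarrow> 0) F"
    proof (rule Lim_null_comparison)
      show "((\<lambda>b. (2 + \<bar>m1\<bar>)^2 * C b ^ 4 / sq b) \<longlongrightarrow> 0) F" by (rule C_power) simp
      show "\<forall>\<^sub>F b in F. norm (y b ^ 2 / sq b) \<le> (2 + \<bar>m1\<bar>)^2 * C b ^ 4 / sq b"
        using yb
      proof eventually_elim
        case (elim b)
        have "y b ^ 2 \<le> ((2 + \<bar>m1\<bar>) * C b ^ 2)^2" using elim by (rule abs_le_square_iff[THEN iffD1, OF order_trans]) simp
        then show ?case by (simp add: power_mult_distrib divide_right_mono)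
      qed
    qed
    then show ?thesis by (rule tendsto_mult_right_zero)
  qed
  define z' where "z' b = - ln (1 + \<delta> b) / ah b" for b
  have small: "\<forall>\<^sub>F b in F. \<bar>\<delta> b\<bar> < min (1/2) (a0 / 4) \<and> a0 / 2 < ah b \<and> 0 < A 0 (ah b) b \<and> 0 < sq b"
  proof -
    have "\<forall>\<^sub>F b in F. \<bar>\<delta> b\<bar> < min (1/2) (a0 / 4)"
      using tendstoD[OF \<delta>lim, of "min (1/2) (a0 / 4)"] a0 by (simp add: dist_real_def)
    moreover have "\<forall>\<^sub>F b in F. a0 / 2 < ah b" using order_tendstoD(1)[OF ar(2), of "a0 / 2"] a0 by simp
    ultimately show ?thesis using pos
    proof eventually_elim
      case (elim b)
      then show ?case using log_power_mean_pos[of "k b" "x b" "ah b"] by auto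
    qed
  qed
  have main: "\<forall>\<^sub>F b in F. norm (sq b * (profile_scale (k b) (x b) (ah b) - 1) + y b / a0)
     \<le> 16 / a0^2 * exp 1 * (y b ^ 2 / sq b) + (4 / a0) * (y b ^ 2 / sq b) + (2 / a0^2) * (2 + \<bar>m1\<bar>) * C b ^ 4 / sq b"
    using small yb root_near
  proof eventually_elim
    case (elim b)
    have d: "\<bar>\<delta> b\<bar> \<le> 1/2" "\<bar>\<delta> b\<bar> \<le> a0 / 4" and a: "a0 / 2 < ah b" "0 < ah b" and s: "0 < sq b" using elim a0 by auto
    have sqd: "t * (u / t)^2 = u ^ 2 / t" if "0 < t" for t u :: real using that by (simp add: power2_eq_square)
    have \<delta>y: "\<delta> b = y b / sq b" using s by (simp add: y_def)
    have ln1: "\<bar>ln (1 + \<delta> b) - \<delta> b\<bar> \<le> 2 * (\<delta> b)^2" by (rule abs_ln_one_plus_x_minus_x_bound[OF d(1)])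
    have dd: "2 * (\<delta> b)^2 \<le> \<bar>\<delta> b\<bar>"
    proof -
      have "\<bar>\<delta> b\<bar> * \<bar>\<delta> b\<bar> \<le> (1/2) * \<bar>\<delta> b\<bar>" using d by (intro mult_right_mono) auto
      then show ?thesis by (simp add: power2_eq_square)
    qed
    have inv: "1 / ah b \<le> 2 / a0" using a a0 by (simp add: field_simps)
    have "\<bar>ln (1 + \<delta> b)\<bar> \<le> 2 * \<bar>\<delta> b\<bar>" using ln1 dd by linarith
    then have zb: "\<bar>z' b\<bar> \<le> 4 / a0 * \<bar>\<delta> b\<bar>"
    proof -
      have "\<bar>z' b\<bar> = \<bar>ln (1 + \<delta> b)\<bar> * (1 / ah b)" using a by (simp add: z'_def abs_divide)
      also have "\<dots> \<le> (2 * \<bar>\<delta> b\<bar>) * (2 / a0)" using \<open>\<bar>ln (1 + \<delta> b)\<bar> \<le> 2 * \<bar>\<delta> b\<bar>\<close> inv a by (intro mult_mono) auto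
      finally show ?thesis by simp
    qed
    have z1: "\<bar>z' b\<bar> \<le> 1"
    proof -
      have "4 / a0 * \<bar>\<delta> b\<bar> \<le> 4 / a0 * (a0 / 4)" using d a0 by (intro mult_left_mono) auto
      moreover have "4 / a0 * (a0 / 4) = 1" using a0 by simp
      ultimately show ?thesis using zb by linarith
    qed
    have sc: "profile_scale (k b) (x b) (ah b) = exp (z' b)"
      using elim by (simp add: profile_scale_def powr_def z'_def \<delta>_def)
    have "\<bar>exp (z' b) - 1 - z' b\<bar> \<le> (z' b)^2 * exp \<bar>z' b\<bar>" by (rule exp_taylor1_le)
    also have "\<dots> \<le> (4 / a0 * \<bar>\<delta> b\<bar>)^2 * exp 1"
    proof (rule mult_mono)
      have "\<bar>z' b\<bar>^2 \<le> (4 / a0 * \<bar>\<delta> b\<bar>)^2" using zb by (intro power_mono) auto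
      then show "(z' b)^2 \<le> (4 / a0 * \<bar>\<delta> b\<bar>)^2" by (simp only: power2_abs)
    qed (use z1 in auto)
    finally have E1: "\<bar>sq b * (exp (z' b) - 1 - z' b)\<bar> \<le> 16 / a0^2 * exp 1 * (y b ^ 2 / sq b)"
    proof -
      assume "\<bar>exp (z' b) - 1 - z' b\<bar> \<le> (4 / a0 * \<bar>\<delta> b\<bar>)^2 * exp 1"
      then have "sq b * \<bar>exp (z' b) - 1 - z' b\<bar> \<le> sq b * ((4 / a0 * \<bar>\<delta> b\<bar>)^2 * exp 1)" using s by (intro mult_left_mono) auto
      also have "\<dots> = 16 / a0^2 * exp 1 * (sq b * (\<delta> b)^2)" by (simp add: power_mult_distrib power_divide)
      also have "sq b * (\<delta> b)^2 = y b ^ 2 / sq b" unfolding \<delta>y by (rule sqd[OF s])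
      finally show ?thesis using s by (simp add: abs_mult)
    qed
    have E2: "\<bar>sq b * (z' b + \<delta> b / ah b)\<bar> \<le> (4 / a0) * (y b ^ 2 / sq b)"
    proof -
      have "z' b + \<delta> b / ah b = - (ln (1 + \<delta> b) - \<delta> b) / ah b" by (simp add: z'_def diff_divide_distrib)
      then have "\<bar>sq b * (z' b + \<delta> b / ah b)\<bar> = sq b * (\<bar>ln (1 + \<delta> b) - \<delta> b\<bar> * (1 / ah b))" using s a by (simp add: abs_mult)
      also have "\<dots> \<le> sq b * ((2 * (\<delta> b)^2) * (2 / a0))" using ln1 inv a s by (intro mult_left_mono mult_mono) auto
      also have "\<dots> = (4 / a0) * (sq b * (\<delta> b)^2)" by simp
      also have "sq b * (\<delta> b)^2 = y b ^ 2 / sq b" unfolding \<delta>y by (rule sqd[OF s])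
      finally show ?thesis .
    qed
    have E3: "\<bar>y b / a0 - y b / ah b\<bar> \<le> (2 / a0^2) * (2 + \<bar>m1\<bar>) * C b ^ 4 / sq b"
    proof -
      have "y b / a0 - y b / ah b = y b * (ah b - a0) * ((1 / a0) * (1 / ah b))" using a a0 by (simp add: field_simps)
      then have "\<bar>y b / a0 - y b / ah b\<bar> = \<bar>y b\<bar> * \<bar>ah b - a0\<bar> * ((1 / a0) * (1 / ah b))" using a a0 by (simp add: abs_mult)
      also have "\<dots> \<le> ((2 + \<bar>m1\<bar>) * C b ^ 2) * (C b ^ 2 / sq b) * ((1 / a0) * (2 / a0))"
        using elim(2,3) inv a a0 s by (intro mult_mono) (auto simp: h_def)
      also have "\<dots> = (2 / a0^2) * (2 + \<bar>m1\<bar>) * C b ^ 4 / sq b"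
      proof -
        have "(m * u^2) * (u^2 / t) * ((1 / v) * (2 / v)) = (2 / v^2) * m * u^4 / t" for m u t v :: real
          by (simp add: power2_eq_square power4_eq_xxxx mult_ac)
        then show ?thesis .
      qed
      finally show ?thesis .
    qed
    have "sq b * (profile_scale (k b) (x b) (ah b) - 1) + y b / a0
      = sq b * (exp (z' b) - 1 - z' b) + sq b * (z' b + \<delta> b / ah b) + (y b / a0 - y b / ah b)"
      unfolding sc y_def by (simp add: algebra_simps)
    then show ?case using E1 E2 E3 unfolding real_norm_def by linarith
  qed
  have "((\<lambda>b. 16 / a0^2 * exp 1 * (y b ^ 2 / sq b) + (4 / a0) * (y b ^ 2 / sq b) + (2 / a0^2) * (2 + \<bar>m1\<bar>) * C b ^ 4 / sq b) \<longlongrightarrow> 0 + 0 + 0) F"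
    by (intro tendsto_add y2 C_power) simp
  then have "((\<lambda>b. sq b * (profile_scale (k b) (x b) (ah b) - 1) + y b / a0) \<longlongrightarrow> 0) F"
    by (intro Lim_null_comparison[OF main]) simp
  moreover have "((\<lambda>b. (y b - (g2 b - m1 * W b)) / a0) \<longlongrightarrow> 0 / a0) F" using a0 by (intro tendsto_divide y1 tendsto_const) auto
  moreover have "((\<lambda>b. m1 * (W b - T b) / a0) \<longlongrightarrow> m1 * 0 / a0) F" using a0 by (intro tendsto_intros shape_expansion) auto
  ultimately have "((\<lambda>b. (sq b * (profile_scale (k b) (x b) (ah b) - 1) + y b / a0) - (y b - (g2 b - m1 * W b)) / a0 + m1 * (W b - T b) / a0)
      \<longlongrightarrow> 0 - 0 / a0 + m1 * 0 / a0) F"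
    by (intro tendsto_add tendsto_diff)
  moreover have "(sq b * (profile_scale (k b) (x b) (ah b) - 1) + y b / a0) - (y b - (g2 b - m1 * W b)) / a0 + m1 * (W b - T b) / a0
     = sq b * (profile_scale (k b) (x b) (ah b) - 1) + (g2 b - m1 * T b) / a0" for b
    by (simp add: diff_divide_distrib add_divide_distrib algebra_simps)
  ultimately show ?thesis by simp
qed

lemma maximizer_expansion:
  "((\<lambda>b. sq b * (ah b - a0) - (g1 b - m1 * g2 b - g3 b) / D) \<longlongrightarrow> 0) F"
  "((\<lambda>b. sq b * (profile_scale (k b) (x b) (ah b) - 1) + (g2 b - m1 * ((g1 b - m1 * g2 b - g3 b) / D)) / a0) \<longlongrightarrow> 0) F"
  using shape_expansion scale_expansion unfolding W_def T_def .

end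
end

section \<open>Convergence of moments\<close>

text \<open>Truncation of \<open>g\<close> makes it bounded, and the set where it may be discontinuous is null for the limit;
  a moment of order above one makes the truncation error uniformly small.\<close>

lemma weak_conv_moment_convergence:
  fixes g :: "real \<Rightarrow> real"
  assumes \<mu>: "\<And>n. real_distribution (\<mu> n)" and \<mu>': "real_distribution \<mu>'" and wc: "weak_conv_m \<mu> \<mu>'"
    and g [measurable]: "g \<in> borel_measurable borel" and cont: "\<And>x. 0 < x \<Longrightarrow> isCont g x"
    and null: "emeasure \<mu>' {..0} = 0" and p: "1 < p"
    and mom: "\<forall>\<^sub>F n in sequentially. integrable (\<mu> n) (\<lambda>x. \<bar>g x\<bar> powr p) \<and> (\<integral>x. \<bar>g x\<bar> powr p \<partial>\<mu> n) \<le> K"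
    and int': "integrable \<mu>' g"
  shows "(\<lambda>n. \<integral>x. g x \<partial>\<mu> n) \<longlonglongrightarrow> (\<integral>x. g x \<partial>\<mu>')"
proof -
  interpret L: real_distribution \<mu>' by fact
  have trc: "(\<lambda>n. \<integral>x. trunc T (g x) \<partial>\<mu> n) \<longlonglongrightarrow> (\<integral>x. trunc T (g x) \<partial>\<mu>')" if "0 \<le> T" for T
  proof (rule weak_conv_imp_bdd_ae_continuous_conv[OF \<mu> \<mu>' wc, where B=T])
    have "{x. \<not> isCont (\<lambda>x. trunc T (g x)) x} \<subseteq> {..0}"
    proof
      fix x assume x: "x \<in> {x. \<not> isCont (\<lambda>x. trunc T (g x)) x}"
      have "isCont (\<lambda>x. trunc T (g x)) x" if "0 < x"
        unfolding trunc_def using cont[OF that] by (intro continuous_intros)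
      then show "x \<in> {..0}" using x by force
    qed
    then have "emeasure \<mu>' {x. \<not> isCont (\<lambda>x. trunc T (g x)) x} \<le> emeasure \<mu>' {..0}"
      by (rule emeasure_mono) simp
    then show "emeasure \<mu>' {x. \<not> isCont (\<lambda>x. trunc T (g x)) x} = 0" using null by simp
  qed (use that abs_trunc_le in auto)
  have K0: "0 \<le> K"
  proof -
    obtain n where "(\<integral>x. \<bar>g x\<bar> powr p \<partial>\<mu> n) \<le> K" using mom by (auto simp: eventually_sequentially)
    moreover have "0 \<le> (\<integral>x. \<bar>g x\<bar> powr p \<partial>\<mu> n)" by (intro integral_nonneg_AE) auto
    ultimately show ?thesis by linarith
  qed
  have tail: "\<forall>\<^sub>F n in sequentially. \<bar>(\<integral>x. g x \<partial>\<mu> n) - (\<integral>x. trunc T (g x) \<partial>\<mu> n)\<bar> \<le> K * T powr (1 - p)" if T: "1 \<le> T" for T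
    using mom
  proof eventually_elim
    case (elim n)
    interpret real_distribution "\<mu> n" by (rule \<mu>)
    have le1: "\<bar>y\<bar> \<le> 1 + \<bar>y\<bar> powr p" for y using p by (intro abs_le_powr) simp
    have i: "integrable (\<mu> n) g"
      by (rule Bochner_Integration.integrable_bound[of _ "\<lambda>x. 1 + \<bar>g x\<bar> powr p"]) (use elim le1 in \<open>auto intro: order_trans\<close>)
    have it: "integrable (\<mu> n) (\<lambda>x. trunc T (g x))"
      by (rule integrable_const_bound[where B=T]) (use T abs_trunc_le in auto)
    have "\<bar>(\<integral>x. g x \<partial>\<mu> n) - (\<integral>x. trunc T (g x) \<partial>\<mu> n)\<bar> = \<bar>\<integral>x. g x - trunc T (g x) \<partial>\<mu> n\<bar>" using i it by simp
    also have "\<dots> \<le> (\<integral>x. \<bar>g x - trunc T (g x)\<bar> \<partial>\<mu> n)" by (rule integral_abs_bound)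
    also have "\<dots> \<le> (\<integral>x. \<bar>g x\<bar> powr p * T powr (1 - p) \<partial>\<mu> n)"
      using i it elim p T by (intro integral_mono trunc_diff_le) auto
    also have "\<dots> = (\<integral>x. \<bar>g x\<bar> powr p \<partial>\<mu> n) * T powr (1 - p)" by simp
    also have "\<dots> \<le> K * T powr (1 - p)" using elim by (intro mult_right_mono) auto
    finally show ?case .
  qed
  have lim1: "(\<lambda>m. \<integral>x. trunc (real m) (g x) \<partial>\<mu>') \<longlonglongrightarrow> (\<integral>x. g x \<partial>\<mu>')"
  proof (rule integral_dominated_convergence[where w="\<lambda>x. \<bar>g x\<bar>"])
    show "AE x in \<mu>'. (\<lambda>m. trunc (real m) (g x)) \<longlonglongrightarrow> g x"
    proof (rule AE_I2)
      fix x
      obtain m0 :: nat where m0: "\<bar>g x\<bar> \<le> real m0" using real_arch_simple by blast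
      have "\<forall>\<^sub>F m in sequentially. trunc (real m) (g x) = g x"
        using eventually_ge_at_top[of m0] by eventually_elim (use m0 in \<open>auto simp: trunc_def\<close>)
      then show "(\<lambda>m. trunc (real m) (g x)) \<longlonglongrightarrow> g x" by (rule tendsto_eventually)
    qed
  qed (use int' abs_trunc_le in auto)
  have lim2: "(\<lambda>m. K * real m powr (1 - p)) \<longlonglongrightarrow> 0"
    by (rule tendsto_mult_right_zero, rule tendsto_neg_powr[OF _ filterlim_real_sequentially]) (use p in simp)
  show ?thesis
  proof (rule tendstoI)
    fix e :: real assume e: "0 < e"
    have "\<forall>\<^sub>F m in sequentially. dist (\<integral>x. trunc (real m) (g x) \<partial>\<mu>') (\<integral>x. g x \<partial>\<mu>') < e / 3 \<and> K * real m powr (1 - p) < e / 3 \<and> 1 \<le> m"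
      using tendstoD[OF lim1, of "e/3"] order_tendstoD(2)[OF lim2, of "e/3"] eventually_ge_at_top[of 1] e
      by (intro eventually_conj) auto
    then obtain m where m: "dist (\<integral>x. trunc (real m) (g x) \<partial>\<mu>') (\<integral>x. g x \<partial>\<mu>') < e / 3" "K * real m powr (1 - p) < e / 3" "1 \<le> real m"
      by (auto simp: eventually_sequentially)
    have tm: "\<forall>\<^sub>F n in sequentially. dist (\<integral>x. trunc (real m) (g x) \<partial>\<mu> n) (\<integral>x. trunc (real m) (g x) \<partial>\<mu>') < e / 3"
      using trc[of "real m"] e by (intro tendstoD) auto
    show "\<forall>\<^sub>F n in sequentially. dist (\<integral>x. g x \<partial>\<mu> n) (\<integral>x. g x \<partial>\<mu>') < e"
      using tail[OF m(3)] tm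
    proof eventually_elim
      case (elim n)
      then show ?case using m(1,2) unfolding dist_real_def by linarith
    qed
  qed
qed

text \<open>The moment condition concerns \<open>max b 1\<close>, the block maxima here are bounded below by \<open>c\<close> instead.
  The two differ by constant factors, which change a power by a constant factor and a logarithm by
  an additive constant. The exponent \<open>\<beta>\<close> is chosen so that \<open>\<beta> * p = \<alpha> * (2 + \<nu>)\<close>.\<close>

lemma envelope_moment:
  fixes \<alpha> \<nu> p c :: real
  assumes \<alpha>: "0 < \<alpha>" and p: "2 < p" "p < 2 + \<nu>" and c: "0 < c"
  defines "\<beta> \<equiv> \<alpha> * (2 + \<nu>) / p"
  obtains K where "0 \<le> K" "\<And>b s. 0 < s \<Longrightarrow>
     (1 + (max b c / s) powr (- \<beta>) + max 0 (ln (max b c / s))) powr p \<le> K * (1 + g_mom \<nu> \<alpha> (max b 1 / s))"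
proof -
  define q where "q = 2 + \<nu>"
  have q: "p < q" "0 < q" using p by (auto simp: q_def)
  have \<beta>: "\<beta> * p = \<alpha> * q" using p by (simp add: \<beta>_def q_def)
  define c1 c2 L where "c1 = min c 1" and "c2 = max c 1" and "L = 1 + ln c2"
  have cc: "0 < c1" "1 \<le> c2" "1 \<le> L" using c by (auto simp: c1_def c2_def L_def)
  define K where "K = 3 powr p * (1 + c1 powr (- (\<alpha> * q)) + L powr p)"
  have K: "0 \<le> K" using cc by (auto simp: K_def intro!: mult_nonneg_nonneg add_nonneg_nonneg)
  have "(1 + (max b c / s) powr (- \<beta>) + max 0 (ln (max b c / s))) powr p \<le> K * (1 + g_mom \<nu> \<alpha> (max b 1 / s))" if s: "0 < s" for b s
  proof -
    define x y where "x = max b c / s" and "y = max b 1 / s"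
    have x0: "0 < x" and y0: "0 < y" using s c by (auto simp: x_def y_def less_max_iff_disj)
    have xy: "c1 * y \<le> x"
    proof -
      have "c1 * max b 1 \<le> max b c"
      proof (cases "0 \<le> b")
        case True
        then have "c1 * b \<le> 1 * b" by (intro mult_right_mono) (auto simp: c1_def)
        then show ?thesis by (auto simp: max_def c1_def)
      qed (auto simp: c1_def max_def)
      then show ?thesis using s by (simp add: x_def y_def divide_right_mono)
    qed
    have yx: "x \<le> c2 * y"
    proof -
      have "max b c \<le> c2 * max b 1"
      proof -
        have "1 * max b 1 \<le> c2 * max b 1" using cc by (intro mult_right_mono) auto
        moreover have "c2 * 1 \<le> c2 * max b 1" using cc by (intro mult_left_mono) auto
        moreover have "c \<le> c2 * 1" by (simp add: c2_def)
        ultimately show ?thesis by auto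
      qed
      then show ?thesis using s by (simp add: x_def y_def divide_right_mono)
    qed
    define g where "g = g_mom \<nu> \<alpha> y"
    have g0: "0 \<le> g" by (simp add: g_def g_mom_def)
    have g1: "g = y powr (- (\<alpha> * q))" if "y \<le> exp 1"
      using that by (simp add: g_def g_mom_def q_def powr_powr)
    have g2: "g = (ln y) powr q" if "exp 1 < y" using that by (simp add: g_def g_mom_def q_def)
    have ln1: "1 \<le> ln y" if "exp 1 < y" using that y0 by (simp add: ln_ge_iff less_imp_le)
    have A: "(x powr (- \<beta>)) powr p \<le> c1 powr (- (\<alpha> * q)) * (1 + g)"
    proof -
      have "(x powr (- \<beta>)) powr p = x powr (- (\<alpha> * q))" using \<beta> by (simp add: powr_powr)
      also have "\<dots> \<le> (c1 * y) powr (- (\<alpha> * q))" using xy cc y0 \<alpha> q by (intro powr_mono2') auto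
      also have "\<dots> = c1 powr (- (\<alpha> * q)) * y powr (- (\<alpha> * q))" using cc y0 by (simp add: powr_mult)
      also have "\<dots> \<le> c1 powr (- (\<alpha> * q)) * (1 + g)"
      proof (intro mult_left_mono)
        show "y powr (- (\<alpha> * q)) \<le> 1 + g"
        proof (cases "y \<le> exp 1")
          case False
          have "1 \<le> exp (1::real)" by simp
          then have "1 \<le> y" using False by linarith
          then have "y powr (- (\<alpha> * q)) \<le> y powr 0" using \<alpha> q by (intro powr_mono) auto
          then show ?thesis using g0 y0 by simp
        qed (simp add: g1)
      qed auto
      finally show ?thesis by simp
    qed
    have Bd: "max 0 (ln x) powr p \<le> L powr p * (1 + g)"
    proof (cases "y \<le> exp 1")
      case True
      have "ln x \<le> ln (c2 * y)" using yx x0 by (subst ln_le_cancel_iff) auto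
      also have "\<dots> = ln c2 + ln y" using cc y0 by (subst ln_mult) auto
      also have "ln y \<le> 1"
      proof -
        have "ln y \<le> ln (exp 1)" using True y0 by (subst ln_le_cancel_iff) auto
        then show ?thesis by simp
      qed
      finally have "max 0 (ln x) \<le> L" using cc by (simp add: L_def)
      then have "max 0 (ln x) powr p \<le> L powr p" using p by (intro powr_mono2) auto
      also have "\<dots> * 1 \<le> L powr p * (1 + g)" using g0 by (intro mult_left_mono) auto
      finally show ?thesis by simp
    next
      case False
      then have l: "1 \<le> ln y" using ln1 by simp
      have "ln x \<le> ln (c2 * y)" using yx x0 by (subst ln_le_cancel_iff) auto
      also have "\<dots> = ln c2 + ln y" using cc y0 by (subst ln_mult) auto
      also have "\<dots> \<le> ln c2 * ln y + ln y" using l cc mult_left_mono[of 1 "ln y" "ln c2"] by simp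
      also have "\<dots> = L * ln y" by (simp add: L_def algebra_simps)
      finally have "max 0 (ln x) \<le> L * ln y" using cc l by simp
      then have "max 0 (ln x) powr p \<le> (L * ln y) powr p" using p by (intro powr_mono2) auto
      also have "\<dots> = L powr p * (ln y) powr p" using cc l by (simp add: powr_mult)
      also have "\<dots> \<le> L powr p * (ln y) powr q" using l q by (intro mult_left_mono powr_mono) auto
      also have "\<dots> \<le> L powr p * (1 + g)" using False g2 by (intro mult_left_mono) auto
      finally show ?thesis .
    qed
    have three: "(u + v + z) powr p \<le> 3 powr p * (u powr p + v powr p + z powr p)" if "0 \<le> u" "0 \<le> v" "0 \<le> z" for u v z :: real
    proof -
      define m where "m = max u (max v z)"
      have "(u + v + z) powr p \<le> (3 * m) powr p" using that p by (intro powr_mono2) (auto simp: m_def)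
      also have "\<dots> = 3 powr p * m powr p" using that by (simp add: powr_mult m_def)
      also have "m powr p \<le> u powr p + v powr p + z powr p" by (auto simp: m_def max_def)
      finally show ?thesis by simp
    qed
    have "(1 + x powr (- \<beta>) + max 0 (ln x)) powr p \<le> 3 powr p * (1 powr p + (x powr (- \<beta>)) powr p + max 0 (ln x) powr p)"
      using three[of 1 "x powr (- \<beta>)" "max 0 (ln x)"] by simp
    also have "\<dots> \<le> 3 powr p * (1 * (1 + g) + c1 powr (- (\<alpha> * q)) * (1 + g) + L powr p * (1 + g))"
      using A Bd g0 by (intro mult_left_mono add_mono) auto
    also have "\<dots> = K * (1 + g)" by (simp add: K_def algebra_simps)
    finally show ?thesis by (simp add: x_def y_def g_def)
  qed
  with K show thesis by (rule that)
qed

section \<open>The rescaled block maxima\<close>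

text \<open>The hypotheses on which the central limit theorem for sums over blocks rests; those on the bias and
  on the smallest block maximum concern the likelihood and are added later.\<close>

locale frechet_block_maxima = prob_space M for M :: "'a measure" +
  fixes \<xi> :: "int \<Rightarrow> 'a \<Rightarrow> real" and r k :: "nat \<Rightarrow> nat" and \<sigma> :: "nat \<Rightarrow> real"
    and \<alpha>\<^sub>0 \<omega> \<nu> c :: real
  assumes rv: "\<And>t. \<xi> t \<in> borel_measurable M"
    and stat: "strictly_stationary M \<xi>"
    and r_pos: "\<And>n. n \<ge> 1 \<Longrightarrow> r n > 0"
    and r_lim: "filterlim r at_top sequentially"
    and k_lim: "filterlim k at_top sequentially"
    and \<sigma>_pos: "\<And>n. n \<ge> 1 \<Longrightarrow> \<sigma> n > 0"
    and \<sigma>_lim: "filterlim \<sigma> at_top sequentially"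
    and \<alpha>0_pos: "\<alpha>\<^sub>0 > 0"
    and doa: "weak_conv_m (\<lambda>n. distr M borel (\<lambda>w. block_max \<xi> n 1 w / \<sigma> n)) (frechet \<alpha>\<^sub>0 1)"
    and mixing: "mixing_coeff M \<xi> \<longlonglongrightarrow> 0"
    and \<omega>_pos: "\<omega> > 0"
    and mixing_rate: "(\<lambda>n. real (k n) powr (1 + \<omega>) * mixing_coeff M \<xi> (r n)) \<longlonglongrightarrow> 0"
    and \<nu>_gt: "\<nu> > 2 / \<omega>"
    and moments: "limsup (\<lambda>n. \<integral>\<^sup>+ w. ennreal (g_mom \<nu> \<alpha>\<^sub>0 (max (block_max \<xi> n 1 w) 1 / \<sigma> n)) \<partial>M) < \<infinity>"
    and c_pos: "c > 0"
begin

text \<open>The exponent has to stay below \<open>2 + \<nu>\<close>, so that a power slightly steeper than \<open>x powr (- \<alpha>\<^sub>0)\<close> still has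
  a \<open>p\<close>-th moment, and above \<open>2 + 2 / \<omega>\<close>, so that truncation errors are beaten by the mixing rate.\<close>

definition p where "p = 2 + (2 / \<omega> + \<nu>) / 2"
definition \<beta> where "\<beta> = \<alpha>\<^sub>0 * (2 + \<nu>) / p"
definition env where "env x = 1 + x powr (- \<beta>) + max 0 (ln x)"
definition X where "X n i w = max (block_max \<xi> (r n) i w) c / \<sigma> (r n)"

text \<open>The test functions for which the block maxima satisfy laws of large numbers and central limit
  theorems: \<open>env\<close> bounds them by functions with bounded \<open>p\<close>-th moments, and continuity off the
  Frechet null set \<open>{..0}\<close> transfers weak convergence to their means.\<close>

definition admissible :: "(real \<Rightarrow> real) \<Rightarrow> bool" where
  "admissible f \<longleftrightarrow> f \<in> borel_measurable borel \<and> (\<forall>x>0. isCont f x) \<and> (\<exists>C. \<forall>x>0. \<bar>f x\<bar> \<le> C * env x)"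

lemma p: "2 < p" "p < 2 + \<nu>" "2 / \<omega> < p - 2"
proof -
  have "2 < 2 + (z + \<nu>) / 2 \<and> 2 + (z + \<nu>) / 2 < 2 + \<nu> \<and> z < 2 + (z + \<nu>) / 2 - 2" if "0 < z" "z < \<nu>" for z
    using that by auto
  from this[of "2 / \<omega>"] show "2 < p" "p < 2 + \<nu>" "2 / \<omega> < p - 2"
    using \<nu>_gt \<omega>_pos by (auto simp: p_def)
qed

lemma \<beta>: "\<alpha>\<^sub>0 < \<beta>"
proof -
  have "\<alpha>\<^sub>0 * p < \<alpha>\<^sub>0 * (2 + \<nu>)" using p \<alpha>0_pos by (intro mult_strict_left_mono) auto
  then show ?thesis using p by (simp add: \<beta>_def field_simps)
qed

lemma env_ge_1: "1 \<le> env x" by (simp add: env_def)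

lemma env_measurable [measurable]: "env \<in> borel_measurable borel" unfolding env_def[abs_def] by measurable

lemma bm_measurable [measurable]: "block_max \<xi> m i \<in> borel_measurable M" by (rule block_max_measurable[OF rv])

lemma X_measurable [measurable]: "X n i \<in> borel_measurable M"
  unfolding X_def[abs_def] by measurable

lemma \<sigma>r_pos: "1 \<le> n \<Longrightarrow> 0 < \<sigma> (r n)"
  using r_pos[of n] by (intro \<sigma>_pos) simp

lemma X_pos: "1 \<le> n \<Longrightarrow> 0 < X n i w"
  using \<sigma>r_pos[of n] c_pos by (simp add: X_def less_max_iff_disj)

lemma \<sigma>r_lim: "filterlim (\<lambda>n. \<sigma> (r n)) at_top sequentially"
  by (rule filterlim_compose[OF \<sigma>_lim r_lim])

lemma X_law:
  assumes "1 \<le> i" and g [measurable]: "g \<in> borel_measurable borel"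
  shows "distr M borel (\<lambda>w. g (X n i w)) = distr M borel (\<lambda>w. g (X n 1 w) :: real)"
  unfolding X_def using assms(1) by (rule block_max_law[OF stat rv, where g="\<lambda>b. g (max b c / \<sigma> (r n))"]) measurable

lemma X_law_integral:
  assumes "1 \<le> i" and g [measurable]: "g \<in> borel_measurable borel"
  shows "expectation (\<lambda>w. g (X n i w) :: real) = expectation (\<lambda>w. g (X n 1 w))"
    and "integrable M (\<lambda>w. g (X n i w)) \<longleftrightarrow> integrable M (\<lambda>w. g (X n 1 w))"
proof -
  have "expectation (\<lambda>w. g (X n j w)) = (\<integral>y. y \<partial>distr M borel (\<lambda>w. g (X n j w)))" for j by (subst integral_distr) auto
  then show "expectation (\<lambda>w. g (X n i w)) = expectation (\<lambda>w. g (X n 1 w))" using X_law[OF assms] by simp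
  have "integrable M (\<lambda>w. g (X n j w)) \<longleftrightarrow> integrable (distr M borel (\<lambda>w. g (X n j w))) (\<lambda>y. y)" for j by (subst integrable_distr_eq) auto
  then show "integrable M (\<lambda>w. g (X n i w)) \<longleftrightarrow> integrable M (\<lambda>w. g (X n 1 w))" using X_law[OF assms] by simp
qed

lemma env_moment: "\<exists>K\<ge>0. \<forall>\<^sub>F n in sequentially. integrable M (\<lambda>w. env (X n 1 w) powr p) \<and> expectation (\<lambda>w. env (X n 1 w) powr p) \<le> K"
proof -
  obtain K0 where K0: "0 \<le> K0" "\<And>b s. 0 < s \<Longrightarrow>
     (1 + (max b c / s) powr (- \<beta>) + max 0 (ln (max b c / s))) powr p \<le> K0 * (1 + g_mom \<nu> \<alpha>\<^sub>0 (max b 1 / s))"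
    using envelope_moment[OF \<alpha>0_pos p(1,2) c_pos] unfolding \<beta>_def by blast
  obtain L where "limsup (\<lambda>n. \<integral>\<^sup>+ w. ennreal (g_mom \<nu> \<alpha>\<^sub>0 (max (block_max \<xi> n 1 w) 1 / \<sigma> n)) \<partial>M) < L" "L < \<infinity>"
    using moments dense by blast
  then have "\<forall>\<^sub>F m in sequentially. (\<integral>\<^sup>+ w. ennreal (g_mom \<nu> \<alpha>\<^sub>0 (max (block_max \<xi> m 1 w) 1 / \<sigma> m)) \<partial>M) < L"
    by (intro Limsup_lessD) auto
  then have ev: "\<forall>\<^sub>F n in sequentially. (\<integral>\<^sup>+ w. ennreal (g_mom \<nu> \<alpha>\<^sub>0 (max (block_max \<xi> (r n) 1 w) 1 / \<sigma> (r n))) \<partial>M) < L"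
    by (rule eventually_compose_filterlim[OF _ r_lim])
  define l where "l = enn2real L"
  have L: "L = ennreal l" using \<open>L < \<infinity>\<close> by (simp add: l_def)
  have l0: "0 \<le> l" by (simp add: l_def)
  have "\<forall>\<^sub>F n in sequentially. integrable M (\<lambda>w. env (X n 1 w) powr p) \<and> expectation (\<lambda>w. env (X n 1 w) powr p) \<le> K0 * (1 + l)"
    using ev eventually_ge_at_top[of 1]
  proof eventually_elim
    case (elim n)
    define g where "g w = g_mom \<nu> \<alpha>\<^sub>0 (max (block_max \<xi> (r n) 1 w) 1 / \<sigma> (r n))" for w
    have gm [measurable]: "g \<in> borel_measurable M" unfolding g_def[abs_def] g_mom_def by measurable
    have g0: "0 \<le> g w" for w by (simp add: g_def g_mom_def)
    have gi: "(\<integral>\<^sup>+ w. ennreal (g w) \<partial>M) < ennreal l" using elim L by (simp add: g_def)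
    have int: "integrable M g" by (rule integrableI_nonneg) (use g0 gi in \<open>auto intro: less_trans\<close>)
    have "ennreal (expectation g) \<le> ennreal l"
      using gi nn_integral_eq_integral[OF int] g0 by simp
    then have el: "expectation g \<le> l" using l0 by simp
    have le: "env (X n 1 w) powr p \<le> K0 * (1 + g w)" for w
      unfolding env_def X_def g_def by (rule K0(2)[OF \<sigma>r_pos[OF elim(2)]])
    have bi: "integrable M (\<lambda>w. K0 * (1 + g w))" using int by simp
    have i: "integrable M (\<lambda>w. env (X n 1 w) powr p)"
      by (rule Bochner_Integration.integrable_bound[OF bi]) (use le in \<open>auto intro: order_trans[OF _ abs_ge_self]\<close>)
    have "expectation (\<lambda>w. env (X n 1 w) powr p) \<le> expectation (\<lambda>w. K0 * (1 + g w))"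
      by (rule integral_mono[OF i bi le])
    also have "\<dots> = K0 * (1 + expectation g)" using int by (simp add: prob_space)
    also have "\<dots> \<le> K0 * (1 + l)" using el K0(1) by (intro mult_left_mono) auto
    finally show ?case using i by simp
  qed
  then show ?thesis using K0(1) l0 by (intro exI[of _ "K0 * (1 + l)"]) auto
qed

lemma admissible_moment:
  assumes f: "admissible f"
  shows "\<exists>K\<ge>0. \<forall>\<^sub>F n in sequentially. \<forall>i\<ge>1. integrable M (\<lambda>w. \<bar>f (X n i w)\<bar> powr p) \<and> expectation (\<lambda>w. \<bar>f (X n i w)\<bar> powr p) \<le> K"
proof -
  have fm [measurable]: "f \<in> borel_measurable borel" using f by (simp add: admissible_def)
  obtain C where C: "\<And>x. 0 < x \<Longrightarrow> \<bar>f x\<bar> \<le> C * env x" using f unfolding admissible_def by blast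
  have C0: "0 \<le> C"
  proof -
    have "0 \<le> C * env 1" using C[of 1] by simp
    then show ?thesis using env_ge_1[of 1] by (simp add: zero_le_mult_iff)
  qed
  obtain K where K: "0 \<le> K" "\<forall>\<^sub>F n in sequentially. integrable M (\<lambda>w. env (X n 1 w) powr p) \<and> expectation (\<lambda>w. env (X n 1 w) powr p) \<le> K"
    using env_moment by blast
  have "\<forall>\<^sub>F n in sequentially. \<forall>i\<ge>1. integrable M (\<lambda>w. \<bar>f (X n i w)\<bar> powr p) \<and> expectation (\<lambda>w. \<bar>f (X n i w)\<bar> powr p) \<le> C powr p * K"
    using K(2) eventually_ge_at_top[of 1]
  proof eventually_elim
    case (elim n)
    have le: "\<bar>f (X n 1 w)\<bar> powr p \<le> C powr p * (env (X n 1 w) powr p)" for w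
    proof -
      have "\<bar>f (X n 1 w)\<bar> powr p \<le> (C * env (X n 1 w)) powr p"
        using C[OF X_pos[OF elim(2)]] p by (intro powr_mono2) auto
      then show ?thesis using C0 env_ge_1[of "X n 1 w"] by (simp add: powr_mult)
    qed
    have bi: "integrable M (\<lambda>w. C powr p * (env (X n 1 w) powr p))" using elim by simp
    have i: "integrable M (\<lambda>w. \<bar>f (X n 1 w)\<bar> powr p)"
      by (rule Bochner_Integration.integrable_bound[OF bi]) (use le in \<open>auto intro: order_trans[OF _ abs_ge_self]\<close>)
    have "expectation (\<lambda>w. \<bar>f (X n 1 w)\<bar> powr p) \<le> expectation (\<lambda>w. C powr p * (env (X n 1 w) powr p))"
      by (rule integral_mono[OF i bi le])
    also have "\<dots> = C powr p * expectation (\<lambda>w. env (X n 1 w) powr p)" by simp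
    also have "\<dots> \<le> C powr p * K" using elim by (intro mult_left_mono) auto
    finally have e: "expectation (\<lambda>w. \<bar>f (X n 1 w)\<bar> powr p) \<le> C powr p * K" .
    show ?case
    proof (intro allI impI)
      fix i :: nat assume "1 \<le> i"
      note L = X_law_integral[OF this, of "\<lambda>x. \<bar>f x\<bar> powr p" n]
      show "integrable M (\<lambda>w. \<bar>f (X n i w)\<bar> powr p) \<and> expectation (\<lambda>w. \<bar>f (X n i w)\<bar> powr p) \<le> C powr p * K"
        using L i e by simp
    qed
  qed
  then show ?thesis using K(1) by (intro exI[of _ "C powr p * K"]) auto
qed

lemma frechet_cdf_cont: "isCont (cdf (frechet \<alpha>\<^sub>0 1)) x"
proof -
  interpret F: real_distribution "frechet \<alpha>\<^sub>0 1" by (rule real_distribution_frechet[OF \<alpha>0_pos])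
  show ?thesis by (simp add: F.isCont_cdf measure_def frechet_null)
qed

lemma frechet_cdf_0: "x \<le> 0 \<Longrightarrow> cdf (frechet \<alpha>\<^sub>0 1) x = 0"
proof -
  interpret F: real_distribution "frechet \<alpha>\<^sub>0 1" by (rule real_distribution_frechet[OF \<alpha>0_pos])
  assume "x \<le> 0"
  then have "emeasure (frechet \<alpha>\<^sub>0 1) {..x} \<le> emeasure (frechet \<alpha>\<^sub>0 1) {..0}" by (intro emeasure_mono) auto
  then show ?thesis by (simp add: cdf_def measure_def frechet_null)
qed

lemma doa_cdf: "(\<lambda>n. prob {w\<in>space M. block_max \<xi> (r n) 1 w / \<sigma> (r n) \<le> x}) \<longlonglongrightarrow> cdf (frechet \<alpha>\<^sub>0 1) x"
proof -
  have "(\<lambda>n. cdf (distr M borel (\<lambda>w. block_max \<xi> n 1 w / \<sigma> n)) x) \<longlonglongrightarrow> cdf (frechet \<alpha>\<^sub>0 1) x"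
    using doa frechet_cdf_cont by (simp add: weak_conv_m_def weak_conv_def)
  from filterlim_compose[OF this r_lim]
  have "(\<lambda>n. cdf (distr M borel (\<lambda>w. block_max \<xi> (r n) 1 w / \<sigma> (r n))) x) \<longlonglongrightarrow> cdf (frechet \<alpha>\<^sub>0 1) x" .
  moreover have "cdf (distr M borel (\<lambda>w. block_max \<xi> (r n) 1 w / \<sigma> (r n))) x = prob {w\<in>space M. block_max \<xi> (r n) 1 w / \<sigma> (r n) \<le> x}" for n
    unfolding cdf_def by (subst measure_distr) (auto simp: vimage_def Int_def conj_commute)
  ultimately show ?thesis by simp
qed

text \<open>The clipping at \<open>c\<close> takes place below \<open>c / \<sigma> (r n)\<close>, which tends to \<open>0\<close>, where the limit law has no mass.\<close>

lemma X_weak_conv: "weak_conv_m (\<lambda>n. distr M borel (X n 1)) (frechet \<alpha>\<^sub>0 1)"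
  unfolding weak_conv_m_def weak_conv_def
proof (intro allI impI)
  fix x
  have cX: "cdf (distr M borel (X n 1)) x = prob {w\<in>space M. X n 1 w \<le> x}" for n
    unfolding cdf_def by (subst measure_distr) (auto simp: vimage_def Int_def conj_commute)
  show "(\<lambda>n. cdf (distr M borel (X n 1)) x) \<longlonglongrightarrow> cdf (frechet \<alpha>\<^sub>0 1) x"
  proof (cases "0 < x")
    case True
    have "\<forall>\<^sub>F n in sequentially. c / x < \<sigma> (r n)"
      using \<sigma>r_lim by (simp add: filterlim_at_top_dense)
    then have "\<forall>\<^sub>F n in sequentially. prob {w\<in>space M. block_max \<xi> (r n) 1 w / \<sigma> (r n) \<le> x} = cdf (distr M borel (X n 1)) x"
      using eventually_ge_at_top[of 1]
    proof eventually_elim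
      case (elim n)
      have eq: "X n 1 w \<le> x \<longleftrightarrow> block_max \<xi> (r n) 1 w / \<sigma> (r n) \<le> x" for w
        using elim \<sigma>r_pos[of n] True by (auto simp: X_def field_simps max_def)
      show ?case unfolding cX eq ..
    qed
    with doa_cdf show ?thesis by (rule Lim_transform_eventually)
  next
    case False
    have "\<forall>\<^sub>F n in sequentially. cdf (distr M borel (X n 1)) x = 0"
      using eventually_ge_at_top[of 1]
    proof eventually_elim
      case (elim n)
      have eq: "{w\<in>space M. X n 1 w \<le> x} = {}"
      proof -
        have "\<not> X n 1 w \<le> x" for w using X_pos[OF elim, of 1 w] False by linarith
        then show ?thesis by simp
      qed
      show ?case unfolding cX eq by simp
    qed
    then show ?thesis using False by (simp add: frechet_cdf_0 tendsto_eventually)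
  qed
qed

lemma X_moment_convergence:
  fixes q K :: real
  assumes g [measurable]: "g \<in> borel_measurable borel" and cont: "\<And>x. 0 < x \<Longrightarrow> isCont g x" and q: "1 < q"
    and mom: "\<forall>\<^sub>F n in sequentially. integrable M (\<lambda>w. \<bar>g (X n 1 w)\<bar> powr q) \<and> expectation (\<lambda>w. \<bar>g (X n 1 w)\<bar> powr q) \<le> K"
    and int: "integrable (frechet \<alpha>\<^sub>0 1) g"
  shows "(\<lambda>n. expectation (\<lambda>w. g (X n 1 w))) \<longlonglongrightarrow> (\<integral>x. g x \<partial>frechet \<alpha>\<^sub>0 1)"
proof -
  have "(\<lambda>n. \<integral>x. g x \<partial>distr M borel (X n 1)) \<longlonglongrightarrow> (\<integral>x. g x \<partial>frechet \<alpha>\<^sub>0 1)"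
  proof (rule weak_conv_moment_convergence[where p=q and K=K])
    show "real_distribution (distr M borel (X n 1))" for n by (rule real_distribution_distr) measurable
    show "\<forall>\<^sub>F n in sequentially. integrable (distr M borel (X n 1)) (\<lambda>x. \<bar>g x\<bar> powr q) \<and> (\<integral>x. \<bar>g x\<bar> powr q \<partial>distr M borel (X n 1)) \<le> K"
      using mom by eventually_elim (simp add: integrable_distr_eq integral_distr)
  qed (use real_distribution_frechet[OF \<alpha>0_pos] X_weak_conv g cont frechet_null(1) q int in auto)
  then show ?thesis by (simp add: integral_distr)
qed

lemma admissible_frechet_integrable:
  assumes f: "admissible f"
  shows "integrable (frechet \<alpha>\<^sub>0 1) f" "integrable (frechet \<alpha>\<^sub>0 1) (\<lambda>x. (f x)^2)"
proof -
  interpret F: real_distribution "frechet \<alpha>\<^sub>0 1" by (rule real_distribution_frechet[OF \<alpha>0_pos])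
  have fm: "f \<in> borel_measurable borel" using f by (simp add: admissible_def)
  have fm' [measurable]: "f \<in> borel_measurable (frechet \<alpha>\<^sub>0 1)" using fm by (simp cong: measurable_cong_sets)
  obtain C where C: "\<And>x. 0 < x \<Longrightarrow> \<bar>f x\<bar> \<le> C * env x" using f unfolding admissible_def by blast
  have "integrable (frechet \<alpha>\<^sub>0 1) (\<lambda>x. C^2 * (3 * (1 + x powr (- (2 * \<beta>)) + (4 / \<alpha>\<^sub>0)^2 * x powr (- (- (\<alpha>\<^sub>0 / 2))))))"
    using integrable_frechet_powr[OF \<alpha>0_pos, of "2 * \<beta>"] integrable_frechet_powr[OF \<alpha>0_pos, of "- (\<alpha>\<^sub>0 / 2)"] \<alpha>0_pos \<beta> by simp
  moreover have "(f x)^2 \<le> C^2 * (3 * (1 + x powr (- (2 * \<beta>)) + (4 / \<alpha>\<^sub>0)^2 * x powr (- (- (\<alpha>\<^sub>0 / 2)))))" if "0 < x" for x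
  proof -
    have 3: "(u + v + z)^2 \<le> 3 * (u^2 + v^2 + z^2)" for u v z :: real
      using zero_le_power2[of "u - v"] zero_le_power2[of "u - z"] zero_le_power2[of "v - z"]
      by (simp add: power2_eq_square algebra_simps)
    have ln_le: "max 0 (ln x) \<le> (4 / \<alpha>\<^sub>0) * x powr (\<alpha>\<^sub>0 / 4)"
    proof (cases "1 \<le> x")
      case True
      then show ?thesis using ln_powr_bound[of x "\<alpha>\<^sub>0 / 4"] \<alpha>0_pos by (simp add: field_simps)
    next
      case False
      then have "ln x \<le> 0" using that by simp
      then show ?thesis using \<alpha>0_pos by simp
    qed
    have "(f x)^2 = \<bar>f x\<bar>^2" by simp
    also have "\<dots> \<le> (C * env x)^2" using C[OF that] by (intro power_mono) auto
    also have "\<dots> = C^2 * (env x)^2" by (simp add: power_mult_distrib)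
    also have "\<dots> \<le> C^2 * (3 * (1 + x powr (- (2 * \<beta>)) + (4 / \<alpha>\<^sub>0)^2 * x powr (- (- (\<alpha>\<^sub>0 / 2)))))"
    proof (intro mult_left_mono)
      have "(env x)^2 \<le> 3 * (1^2 + (x powr (- \<beta>))^2 + (max 0 (ln x))^2)" unfolding env_def by (rule 3)
      also have "(x powr (- \<beta>))^2 = x powr (- (2 * \<beta>))" using that by (simp add: powr_power mult.commute)
      also have "(max 0 (ln x))^2 \<le> ((4 / \<alpha>\<^sub>0) * x powr (\<alpha>\<^sub>0 / 4))^2" using ln_le by (intro power_mono) auto
      also have "((4 / \<alpha>\<^sub>0) * x powr (\<alpha>\<^sub>0 / 4))^2 = (4 / \<alpha>\<^sub>0)^2 * x powr (- (- (\<alpha>\<^sub>0 / 2)))"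
        unfolding power_mult_distrib using that by (simp add: powr_power)
      finally show "(env x)^2 \<le> 3 * (1 + x powr (- (2 * \<beta>)) + (4 / \<alpha>\<^sub>0)^2 * x powr (- (- (\<alpha>\<^sub>0 / 2))))" by simp
    qed simp
    finally show ?thesis .
  qed
  moreover have "AE x in frechet \<alpha>\<^sub>0 1. 0 < x"
    by (rule AE_I[where N="{..0}"]) (auto simp: frechet_null)
  ultimately show sq: "integrable (frechet \<alpha>\<^sub>0 1) (\<lambda>x. (f x)^2)"
    by (elim Bochner_Integration.integrable_bound) (auto elim!: eventually_mono intro: order_trans[OF _ abs_ge_self])
  show "integrable (frechet \<alpha>\<^sub>0 1) f"
    by (rule F.square_integrable_imp_integrable[OF _ sq]) simp
qed

text \<open>For the second moment, \<open>\<bar>f\<bar> powr p\<close> is the moment of order \<open>p / 2 > 1\<close> of \<open>f^2\<close>.\<close>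

lemma admissible_mean:
  assumes f: "admissible f"
  shows "(\<lambda>n. expectation (\<lambda>w. f (X n 1 w))) \<longlonglongrightarrow> (\<integral>x. f x \<partial>frechet \<alpha>\<^sub>0 1)"
    "(\<lambda>n. expectation (\<lambda>w. (f (X n 1 w))^2)) \<longlonglongrightarrow> (\<integral>x. (f x)^2 \<partial>frechet \<alpha>\<^sub>0 1)"
proof -
  have fm [measurable]: "f \<in> borel_measurable borel" and fc: "\<And>x. 0 < x \<Longrightarrow> isCont f x" using f by (auto simp: admissible_def)
  obtain K where K: "\<forall>\<^sub>F n in sequentially. \<forall>i\<ge>1. integrable M (\<lambda>w. \<bar>f (X n i w)\<bar> powr p) \<and> expectation (\<lambda>w. \<bar>f (X n i w)\<bar> powr p) \<le> K"
    using admissible_moment[OF f] by blast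
  have K1: "\<forall>\<^sub>F n in sequentially. integrable M (\<lambda>w. \<bar>f (X n 1 w)\<bar> powr p) \<and> expectation (\<lambda>w. \<bar>f (X n 1 w)\<bar> powr p) \<le> K"
    using K by eventually_elim simp
  show "(\<lambda>n. expectation (\<lambda>w. f (X n 1 w))) \<longlonglongrightarrow> (\<integral>x. f x \<partial>frechet \<alpha>\<^sub>0 1)"
    by (rule X_moment_convergence[OF fm fc _ K1 admissible_frechet_integrable(1)[OF f]]) (use p in auto)
  have eq: "\<bar>(f x)^2\<bar> powr (p / 2) = \<bar>f x\<bar> powr p" for x
  proof -
    have "\<bar>(f x)^2\<bar> = \<bar>f x\<bar> powr 2"
    proof (cases "f x = 0")
      case False
      then show ?thesis using powr_realpow[of "\<bar>f x\<bar>" 2] by simp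
    qed simp
    then show ?thesis by (simp only: powr_powr) simp
  qed
  have K2: "\<forall>\<^sub>F n in sequentially. integrable M (\<lambda>w. \<bar>(f (X n 1 w))^2\<bar> powr (p / 2)) \<and> expectation (\<lambda>w. \<bar>(f (X n 1 w))^2\<bar> powr (p / 2)) \<le> K"
    unfolding eq by (rule K1)
  show "(\<lambda>n. expectation (\<lambda>w. (f (X n 1 w))^2)) \<longlonglongrightarrow> (\<integral>x. (f x)^2 \<partial>frechet \<alpha>\<^sub>0 1)"
    by (rule X_moment_convergence[OF _ _ _ K2 admissible_frechet_integrable(2)[OF f]]) (use p fc in \<open>auto intro!: continuous_intros\<close>)
qed

end

section \<open>Mixing bounds for block maxima\<close>

context frechet_block_maxima
begin

lemma mixing_nonneg: "0 \<le> mixing_coeff M \<xi> l"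
proof -
  have "{} \<in> generated_events M \<xi> T" for T by (simp add: generated_events_def sigma_sets.Empty)
  from mixing_coeff_upper[OF this this, of l] show ?thesis by simp
qed

lemma X_window:
  assumes "block (r n) i \<subseteq> J"
  shows "f (X n i w) = f (max (block_max (\<lambda>t z. z t) (r n) i (window \<xi> J 0 w)) c / \<sigma> (r n))"
  unfolding X_def block_max_window[OF assms, of \<xi> w] ..

lemma X_window_measurable:
  assumes J: "block (r n) i \<subseteq> J" and f [measurable]: "f \<in> borel_measurable borel"
  shows "(\<lambda>z. f (max (block_max (\<lambda>t z. z t) (r n) i z) c / \<sigma> (r n))) \<in> borel_measurable (PiM J (\<lambda>_. borel))"
proof -
  have [measurable]: "block_max (\<lambda>t z. z t) (r n) i \<in> borel_measurable (PiM J (\<lambda>_. borel :: real measure))"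
    by (rule block_max_coordinates_measurable[OF J])
  show ?thesis by measurable
qed

lemma block_le: "block m i \<subseteq> {..int i * int m}" and block_ge: "block m i \<subseteq> {(int i - 1) * int m + 1..}"
  by (auto simp: block_def)

lemma mixing_covariance_X:
  assumes ij: "i + 2 \<le> j" and f: "f \<in> borel_measurable borel" "\<And>x. \<bar>f x\<bar> \<le> a" and a: "0 < a"
  shows "\<bar>expectation (\<lambda>w. f (X n i w) * f (X n j w)) - expectation (\<lambda>w. f (X n i w)) * expectation (\<lambda>w. f (X n j w))\<bar>
    \<le> 4 * a * a * mixing_coeff M \<xi> (r n)"
proof -
  let ?u = "\<lambda>i z. f (max (block_max (\<lambda>t z. z t) (r n) i z) c / \<sigma> (r n))"
  have "(int i + 1) * int (r n) \<le> (int j - 1) * int (r n)" using ij by (intro mult_right_mono) auto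
  then have J': "block (r n) j \<subseteq> {int i * int (r n) + int (r n)..}"
    using block_ge[of "r n" j] by (auto simp: algebra_simps)
  have eq: "f (X n i w) = ?u i (window \<xi> (block (r n) i) 0 w)" for i w by (rule X_window[OF order_refl])
  show ?thesis
    unfolding eq
    by (rule mixing_covariance[OF stat rv finite_block block_le finite_block J', of "?u i" a "?u j" a])
       (use X_window_measurable[OF order_refl f(1)] f(2) a in auto)
qed

text \<open>Blocks with indices at distance two are separated by \<open>r n\<close> observations. The mixing bound applies
  to the truncated functions and the moment bound to what truncation removes.\<close>

lemma covariance_far:
  assumes ij: "i + 2 \<le> j" "1 \<le> i" and f [measurable]: "f \<in> borel_measurable borel" and T: "1 \<le> T"
    and mom: "\<And>i. 1 \<le> i \<Longrightarrow> integrable M (\<lambda>w. \<bar>f (X n i w)\<bar> powr p) \<and> expectation (\<lambda>w. \<bar>f (X n i w)\<bar> powr p) \<le> K"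
  shows "\<bar>expectation (\<lambda>w. f (X n i w) * f (X n j w)) - expectation (\<lambda>w. f (X n i w)) * expectation (\<lambda>w. f (X n j w))\<bar>
    \<le> 4 * T^2 * mixing_coeff M \<xi> (r n) + (4 * K + 2 * K * (1 + K)) * T powr (2 - p)"
proof -
  have j: "1 \<le> j" using ij by simp
  have "\<bar>(expectation (\<lambda>w. f (X n i w) * f (X n j w)) - expectation (\<lambda>w. f (X n i w)) * expectation (\<lambda>w. f (X n j w)))
     - (expectation (\<lambda>w. trunc T (f (X n i w)) * trunc T (f (X n j w))) - expectation (\<lambda>w. trunc T (f (X n i w))) * expectation (\<lambda>w. trunc T (f (X n j w))))\<bar>
     \<le> (4 * K + 2 * K * (1 + K)) * T powr (2 - p)"
    by (rule covariance_truncation) (use mom[OF ij(2)] mom[OF j] p T in auto)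
  moreover have "\<bar>expectation (\<lambda>w. trunc T (f (X n i w)) * trunc T (f (X n j w))) - expectation (\<lambda>w. trunc T (f (X n i w))) * expectation (\<lambda>w. trunc T (f (X n j w)))\<bar>
    \<le> 4 * T * T * mixing_coeff M \<xi> (r n)"
    by (rule mixing_covariance_X[OF ij(1), of "\<lambda>x. trunc T (f x)"]) (use T abs_trunc_le in auto)
  ultimately show ?thesis by (simp add: power2_eq_square)
qed

text \<open>The largest of the first \<open>m - l\<close> observations: a gap of \<open>l\<close> separates it from the second block.\<close>

definition clipped :: "nat \<Rightarrow> nat \<Rightarrow> 'a \<Rightarrow> real" where
  "clipped l m w = Max ((\<lambda>t. \<xi> t w) ` {1..int m - int l})"

text \<open>A single observation is negligible on the scale of block maxima, since \<open>\<sigma> (r n)\<close> diverges.\<close>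

lemma single_tail: "(\<lambda>n. prob {w\<in>space M. y * \<sigma> (r n) < \<xi> 0 w}) \<longlonglongrightarrow> 0" if "0 < y"
proof -
  interpret D: real_distribution "distr M borel (\<xi> 0)" by (rule real_distribution_distr) (rule rv)
  have [measurable]: "\<xi> 0 \<in> borel_measurable M" by (rule rv)
  have "filterlim (\<lambda>n. y * \<sigma> (r n)) at_top sequentially"
    by (rule filterlim_tendsto_pos_mult_at_top[OF tendsto_const that \<sigma>r_lim])
  from filterlim_compose[OF D.cdf_lim_at_top_prob this]
  have "(\<lambda>n. 1 - cdf (distr M borel (\<xi> 0)) (y * \<sigma> (r n))) \<longlonglongrightarrow> 1 - 1" by (intro tendsto_intros)
  moreover have "1 - cdf (distr M borel (\<xi> 0)) z = prob {w\<in>space M. z < \<xi> 0 w}" for z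
  proof -
    have "cdf (distr M borel (\<xi> 0)) z = prob {w\<in>space M. \<xi> 0 w \<le> z}"
      unfolding cdf_def by (subst measure_distr) (auto simp: vimage_def Int_def conj_commute)
    moreover have "{w\<in>space M. z < \<xi> 0 w} = space M - {w\<in>space M. \<xi> 0 w \<le> z}" by auto
    ultimately show ?thesis by (simp add: prob_compl)
  qed
  ultimately show ?thesis by simp
qed

lemma single_law: "prob {w\<in>space M. z < \<xi> t w} = prob {w\<in>space M. z < \<xi> 0 w}"
proof -
  define S where "S = {f\<in>space (PiM {0::int} (\<lambda>_. borel :: real measure)). z < f 0}"
  have "S \<in> sets (PiM {0::int} (\<lambda>_. borel))" unfolding S_def by measurable
  from stationary_window_prob[OF stat rv _ this, of t]
  have "prob {w\<in>space M. window \<xi> {0} t w \<in> S} = prob {w\<in>space M. window \<xi> {0} 0 w \<in> S}" by simp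
  moreover have "window \<xi> {0} h w \<in> S \<longleftrightarrow> z < \<xi> h w" for h w by (simp add: S_def window_def space_PiM)
  ultimately show ?thesis by simp
qed

lemma clipped_measurable [measurable]: "clipped l m \<in> borel_measurable M"
  unfolding clipped_def[abs_def] by (rule borel_measurable_Max) (use rv in auto)

text \<open>If the maximum is lost by omitting the last \<open>l\<close> observations, then it is attained among these: either
  one of them exceeds \<open>y * s\<close>, or the whole block maximum does not.\<close>

lemma clipped_differs_le:
  assumes l: "l < m" and s: "0 < s"
  shows "prob {w\<in>space M. block_max \<xi> m 1 w \<noteq> clipped l m w}
    \<le> real l * prob {w\<in>space M. y * s < \<xi> 0 w} + prob {w\<in>space M. block_max \<xi> m 1 w / s \<le> y}"
proof -
  have [measurable]: "\<xi> t \<in> borel_measurable M" for t by (rule rv)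
  define last where "last = {int m - int l + 1..int m}"
  have sub: "{w\<in>space M. block_max \<xi> m 1 w \<noteq> clipped l m w}
    \<subseteq> (\<Union>t\<in>last. {w\<in>space M. y * s < \<xi> t w}) \<union> {w\<in>space M. block_max \<xi> m 1 w / s \<le> y}"
  proof
    fix w assume w: "w \<in> {w\<in>space M. block_max \<xi> m 1 w \<noteq> clipped l m w}"
    show "w \<in> (\<Union>t\<in>last. {w\<in>space M. y * s < \<xi> t w}) \<union> {w\<in>space M. block_max \<xi> m 1 w / s \<le> y}"
    proof (rule ccontr)
      assume n: "w \<notin> (\<Union>t\<in>last. {w\<in>space M. y * s < \<xi> t w}) \<union> {w\<in>space M. block_max \<xi> m 1 w / s \<le> y}"
      have big: "y * s < block_max \<xi> m 1 w" using n w s by (auto simp: not_le field_simps)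
      have small: "\<xi> t w \<le> y * s" if "t \<in> last" for t using n w that by (auto simp: not_less)
      have "block_max \<xi> m 1 w \<in> (\<lambda>t. \<xi> t w) ` {1..int m}"
        unfolding block_max_def using l by (intro Max_in[of "(\<lambda>t. \<xi> t w) ` {1..int m}", simplified] | simp)+
      then obtain t where t: "t \<in> {1..int m}" "block_max \<xi> m 1 w = \<xi> t w" by auto
      have "t \<notin> last" using small[of t] big t by auto
      then have tt: "t \<in> {1..int m - int l}" using t by (auto simp: last_def)
      have "block_max \<xi> m 1 w \<le> clipped l m w" unfolding t(2) clipped_def using tt by (intro Max_ge) auto
      moreover have "clipped l m w \<le> block_max \<xi> m 1 w"
        unfolding clipped_def block_max_def using l by (intro Max_mono) auto
      ultimately show False using w by simp
    qed
  qed
  have S1: "{w\<in>space M. y * s < \<xi> t w} \<in> sets M" for t by measurable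
  have S2: "{w\<in>space M. block_max \<xi> m 1 w / s \<le> y} \<in> sets M" by measurable
  have S3: "(\<Union>t\<in>last. {w\<in>space M. y * s < \<xi> t w}) \<in> sets M" by (intro sets.finite_UN S1) (simp add: last_def)
  let ?U = "\<Union>t\<in>last. {w\<in>space M. y * s < \<xi> t w}" and ?L = "{w\<in>space M. block_max \<xi> m 1 w / s \<le> y}"
  have 1: "prob {w\<in>space M. block_max \<xi> m 1 w \<noteq> clipped l m w} \<le> prob (?U \<union> ?L)"
    by (rule finite_measure_mono[OF sub sets.Un[OF S3 S2]])
  have 2: "prob (?U \<union> ?L) \<le> prob ?U + prob ?L" by (rule measure_Un_le[OF S3 S2])
  have 3: "prob ?U \<le> (\<Sum>t\<in>last. prob {w\<in>space M. y * s < \<xi> t w})"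
    by (rule finite_measure_subadditive_finite) (use S1 in \<open>auto simp: last_def\<close>)
  have 4: "(\<Sum>t\<in>last. prob {w\<in>space M. y * s < \<xi> t w}) = real l * prob {w\<in>space M. y * s < \<xi> 0 w}"
  proof -
    have "(\<Sum>t\<in>last. prob {w\<in>space M. y * s < \<xi> t w}) = (\<Sum>t\<in>last. prob {w\<in>space M. y * s < \<xi> 0 w})"
      by (intro sum.cong refl single_law)
    then show ?thesis by (simp add: last_def)
  qed
  show ?thesis using 1 2 3 unfolding 4 by linarith
qed

text \<open>The first block maximum is replaced by the one with the last \<open>l\<close> observations left out. For \<open>l\<close> fixed
  the replacement is harmless as \<open>n\<close> grows, and for \<open>l\<close> large the mixing coefficient at \<open>l\<close> is small.\<close>

lemma bounded_covariance_adjacent: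
  fixes f :: "real \<Rightarrow> real" and T e :: real
  assumes f [measurable]: "f \<in> borel_measurable borel" and b: "\<And>x. \<bar>f x\<bar> \<le> T" and T: "0 < T" and e: "0 < e"
  shows "\<forall>\<^sub>F n in sequentially.
    \<bar>expectation (\<lambda>w. f (X n 1 w) * f (X n 2 w)) - expectation (\<lambda>w. f (X n 1 w)) * expectation (\<lambda>w. f (X n 2 w))\<bar> < e"
proof -
  have "\<forall>\<^sub>F l in sequentially. mixing_coeff M \<xi> l < e / (16 * T^2)"
    using e T by (intro order_tendstoD(2)[OF mixing]) auto
  then obtain l where l: "mixing_coeff M \<xi> l < e / (16 * T^2)" by (auto simp: eventually_sequentially)
  define d where "d = e / (16 * T^2)"
  have d: "0 < d" using e T by (simp add: d_def)
  have "(cdf (frechet \<alpha>\<^sub>0 1) \<longlongrightarrow> cdf (frechet \<alpha>\<^sub>0 1) 0) (at 0)"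
    using frechet_cdf_cont[of 0] by (simp add: isCont_def)
  then have "(cdf (frechet \<alpha>\<^sub>0 1) \<longlongrightarrow> 0) (at_right 0)"
    using frechet_cdf_0[of 0] by (auto intro: tendsto_within_subset)
  then have "\<forall>\<^sub>F y in at_right 0. cdf (frechet \<alpha>\<^sub>0 1) y < d" using d by (rule order_tendstoD(2))
  then obtain y where y: "0 < y" "cdf (frechet \<alpha>\<^sub>0 1) y < d"
    using eventually_happens[of "\<lambda>y. cdf (frechet \<alpha>\<^sub>0 1) y < d \<and> 0 < y" "at_right 0"] eventually_at_right_less[of 0]
    by (auto simp: eventually_conj_iff trivial_limit_at_right_real)
  have "(\<lambda>n. real l * prob {w\<in>space M. y * \<sigma> (r n) < \<xi> 0 w} + prob {w\<in>space M. block_max \<xi> (r n) 1 w / \<sigma> (r n) \<le> y})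
     \<longlonglongrightarrow> real l * 0 + cdf (frechet \<alpha>\<^sub>0 1) y"
    by (intro tendsto_intros single_tail y doa_cdf)
  then have ev: "\<forall>\<^sub>F n in sequentially. real l * prob {w\<in>space M. y * \<sigma> (r n) < \<xi> 0 w} + prob {w\<in>space M. block_max \<xi> (r n) 1 w / \<sigma> (r n) \<le> y} < d"
    by (rule order_tendstoD(2)) (use y in simp)
  have "\<forall>\<^sub>F n in sequentially. Suc l \<le> r n" using r_lim unfolding filterlim_at_top by blast
  then have rl: "\<forall>\<^sub>F n in sequentially. l < r n" by (rule eventually_mono) simp
  show ?thesis
    using ev rl eventually_ge_at_top[of 1]
  proof eventually_elim
    case (elim n)
    have \<sigma>0: "0 < \<sigma> (r n)" by (rule \<sigma>r_pos[OF elim(3)])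
    define U where "U w = f (X n 1 w)" for w
    define V where "V w = f (X n 2 w)" for w
    define U' where "U' w = f (max (clipped l (r n) w) c / \<sigma> (r n))" for w
    have [measurable]: "U \<in> borel_measurable M" "V \<in> borel_measurable M" "U' \<in> borel_measurable M"
      unfolding U_def[abs_def] V_def[abs_def] U'_def[abs_def] by measurable
    have ub: "\<bar>U w\<bar> \<le> T" "\<bar>V w\<bar> \<le> T" "\<bar>U' w\<bar> \<le> T" for w by (simp_all add: U_def V_def U'_def b)
    have ub2: "\<bar>U w * V w\<bar> \<le> T * T" "\<bar>U' w * V w\<bar> \<le> T * T" for w
      unfolding abs_mult using ub T by (auto intro!: mult_mono)
    have int1: "integrable M U" "integrable M V" "integrable M U'"
      by (rule integrable_const_bound[where B=T]; use ub in simp)+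
    have int2: "integrable M (\<lambda>w. U w * V w)" "integrable M (\<lambda>w. U' w * V w)"
      by (rule integrable_const_bound[where B="T * T"]; use ub2 in simp)+
    note int = int1 int2
    define N where "N = {w\<in>space M. block_max \<xi> (r n) 1 w \<noteq> clipped l (r n) w}"
    have Nm [measurable]: "N \<in> sets M" unfolding N_def by measurable
    have PN: "prob N < d" using clipped_differs_le[OF elim(2) \<sigma>0, of y] elim(1) unfolding N_def by linarith
    have UU': "\<bar>U w - U' w\<bar> \<le> 2 * T * indicator N w" if "w \<in> space M" for w
    proof (cases "w \<in> N")
      case True
      then show ?thesis using ub(1)[of w] ub(3)[of w] by simp
    next
      case False
      then have "U w = U' w" using that by (simp add: N_def U_def U'_def X_def)
      then show ?thesis using T by simp
    qed
    have intN: "integrable M (\<lambda>w. t * indicator N w :: real)" for t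
      by (intro integrable_mult_right integrable_real_indicator) (simp_all add: emeasure_eq_measure)
    have EI: "expectation (\<lambda>w. t * indicator N w) = t * prob N" for t by simp
    have c1: "\<bar>expectation (\<lambda>w. U w * V w) - expectation (\<lambda>w. U' w * V w)\<bar> \<le> 2 * T * T * prob N"
    proof -
      have "\<bar>expectation (\<lambda>w. U w * V w) - expectation (\<lambda>w. U' w * V w)\<bar> = \<bar>expectation (\<lambda>w. U w * V w - U' w * V w)\<bar>" using int by simp
      also have "\<dots> \<le> expectation (\<lambda>w. \<bar>U w * V w - U' w * V w\<bar>)" by (rule integral_abs_bound)
      also have "\<dots> \<le> expectation (\<lambda>w. 2 * T * T * indicator N w)"
      proof (rule integral_mono)
        fix w assume w: "w \<in> space M"
        have "\<bar>U w * V w - U' w * V w\<bar> = \<bar>U w - U' w\<bar> * \<bar>V w\<bar>" by (simp add: abs_mult[symmetric] left_diff_distrib)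
        also have "\<dots> \<le> (2 * T * indicator N w) * T" using UU'[OF w] ub T by (intro mult_mono) auto
        finally show "\<bar>U w * V w - U' w * V w\<bar> \<le> 2 * T * T * indicator N w" by (simp add: mult_ac)
      qed (intro integrable_abs Bochner_Integration.integrable_diff int intN)+
      finally show ?thesis by (simp only: EI)
    qed
    have c2: "\<bar>expectation U - expectation U'\<bar> \<le> 2 * T * prob N"
    proof -
      have "\<bar>expectation U - expectation U'\<bar> = \<bar>expectation (\<lambda>w. U w - U' w)\<bar>" using int by simp
      also have "\<dots> \<le> expectation (\<lambda>w. \<bar>U w - U' w\<bar>)" by (rule integral_abs_bound)
      also have "\<dots> \<le> expectation (\<lambda>w. 2 * T * indicator N w)" using UU' by (intro integral_mono integrable_abs Bochner_Integration.integrable_diff int intN) auto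
      finally show ?thesis by (simp only: EI)
    qed
    have c3: "\<bar>expectation (\<lambda>w. U' w * V w) - expectation U' * expectation V\<bar> \<le> 4 * T * T * mixing_coeff M \<xi> l"
    proof -
      define J where "J = {1..int (r n) - int l}"
      define u where "u z = f (max (Max ((\<lambda>t. z t) ` J)) c / \<sigma> (r n))" for z :: "int \<Rightarrow> real"
      let ?v = "\<lambda>z. f (max (block_max (\<lambda>t z. z t) (r n) 2 z) c / \<sigma> (r n))"
      have Jm: "(\<lambda>z. Max ((\<lambda>t. z t) ` J)) \<in> borel_measurable (PiM J (\<lambda>_. borel :: real measure))"
        by (rule borel_measurable_Max) (auto simp: J_def)
      have um: "u \<in> borel_measurable (PiM J (\<lambda>_. borel))"
        unfolding u_def by (intro measurable_compose[OF _ f] borel_measurable_divide borel_measurable_max Jm borel_measurable_const)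
      have uU: "U' w = u (window \<xi> J 0 w)" for w
        unfolding U'_def u_def clipped_def window_def J_def by (intro arg_cong[where f="\<lambda>S. f (max (Max S) c / \<sigma> (r n))"] image_cong) auto
      have vV: "V w = ?v (window \<xi> (block (r n) 2) 0 w)" for w
        unfolding V_def by (rule X_window[OF order_refl])
      show ?thesis unfolding uU[abs_def] vV[abs_def]
      proof (rule mixing_covariance[OF stat rv, where m="int (r n) - int l"])
        show "block (r n) 2 \<subseteq> {int (r n) - int l + int l..}" using block_ge[of "r n" 2] by auto
        show "?v \<in> borel_measurable (PiM (block (r n) 2) (\<lambda>_. borel))" by (rule X_window_measurable[OF order_refl f])
      qed (use um b T in \<open>auto simp: J_def u_def\<close>)
    qed
    have eV: "\<bar>expectation V\<bar> \<le> T"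
    proof -
      have "\<bar>expectation V\<bar> \<le> expectation (\<lambda>w. \<bar>V w\<bar>)" by (rule integral_abs_bound)
      also have "\<dots> \<le> expectation (\<lambda>w. T)" using int ub by (intro integral_mono) auto
      finally show ?thesis by (simp add: prob_space)
    qed
    have c2': "\<bar>(expectation U - expectation U') * expectation V\<bar> \<le> 2 * T * prob N * T"
      unfolding abs_mult using c2 eV by (intro mult_mono) auto
    have "expectation (\<lambda>w. U w * V w) - expectation U * expectation V
      = (expectation (\<lambda>w. U w * V w) - expectation (\<lambda>w. U' w * V w)) + (expectation (\<lambda>w. U' w * V w) - expectation U' * expectation V)
        - (expectation U - expectation U') * expectation V" by (simp add: algebra_simps)
    then have "\<bar>expectation (\<lambda>w. U w * V w) - expectation U * expectation V\<bar>
      \<le> 2 * T * T * prob N + 4 * T * T * mixing_coeff M \<xi> l + 2 * T * prob N * T"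
      using c1 c2' c3 by linarith
    also have "\<dots> = 4 * T^2 * prob N + 4 * T^2 * mixing_coeff M \<xi> l" by (simp add: power2_eq_square)
    also have "\<dots> < 4 * T^2 * d + 4 * T^2 * d"
      using PN l T by (intro add_strict_mono mult_strict_left_mono) (auto simp: d_def)
    also have "\<dots> = e / 2" using T by (simp add: d_def)
    also have "\<dots> < e" using e by simp
    finally show ?case unfolding U_def[abs_def] V_def[abs_def] .
  qed
qed

end

section \<open>Central limit theorem for sums over blocks\<close>

context frechet_block_maxima
begin

lemma X_pair_law_integral:
  fixes f :: "real \<Rightarrow> real"
  assumes "1 \<le> i" and f [measurable]: "f \<in> borel_measurable borel"
  shows "expectation (\<lambda>w. f (X n i w) * f (X n (Suc i) w)) = expectation (\<lambda>w. f (X n 1 w) * f (X n 2 w))"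
proof -
  let ?g = "\<lambda>q. f (max (fst q) c / \<sigma> (r n)) * f (max (snd q) c / \<sigma> (r n)) :: real"
  have "expectation (\<lambda>w. f (X n (i + 1) w) * f (X n (i + 2) w))
     = (\<integral>q. ?g q \<partial>distr M (borel \<Otimes>\<^sub>M borel) (\<lambda>w. (block_max \<xi> (r n) (i + 1) w, block_max \<xi> (r n) (i + 2) w)))" for i
    by (subst integral_distr) (auto simp: X_def)
  from this[of "i - 1"] this[of 0] show ?thesis
    using assms(1) block_max_pair_law[OF stat rv, of "r n" "i - 1"] block_max_pair_law[OF stat rv, of "r n" 0]
    by (simp add: numeral_2_eq_2)
qed

text \<open>A fixed large truncation level reduces the claim to bounded functions.\<close>

lemma covariance_adjacent:
  assumes f: "admissible f"
  shows "(\<lambda>n. expectation (\<lambda>w. f (X n 1 w) * f (X n 2 w)) - expectation (\<lambda>w. f (X n 1 w)) * expectation (\<lambda>w. f (X n 2 w))) \<longlonglongrightarrow> 0"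
proof (rule tendstoI)
  fix e :: real assume e: "0 < e"
  have fm [measurable]: "f \<in> borel_measurable borel" using f by (simp add: admissible_def)
  obtain K where K: "\<forall>\<^sub>F n in sequentially. \<forall>i\<ge>1. integrable M (\<lambda>w. \<bar>f (X n i w)\<bar> powr p) \<and> expectation (\<lambda>w. \<bar>f (X n i w)\<bar> powr p) \<le> K"
    using admissible_moment[OF f] by blast
  have "(\<lambda>m. (4 * K + 2 * K * (1 + K)) * real m powr (2 - p)) \<longlonglongrightarrow> 0"
    by (rule tendsto_mult_right_zero, rule tendsto_neg_powr[OF _ filterlim_real_sequentially]) (use p in simp)
  then have "\<forall>\<^sub>F m in sequentially. (4 * K + 2 * K * (1 + K)) * real m powr (2 - p) < e / 2"
    by (rule order_tendstoD(2)) (use e in simp)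
  then have "\<forall>\<^sub>F m in sequentially. (4 * K + 2 * K * (1 + K)) * real m powr (2 - p) < e / 2 \<and> 1 \<le> m"
    using eventually_ge_at_top[of 1] by (rule eventually_conj)
  then obtain m :: nat where m: "(4 * K + 2 * K * (1 + K)) * real m powr (2 - p) < e / 2" "1 \<le> real m"
    by (auto simp: eventually_sequentially)
  define T where "T = real m"
  have bnd: "\<forall>\<^sub>F n in sequentially.
    \<bar>expectation (\<lambda>w. trunc T (f (X n 1 w)) * trunc T (f (X n 2 w))) - expectation (\<lambda>w. trunc T (f (X n 1 w))) * expectation (\<lambda>w. trunc T (f (X n 2 w)))\<bar> < e / 2"
    by (rule bounded_covariance_adjacent[of "\<lambda>x. trunc T (f x)" T]) (use m e abs_trunc_le in \<open>auto simp: T_def\<close>)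
  show "\<forall>\<^sub>F n in sequentially. dist (expectation (\<lambda>w. f (X n 1 w) * f (X n 2 w)) - expectation (\<lambda>w. f (X n 1 w)) * expectation (\<lambda>w. f (X n 2 w))) 0 < e"
    using K bnd
  proof eventually_elim
    case (elim n)
    have "\<bar>(expectation (\<lambda>w. f (X n 1 w) * f (X n 2 w)) - expectation (\<lambda>w. f (X n 1 w)) * expectation (\<lambda>w. f (X n 2 w)))
     - (expectation (\<lambda>w. trunc T (f (X n 1 w)) * trunc T (f (X n 2 w))) - expectation (\<lambda>w. trunc T (f (X n 1 w))) * expectation (\<lambda>w. trunc T (f (X n 2 w))))\<bar>
     \<le> (4 * K + 2 * K * (1 + K)) * T powr (2 - p)"
      by (rule covariance_truncation) (use elim(1)[rule_format, of 1] elim(1)[rule_format, of 2] p m in \<open>auto simp: T_def\<close>)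
    then show ?case using elim(2) m(1) unfolding T_def[symmetric] dist_real_def by linarith
  qed
qed

definition lim_var where "lim_var f = (\<integral>x. (f x)^2 \<partial>frechet \<alpha>\<^sub>0 1) - (\<integral>x. f x \<partial>frechet \<alpha>\<^sub>0 1)^2"

lemma lim_var_nonneg: "admissible f \<Longrightarrow> 0 \<le> lim_var f"
proof -
  assume f: "admissible f"
  interpret F: real_distribution "frechet \<alpha>\<^sub>0 1" by (rule real_distribution_frechet[OF \<alpha>0_pos])
  have "0 \<le> F.variance f" by (rule F.variance_positive)
  also have "F.variance f = lim_var f"
    unfolding lim_var_def by (rule F.variance_eq) (use admissible_frechet_integrable[OF f] in auto)
  finally show ?thesis .
qed

text \<open>The array of values at block maxima has the covariances that the central limit theorem for arrays
  asks for. The covariances of nonadjacent blocks are bounded with truncation level \<open>k n powr s\<close>.\<close>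

lemma covariance_structure:
  assumes f: "admissible f"
  shows "\<exists>e. (\<forall>n. 0 \<le> e n) \<and> e \<longlonglongrightarrow> 0 \<and> (\<forall>\<^sub>F n in sequentially. \<forall>i\<in>{1..k n}. \<forall>j\<in>{1..k n}.
     \<bar>expectation (\<lambda>w. f (X n i w) * f (X n j w)) - expectation (\<lambda>w. f (X n 1 w))^2 - (if i = j then lim_var f else 0)\<bar>
       \<le> e n / real (k n) + (if j \<in> {i - 1, i, Suc i} then e n else 0))"
proof -
  have fm [measurable]: "f \<in> borel_measurable borel" using f by (simp add: admissible_def)
  obtain K where K: "0 \<le> K" "\<forall>\<^sub>F n in sequentially. \<forall>i\<ge>1. integrable M (\<lambda>w. \<bar>f (X n i w)\<bar> powr p) \<and> expectation (\<lambda>w. \<bar>f (X n i w)\<bar> powr p) \<le> K"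
    using admissible_moment[OF f] by blast
  \<comment> \<open>\<open>s < \<omega> / 2\<close> keeps \<open>k * (k powr s)^2\<close> below \<open>k powr (1 + \<omega>)\<close>, and \<open>1 / (p - 2) < s\<close> makes
    \<open>k * (k powr s) powr (2 - p)\<close> vanish\<close>
  define s where "s = (1 / (p - 2) + \<omega> / 2) / 2"
  have s: "0 < s" "1 / (p - 2) < s" "s < \<omega> / 2"
  proof -
    have avg: "0 < (z + u) / 2" "z < (z + u) / 2" "(z + u) / 2 < u" if "0 < z" "z < u" for z u :: real
      using that by auto
    have 1: "1 / (p - 2) < \<omega> / 2" using p \<omega>_pos by (simp add: field_simps)
    have 2: "0 < 1 / (p - 2)" using p by simp
    show "0 < s" "1 / (p - 2) < s" "s < \<omega> / 2" unfolding s_def by (fact avg[OF 2 1])+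
  qed
  define \<mu> where "\<mu> n = expectation (\<lambda>w. f (X n 1 w))" for n
  define C where "C = 4 * K + 2 * K * (1 + K)"
  have C0: "0 \<le> C" using K(1) by (simp add: C_def)
  define far where "far n = 4 * (real (k n) powr s)^2 * mixing_coeff M \<xi> (r n) + C * (real (k n) powr s) powr (2 - p)" for n
  define diag where "diag n = \<bar>expectation (\<lambda>w. (f (X n 1 w))^2) - (\<mu> n)^2 - lim_var f\<bar>" for n
  define adj where "adj n = \<bar>expectation (\<lambda>w. f (X n 1 w) * f (X n 2 w)) - expectation (\<lambda>w. f (X n 1 w)) * expectation (\<lambda>w. f (X n 2 w))\<bar>" for n
  define e where "e n = diag n + adj n + real (k n) * far n" for n
  have far0: "0 \<le> far n" for n unfolding far_def using mixing_nonneg C0 by (intro add_nonneg_nonneg mult_nonneg_nonneg) auto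
  have e0: "0 \<le> e n" for n using far0[of n] by (simp add: e_def diag_def adj_def)
  have kr: "filterlim (\<lambda>n. real (k n)) at_top sequentially"
    by (rule filterlim_compose[OF filterlim_real_sequentially k_lim])
  have k1: "\<forall>\<^sub>F n in sequentially. 1 \<le> k n" using k_lim unfolding filterlim_at_top by blast
  have mean: "\<mu> \<longlonglongrightarrow> (\<integral>x. f x \<partial>frechet \<alpha>\<^sub>0 1)" unfolding \<mu>_def[abs_def] by (rule admissible_mean(1)[OF f])
  have "(\<lambda>n. expectation (\<lambda>w. (f (X n 1 w))^2) - (\<mu> n)^2 - lim_var f) \<longlonglongrightarrow> lim_var f - lim_var f"
    unfolding lim_var_def by (intro tendsto_intros admissible_mean(2)[OF f] mean)
  then have diag: "diag \<longlonglongrightarrow> 0" unfolding diag_def[abs_def] using tendsto_rabs by fastforce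
  have adj: "adj \<longlonglongrightarrow> 0" unfolding adj_def[abs_def] using tendsto_rabs[OF covariance_adjacent[OF f]] by simp
  have farl: "(\<lambda>n. real (k n) * far n) \<longlonglongrightarrow> 0"
  proof (rule Lim_null_comparison)
    have neg: "1 + s * (2 - p) < 0" using s(2) p by (simp add: field_simps)
    have "(\<lambda>n. 4 * (real (k n) powr (1 + \<omega>) * mixing_coeff M \<xi> (r n)) + C * real (k n) powr (1 + s * (2 - p))) \<longlonglongrightarrow> 4 * 0 + C * 0"
      by (intro tendsto_intros mixing_rate tendsto_neg_powr[OF neg kr])
    then show "(\<lambda>n. 4 * (real (k n) powr (1 + \<omega>) * mixing_coeff M \<xi> (r n)) + C * real (k n) powr (1 + s * (2 - p))) \<longlonglongrightarrow> 0" by simp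
    show "\<forall>\<^sub>F n in sequentially. norm (real (k n) * far n) \<le> 4 * (real (k n) powr (1 + \<omega>) * mixing_coeff M \<xi> (r n)) + C * real (k n) powr (1 + s * (2 - p))"
      using k1
    proof eventually_elim
      case (elim n)
      define \<kappa> where "\<kappa> = real (k n)"
      have \<kappa>: "1 \<le> \<kappa>" using elim by (simp add: \<kappa>_def)
      have "\<kappa> * (\<kappa> powr s)^2 = \<kappa> powr (1 + 2 * s)"
        using \<kappa> by (simp add: powr_power powr_add mult.commute)
      also have "\<dots> \<le> \<kappa> powr (1 + \<omega>)" using \<kappa> s by (intro powr_mono) auto
      finally have 1: "\<kappa> * (\<kappa> powr s)^2 * mixing_coeff M \<xi> (r n) \<le> \<kappa> powr (1 + \<omega>) * mixing_coeff M \<xi> (r n)"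
        by (intro mult_right_mono mixing_nonneg)
      have 2: "\<kappa> * (\<kappa> powr s) powr (2 - p) = \<kappa> powr (1 + s * (2 - p))"
        using \<kappa> by (simp only: powr_powr powr_add) simp
      have "\<kappa> * far n = 4 * (\<kappa> * (\<kappa> powr s)^2 * mixing_coeff M \<xi> (r n)) + C * (\<kappa> * (\<kappa> powr s) powr (2 - p))"
        by (simp add: far_def \<kappa>_def algebra_simps)
      also have "\<dots> \<le> 4 * (\<kappa> powr (1 + \<omega>) * mixing_coeff M \<xi> (r n)) + C * \<kappa> powr (1 + s * (2 - p))"
        using 1 unfolding 2 by simp
      finally show ?case using far0[of n] by (simp add: \<kappa>_def)
    qed
  qed
  have el: "e \<longlonglongrightarrow> 0"
    unfolding e_def[abs_def] using tendsto_add[OF tendsto_add[OF diag adj] farl] by simp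
  have "\<forall>\<^sub>F n in sequentially. \<forall>i\<in>{1..k n}. \<forall>j\<in>{1..k n}.
     \<bar>expectation (\<lambda>w. f (X n i w) * f (X n j w)) - (\<mu> n)^2 - (if i = j then lim_var f else 0)\<bar>
       \<le> e n / real (k n) + (if j \<in> {i - 1, i, Suc i} then e n else 0)"
    using K(2) k1
  proof eventually_elim
    case (elim n)
    have kpos: "0 < real (k n)" using elim(2) by simp
    have mu: "expectation (\<lambda>w. f (X n i w)) = \<mu> n" if "1 \<le> i" for i
      unfolding \<mu>_def by (rule X_law_integral(1)[OF that fm])
    have farij: "\<bar>expectation (\<lambda>w. f (X n i w) * f (X n j w)) - (\<mu> n)^2\<bar> \<le> e n / real (k n)" if ij: "1 \<le> i" "i + 2 \<le> j" for i j
    proof -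
      have "1 powr s \<le> real (k n) powr s" using elim(2) s by (intro powr_mono2) auto
      then have T: "1 \<le> real (k n) powr s" by simp
      have "\<bar>expectation (\<lambda>w. f (X n i w) * f (X n j w)) - expectation (\<lambda>w. f (X n i w)) * expectation (\<lambda>w. f (X n j w))\<bar> \<le> far n"
        unfolding far_def C_def using elim(1) by (intro covariance_far[OF ij(2,1) fm T]) auto
      moreover have "expectation (\<lambda>w. f (X n i w)) * expectation (\<lambda>w. f (X n j w)) = (\<mu> n)^2"
        using mu[of i] mu[of j] ij by (simp add: power2_eq_square)
      moreover have "far n \<le> e n / real (k n)"
      proof -
        have "real (k n) * far n \<le> e n" by (simp add: e_def diag_def adj_def)
        then show ?thesis using kpos by (simp add: field_simps)
      qed
      ultimately show ?thesis by simp
    qed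
    have ekn: "0 \<le> e n / real (k n)" using e0 kpos by simp
    have adjij: "\<bar>expectation (\<lambda>w. f (X n i w) * f (X n (Suc i) w)) - (\<mu> n)^2\<bar> \<le> e n / real (k n) + e n" if "1 \<le> i" for i
    proof -
      have "\<bar>expectation (\<lambda>w. f (X n i w) * f (X n (Suc i) w)) - (\<mu> n)^2\<bar> = adj n"
        unfolding X_pair_law_integral[OF that fm] adj_def using mu[of 1] mu[of 2] by (simp add: power2_eq_square)
      also have "\<dots> \<le> e n" using far0[of n] by (simp add: e_def diag_def)
      finally show ?thesis using add_increasing[OF ekn order_refl] by (rule order_trans)
    qed
    show ?case
    proof (intro ballI)
      fix i j assume ij: "i \<in> {1..k n}" "j \<in> {1..k n}"
      have comm: "expectation (\<lambda>w. f (X n i w) * f (X n j w)) = expectation (\<lambda>w. f (X n j w) * f (X n i w))" by (simp add: mult.commute)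
      consider "i = j" | "j = Suc i" | "i = Suc j" | "i + 2 \<le> j" | "j + 2 \<le> i" by linarith
      then show "\<bar>expectation (\<lambda>w. f (X n i w) * f (X n j w)) - (\<mu> n)^2 - (if i = j then lim_var f else 0)\<bar>
       \<le> e n / real (k n) + (if j \<in> {i - 1, i, Suc i} then e n else 0)"
      proof cases
        case 1
        have i1: "1 \<le> i" using ij by simp
        have "expectation (\<lambda>w. f (X n i w) * f (X n i w)) = expectation (\<lambda>w. (f (X n 1 w))^2)"
          using X_law_integral(1)[OF i1, of "\<lambda>x. (f x)^2" n] by (simp add: power2_eq_square)
        then have "\<bar>expectation (\<lambda>w. f (X n i w) * f (X n j w)) - (\<mu> n)^2 - lim_var f\<bar> = diag n" using 1 by (simp add: diag_def)
        also have "\<dots> \<le> e n" using far0[of n] by (simp add: e_def adj_def)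
        also have "\<dots> \<le> e n / real (k n) + e n" using ekn by linarith
        finally show ?thesis using 1 by simp
      next
        case 2
        then show ?thesis using adjij[of i] ij by simp
      next
        case 3
        then show ?thesis using adjij[of j] ij comm by simp
      next
        case 4
        then show ?thesis using farij[of i j] ij e0[of n] by (auto simp: add_increasing2)
      next
        case 5
        then show ?thesis using farij[of j i] ij e0[of n] comm by (auto simp: add_increasing2)
      qed
    qed
  qed
  then show ?thesis using e0 el unfolding \<mu>_def by blast
qed

definition centered_sum where
  "centered_sum f n A w = (\<Sum>i\<in>A. f (X n i w) - expectation (\<lambda>w. f (X n 1 w))) / sqrt (real (k n))"

text \<open>If an index \<open>b\<close> lies between two sets of blocks, then the \<open>b\<close>-th block separates their observations.
  The mixing bound applies to the real and imaginary parts, that is, to four products of sines and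
  cosines.\<close>

lemma char_factorizes:
  fixes f :: "real \<Rightarrow> real"
  assumes f [measurable]: "f \<in> borel_measurable borel" and A: "A \<subseteq> {1..<b}" and B: "B \<subseteq> {Suc b..k n}"
  shows "cmod (expectation (\<lambda>w. iexp (centered_sum f n (A \<union> B) w))
      - expectation (\<lambda>w. iexp (centered_sum f n A w)) * expectation (\<lambda>w. iexp (centered_sum f n B w))) \<le> 16 * mixing_coeff M \<xi> (r n)"
proof -
  define S where "S = centered_sum f n"
  have fin: "finite A" "finite B" using A B finite_subset by blast+
  have disj: "A \<inter> B = {}" using A B by fastforce
  have SAB: "S (A \<union> B) w = S A w + S B w" for w
    using fin disj by (simp add: S_def centered_sum_def sum.union_disjoint add_divide_distrib)
  have Sm [measurable]: "S D \<in> borel_measurable M" for D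
    unfolding S_def centered_sum_def[abs_def] by measurable
  define J where "J D = (\<Union>i\<in>D. block (r n) i)" for D
  define u where "u D z = (\<Sum>i\<in>D. f (max (block_max (\<lambda>t z. z t) (r n) i z) c / \<sigma> (r n)) - expectation (\<lambda>w. f (X n 1 w))) / sqrt (real (k n))" for D z
  have um: "u D \<in> borel_measurable (PiM (J D) (\<lambda>_. borel))" for D
    unfolding u_def by (intro borel_measurable_divide borel_measurable_sum borel_measurable_diff borel_measurable_const X_window_measurable f) (auto simp: J_def)
  have uS: "S D w = u D (window \<xi> (J D) 0 w)" for D w
    unfolding S_def centered_sum_def u_def
    by (intro arg_cong2[where f="(/)"] sum.cong refl arg_cong2[where f="(-)"] X_window) (auto simp: J_def)
  have JA: "finite (J A)" "J A \<subseteq> {..(int b - 1) * int (r n)}"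
  proof -
    show "finite (J A)" using fin by (simp add: J_def)
    have "block (r n) i \<subseteq> {..(int b - 1) * int (r n)}" if "i \<in> A" for i
    proof -
      have "int i * int (r n) \<le> (int b - 1) * int (r n)" using that A by (intro mult_right_mono) auto
      then show ?thesis using block_le[of "r n" i] by auto
    qed
    then show "J A \<subseteq> {..(int b - 1) * int (r n)}" by (auto simp: J_def)
  qed
  have JB: "finite (J B)" "J B \<subseteq> {(int b - 1) * int (r n) + int (r n)..}"
  proof -
    show "finite (J B)" using fin by (simp add: J_def)
    have "block (r n) i \<subseteq> {(int b - 1) * int (r n) + int (r n)..}" if "i \<in> B" for i
    proof -
      have "int b * int (r n) \<le> (int i - 1) * int (r n)" using that B by (intro mult_right_mono) auto
      then show ?thesis using block_ge[of "r n" i] by (auto simp: algebra_simps)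
    qed
    then show "J B \<subseteq> {(int b - 1) * int (r n) + int (r n)..}" by (auto simp: J_def)
  qed
  define cov where "cov g h = expectation (\<lambda>w. g (S A w) * h (S B w)) - expectation (\<lambda>w. g (S A w)) * expectation (\<lambda>w. h (S B w))" for g h :: "real \<Rightarrow> real"
  have cov: "\<bar>cov g h\<bar> \<le> 4 * mixing_coeff M \<xi> (r n)"
    if [measurable]: "g \<in> borel_measurable borel" "h \<in> borel_measurable borel" and b: "\<And>x. \<bar>g x\<bar> \<le> 1" "\<And>x. \<bar>h x\<bar> \<le> 1" for g h
  proof -
    have gm: "(\<lambda>z. g (u A z)) \<in> borel_measurable (PiM (J A) (\<lambda>_. borel))" by (rule measurable_compose[OF um that(1)])
    have hm: "(\<lambda>z. h (u B z)) \<in> borel_measurable (PiM (J B) (\<lambda>_. borel))" by (rule measurable_compose[OF um that(2)])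
    have "\<bar>cov g h\<bar> \<le> 4 * 1 * 1 * mixing_coeff M \<xi> (r n)"
      unfolding cov_def uS by (rule mixing_covariance[OF stat rv JA JB gm _ hm]) (use b in auto)
    then show ?thesis by simp
  qed
  have int: "integrable M (\<lambda>w. g (S A w))" "integrable M (\<lambda>w. g (S B w))"
    if [measurable]: "g \<in> borel_measurable borel" and "\<And>x. \<bar>g x\<bar> \<le> 1" for g :: "real \<Rightarrow> real"
    using that by (auto intro!: integrable_const_bound[where B=1])
  have int2: "integrable M (\<lambda>w. g (S A w) * h (S B w))"
    if [measurable]: "g \<in> borel_measurable borel" "h \<in> borel_measurable borel" and "\<And>x. \<bar>g x\<bar> \<le> 1" "\<And>x. \<bar>h x\<bar> \<le> 1" for g h :: "real \<Rightarrow> real"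
    using that by (auto intro!: integrable_const_bound[where B=1] simp: abs_mult mult_le_one)
  have cs [measurable]: "(cos :: real \<Rightarrow> real) \<in> borel_measurable borel" "(sin :: real \<Rightarrow> real) \<in> borel_measurable borel"
    by (intro borel_measurable_continuous_onI continuous_intros)+
  have cb: "\<bar>cos x\<bar> \<le> 1" "\<bar>sin x\<bar> \<le> 1" for x :: real by auto
  have ie: "expectation (\<lambda>w. iexp (S D w)) = Complex (expectation (\<lambda>w. cos (S D w))) (expectation (\<lambda>w. sin (S D w)))"
    for D
  proof -
    have i: "integrable M (\<lambda>w. iexp (S D w))"
      by (rule integrable_iexp[where f="\<lambda>w. complex_of_real (S D w)"]) auto
    show ?thesis using integral_Re[OF i] integral_Im[OF i] by (simp add: complex_eq_iff Re_exp Im_exp)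
  qed
  have cA: "expectation (\<lambda>w. cos (S (A \<union> B) w)) = expectation (\<lambda>w. cos (S A w) * cos (S B w)) - expectation (\<lambda>w. sin (S A w) * sin (S B w))"
    unfolding SAB cos_add using int2[OF cs(1) cs(1) cb(1) cb(1)] int2[OF cs(2) cs(2) cb(2) cb(2)] by simp
  have sA: "expectation (\<lambda>w. sin (S (A \<union> B) w)) = expectation (\<lambda>w. sin (S A w) * cos (S B w)) + expectation (\<lambda>w. cos (S A w) * sin (S B w))"
    unfolding SAB sin_add using int2[OF cs(2) cs(1) cb(2) cb(1)] int2[OF cs(1) cs(2) cb(1) cb(2)] by simp
  have eq: "expectation (\<lambda>w. iexp (S (A \<union> B) w)) - expectation (\<lambda>w. iexp (S A w)) * expectation (\<lambda>w. iexp (S B w))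
    = Complex (cov cos cos - cov sin sin) (cov sin cos + cov cos sin)"
    unfolding ie cA sA by (simp add: complex_eq_iff cov_def algebra_simps)
  have le: "cmod (Complex (cov cos cos - cov sin sin) (cov sin cos + cov cos sin))
    \<le> \<bar>cov cos cos - cov sin sin\<bar> + \<bar>cov sin cos + cov cos sin\<bar>"
    using cmod_le[of "Complex (cov cos cos - cov sin sin) (cov sin cos + cov cos sin)"] by simp
  have "\<bar>cov cos cos\<bar> \<le> 4 * mixing_coeff M \<xi> (r n)" "\<bar>cov sin sin\<bar> \<le> 4 * mixing_coeff M \<xi> (r n)"
    "\<bar>cov sin cos\<bar> \<le> 4 * mixing_coeff M \<xi> (r n)" "\<bar>cov cos sin\<bar> \<le> 4 * mixing_coeff M \<xi> (r n)"
    by (rule cov; (rule cs cb))+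
  then show ?thesis using le unfolding S_def[symmetric] eq by linarith
qed

lemma admissible_square_integrable:
  assumes f: "admissible f"
  shows "\<forall>\<^sub>F n in sequentially. \<forall>i\<ge>1. integrable M (\<lambda>w. f (X n i w)) \<and> integrable M (\<lambda>w. (f (X n i w))^2)"
proof -
  have [measurable]: "f \<in> borel_measurable borel" using f by (simp add: admissible_def)
  obtain K where K: "\<forall>\<^sub>F n in sequentially. \<forall>i\<ge>1. integrable M (\<lambda>w. \<bar>f (X n i w)\<bar> powr p) \<and> expectation (\<lambda>w. \<bar>f (X n i w)\<bar> powr p) \<le> K"
    using admissible_moment[OF f] by blast
  show ?thesis using K
  proof eventually_elim
    case (elim n)
    show ?case
    proof (intro allI impI)
      fix i :: nat assume i: "1 \<le> i"
      have sq: "integrable M (\<lambda>w. (f (X n i w))^2)"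
        by (rule square_integrable_of_moment[of _ p]) (use elim i p in auto)
      then show "integrable M (\<lambda>w. f (X n i w)) \<and> integrable M (\<lambda>w. (f (X n i w))^2)"
        using square_integrable_imp_integrable[OF _ sq] by auto
    qed
  qed
qed

lemma centered_covariance:
  fixes f :: "real \<Rightarrow> real"
  assumes f [measurable]: "f \<in> borel_measurable borel" and i: "1 \<le> i" "1 \<le> j"
    and int: "\<forall>i\<ge>1. integrable M (\<lambda>w. f (X n i w)) \<and> integrable M (\<lambda>w. (f (X n i w))^2)"
  shows "integrable M (\<lambda>w. (f (X n i w) - expectation (\<lambda>w. f (X n 1 w))) * (f (X n j w) - expectation (\<lambda>w. f (X n 1 w))))"
    "expectation (\<lambda>w. (f (X n i w) - expectation (\<lambda>w. f (X n 1 w))) * (f (X n j w) - expectation (\<lambda>w. f (X n 1 w))))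
      = expectation (\<lambda>w. f (X n i w) * f (X n j w)) - expectation (\<lambda>w. f (X n 1 w))^2"
proof -
  define \<mu> where "\<mu> = expectation (\<lambda>w. f (X n 1 w))"
  have mu: "expectation (\<lambda>w. f (X n i w)) = \<mu>" if "1 \<le> i" for i
    unfolding \<mu>_def by (rule X_law_integral(1)[OF that f])
  have i2: "integrable M (\<lambda>w. f (X n i w) * f (X n j w))"
    by (rule integrable_mult_of_squares) (use int i in auto)
  have eq: "(f (X n i w) - \<mu>) * (f (X n j w) - \<mu>) = f (X n i w) * f (X n j w) - \<mu> * f (X n i w) - \<mu> * f (X n j w) + \<mu>^2" for w
    by (simp add: algebra_simps power2_eq_square)
  have ii: "integrable M (\<lambda>w. f (X n i w))" "integrable M (\<lambda>w. f (X n j w))" using int i by auto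
  show "integrable M (\<lambda>w. (f (X n i w) - expectation (\<lambda>w. f (X n 1 w))) * (f (X n j w) - expectation (\<lambda>w. f (X n 1 w))))"
    unfolding \<mu>_def[symmetric] eq using i2 ii by simp
  show "expectation (\<lambda>w. (f (X n i w) - expectation (\<lambda>w. f (X n 1 w))) * (f (X n j w) - expectation (\<lambda>w. f (X n 1 w))))
      = expectation (\<lambda>w. f (X n i w) * f (X n j w)) - expectation (\<lambda>w. f (X n 1 w))^2"
    unfolding \<mu>_def[symmetric] eq using i2 ii mu[OF i(1)] mu[OF i(2)] by (simp add: prob_space power2_eq_square)
qed

lemma centered_sum_variance:
  assumes f: "admissible f"
  shows "\<exists>V. \<forall>\<^sub>F n in sequentially. integrable M (\<lambda>w. (centered_sum f n {1..k n} w)^2)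
     \<and> expectation (\<lambda>w. (centered_sum f n {1..k n} w)^2) \<le> V"
proof -
  have fm [measurable]: "f \<in> borel_measurable borel" using f by (simp add: admissible_def)
  obtain e where e: "\<And>n. 0 \<le> e n" "e \<longlonglongrightarrow> 0" and cov: "\<forall>\<^sub>F n in sequentially. \<forall>i\<in>{1..k n}. \<forall>j\<in>{1..k n}.
     \<bar>expectation (\<lambda>w. f (X n i w) * f (X n j w)) - expectation (\<lambda>w. f (X n 1 w))^2 - (if i = j then lim_var f else 0)\<bar>
       \<le> e n / real (k n) + (if j \<in> {i - 1, i, Suc i} then e n else 0)"
    using covariance_structure[OF f] by blast
  have k1: "\<forall>\<^sub>F n in sequentially. 1 \<le> k n" using k_lim unfolding filterlim_at_top by blast
  have e1: "\<forall>\<^sub>F n in sequentially. e n < 1" by (rule order_tendstoD(2)[OF e(2)]) simp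
  have "\<forall>\<^sub>F n in sequentially. integrable M (\<lambda>w. (centered_sum f n {1..k n} w)^2)
     \<and> expectation (\<lambda>w. (centered_sum f n {1..k n} w)^2) \<le> lim_var f + 4"
    using cov admissible_square_integrable[OF f] k1 e1
  proof eventually_elim
    case (elim n)
    define \<mu> where "\<mu> = expectation (\<lambda>w. f (X n 1 w))"
    define Y where "Y i w = f (X n i w) - \<mu>" for i w
    note cc = centered_covariance[OF fm _ _ elim(2), folded \<mu>_def]
    have Yint: "integrable M (\<lambda>w. Y i w * Y j w)" if ij: "i \<in> {1..k n}" "j \<in> {1..k n}" for i j
      unfolding Y_def by (rule cc(1)) (use ij in auto)
    have Ycov: "\<bar>expectation (\<lambda>w. Y i w * Y j w) - (if i = j then lim_var f else 0)\<bar>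
         \<le> e n / real (k n) + (if j \<in> {i - 1, i, Suc i} then e n else 0)" if ij: "i \<in> {1..k n}" "j \<in> {1..k n}" for i j
    proof -
      have "expectation (\<lambda>w. Y i w * Y j w) = expectation (\<lambda>w. f (X n i w) * f (X n j w)) - \<mu>^2"
        unfolding Y_def by (rule cc(2)) (use ij in auto)
      then show ?thesis using elim(1)[folded \<mu>_def, rule_format, OF ij] by simp
    qed
    have 1: "integrable M (\<lambda>w. (\<Sum>i\<in>{1..k n}. Y i w)^2)"
      "\<bar>expectation (\<lambda>w. (\<Sum>i\<in>{1..k n}. Y i w)^2) - real (card {1..k n}) * lim_var f\<bar> \<le> 4 * real (card {1..k n}) * e n"
      by (rule expectation_sum_square[OF order_refl e(1)[of n] Yint Ycov]; assumption)+
    have eq: "(centered_sum f n {1..k n} w)^2 = (\<Sum>i\<in>{1..k n}. Y i w)^2 / real (k n)" for w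
      by (simp add: centered_sum_def power_divide Y_def \<mu>_def)
    have "expectation (\<lambda>w. (\<Sum>i\<in>{1..k n}. Y i w)^2) \<le> real (k n) * lim_var f + 4 * real (k n) * e n"
      using 1(2) by (simp add: abs_le_iff)
    also have "\<dots> \<le> real (k n) * lim_var f + 4 * real (k n) * 1"
      using elim(4) by (intro add_left_mono mult_left_mono) auto
    also have "\<dots> = (lim_var f + 4) * real (k n)" by (simp add: algebra_simps)
    finally have "expectation (\<lambda>w. (\<Sum>i\<in>{1..k n}. Y i w)^2) / real (k n) \<le> lim_var f + 4"
      using elim(3) by (simp add: pos_divide_le_eq)
    then show ?case unfolding eq integral_divide_zero using integrable_divide_zero[OF 1(1)] by simp
  qed
  then show ?thesis by blast
qed

text \<open>The moment and covariance bounds hold from some index \<open>N\<close> on, whereas the theorem for arrays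
  requires them throughout; hence the shift by \<open>N\<close>. The exponent is cut down to \<open>3\<close> to fit the
  Taylor bound.\<close>

theorem centered_sum_clt:
  assumes f: "admissible f"
  shows "(\<lambda>n. expectation (\<lambda>w. iexp (centered_sum f n {1..k n} w))) \<longlonglongrightarrow> exp (- lim_var f / 2)"
proof -
  have fm [measurable]: "f \<in> borel_measurable borel" using f by (simp add: admissible_def)
  obtain K where K: "0 \<le> K" "\<forall>\<^sub>F n in sequentially. \<forall>i\<ge>1. integrable M (\<lambda>w. \<bar>f (X n i w)\<bar> powr p) \<and> expectation (\<lambda>w. \<bar>f (X n i w)\<bar> powr p) \<le> K"
    using admissible_moment[OF f] by blast
  obtain e where e: "\<And>n. 0 \<le> e n" "e \<longlonglongrightarrow> 0" and cov: "\<forall>\<^sub>F n in sequentially. \<forall>i\<in>{1..k n}. \<forall>j\<in>{1..k n}.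
     \<bar>expectation (\<lambda>w. f (X n i w) * f (X n j w)) - expectation (\<lambda>w. f (X n 1 w))^2 - (if i = j then lim_var f else 0)\<bar>
       \<le> e n / real (k n) + (if j \<in> {i - 1, i, Suc i} then e n else 0)"
    using covariance_structure[OF f] by blast
  have k1: "\<forall>\<^sub>F n in sequentially. 1 \<le> k n" using k_lim unfolding filterlim_at_top by blast
  have "\<forall>\<^sub>F n in sequentially.
     (\<forall>i\<ge>1. integrable M (\<lambda>w. \<bar>f (X n i w)\<bar> powr p) \<and> expectation (\<lambda>w. \<bar>f (X n i w)\<bar> powr p) \<le> K) \<and>
     (\<forall>i\<in>{1..k n}. \<forall>j\<in>{1..k n}.
     \<bar>expectation (\<lambda>w. f (X n i w) * f (X n j w)) - expectation (\<lambda>w. f (X n 1 w))^2 - (if i = j then lim_var f else 0)\<bar>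
       \<le> e n / real (k n) + (if j \<in> {i - 1, i, Suc i} then e n else 0)) \<and>
     (\<forall>i\<ge>1. integrable M (\<lambda>w. f (X n i w)) \<and> integrable M (\<lambda>w. (f (X n i w))^2))"
    using K(2) cov admissible_square_integrable[OF f] by eventually_elim blast
  then obtain N where N: "\<And>n i. N \<le> n \<Longrightarrow> 1 \<le> i \<Longrightarrow> integrable M (\<lambda>w. \<bar>f (X n i w)\<bar> powr p) \<and> expectation (\<lambda>w. \<bar>f (X n i w)\<bar> powr p) \<le> K"
    "\<And>n i j. N \<le> n \<Longrightarrow> i \<in> {1..k n} \<Longrightarrow> j \<in> {1..k n} \<Longrightarrow>
     \<bar>expectation (\<lambda>w. f (X n i w) * f (X n j w)) - expectation (\<lambda>w. f (X n 1 w))^2 - (if i = j then lim_var f else 0)\<bar>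
       \<le> e n / real (k n) + (if j \<in> {i - 1, i, Suc i} then e n else 0)"
    "\<And>n. N \<le> n \<Longrightarrow> \<forall>i\<ge>1. integrable M (\<lambda>w. f (X n i w)) \<and> integrable M (\<lambda>w. (f (X n i w))^2)"
    unfolding eventually_sequentially by blast
  define \<mu> where "\<mu> n = expectation (\<lambda>w. f (X n 1 w))" for n
  define Y where "Y n i w = f (X (n + N) i w) - \<mu> (n + N)" for n i w
  define q where "q = min p 3"
  have q: "2 < q" "q \<le> 3" "q \<le> p" using p by (auto simp: q_def)
  define K' where "K' = 1 + 2 powr p * (K + (1 + K) powr p)"
  have diffp: "\<bar>a - b\<bar> powr p \<le> 2 powr p * (\<bar>a\<bar> powr p + \<bar>b\<bar> powr p)" for a b :: real
  proof -
    define m where "m = max \<bar>a\<bar> \<bar>b\<bar>"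
    have "\<bar>a - b\<bar> powr p \<le> (2 * m) powr p" using p by (intro powr_mono2) (auto simp: m_def)
    also have "\<dots> = 2 powr p * m powr p" by (simp add: powr_mult m_def)
    also have "m powr p \<le> \<bar>a\<bar> powr p + \<bar>b\<bar> powr p" by (auto simp: m_def max_def)
    finally show ?thesis by simp
  qed
  have mub: "\<bar>\<mu> n\<bar> \<le> 1 + K" if "N \<le> n" for n
  proof -
    have i: "integrable M (\<lambda>w. \<bar>f (X n 1 w)\<bar> powr p)" "expectation (\<lambda>w. \<bar>f (X n 1 w)\<bar> powr p) \<le> K" using N(1)[OF that, of 1] by auto
    have "\<bar>\<mu> n\<bar> \<le> expectation (\<lambda>w. \<bar>f (X n 1 w)\<bar>)" unfolding \<mu>_def by (rule integral_abs_bound)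
    also have "\<dots> \<le> expectation (\<lambda>w. 1 + \<bar>f (X n 1 w)\<bar> powr p)"
      using i N(3)[OF that] abs_le_powr[of p] p by (intro integral_mono) auto
    also have "\<dots> \<le> 1 + K" using i by (simp add: prob_space)
    finally show ?thesis .
  qed
  have Ym [measurable]: "Y n i \<in> borel_measurable M" for n i unfolding Y_def[abs_def] by measurable
  have mom: "integrable M (\<lambda>w. \<bar>Y n i w\<bar> powr q) \<and> expectation (\<lambda>w. \<bar>Y n i w\<bar> powr q) \<le> K'" if "1 \<le> i" for n i
  proof -
    have i: "integrable M (\<lambda>w. \<bar>f (X (n + N) i w)\<bar> powr p)" "expectation (\<lambda>w. \<bar>f (X (n + N) i w)\<bar> powr p) \<le> K"
      using N(1)[of "n + N" i] that by auto
    have le: "\<bar>Y n i w\<bar> powr q \<le> 1 + 2 powr p * (\<bar>f (X (n + N) i w)\<bar> powr p + (1 + K) powr p)" for w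
    proof -
      have "\<bar>Y n i w\<bar> powr q \<le> 1 + \<bar>Y n i w\<bar> powr p" using q by (intro abs_powr_le) auto
      also have "\<bar>Y n i w\<bar> powr p \<le> 2 powr p * (\<bar>f (X (n + N) i w)\<bar> powr p + \<bar>\<mu> (n + N)\<bar> powr p)" unfolding Y_def by (rule diffp)
      also have "\<bar>\<mu> (n + N)\<bar> powr p \<le> (1 + K) powr p" using mub[of "n + N"] p by (intro powr_mono2) auto
      finally show ?thesis by simp
    qed
    have bi: "integrable M (\<lambda>w. 1 + 2 powr p * (\<bar>f (X (n + N) i w)\<bar> powr p + (1 + K) powr p))" using i by simp
    have ii: "integrable M (\<lambda>w. \<bar>Y n i w\<bar> powr q)"
      by (rule Bochner_Integration.integrable_bound[OF bi]) (use le in \<open>auto intro: order_trans[OF _ abs_ge_self]\<close>)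
    have "expectation (\<lambda>w. \<bar>Y n i w\<bar> powr q) \<le> expectation (\<lambda>w. 1 + 2 powr p * (\<bar>f (X (n + N) i w)\<bar> powr p + (1 + K) powr p))"
      by (rule integral_mono[OF ii bi le])
    also have "\<dots> = 1 + 2 powr p * (expectation (\<lambda>w. \<bar>f (X (n + N) i w)\<bar> powr p) + (1 + K) powr p)" using i by (simp add: prob_space)
    also have "\<dots> \<le> K'" unfolding K'_def using i by (intro add_left_mono mult_left_mono add_right_mono) auto
    finally show ?thesis using ii by simp
  qed
  have "(\<lambda>n. expectation (\<lambda>w. iexp ((\<Sum>i\<in>{1..k (n + N)}. Y n i w) / sqrt (real (k (n + N)))))) \<longlonglongrightarrow> exp (- lim_var f / 2)"
  proof (rule clt_weakly_dependent_array[where k="\<lambda>n. k (n + N)" and p=q and K=K' and e="\<lambda>n. e (n + N)" and a="\<lambda>n. 16 * mixing_coeff M \<xi> (r (n + N))"])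
    show "filterlim (\<lambda>n. k (n + N)) at_top sequentially"
      by (rule filterlim_compose[OF k_lim filterlim_add_const_nat_at_top])
    show "(\<lambda>n. e (n + N)) \<longlonglongrightarrow> 0" using e(2) by (rule LIMSEQ_ignore_initial_segment)
    show "expectation (Y n i) = 0" if "i \<in> {1..k (n + N)}" for n i
    proof -
      have "expectation (Y n i) = expectation (\<lambda>w. f (X (n + N) i w)) - \<mu> (n + N)"
        unfolding Y_def using N(3)[of "n + N"] that by (simp add: prob_space)
      then show ?thesis using X_law_integral(1)[of i f "n + N"] that by (simp add: \<mu>_def)
    qed
    show "\<bar>expectation (\<lambda>w. Y n i w * Y n j w) - (if i = j then lim_var f else 0)\<bar>
       \<le> e (n + N) / real (k (n + N)) + (if j \<in> {i - 1, i, Suc i} then e (n + N) else 0)"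
      if "i \<in> {1..k (n + N)}" "j \<in> {1..k (n + N)}" for n i j
    proof -
      have "expectation (\<lambda>w. Y n i w * Y n j w) = expectation (\<lambda>w. f (X (n + N) i w) * f (X (n + N) j w)) - (\<mu> (n + N))^2"
        unfolding Y_def \<mu>_def by (rule centered_covariance(2)[OF fm _ _ N(3)]) (use that in auto)
      then show ?thesis using N(2)[of "n + N" i j] that by (simp add: \<mu>_def)
    qed
    show "cmod (expectation (\<lambda>w. iexp ((\<Sum>i\<in>A \<union> B. Y n i w) / sqrt (real (k (n + N)))))
       - expectation (\<lambda>w. iexp ((\<Sum>i\<in>A. Y n i w) / sqrt (real (k (n + N))))) * expectation (\<lambda>w. iexp ((\<Sum>i\<in>B. Y n i w) / sqrt (real (k (n + N))))))
       \<le> 16 * mixing_coeff M \<xi> (r (n + N))" if "A \<subseteq> {1..<b}" "B \<subseteq> {Suc b..k (n + N)}" for n A B b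
      using char_factorizes[OF fm that] unfolding centered_sum_def Y_def \<mu>_def .
    have kc: "(\<lambda>n. real (k n) * mixing_coeff M \<xi> (r n)) \<longlonglongrightarrow> 0"
    proof (rule Lim_null_comparison[OF _ mixing_rate])
      show "\<forall>\<^sub>F n in sequentially. norm (real (k n) * mixing_coeff M \<xi> (r n)) \<le> real (k n) powr (1 + \<omega>) * mixing_coeff M \<xi> (r n)"
        using k1
      proof eventually_elim
        case (elim n)
        have "real (k n) powr 1 \<le> real (k n) powr (1 + \<omega>)" using elim \<omega>_pos by (intro powr_mono) auto
        then have "real (k n) \<le> real (k n) powr (1 + \<omega>)" using elim by simp
        then show ?case using mixing_nonneg by (simp add: abs_mult mult_right_mono)
      qed
    qed
    have "(\<lambda>n. 16 * (real (k (n + N)) * mixing_coeff M \<xi> (r (n + N)))) \<longlonglongrightarrow> 16 * 0"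
      by (intro tendsto_mult tendsto_const LIMSEQ_ignore_initial_segment[OF kc])
    then show "(\<lambda>n. real (k (n + N)) * (16 * mixing_coeff M \<xi> (r (n + N)))) \<longlonglongrightarrow> 0" by (simp add: mult_ac)
  qed (use q mom e(1) lim_var_nonneg[OF f] in auto)
  then have "(\<lambda>n. expectation (\<lambda>w. iexp (centered_sum f (n + N) {1..k (n + N)} w))) \<longlonglongrightarrow> exp (- lim_var f / 2)"
    unfolding centered_sum_def Y_def \<mu>_def .
  then show ?thesis by (rule LIMSEQ_offset)
qed

end

section \<open>Events of probability tending to one\<close>

lemma (in prob_space) prob_Int_tendsto_1:
  assumes "\<And>n. A n \<in> events" "\<And>n. B n \<in> events"
    and "(\<lambda>n. prob (A n)) \<longlonglongrightarrow> 1" "(\<lambda>n. prob (B n)) \<longlonglongrightarrow> 1"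
  shows "(\<lambda>n. prob (A n \<inter> B n)) \<longlonglongrightarrow> 1"
proof (rule tendsto_sandwich[where h="\<lambda>_. 1"])
  have "(\<lambda>n. prob (A n) + prob (B n) - 1) \<longlonglongrightarrow> 1 + 1 - 1" by (intro tendsto_intros assms)
  then show "(\<lambda>n. prob (A n) + prob (B n) - 1) \<longlonglongrightarrow> 1" by simp
  have "prob (A n) + prob (B n) - 1 \<le> prob (A n \<inter> B n)" for n
    using finite_measure_Union'[OF assms(1)[of n] assms(2)[of n]]
      finite_measure_Diff'[OF assms(2)[of n] assms(1)[of n]] prob_le_1[of "A n \<union> B n"]
    by (simp add: Int_commute)
  then show "\<forall>\<^sub>F n in sequentially. prob (A n) + prob (B n) - 1 \<le> prob (A n \<inter> B n)" by simp
qed simp_all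

text \<open>Random variables that are uniformly close on events of probability tending to one have the same
  limit of characteristic functions, because \<open>iexp\<close> is bounded and Lipschitz.\<close>

lemma (in prob_space) iexp_expectation_perturb:
  fixes U V :: "nat \<Rightarrow> 'a \<Rightarrow> real"
  assumes [measurable]: "\<And>n. U n \<in> borel_measurable M" "\<And>n. V n \<in> borel_measurable M"
    and E [measurable]: "\<And>n. E n \<in> events" and E1: "(\<lambda>n. prob (E n)) \<longlonglongrightarrow> 1"
    and close: "\<And>e. 0 < e \<Longrightarrow> \<forall>\<^sub>F n in sequentially. \<forall>w\<in>E n. \<bar>U n w - V n w\<bar> \<le> e"
    and V: "(\<lambda>n. expectation (\<lambda>w. iexp (V n w))) \<longlonglongrightarrow> l"
  shows "(\<lambda>n. expectation (\<lambda>w. iexp (U n w))) \<longlonglongrightarrow> l"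
proof -
  have bnd: "cmod (expectation (\<lambda>w. iexp (U n w)) - expectation (\<lambda>w. iexp (V n w))) \<le> e + 2 * (1 - prob (E n))"
    if e: "0 < e" "\<forall>w\<in>E n. \<bar>U n w - V n w\<bar> \<le> e" for n e
  proof -
    have iU: "integrable M (\<lambda>w. iexp (U n w))" by (rule integrable_iexp[where f="\<lambda>w. complex_of_real (U n w)"]) auto
    have iV: "integrable M (\<lambda>w. iexp (V n w))" by (rule integrable_iexp[where f="\<lambda>w. complex_of_real (V n w)"]) auto
    have ii: "integrable M (\<lambda>w. e + 2 * indicator (space M - E n) w :: real)"
      by (intro Bochner_Integration.integrable_add integrable_const integrable_mult_right integrable_real_indicator) (auto simp: emeasure_eq_measure)
    have "cmod (expectation (\<lambda>w. iexp (U n w)) - expectation (\<lambda>w. iexp (V n w))) = cmod (expectation (\<lambda>w. iexp (U n w) - iexp (V n w)))"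
      using iU iV by simp
    moreover have "cmod (expectation (\<lambda>w. iexp (U n w) - iexp (V n w))) \<le> expectation (\<lambda>w. cmod (iexp (U n w) - iexp (V n w)))"
      by (rule integral_norm_bound)
    moreover have "expectation (\<lambda>w. cmod (iexp (U n w) - iexp (V n w))) \<le> expectation (\<lambda>w. e + 2 * indicator (space M - E n) w)"
    proof (rule integral_mono[OF integrable_norm[OF Bochner_Integration.integrable_diff[OF iU iV]] ii])
      fix w assume w: "w \<in> space M"
      show "cmod (iexp (U n w) - iexp (V n w)) \<le> e + 2 * indicator (space M - E n) w"
      proof (cases "w \<in> E n")
        case True
        then show ?thesis using norm_iexp_diff_le[of "U n w" "V n w"] e by force
      next
        case False
        have "cmod (iexp (U n w) - iexp (V n w)) \<le> cmod (iexp (U n w)) + cmod (iexp (V n w))" by (rule norm_triangle_ineq4)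
        also have "\<dots> = 2" by simp
        finally show ?thesis using False w e by simp
      qed
    qed
    moreover have "expectation (\<lambda>w. e + 2 * indicator (space M - E n) w) = e + 2 * (1 - prob (E n))"
    proof -
      have "integrable M (\<lambda>w. 2 * indicator (space M - E n) w :: real)"
        by (intro integrable_mult_right integrable_real_indicator) (auto simp: emeasure_eq_measure)
      then show ?thesis using prob_compl[OF E[of n]] by (simp add: prob_space)
    qed
    ultimately show ?thesis by linarith
  qed
  have "(\<lambda>n. expectation (\<lambda>w. iexp (U n w)) - expectation (\<lambda>w. iexp (V n w))) \<longlonglongrightarrow> 0"
  proof (rule tendstoI)
    fix e :: real assume e: "0 < e"
    have "\<forall>\<^sub>F n in sequentially. 1 - e / 8 < prob (E n)" by (rule order_tendstoD(1)[OF E1]) (use e in simp)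
    moreover have "\<forall>\<^sub>F n in sequentially. \<forall>w\<in>E n. \<bar>U n w - V n w\<bar> \<le> e / 2" by (rule close) (use e in simp)
    ultimately show "\<forall>\<^sub>F n in sequentially. dist (expectation (\<lambda>w. iexp (U n w)) - expectation (\<lambda>w. iexp (V n w))) 0 < e"
    proof eventually_elim
      case (elim n)
      show ?case using bnd[of "e / 2" n] elim e unfolding dist_norm by simp
    qed
  qed
  from tendsto_add[OF this V] show ?thesis by simp
qed

text \<open>Limits along this filter are limits in \<open>n\<close> that are uniform over \<open>w \<in> E n\<close>, which turns the
  pointwise expansion of the maximizer into a statement in probability.\<close>

definition sample_filter :: "(nat \<Rightarrow> 'a set) \<Rightarrow> (nat \<times> 'a) filter" where
  "sample_filter E = inf (filtercomap fst sequentially) (principal {b. snd b \<in> E (fst b)})"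

lemma eventually_sample_filter:
  "eventually P (sample_filter E) \<longleftrightarrow> (\<forall>\<^sub>F n in sequentially. \<forall>w\<in>E n. P (n, w))"
  unfolding sample_filter_def eventually_inf_principal eventually_filtercomap
proof safe
  fix Q assume "eventually Q sequentially" "\<forall>x. Q (fst x) \<longrightarrow> x \<in> {b. snd b \<in> E (fst b)} \<longrightarrow> P x"
  then show "\<forall>\<^sub>F n in sequentially. \<forall>w\<in>E n. P (n, w)" by (auto elim!: eventually_mono)
next
  assume "\<forall>\<^sub>F n in sequentially. \<forall>w\<in>E n. P (n, w)"
  then show "\<exists>Q. eventually Q sequentially \<and> (\<forall>x. Q (fst x) \<longrightarrow> x \<in> {b. snd b \<in> E (fst b)} \<longrightarrow> P x)" by (intro exI[of _ "\<lambda>n. \<forall>w\<in>E n. P (n, w)"]) auto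
qed

lemma filterlim_fst_sample_filter: "filterlim fst sequentially (sample_filter E)"
  unfolding sample_filter_def by (rule filterlim_mono[OF filterlim_filtercomap order_refl inf_le1])

lemma frechet_maximizer_cong:
  assumes "\<And>i. i \<in> {1..k} \<Longrightarrow> x i = y i"
  shows "frechet_maximizer k x \<theta> \<longleftrightarrow> frechet_maximizer k y \<theta>"
proof -
  have "frechet_loglik k x \<theta> = frechet_loglik k y \<theta>" for \<theta>
    unfolding frechet_loglik_def by (cases \<theta>) (auto simp: assms intro!: sum.cong)
  then show ?thesis using assms unfolding frechet_maximizer_def by auto
qed

context frechet_block_maxima
begin

lemma admissible_lincomb:
  assumes "admissible f" "admissible g"
  shows "admissible (\<lambda>x. a * f x + b * g x)"
proof -
  obtain Cf Cg where C: "\<And>x. 0 < x \<Longrightarrow> \<bar>f x\<bar> \<le> Cf * env x" "\<And>x. 0 < x \<Longrightarrow> \<bar>g x\<bar> \<le> Cg * env x"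
    using assms unfolding admissible_def by blast
  have "\<bar>a * f x + b * g x\<bar> \<le> (\<bar>a\<bar> * Cf + \<bar>b\<bar> * Cg) * env x" if "0 < x" for x
  proof -
    have "\<bar>a * f x + b * g x\<bar> \<le> \<bar>a\<bar> * \<bar>f x\<bar> + \<bar>b\<bar> * \<bar>g x\<bar>" using abs_triangle_ineq[of "a * f x" "b * g x"] by (simp add: abs_mult)
    also have "\<dots> \<le> \<bar>a\<bar> * (Cf * env x) + \<bar>b\<bar> * (Cg * env x)" using C[OF that] by (intro add_mono mult_left_mono) auto
    finally show ?thesis by (simp add: algebra_simps)
  qed
  then show ?thesis using assms unfolding admissible_def
    by (intro conjI allI impI exI[of _ "\<bar>a\<bar> * Cf + \<bar>b\<bar> * Cg"]) auto
qed

lemma admissible_log_power: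
  assumes "j \<le> 3"
  shows "admissible (\<lambda>x. x powr (- \<alpha>\<^sub>0) * ln x ^ j)"
proof -
  obtain \<epsilon> C where C: "0 < \<epsilon>" "0 < C"
    "\<And>y a j. 0 < y \<Longrightarrow> \<bar>a - \<alpha>\<^sub>0\<bar> \<le> \<epsilon> \<Longrightarrow> j \<le> 3 \<Longrightarrow> y powr (- a) * \<bar>ln y\<bar> ^ j \<le> C * (1 + y powr (- \<beta>))"
    using log_power_envelope[OF \<alpha>0_pos \<beta>] by blast
  have "\<bar>x powr (- \<alpha>\<^sub>0) * ln x ^ j\<bar> \<le> C * env x" if "0 < x" for x
  proof -
    have "\<bar>x powr (- \<alpha>\<^sub>0) * ln x ^ j\<bar> = x powr (- \<alpha>\<^sub>0) * \<bar>ln x\<bar> ^ j" by (simp add: abs_mult power_abs)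
    also have "\<dots> \<le> C * (1 + x powr (- \<beta>))" using C(1) that assms by (intro C(3)) auto
    also have "\<dots> \<le> C * env x" using C(2) by (intro mult_left_mono) (auto simp: env_def)
    finally show ?thesis .
  qed
  then show ?thesis unfolding admissible_def
    by (intro conjI allI impI exI[of _ C] continuous_intros) auto
qed

text \<open>The function whose mean appears in the slope of the score.\<close>

definition f4 where "f4 x = x powr (- \<alpha>\<^sub>0) * (ln x)^2"
definition envelope_power where "envelope_power x = 1 + x powr (- \<beta>)"

lemma admissible_tests: "admissible (f1 \<alpha>\<^sub>0)" "admissible (f2 \<alpha>\<^sub>0)" "admissible f3" "admissible f4" "admissible envelope_power"
proof -
  show "admissible (f1 \<alpha>\<^sub>0)" "admissible (f2 \<alpha>\<^sub>0)" "admissible f4"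
    using admissible_log_power[of 1] admissible_log_power[of 0] admissible_log_power[of 2]
    by (simp_all add: f1_def[abs_def] f2_def[abs_def] f4_def[abs_def])
  have "\<bar>ln x\<bar> \<le> (1 + 1 / \<beta>) * env x" if x: "0 < x" for x
  proof (cases "1 \<le> x")
    case True
    then have "\<bar>ln x\<bar> \<le> 1 * env x" by (simp add: env_def)
    also have "\<dots> \<le> (1 + 1 / \<beta>) * env x" using \<beta> \<alpha>0_pos env_ge_1[of x] by (intro mult_right_mono) auto
    finally show ?thesis .
  next
    case False
    have b: "0 < \<beta>" using \<beta> \<alpha>0_pos by simp
    have "x powr \<beta> \<le> 1 powr \<beta>" using False x b by (intro powr_mono2) auto
    then have "\<bar>ln x\<bar> \<le> (1 + x powr (- \<beta>)) / \<beta>"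
      using abs_ln_power_le[OF x b, of 1] b by (simp add: field_simps)
    also have "\<dots> \<le> 1 / \<beta> * env x" using b by (simp add: env_def divide_right_mono)
    also have "\<dots> \<le> (1 + 1 / \<beta>) * env x" using env_ge_1[of x] by (intro mult_right_mono) auto
    finally show ?thesis .
  qed
  then show "admissible f3" unfolding admissible_def f3_def[abs_def]
    by (intro conjI allI impI exI[of _ "1 + 1 / \<beta>"] continuous_intros) auto
  have "\<bar>envelope_power x\<bar> \<le> 1 * env x" for x by (simp add: envelope_power_def env_def)
  then show "admissible envelope_power" unfolding admissible_def
    by (intro conjI allI impI exI[of _ 1]) (auto simp: envelope_power_def[abs_def] intro!: continuous_intros)
qed

lemma sample_mean_eq:
  assumes "0 < k n"
  shows "(\<Sum>i=1..k n. f (X n i w)) / real (k n) = expectation (\<lambda>w. f (X n 1 w)) + centered_sum f n {1..k n} w / sqrt (real (k n))"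
  using assms by (simp add: centered_sum_def sum_subtractf field_simps)

lemma centered_sum_measurable [measurable]:
  fixes f :: "real \<Rightarrow> real"
  assumes [measurable]: "f \<in> borel_measurable borel"
  shows "centered_sum f n A \<in> borel_measurable M"
  unfolding centered_sum_def[abs_def] by measurable

text \<open>Chebyshev's inequality with the bounded second moments.\<close>

lemma centered_sum_tight:
  assumes f: "admissible f" and C: "filterlim C at_top sequentially"
  shows "(\<lambda>n. prob {w\<in>space M. \<bar>centered_sum f n {1..k n} w\<bar> \<le> C n}) \<longlonglongrightarrow> 1"
proof -
  have [measurable]: "f \<in> borel_measurable borel" using f by (simp add: admissible_def)
  obtain V where V: "\<forall>\<^sub>F n in sequentially. integrable M (\<lambda>w. (centered_sum f n {1..k n} w)^2)
     \<and> expectation (\<lambda>w. (centered_sum f n {1..k n} w)^2) \<le> V" using centered_sum_variance[OF f] by blast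
  have C0: "\<forall>\<^sub>F n in sequentially. 0 < C n" using C unfolding filterlim_at_top_dense by blast
  have "((\<lambda>n. (1 / C n)) \<longlongrightarrow> 0) sequentially" using tendsto_inverse_0_at_top[OF C] by (simp add: inverse_eq_divide)
  then have "(\<lambda>n. 1 - V * (1 / C n)^2) \<longlonglongrightarrow> 1 - V * 0^2" by (intro tendsto_intros)
  then have lim: "(\<lambda>n. 1 - V * (1 / C n)^2) \<longlonglongrightarrow> 1" by simp
  show ?thesis
  proof (rule tendsto_sandwich[OF _ _ lim tendsto_const])
    show "\<forall>\<^sub>F n in sequentially. 1 - V * (1 / C n)^2 \<le> prob {w\<in>space M. \<bar>centered_sum f n {1..k n} w\<bar> \<le> C n}"
      using V C0
    proof eventually_elim
      case (elim n)
      define S where "S = centered_sum f n {1..k n}"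
      have [measurable]: "S \<in> borel_measurable M" unfolding S_def by measurable
      have "prob {w\<in>space M. (C n)^2 \<le> (S w)^2} \<le> expectation (\<lambda>w. (S w)^2) / (C n)^2"
        by (rule integral_Markov_inequality_measure[where A="{}"]) (use elim in \<open>auto simp: S_def\<close>)
      also have "\<dots> \<le> V / (C n)^2" using elim by (intro divide_right_mono) (auto simp: S_def)
      finally have 1: "prob {w\<in>space M. (C n)^2 \<le> (S w)^2} \<le> V * (1 / C n)^2" by (simp add: power_divide)
      have "prob (space M - {w\<in>space M. \<bar>S w\<bar> \<le> C n}) \<le> prob {w\<in>space M. (C n)^2 \<le> (S w)^2}"
      proof (rule finite_measure_mono)
        have "(C n)^2 \<le> (S w)^2" if "C n < \<bar>S w\<bar>" for w
          using power_mono[of "C n" "\<bar>S w\<bar>" 2] that elim by simp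
        then show "space M - {w\<in>space M. \<bar>S w\<bar> \<le> C n} \<subseteq> {w\<in>space M. (C n)^2 \<le> (S w)^2}" by auto
      qed measurable
      moreover have "prob (space M - {w\<in>space M. \<bar>S w\<bar> \<le> C n}) = 1 - prob {w\<in>space M. \<bar>S w\<bar> \<le> C n}"
        by (rule prob_compl) measurable
      ultimately show ?case using 1 unfolding S_def by linarith
    qed
  qed simp
qed

definition drift where "drift n = \<bar>expectation (\<lambda>w. f4 (X n 1 w)) - frechet_integral \<alpha>\<^sub>0 f4\<bar>"

text \<open>The mean of \<open>f4\<close> converges without a rate, at distance \<open>drift\<close> from its limit, so \<open>C\<close> has to grow
  slower than \<open>1 / drift\<close>; the second summand gives \<open>C n \<le> k n powr (1 / 16)\<close>, whose fifth power is
  below \<open>sqrt (k n)\<close>.\<close>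

definition C where "C n = 1 / sqrt (drift n + real (k n) powr (- (1 / 8)))"

lemma k_real_lim: "filterlim (\<lambda>n. real (k n)) at_top sequentially"
  by (rule filterlim_compose[OF filterlim_real_sequentially k_lim])

lemma k_pos: "\<forall>\<^sub>F n in sequentially. 0 < k n"
proof -
  have "\<forall>\<^sub>F n in sequentially. Suc 0 \<le> k n" using k_lim unfolding filterlim_at_top by blast
  then show ?thesis by (rule eventually_mono) simp
qed

lemma mean_limit:
  assumes "admissible f"
  shows "(\<lambda>n. expectation (\<lambda>w. f (X n 1 w))) \<longlonglongrightarrow> frechet_integral \<alpha>\<^sub>0 f"
  using admissible_mean(1)[OF assms] frechet_integral_eq[OF \<alpha>0_pos, of f] assms by (simp add: admissible_def)

lemma drift_lim: "drift \<longlonglongrightarrow> 0"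
  unfolding drift_def[abs_def] using tendsto_rabs[OF LIM_zero[OF mean_limit[OF admissible_tests(4)]]] by simp

lemma C_props:
  shows "filterlim C at_top sequentially" "(\<lambda>n. C n ^ 5 / sqrt (real (k n))) \<longlonglongrightarrow> 0" "(\<lambda>n. C n * drift n) \<longlonglongrightarrow> 0"
proof -
  define \<delta> where "\<delta> n = drift n + real (k n) powr (- (1 / 8))" for n
  have d0: "0 \<le> drift n" for n by (simp add: drift_def)
  have \<delta>0: "\<forall>\<^sub>F n in sequentially. 0 < \<delta> n"
    using k_pos by eventually_elim (use d0 in \<open>simp add: \<delta>_def add_nonneg_pos\<close>)
  have "(\<lambda>n. real (k n) powr (- (1 / 8))) \<longlonglongrightarrow> 0" by (rule tendsto_neg_powr[OF _ k_real_lim]) simp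
  from tendsto_add[OF drift_lim this] have \<delta>l: "\<delta> \<longlonglongrightarrow> 0" by (simp add: \<delta>_def[abs_def])
  then have sl: "(\<lambda>n. sqrt (\<delta> n)) \<longlonglongrightarrow> 0" using tendsto_real_sqrt by fastforce
  have Cd: "C = (\<lambda>n. inverse (sqrt (\<delta> n)))" by (simp add: C_def[abs_def] \<delta>_def inverse_eq_divide)
  show "filterlim C at_top sequentially" unfolding Cd
    by (rule filterlim_inverse_at_top[OF sl]) (use \<delta>0 in \<open>simp add: eventually_mono\<close>)
  have kneg: "(\<lambda>n. real (k n) powr (- (3 / 16))) \<longlonglongrightarrow> 0" by (rule tendsto_neg_powr[OF _ k_real_lim]) simp
  show "(\<lambda>n. C n ^ 5 / sqrt (real (k n))) \<longlonglongrightarrow> 0"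
  proof (rule Lim_null_comparison[OF _ kneg])
    show "\<forall>\<^sub>F n in sequentially. norm (C n ^ 5 / sqrt (real (k n))) \<le> real (k n) powr (- (3 / 16))"
      using k_pos
    proof eventually_elim
      case (elim n)
      define \<kappa> where "\<kappa> = real (k n)"
      have \<kappa>: "0 < \<kappa>" using elim by (simp add: \<kappa>_def)
      have "sqrt (\<kappa> powr (- (1 / 8))) = \<kappa> powr (- (1 / 16))" using \<kappa> by (simp add: powr_half_sqrt[symmetric] powr_powr)
      moreover have "sqrt (\<kappa> powr (- (1 / 8))) \<le> sqrt (\<delta> n)" using d0 by (simp add: \<delta>_def \<kappa>_def)
      ultimately have "\<kappa> powr (- (1 / 16)) \<le> sqrt (\<delta> n)" by simp
      then have "C n \<le> inverse (\<kappa> powr (- (1 / 16)))" unfolding Cd using \<kappa> by (intro le_imp_inverse_le) auto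
      also have "\<dots> = \<kappa> powr (1 / 16)" by (simp add: powr_minus)
      finally have Cn: "C n \<le> \<kappa> powr (1 / 16)" .
      have C0: "0 \<le> C n" using d0 by (simp add: Cd \<delta>_def)
      have "C n ^ 5 \<le> (\<kappa> powr (1 / 16)) ^ 5" by (rule power_mono[OF Cn C0])
      also have "\<dots> = \<kappa> powr (5 / 16)" using \<kappa> by (simp add: powr_power)
      finally have "C n ^ 5 / sqrt \<kappa> \<le> \<kappa> powr (5 / 16) / \<kappa> powr (1 / 2)"
        using \<kappa> by (simp add: powr_half_sqrt divide_right_mono)
      also have "\<dots> = \<kappa> powr (5 / 16 - 1 / 2)" by (rule powr_diff[symmetric])
      finally show ?case using C0 by (simp add: \<kappa>_def)
    qed
  qed
  show "(\<lambda>n. C n * drift n) \<longlonglongrightarrow> 0"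
  proof (rule Lim_null_comparison[OF _ sl])
    show "\<forall>\<^sub>F n in sequentially. norm (C n * drift n) \<le> sqrt (\<delta> n)"
      using \<delta>0
    proof eventually_elim
      case (elim n)
      have "C n * drift n \<le> C n * \<delta> n" using d0 elim by (intro mult_left_mono) (auto simp: \<delta>_def Cd)
      also have "\<dots> = sqrt (\<delta> n)" using elim by (simp add: Cd inverse_eq_divide real_div_sqrt)
      finally show ?case using d0 elim by (simp add: Cd)
    qed
  qed
qed

end

section \<open>The events on which the likelihood is well behaved\<close>

lemma scaled_matrix_mult:
  fixes s :: real
  shows "((s *\<^sub>R vector [vector [a, b, c], vector [d, e, f]] :: real^3^2) *v vector [x, y, z]) $ 1 = s * (a * x + b * y + c * z)"
    "((s *\<^sub>R vector [vector [a, b, c], vector [d, e, f]] :: real^3^2) *v vector [x, y, z]) $ 2 = s * (d * x + e * y + f * z)"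
  by (simp_all add: matrix_vector_mult_def sum_3 vector_3 algebra_simps)

lemma M_mat_mult:
  "(M_mat a *v vector [x, y, z]) $ 1 = 6 / pi^2 * (a^2 * x + a * (1 - euler_mascheroni) * y - a^2 * z)"
  "(M_mat a *v vector [x, y, z]) $ 2 = 6 / pi^2 * ((euler_mascheroni - 1) * x
     - (((1 - euler_mascheroni)^2 + pi^2 / 6) / a) * y + (1 - euler_mascheroni) * z)"
  unfolding M_mat_def scaled_matrix_mult deriv2_Gamma_2 by simp_all

locale frechet_mle = frechet_block_maxima +
  fixes B :: "(real \<Rightarrow> real) \<Rightarrow> real"
  assumes diverge: "\<And>b. b > 0 \<Longrightarrow>
      (\<lambda>n. measure M {w \<in> space M. Min ((\<lambda>i. block_max \<xi> (r n) i w) ` {1..k n}) \<le> b}) \<longlonglongrightarrow> 0"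
    and bias: "\<And>f. f \<in> {f1 \<alpha>\<^sub>0, f2 \<alpha>\<^sub>0, f3} \<Longrightarrow>
      (\<lambda>n. sqrt (real (k n)) *
             ((\<integral>w. f (max (block_max \<xi> (r n) 1 w) c / \<sigma> (r n)) \<partial>M) - frechet_integral \<alpha>\<^sub>0 f)) \<longlonglongrightarrow> B f"
begin

definition test_functions where "test_functions = {f1 \<alpha>\<^sub>0, f2 \<alpha>\<^sub>0, f3, f4, envelope_power}"

text \<open>Half of \<open>C\<close> is reserved for the bias. Block maxima above \<open>c\<close> are not affected by the clipping at \<open>c\<close>,
  so the likelihood of the clipped and of the original sample agree.\<close>

definition good where
  "good n = {w\<in>space M. (\<forall>f\<in>test_functions. \<bar>centered_sum f n {1..k n} w\<bar> \<le> C n / 2) \<and> (\<forall>i\<in>{1..k n}. c < block_max \<xi> (r n) i w)}"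

lemma test_functions: "f \<in> test_functions \<Longrightarrow> admissible f" "f \<in> test_functions \<Longrightarrow> f \<in> borel_measurable borel"
  using admissible_tests by (auto simp: test_functions_def admissible_def)

lemma good_split: "good n = (\<Inter>f\<in>test_functions. {w\<in>space M. \<bar>centered_sum f n {1..k n} w\<bar> \<le> C n / 2})
    \<inter> {w\<in>space M. \<forall>i\<in>{1..k n}. c < block_max \<xi> (r n) i w}"
  by (auto simp: good_def test_functions_def)

lemma large_blocks_event: "{w\<in>space M. \<forall>i\<in>{1..k n}. c < block_max \<xi> (r n) i w} \<in> events" by measurable

lemma tests_event: "f \<in> test_functions \<Longrightarrow> {w\<in>space M. \<bar>centered_sum f n {1..k n} w\<bar> \<le> C n / 2} \<in> events"
  using test_functions(2)[of f] by measurable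

lemma good_event [measurable]: "good n \<in> events"
  unfolding good_split by (intro sets.Int sets.finite_INT large_blocks_event tests_event) (auto simp: test_functions_def)

lemma good_prob: "(\<lambda>n. prob (good n)) \<longlonglongrightarrow> 1"
proof -
  have C2: "filterlim (\<lambda>n. C n / 2) at_top sequentially"
    using filterlim_tendsto_pos_mult_at_top[OF tendsto_const[of "1/2"] _ C_props(1)] by simp
  have t: "(\<lambda>n. prob {w\<in>space M. \<bar>centered_sum f n {1..k n} w\<bar> \<le> C n / 2}) \<longlonglongrightarrow> 1" if "f \<in> test_functions" for f
    by (rule centered_sum_tight[OF test_functions(1)[OF that] C2])
  have b: "(\<lambda>n. prob {w\<in>space M. \<forall>i\<in>{1..k n}. c < block_max \<xi> (r n) i w}) \<longlonglongrightarrow> 1"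
  proof (rule Lim_transform_eventually)
    have "(\<lambda>n. 1 - prob {w\<in>space M. Min ((\<lambda>i. block_max \<xi> (r n) i w) ` {1..k n}) \<le> c}) \<longlonglongrightarrow> 1 - 0"
      by (intro tendsto_intros diverge c_pos)
    then show "(\<lambda>n. 1 - prob {w\<in>space M. Min ((\<lambda>i. block_max \<xi> (r n) i w) ` {1..k n}) \<le> c}) \<longlonglongrightarrow> 1" by simp
    show "\<forall>\<^sub>F n in sequentially. 1 - prob {w\<in>space M. Min ((\<lambda>i. block_max \<xi> (r n) i w) ` {1..k n}) \<le> c}
      = prob {w\<in>space M. \<forall>i\<in>{1..k n}. c < block_max \<xi> (r n) i w}"
      using k_pos
    proof eventually_elim
      case (elim n)
      have "{w\<in>space M. Min ((\<lambda>i. block_max \<xi> (r n) i w) ` {1..k n}) \<le> c}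
        = space M - {w\<in>space M. \<forall>i\<in>{1..k n}. c < block_max \<xi> (r n) i w}"
        using elim by (auto simp: Min_le_iff not_less not_le)
      then show ?case using prob_compl[OF large_blocks_event[of n]] by simp
    qed
  qed
  have *: "good n = ((((({w\<in>space M. \<forall>i\<in>{1..k n}. c < block_max \<xi> (r n) i w}
      \<inter> {w\<in>space M. \<bar>centered_sum (f1 \<alpha>\<^sub>0) n {1..k n} w\<bar> \<le> C n / 2})
      \<inter> {w\<in>space M. \<bar>centered_sum (f2 \<alpha>\<^sub>0) n {1..k n} w\<bar> \<le> C n / 2})
      \<inter> {w\<in>space M. \<bar>centered_sum f3 n {1..k n} w\<bar> \<le> C n / 2})
      \<inter> {w\<in>space M. \<bar>centered_sum f4 n {1..k n} w\<bar> \<le> C n / 2})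
      \<inter> {w\<in>space M. \<bar>centered_sum envelope_power n {1..k n} w\<bar> \<le> C n / 2})" for n
    by (auto simp: good_def test_functions_def)
  show ?thesis unfolding *
    by (intro prob_Int_tendsto_1 sets.Int large_blocks_event tests_event b t) (simp_all add: test_functions_def)
qed

lemma bias_X: "f \<in> {f1 \<alpha>\<^sub>0, f2 \<alpha>\<^sub>0, f3} \<Longrightarrow>
    (\<lambda>n. sqrt (real (k n)) * (expectation (\<lambda>w. f (X n 1 w)) - frechet_integral \<alpha>\<^sub>0 f)) \<longlonglongrightarrow> B f"
  unfolding X_def by (rule bias)

lemma emp_proc_eq:
  "emp_proc \<xi> r k \<sigma> \<alpha>\<^sub>0 c n f w = sqrt (real (k n)) * ((\<Sum>i=1..k n. f (X n i w)) / real (k n) - frechet_integral \<alpha>\<^sub>0 f)"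
  by (simp add: emp_proc_def X_def)

text \<open>A centered sum, to which the central limit theorem applies, and a deterministic bias.\<close>

lemma emp_proc_decomposition:
  assumes "0 < k n"
  shows "emp_proc \<xi> r k \<sigma> \<alpha>\<^sub>0 c n f w
    = centered_sum f n {1..k n} w + sqrt (real (k n)) * (expectation (\<lambda>w. f (X n 1 w)) - frechet_integral \<alpha>\<^sub>0 f)"
  unfolding emp_proc_eq sample_mean_eq[OF assms] using assms by (simp add: algebra_simps)

lemma emp_proc_bound:
  assumes f: "f \<in> {f1 \<alpha>\<^sub>0, f2 \<alpha>\<^sub>0, f3}"
  shows "\<forall>\<^sub>F n in sequentially. \<forall>w\<in>good n. \<bar>emp_proc \<xi> r k \<sigma> \<alpha>\<^sub>0 c n f w\<bar> \<le> C n"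
proof -
  have "\<forall>\<^sub>F n in sequentially. \<bar>sqrt (real (k n)) * (expectation (\<lambda>w. f (X n 1 w)) - frechet_integral \<alpha>\<^sub>0 f)\<bar> < \<bar>B f\<bar> + 1"
    by (rule order_tendstoD(2)[OF tendsto_rabs[OF bias_X[OF f]]]) simp
  moreover have "\<forall>\<^sub>F n in sequentially. 2 * (\<bar>B f\<bar> + 1) \<le> C n" using C_props(1) unfolding filterlim_at_top by blast
  ultimately show ?thesis using k_pos
  proof eventually_elim
    case (elim n)
    have sum_le: "\<bar>x + y\<bar> \<le> z" if "\<bar>x\<bar> \<le> z / 2" "\<bar>y\<bar> < b + 1" "2 * (b + 1) \<le> z" for x y z b :: real
      using that by (simp add: abs_if split: if_splits)
    show ?case
    proof
      fix w assume "w \<in> good n"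
      then have "\<bar>centered_sum f n {1..k n} w\<bar> \<le> C n / 2" using f by (auto simp: good_def test_functions_def)
      then show "\<bar>emp_proc \<xi> r k \<sigma> \<alpha>\<^sub>0 c n f w\<bar> \<le> C n" unfolding emp_proc_decomposition[OF elim(3)] by (rule sum_le[OF _ elim(1,2)])
    qed
  qed
qed

lemma emp_proc_log_means:
  "emp_proc \<xi> r k \<sigma> \<alpha>\<^sub>0 c n (f1 \<alpha>\<^sub>0) w = sqrt (real (k n)) * (log_power_mean (k n) (\<lambda>i. X n i w) 1 \<alpha>\<^sub>0 - - (1 - euler_mascheroni) / \<alpha>\<^sub>0)"
  "emp_proc \<xi> r k \<sigma> \<alpha>\<^sub>0 c n (f2 \<alpha>\<^sub>0) w = sqrt (real (k n)) * (log_power_mean (k n) (\<lambda>i. X n i w) 0 \<alpha>\<^sub>0 - 1)"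
  "emp_proc \<xi> r k \<sigma> \<alpha>\<^sub>0 c n f3 w = sqrt (real (k n)) * (log_mean (k n) (\<lambda>i. X n i w) - euler_mascheroni / \<alpha>\<^sub>0)"
  unfolding emp_proc_eq frechet_moments[OF \<alpha>0_pos] by (simp_all add: log_power_mean_def log_mean_def f1_def f2_def f3_def)

text \<open>On the events \<open>good\<close> every condition of the deterministic analysis follows from the bound
  \<open>C n / 2\<close> on the centered sums together with the convergence of the corresponding expectation.\<close>

lemma mle_asymptotics_good:
  assumes E: "\<And>n. E n \<subseteq> good n"
  shows "mle_asymptotics (sample_filter E) (\<lambda>b. k (fst b)) (\<lambda>b i. X (fst b) i (snd b)) (\<lambda>b. C (fst b)) \<alpha>\<^sub>0 \<beta>
     (- (1 - euler_mascheroni) / \<alpha>\<^sub>0) (((1 - euler_mascheroni)^2 + pi^2 / 6 - 1) / \<alpha>\<^sub>0^2) (euler_mascheroni / \<alpha>\<^sub>0) (pi^2 / (6 * \<alpha>\<^sub>0^2))"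
proof
  have n1: "\<forall>\<^sub>F n :: nat in sequentially. 1 \<le> n" by (rule eventually_ge_at_top)
  show "0 < \<alpha>\<^sub>0" "\<alpha>\<^sub>0 < \<beta>" by (rule \<alpha>0_pos \<beta>)+
  show "\<forall>\<^sub>F b in sample_filter E. 0 < k (fst b) \<and> (\<forall>i\<in>{1..k (fst b)}. 0 < X (fst b) i (snd b))"
    unfolding eventually_sample_filter using k_pos n1 by eventually_elim (simp add: X_pos)
  show "filterlim (\<lambda>b. C (fst b)) at_top (sample_filter E)"
    by (rule filterlim_compose[OF C_props(1) filterlim_fst_sample_filter])
  show "((\<lambda>b. C (fst b) ^ 5 / sqrt (real (k (fst b)))) \<longlongrightarrow> 0) (sample_filter E)"
    by (rule filterlim_compose[OF C_props(2) filterlim_fst_sample_filter])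
  have G: "\<forall>\<^sub>F b in sample_filter E. \<bar>emp_proc \<xi> r k \<sigma> \<alpha>\<^sub>0 c (fst b) f (snd b)\<bar> \<le> C (fst b)" if "f \<in> {f1 \<alpha>\<^sub>0, f2 \<alpha>\<^sub>0, f3}" for f
    unfolding eventually_sample_filter using emp_proc_bound[OF that] by eventually_elim (use E in auto)
  show "\<forall>\<^sub>F b in sample_filter E. \<bar>sqrt (real (k (fst b))) * (log_power_mean (k (fst b)) (\<lambda>i. X (fst b) i (snd b)) 1 \<alpha>\<^sub>0 - - (1 - euler_mascheroni) / \<alpha>\<^sub>0)\<bar> \<le> C (fst b)"
    "\<forall>\<^sub>F b in sample_filter E. \<bar>sqrt (real (k (fst b))) * (log_power_mean (k (fst b)) (\<lambda>i. X (fst b) i (snd b)) 0 \<alpha>\<^sub>0 - 1)\<bar> \<le> C (fst b)"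
    "\<forall>\<^sub>F b in sample_filter E. \<bar>sqrt (real (k (fst b))) * (log_mean (k (fst b)) (\<lambda>i. X (fst b) i (snd b)) - euler_mascheroni / \<alpha>\<^sub>0)\<bar> \<le> C (fst b)"
    using G[of "f1 \<alpha>\<^sub>0"] G[of "f2 \<alpha>\<^sub>0"] G[of f3] unfolding emp_proc_log_means by simp_all
  let ?m2 = "((1 - euler_mascheroni)^2 + pi^2 / 6 - 1) / \<alpha>\<^sub>0^2"
  have m2: "frechet_integral \<alpha>\<^sub>0 f4 = ?m2"
    using frechet_moments(4)[OF \<alpha>0_pos] by (simp add: f4_def[abs_def])
  have C1: "\<forall>\<^sub>F n in sequentially. 1 \<le> C n" using C_props(1) unfolding filterlim_at_top by blast
  show "((\<lambda>b. C (fst b) * (log_power_mean (k (fst b)) (\<lambda>i. X (fst b) i (snd b)) 2 \<alpha>\<^sub>0 - ?m2)) \<longlongrightarrow> 0) (sample_filter E)"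
  proof (rule Lim_null_comparison)
    have "(\<lambda>n. C n * drift n + C n ^ 5 / sqrt (real (k n))) \<longlonglongrightarrow> 0" using tendsto_add[OF C_props(3,2)] by simp
    from filterlim_compose[OF this filterlim_fst_sample_filter]
    show "((\<lambda>b. C (fst b) * drift (fst b) + C (fst b) ^ 5 / sqrt (real (k (fst b)))) \<longlongrightarrow> 0) (sample_filter E)" .
    show "\<forall>\<^sub>F b in sample_filter E. norm (C (fst b) * (log_power_mean (k (fst b)) (\<lambda>i. X (fst b) i (snd b)) 2 \<alpha>\<^sub>0 - ?m2))
      \<le> C (fst b) * drift (fst b) + C (fst b) ^ 5 / sqrt (real (k (fst b)))"
      unfolding eventually_sample_filter using k_pos C1
    proof eventually_elim
      case (elim n)
      show ?case
      proof
        fix w assume "w \<in> E n"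
        then have S: "\<bar>centered_sum f4 n {1..k n} w\<bar> \<le> C n / 2" using E by (auto simp: good_def test_functions_def)
        define q where "q = sqrt (real (k n))"
        have q: "0 < q" using elim by (simp add: q_def)
        have "log_power_mean (k n) (\<lambda>i. X n i w) 2 \<alpha>\<^sub>0 = (\<Sum>i=1..k n. f4 (X n i w)) / real (k n)"
          by (simp add: log_power_mean_def f4_def)
        then have "log_power_mean (k n) (\<lambda>i. X n i w) 2 \<alpha>\<^sub>0 - ?m2
          = (expectation (\<lambda>w. f4 (X n 1 w)) - frechet_integral \<alpha>\<^sub>0 f4) + centered_sum f4 n {1..k n} w / q"
          unfolding sample_mean_eq[OF elim(1)] m2 q_def by simp
        then have "\<bar>log_power_mean (k n) (\<lambda>i. X n i w) 2 \<alpha>\<^sub>0 - ?m2\<bar> \<le> drift n + \<bar>centered_sum f4 n {1..k n} w / q\<bar>"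
          unfolding drift_def by linarith
        also have "\<bar>centered_sum f4 n {1..k n} w / q\<bar> = \<bar>centered_sum f4 n {1..k n} w\<bar> / q" using q by simp
        also have "\<dots> \<le> C n / q" using S elim q by (intro divide_right_mono) auto
        finally have "C n * \<bar>log_power_mean (k n) (\<lambda>i. X n i w) 2 \<alpha>\<^sub>0 - ?m2\<bar> \<le> C n * (drift n + C n / q)"
          using elim by (intro mult_left_mono) auto
        also have "\<dots> = C n * drift n + C n ^ 2 / q" by (simp add: algebra_simps power2_eq_square)
        also have "C n ^ 2 / q \<le> C n ^ 5 / q" using elim q by (intro divide_right_mono power_increasing) auto
        finally show "norm (C (fst (n, w)) * (log_power_mean (k (fst (n, w))) (\<lambda>i. X (fst (n, w)) i (snd (n, w))) 2 \<alpha>\<^sub>0 - ?m2))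
          \<le> C (fst (n, w)) * drift (fst (n, w)) + C (fst (n, w)) ^ 5 / sqrt (real (k (fst (n, w))))"
          using elim by (simp add: abs_mult q_def)
      qed
    qed
  qed
  define L where "L = frechet_integral \<alpha>\<^sub>0 envelope_power"
  have "\<forall>\<^sub>F n in sequentially. expectation (\<lambda>w. envelope_power (X n 1 w)) < L + 1"
    by (rule order_tendstoD(2)[OF mean_limit[OF admissible_tests(5)]]) (simp add: L_def)
  moreover have "\<forall>\<^sub>F n in sequentially. 2 * (\<bar>L\<bar> + 1) \<le> C n" using C_props(1) unfolding filterlim_at_top by blast
  ultimately show "\<forall>\<^sub>F b in sample_filter E. (\<Sum>i=1..k (fst b). 1 + X (fst b) i (snd b) powr (- \<beta>)) / real (k (fst b)) \<le> C (fst b)"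
    unfolding eventually_sample_filter using k_pos
  proof eventually_elim
    case (elim n)
    have sum_le: "e + y \<le> z" if "\<bar>x\<bar> \<le> z / 2" "y \<le> \<bar>x\<bar>" "e < l + 1" "2 * (\<bar>l\<bar> + 1) \<le> z" for x y z l e :: real
      using that by (simp add: abs_if split: if_splits)
    show ?case
    proof
      fix w assume "w \<in> E n"
      then have S: "\<bar>centered_sum envelope_power n {1..k n} w\<bar> \<le> C n / 2" using E by (auto simp: good_def test_functions_def)
      have "1 \<le> sqrt (real (k n))" using elim(3) by simp
      then have "\<bar>centered_sum envelope_power n {1..k n} w\<bar> / sqrt (real (k n)) \<le> \<bar>centered_sum envelope_power n {1..k n} w\<bar> / 1"
        by (intro divide_left_mono) auto
      moreover have "centered_sum envelope_power n {1..k n} w / sqrt (real (k n)) \<le> \<bar>centered_sum envelope_power n {1..k n} w\<bar> / sqrt (real (k n))"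
        by (intro divide_right_mono) auto
      ultimately have le: "centered_sum envelope_power n {1..k n} w / sqrt (real (k n)) \<le> \<bar>centered_sum envelope_power n {1..k n} w\<bar>"
        by simp
      have eq: "(\<Sum>i=1..k n. 1 + X n i w powr (- \<beta>)) / real (k n) = (\<Sum>i=1..k n. envelope_power (X n i w)) / real (k n)"
        by (simp add: envelope_power_def)
      show "(\<Sum>i=1..k (fst (n, w)). 1 + X (fst (n, w)) i (snd (n, w)) powr (- \<beta>)) / real (k (fst (n, w))) \<le> C (fst (n, w))"
        unfolding fst_conv snd_conv eq sample_mean_eq[OF elim(3)] by (rule sum_le[OF S le elim(1,2)])
    qed
  qed
  show "1 / \<alpha>\<^sub>0 + - (1 - euler_mascheroni) / \<alpha>\<^sub>0 - euler_mascheroni / \<alpha>\<^sub>0 = 0" using \<alpha>0_pos by (simp add: field_simps)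
  show "pi^2 / (6 * \<alpha>\<^sub>0^2) = 1 / \<alpha>\<^sub>0^2 + ?m2 - (- (1 - euler_mascheroni) / \<alpha>\<^sub>0)^2"
  proof -
    have "(- (1 - euler_mascheroni) / \<alpha>\<^sub>0)^2 = (1 - euler_mascheroni)^2 / \<alpha>\<^sub>0^2" by (simp only: power_divide power2_minus)
    then show ?thesis by (simp add: add_divide_distrib diff_divide_distrib)
  qed
  show "0 < pi^2 / (6 * \<alpha>\<^sub>0^2)" using \<alpha>0_pos by simp
qed

lemma maximizer_iff_root:
  assumes n: "1 \<le> n" "0 < k n" and w: "w \<in> good n" and a: "0 < a" "profile_score (k n) (\<lambda>i. X n i w) a = 0"
  shows "frechet_maximizer (k n) (\<lambda>i. block_max \<xi> (r n) i w) \<theta> \<longleftrightarrow> \<theta> = (a, \<sigma> (r n) * profile_scale (k n) (\<lambda>i. X n i w) a)"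
proof -
  obtain u v where \<theta>: "\<theta> = (u, v)" by (cases \<theta>)
  have s: "0 < \<sigma> (r n)" by (rule \<sigma>r_pos[OF n(1)])
  have big: "c < block_max \<xi> (r n) i w" if "i \<in> {1..k n}" for i using w that by (auto simp: good_def)
  have "frechet_maximizer (k n) (\<lambda>i. block_max \<xi> (r n) i w) (u, v)
    \<longleftrightarrow> frechet_maximizer (k n) (\<lambda>i. block_max \<xi> (r n) i w / \<sigma> (r n)) (u, v / \<sigma> (r n))"
    by (rule frechet_maximizer_scale[OF s]) (use big c_pos in \<open>auto intro: less_trans\<close>)
  also have "\<dots> \<longleftrightarrow> frechet_maximizer (k n) (\<lambda>i. X n i w) (u, v / \<sigma> (r n))"
    by (rule frechet_maximizer_cong) (use big in \<open>auto simp: X_def max_def less_imp_le not_le[symmetric]\<close>)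
  also have "\<dots> \<longleftrightarrow> (u, v / \<sigma> (r n)) = (a, profile_scale (k n) (\<lambda>i. X n i w) a)"
    by (rule frechet_maximizer_unique[OF n(2) X_pos[OF n(1)] a])
  also have "\<dots> \<longleftrightarrow> \<theta> = (a, \<sigma> (r n) * profile_scale (k n) (\<lambda>i. X n i w) a)" using s by (auto simp: \<theta> field_simps)
  finally show ?thesis unfolding \<theta> .
qed

lemma root_exists:
  "\<forall>\<^sub>F n in sequentially. 1 \<le> n \<and> 0 < k n \<and> (\<forall>w\<in>good n. \<exists>a>0. profile_score (k n) (\<lambda>i. X n i w) a = 0)"
proof -
  interpret L: mle_asymptotics "sample_filter good" "\<lambda>b. k (fst b)" "\<lambda>b i. X (fst b) i (snd b)" "\<lambda>b. C (fst b)" \<alpha>\<^sub>0 \<beta>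
     "- (1 - euler_mascheroni) / \<alpha>\<^sub>0" "((1 - euler_mascheroni)^2 + pi^2 / 6 - 1) / \<alpha>\<^sub>0^2" "euler_mascheroni / \<alpha>\<^sub>0" "pi^2 / (6 * \<alpha>\<^sub>0^2)"
    by (rule mle_asymptotics_good) simp
  have "\<forall>\<^sub>F n in sequentially. \<forall>w\<in>good n. \<exists>a>0. profile_score (k n) (\<lambda>i. X n i w) a = 0"
    using L.root_exists unfolding eventually_sample_filter by simp
  then show ?thesis using k_pos eventually_ge_at_top[of 1] by eventually_elim simp
qed

end

section \<open>Existence and linear expansion of the maximum likelihood estimator\<close>

context frechet_mle
begin

lemma profile_score_event:
  "{w\<in>space M. profile_score (k n) (\<lambda>i. X n i w) t < 0} \<in> events"
  unfolding profile_score_def log_power_mean_def log_mean_def by measurable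

text \<open>The estimator is the zero of the score on \<open>good\<close> and an arbitrary constant elsewhere. It is measurable
  because the score is decreasing: the zero lies below \<open>t\<close> exactly if the score at \<open>t\<close> is negative.\<close>

theorem mle_exists: "\<exists>a s. asymptotic_frechet_mle M k (\<lambda>n. block_max \<xi> (r n)) a s"
proof -
  obtain N where N: "\<And>n. N \<le> n \<Longrightarrow> 1 \<le> n \<and> 0 < k n \<and> (\<forall>w\<in>good n. \<exists>a>0. profile_score (k n) (\<lambda>i. X n i w) a = 0)"
    using root_exists unfolding eventually_sequentially by blast
  define E where "E n = (if N \<le> n then good n else {})" for n
  define root where "root n w = (SOME a. 0 < a \<and> profile_score (k n) (\<lambda>i. X n i w) a = 0)" for n w
  define a where "a n w = (if w \<in> E n then root n w else 1)" for n w
  define s where "s n w = \<sigma> (r n) * profile_scale (k n) (\<lambda>i. X n i w) (a n w)" for n w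
  have En: "N \<le> n" "1 \<le> n" "0 < k n" "w \<in> good n" if "w \<in> E n" for n w
    using that N[of n] by (auto simp: E_def split: if_splits)
  have root: "0 < root n w \<and> profile_score (k n) (\<lambda>i. X n i w) (root n w) = 0" if "w \<in> E n" for n w
    unfolding root_def by (rule someI_ex) (use N[OF En(1)[OF that]] En(4)[OF that] in blast)
  have Em [measurable]: "E n \<in> events" for n by (simp add: E_def)
  have E1: "(\<lambda>n. prob (E n)) \<longlonglongrightarrow> 1"
    by (rule Lim_transform_eventually[OF good_prob]) (auto simp: E_def eventually_sequentially intro!: exI[of _ N])
  have am [measurable]: "a n \<in> borel_measurable M" for n
    unfolding borel_measurable_iff_less
  proof
    fix t :: real
    have less: "root n w < t \<longleftrightarrow> profile_score (k n) (\<lambda>i. X n i w) t < 0" if w: "w \<in> E n" and t: "0 < t" for w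
    proof -
      have R: "0 < root n w" "profile_score (k n) (\<lambda>i. X n i w) (root n w) = 0" using root[OF w] by auto
      have dec: "profile_score (k n) (\<lambda>i. X n i w) v < profile_score (k n) (\<lambda>i. X n i w) u" if "0 < u" "u < v" for u v
        using that by (intro profile_score_strict_decrease En(3)[OF w] X_pos En(2)[OF w])
      show ?thesis
        using dec[of "root n w" t] dec[of t "root n w"] R t by (cases "root n w" t rule: linorder_cases) auto
    qed
    have split: "{w\<in>space M. a n w < t} = (if 0 < t then E n \<inter> {w\<in>space M. profile_score (k n) (\<lambda>i. X n i w) t < 0} else {})
      \<union> (if 1 < t then space M - E n else {})"
    proof (intro set_eqI)
      fix w
      have "w \<in> E n \<Longrightarrow> w \<in> space M" using sets.sets_into_space[OF Em[of n]] by blast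
      then show "w \<in> {w\<in>space M. a n w < t} \<longleftrightarrow> w \<in> (if 0 < t then E n \<inter> {w\<in>space M. profile_score (k n) (\<lambda>i. X n i w) t < 0} else {})
        \<union> (if 1 < t then space M - E n else {})"
        using less[of w] root[of w n] by (cases "w \<in> E n") (auto simp: a_def)
    qed
    have 1: "(if 0 < t then E n \<inter> {w\<in>space M. profile_score (k n) (\<lambda>i. X n i w) t < 0} else {}) \<in> events"
      using sets.Int[OF Em[of n] profile_score_event[of n t]] by simp
    have 2: "(if 1 < t then space M - E n else {}) \<in> events" by simp
    show "{w\<in>space M. a n w < t} \<in> events" unfolding split by (rule sets.Un[OF 1 2])
  qed
  have sm: "s n \<in> borel_measurable M" for n
    unfolding s_def[abs_def] profile_scale_def log_power_mean_def by measurable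
  have mx: "frechet_maximizer (k n) (\<lambda>i. block_max \<xi> (r n) i w) \<theta> \<longleftrightarrow> \<theta> = (a n w, s n w)" if w: "w \<in> E n" for n w \<theta>
    unfolding s_def using maximizer_iff_root[OF En(2-4)[OF w]] root[OF w] w by (simp add: a_def)
  show ?thesis
    unfolding asymptotic_frechet_mle_def
    by (rule exI[of _ a], rule exI[of _ s], intro conjI allI exI[of _ E] ballI am sm Em E1 mx)
qed

definition G where
  "G n w = (vector [emp_proc \<xi> r k \<sigma> \<alpha>\<^sub>0 c n (f1 \<alpha>\<^sub>0) w, emp_proc \<xi> r k \<sigma> \<alpha>\<^sub>0 c n (f2 \<alpha>\<^sub>0) w,
     emp_proc \<xi> r k \<sigma> \<alpha>\<^sub>0 c n f3 w] :: real^3)"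

text \<open>The coefficients of the expansion are the rows of \<open>M_mat\<close>; the second row uses
  \<open>\<Gamma>''(2) + 1 = (1 - \<gamma>)^2 + \<pi>^2 / 6\<close>.\<close>

lemma row_identities:
  "(g1 - - (1 - euler_mascheroni) / \<alpha>\<^sub>0 * g2 - g3) / (pi^2 / (6 * \<alpha>\<^sub>0^2)) = (M_mat \<alpha>\<^sub>0 *v vector [g1, g2, g3]) $ 1"
  "(g2 - - (1 - euler_mascheroni) / \<alpha>\<^sub>0 * ((g1 - - (1 - euler_mascheroni) / \<alpha>\<^sub>0 * g2 - g3) / (pi^2 / (6 * \<alpha>\<^sub>0^2)))) / \<alpha>\<^sub>0
     = - (M_mat \<alpha>\<^sub>0 *v vector [g1, g2, g3]) $ 2"
  unfolding M_mat_mult using \<alpha>0_pos by (simp_all add: field_simps power2_eq_square)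

text \<open>Any estimator that maximizes the likelihood with probability tending to one agrees there with the
  zero of the score.\<close>

lemma mle_expansion:
  assumes as: "asymptotic_frechet_mle M k (\<lambda>n. block_max \<xi> (r n)) a s"
  obtains E where "\<And>n. E n \<in> events" "(\<lambda>n. prob (E n)) \<longlonglongrightarrow> 1"
    "\<And>e. 0 < e \<Longrightarrow> \<forall>\<^sub>F n in sequentially. \<forall>w\<in>E n.
       \<bar>sqrt (real (k n)) * (a n w - \<alpha>\<^sub>0) - (M_mat \<alpha>\<^sub>0 *v G n w) $ 1\<bar> < e \<and>
       \<bar>sqrt (real (k n)) * (s n w / \<sigma> (r n) - 1) - (M_mat \<alpha>\<^sub>0 *v G n w) $ 2\<bar> < e"
proof -
  obtain E' where E': "\<And>n. E' n \<in> events" "(\<lambda>n. prob (E' n)) \<longlonglongrightarrow> 1"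
    "\<And>n w \<theta>. w \<in> E' n \<Longrightarrow> frechet_maximizer (k n) (\<lambda>i. block_max \<xi> (r n) i w) \<theta> \<longleftrightarrow> \<theta> = (a n w, s n w)"
    using as unfolding asymptotic_frechet_mle_def by blast
  define E where "E n = E' n \<inter> good n" for n
  have E: "\<And>n. E n \<in> events" "(\<lambda>n. prob (E n)) \<longlonglongrightarrow> 1"
    unfolding E_def using E'(1) good_event prob_Int_tendsto_1[OF E'(1) good_event E'(2) good_prob] by auto
  interpret L: mle_asymptotics "sample_filter E" "\<lambda>b. k (fst b)" "\<lambda>b i. X (fst b) i (snd b)" "\<lambda>b. C (fst b)" \<alpha>\<^sub>0 \<beta>
     "- (1 - euler_mascheroni) / \<alpha>\<^sub>0" "((1 - euler_mascheroni)^2 + pi^2 / 6 - 1) / \<alpha>\<^sub>0^2" "euler_mascheroni / \<alpha>\<^sub>0" "pi^2 / (6 * \<alpha>\<^sub>0^2)"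
    by (rule mle_asymptotics_good) (simp add: E_def)
  have root: "\<forall>\<^sub>F n in sequentially. 0 < \<sigma> (r n) \<and> (\<forall>w\<in>E n. 0 < a n w \<and> profile_score (k n) (\<lambda>i. X n i w) (a n w) = 0
      \<and> s n w = \<sigma> (r n) * profile_scale (k n) (\<lambda>i. X n i w) (a n w))"
    using root_exists
  proof eventually_elim
    case (elim n)
    have "0 < a n w \<and> profile_score (k n) (\<lambda>i. X n i w) (a n w) = 0
      \<and> s n w = \<sigma> (r n) * profile_scale (k n) (\<lambda>i. X n i w) (a n w)" if w: "w \<in> E n" for w
    proof -
      have w': "w \<in> E' n" "w \<in> good n" using w by (auto simp: E_def)
      obtain b where b: "0 < b" "profile_score (k n) (\<lambda>i. X n i w) b = 0" using elim w'(2) by blast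
      have "(b, \<sigma> (r n) * profile_scale (k n) (\<lambda>i. X n i w) b) = (a n w, s n w)"
        using E'(3)[OF w'(1)] maximizer_iff_root[OF _ _ w'(2) b] elim by blast
      then show ?thesis using b by auto
    qed
    then show ?case using \<sigma>r_pos elim by blast
  qed
  have root': "\<forall>\<^sub>F b in sample_filter E. 0 < a (fst b) (snd b) \<and>
      profile_score (k (fst b)) (\<lambda>i. X (fst b) i (snd b)) (a (fst b) (snd b)) = 0"
    unfolding eventually_sample_filter using root by eventually_elim auto
  note ex = L.maximizer_expansion[where ah="\<lambda>b. a (fst b) (snd b)", OF root']
  have G: "vector [sqrt (real (k n)) * (log_power_mean (k n) (\<lambda>i. X n i w) 1 \<alpha>\<^sub>0 - - (1 - euler_mascheroni) / \<alpha>\<^sub>0),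
     sqrt (real (k n)) * (log_power_mean (k n) (\<lambda>i. X n i w) 0 \<alpha>\<^sub>0 - 1),
     sqrt (real (k n)) * (log_mean (k n) (\<lambda>i. X n i w) - euler_mascheroni / \<alpha>\<^sub>0)] = G n w" for n w
    unfolding G_def emp_proc_log_means ..
  show ?thesis
  proof (rule that[OF E])
    fix e :: real assume e: "0 < e"
    have 1: "\<forall>\<^sub>F n in sequentially. \<forall>w\<in>E n. \<bar>sqrt (real (k n)) * (a n w - \<alpha>\<^sub>0) - (M_mat \<alpha>\<^sub>0 *v G n w) $ 1\<bar> < e"
      using tendstoD[OF ex(1) e] unfolding eventually_sample_filter row_identities fst_conv snd_conv G dist_real_def by simp
    have 2: "\<forall>\<^sub>F n in sequentially. \<forall>w\<in>E n.
      \<bar>sqrt (real (k n)) * (profile_scale (k n) (\<lambda>i. X n i w) (a n w) - 1) - (M_mat \<alpha>\<^sub>0 *v G n w) $ 2\<bar> < e"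
      using tendstoD[OF ex(2) e] unfolding eventually_sample_filter row_identities(2) fst_conv snd_conv G dist_real_def by simp
    show "\<forall>\<^sub>F n in sequentially. \<forall>w\<in>E n.
       \<bar>sqrt (real (k n)) * (a n w - \<alpha>\<^sub>0) - (M_mat \<alpha>\<^sub>0 *v G n w) $ 1\<bar> < e \<and>
       \<bar>sqrt (real (k n)) * (s n w / \<sigma> (r n) - 1) - (M_mat \<alpha>\<^sub>0 *v G n w) $ 2\<bar> < e"
      using 1 2 root by eventually_elim auto
  qed
qed

lemma emp_proc_measurable:
  fixes f :: "real \<Rightarrow> real"
  assumes [measurable]: "f \<in> borel_measurable borel"
  shows "emp_proc \<xi> r k \<sigma> \<alpha>\<^sub>0 c n f \<in> borel_measurable M"
  unfolding emp_proc_def[abs_def] by measurable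

text \<open>The coefficients of \<open>f1 - f3\<close> and of \<open>f2\<close> in the linear combination of the rows of \<open>M_mat\<close> with
  weights \<open>s\<close> and \<open>t\<close>.\<close>

definition cf1 where "cf1 s t = 6 / pi^2 * (s * \<alpha>\<^sub>0^2 - t * (1 - euler_mascheroni))"
definition cf2 where "cf2 s t = 6 / pi^2 * (s * \<alpha>\<^sub>0 * (1 - euler_mascheroni) - t * (((1 - euler_mascheroni)^2 + pi^2 / 6) / \<alpha>\<^sub>0))"

definition direction where
  "direction s t x = cf1 s t * (f1 \<alpha>\<^sub>0 x - f3 x) + cf2 s t * f2 \<alpha>\<^sub>0 x"

lemma direction_eq: "direction s t = (\<lambda>x. cf1 s t * (f1 \<alpha>\<^sub>0 x - f3 x) + cf2 s t * f2 \<alpha>\<^sub>0 x)"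
  by (simp add: direction_def fun_eq_iff)

lemma rows_direction:
  "s * (M_mat \<alpha>\<^sub>0 *v vector [x, y, z]) $ 1 + t * (M_mat \<alpha>\<^sub>0 *v vector [x, y, z]) $ 2 = cf1 s t * (x - z) + cf2 s t * y"
  unfolding M_mat_mult cf1_def cf2_def using \<alpha>0_pos by (simp add: field_simps)

lemma admissible_direction: "admissible (direction s t)"
proof -
  have "admissible (\<lambda>x. cf1 s t * (1 * f1 \<alpha>\<^sub>0 x + (- 1) * f3 x) + cf2 s t * f2 \<alpha>\<^sub>0 x)"
    by (intro admissible_lincomb admissible_tests)
  then show ?thesis by (simp add: direction_eq)
qed

lemma frechet_integral_direction:
  "frechet_integral \<alpha>\<^sub>0 (direction s t) = cf1 s t * (frechet_integral \<alpha>\<^sub>0 (f1 \<alpha>\<^sub>0) - frechet_integral \<alpha>\<^sub>0 f3) + cf2 s t * frechet_integral \<alpha>\<^sub>0 (f2 \<alpha>\<^sub>0)"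
proof -
  have m: "f \<in> borel_measurable borel" if "admissible f" for f using that by (simp add: admissible_def)
  note I = admissible_frechet_integrable(1)
  show ?thesis
    using I[OF admissible_tests(1)] I[OF admissible_tests(2)] I[OF admissible_tests(3)]
    unfolding frechet_integral_eq[OF \<alpha>0_pos m[OF admissible_direction]] frechet_integral_eq[OF \<alpha>0_pos m[OF admissible_tests(1)]]
      frechet_integral_eq[OF \<alpha>0_pos m[OF admissible_tests(2)]] frechet_integral_eq[OF \<alpha>0_pos m[OF admissible_tests(3)]]
    unfolding direction_eq by simp
qed

lemma emp_proc_direction:
  "emp_proc \<xi> r k \<sigma> \<alpha>\<^sub>0 c n (direction s t) w = s * (M_mat \<alpha>\<^sub>0 *v G n w) $ 1 + t * (M_mat \<alpha>\<^sub>0 *v G n w) $ 2"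
  unfolding G_def rows_direction emp_proc_eq frechet_integral_direction
  by (simp add: direction_eq sum.distrib sum_subtractf sum_distrib_left[symmetric] add_divide_distrib diff_divide_distrib algebra_simps)

lemma bias_direction:
  "(\<lambda>n. sqrt (real (k n)) * (expectation (\<lambda>w. direction s t (X n 1 w)) - frechet_integral \<alpha>\<^sub>0 (direction s t)))
     \<longlonglongrightarrow> cf1 s t * (B (f1 \<alpha>\<^sub>0) - B f3) + cf2 s t * B (f2 \<alpha>\<^sub>0)"
proof (rule Lim_transform_eventually)
  define b where "b f n = sqrt (real (k n)) * (expectation (\<lambda>w. f (X n 1 w)) - frechet_integral \<alpha>\<^sub>0 f)" for f n
  have b: "b f \<longlonglongrightarrow> B f" if "f \<in> {f1 \<alpha>\<^sub>0, f2 \<alpha>\<^sub>0, f3}" for f unfolding b_def[abs_def] by (rule bias_X[OF that])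
  show "(\<lambda>n. cf1 s t * (b (f1 \<alpha>\<^sub>0) n - b f3 n) + cf2 s t * b (f2 \<alpha>\<^sub>0) n) \<longlonglongrightarrow> cf1 s t * (B (f1 \<alpha>\<^sub>0) - B f3) + cf2 s t * B (f2 \<alpha>\<^sub>0)"
    by (intro tendsto_intros b) auto
  show "\<forall>\<^sub>F n in sequentially. cf1 s t * (b (f1 \<alpha>\<^sub>0) n - b f3 n) + cf2 s t * b (f2 \<alpha>\<^sub>0) n
     = sqrt (real (k n)) * (expectation (\<lambda>w. direction s t (X n 1 w)) - frechet_integral \<alpha>\<^sub>0 (direction s t))"
    using admissible_square_integrable[OF admissible_tests(1)] admissible_square_integrable[OF admissible_tests(2)]
      admissible_square_integrable[OF admissible_tests(3)]
  proof eventually_elim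
    case (elim n)
    have i: "integrable M (\<lambda>w. f1 \<alpha>\<^sub>0 (X n 1 w))" "integrable M (\<lambda>w. f2 \<alpha>\<^sub>0 (X n 1 w))" "integrable M (\<lambda>w. f3 (X n 1 w))"
      using elim by auto
    have "expectation (\<lambda>w. direction s t (X n 1 w)) = cf1 s t * (expectation (\<lambda>w. f1 \<alpha>\<^sub>0 (X n 1 w)) - expectation (\<lambda>w. f3 (X n 1 w)))
      + cf2 s t * expectation (\<lambda>w. f2 \<alpha>\<^sub>0 (X n 1 w))"
      unfolding direction_eq using i by simp
    then show ?case unfolding frechet_integral_direction b_def by (simp only:) (simp add: algebra_simps)
  qed
qed

text \<open>The limiting variance in direction \<open>(s, t)\<close> is the quadratic form of \<open>I_inv\<close>.\<close>

lemma lim_var_direction: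
  "lim_var (direction s t) = 6 / pi^2 * \<alpha>\<^sub>0^2 * s^2 + 2 * (6 / pi^2 * (euler_mascheroni - 1)) * s * t
     + 6 / pi^2 * (((1 - euler_mascheroni)^2 + pi^2 / 6) / \<alpha>\<^sub>0^2) * t^2"
proof -
  have m: "direction s t \<in> borel_measurable borel" using admissible_direction[of s t] by (simp add: admissible_def)
  have m2: "(\<lambda>x. (direction s t x)^2) \<in> borel_measurable borel" using m by measurable
  have "lim_var (direction s t) = frechet_integral \<alpha>\<^sub>0 (\<lambda>x. (direction s t x)^2) - (frechet_integral \<alpha>\<^sub>0 (direction s t))^2"
    unfolding lim_var_def frechet_integral_eq[OF \<alpha>0_pos m] frechet_integral_eq[OF \<alpha>0_pos m2] ..
  also have "\<dots> = (cf1 s t)^2 * ((1 - euler_mascheroni)^2 + pi^2 / 6) / \<alpha>\<^sub>0^2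
      - 2 * cf1 s t * cf2 s t * (1 - euler_mascheroni) / \<alpha>\<^sub>0 + (cf2 s t)^2"
    unfolding direction_eq by (rule frechet_moments(5)[OF \<alpha>0_pos])
  finally have 1: "lim_var (direction s t) = (cf1 s t)^2 * ((1 - euler_mascheroni)^2 + pi^2 / 6) / \<alpha>\<^sub>0^2
      - 2 * cf1 s t * cf2 s t * (1 - euler_mascheroni) / \<alpha>\<^sub>0 + (cf2 s t)^2" .
  define h :: real where "h = 1 - euler_mascheroni"
  define V where "V = h^2 + pi^2 / 6"
  define q where "q = 6 / pi^2"
  have q: "q * (V - h^2) = 1" by (simp add: q_def V_def)
  have e: "euler_mascheroni - 1 = - h" by (simp add: h_def)
  have "(q * (s * \<alpha>\<^sub>0^2 - t * h))^2 * V / \<alpha>\<^sub>0^2 - 2 * (q * (s * \<alpha>\<^sub>0^2 - t * h)) * (q * (s * \<alpha>\<^sub>0 * h - t * (V / \<alpha>\<^sub>0))) * h / \<alpha>\<^sub>0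
     + (q * (s * \<alpha>\<^sub>0 * h - t * (V / \<alpha>\<^sub>0)))^2
     = q * (q * (V - h^2)) * (\<alpha>\<^sub>0^2 * s^2 - 2 * h * s * t + V / \<alpha>\<^sub>0^2 * t^2)"
    using \<alpha>0_pos by (simp add: field_simps) algebra
  then show ?thesis
    unfolding 1 cf1_def cf2_def h_def[symmetric] V_def[symmetric] q_def[symmetric] e q by (simp add: algebra_simps)
qed

end

section \<open>The limit law\<close>

lemma I_inv_eq: "I_inv a = vector [vector [6 / pi^2 * a^2, 6 / pi^2 * (euler_mascheroni - 1)],
    vector [6 / pi^2 * (euler_mascheroni - 1), 6 / pi^2 * (((1 - euler_mascheroni)^2 + pi^2 / 6) / a^2)]]"
  unfolding I_inv_def by (simp add: vec_eq_iff forall_2)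

context frechet_mle
begin

lemma direction_char:
  "(\<lambda>n. expectation (\<lambda>w. iexp (emp_proc \<xi> r k \<sigma> \<alpha>\<^sub>0 c n (direction s t) w)))
    \<longlonglongrightarrow> iexp (cf1 s t * (B (f1 \<alpha>\<^sub>0) - B f3) + cf2 s t * B (f2 \<alpha>\<^sub>0)) * exp (- lim_var (direction s t) / 2)"
proof (rule Lim_transform_eventually)
  define b where "b n = sqrt (real (k n)) * (expectation (\<lambda>w. direction s t (X n 1 w)) - frechet_integral \<alpha>\<^sub>0 (direction s t))" for n
  have "(\<lambda>n. iexp (b n)) \<longlonglongrightarrow> iexp (cf1 s t * (B (f1 \<alpha>\<^sub>0) - B f3) + cf2 s t * B (f2 \<alpha>\<^sub>0))"
    unfolding b_def by (intro tendsto_exp tendsto_mult tendsto_const tendsto_of_real bias_direction)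
  from tendsto_mult[OF this centered_sum_clt[OF admissible_direction[of s t]]]
  show "(\<lambda>n. iexp (b n) * expectation (\<lambda>w. iexp (centered_sum (direction s t) n {1..k n} w)))
    \<longlonglongrightarrow> iexp (cf1 s t * (B (f1 \<alpha>\<^sub>0) - B f3) + cf2 s t * B (f2 \<alpha>\<^sub>0)) * exp (- lim_var (direction s t) / 2)" .
  show "\<forall>\<^sub>F n in sequentially. iexp (b n) * expectation (\<lambda>w. iexp (centered_sum (direction s t) n {1..k n} w))
    = expectation (\<lambda>w. iexp (emp_proc \<xi> r k \<sigma> \<alpha>\<^sub>0 c n (direction s t) w))"
    using k_pos
  proof eventually_elim
    case (elim n)
    have "iexp (emp_proc \<xi> r k \<sigma> \<alpha>\<^sub>0 c n (direction s t) w) = iexp (b n) * iexp (centered_sum (direction s t) n {1..k n} w)" for w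
      unfolding emp_proc_decomposition[OF elim] b_def[symmetric] by (simp add: exp_add[symmetric] distrib_left add.commute)
    then show ?case by simp
  qed
qed

text \<open>The characteristic function of the estimation errors at \<open>(u, v)\<close> has the limit of the one of the
  empirical process at \<open>direction u v\<close>, which is the bivariate normal one.\<close>

theorem mle_limit:
  assumes as: "asymptotic_frechet_mle M k (\<lambda>n. block_max \<xi> (r n)) a s"
  defines "Z \<equiv> (\<lambda>n w. vector [sqrt (real (k n)) * (a n w - \<alpha>\<^sub>0), sqrt (real (k n)) * (s n w / \<sigma> (r n) - 1)] :: real^2)"
  shows "small_o_p M (\<lambda>n w. Z n w - M_mat \<alpha>\<^sub>0 *v G n w)"
    and "weak_conv_bounded (\<lambda>n. distr M borel (Z n))
            (normal_law (M_mat \<alpha>\<^sub>0 *v vector [B (f1 \<alpha>\<^sub>0), B (f2 \<alpha>\<^sub>0), B f3]) (I_inv \<alpha>\<^sub>0))"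
proof -
  obtain E where E: "\<And>n. E n \<in> events" "(\<lambda>n. prob (E n)) \<longlonglongrightarrow> 1"
    "\<And>e. 0 < e \<Longrightarrow> \<forall>\<^sub>F n in sequentially. \<forall>w\<in>E n.
       \<bar>sqrt (real (k n)) * (a n w - \<alpha>\<^sub>0) - (M_mat \<alpha>\<^sub>0 *v G n w) $ 1\<bar> < e \<and>
       \<bar>sqrt (real (k n)) * (s n w / \<sigma> (r n) - 1) - (M_mat \<alpha>\<^sub>0 *v G n w) $ 2\<bar> < e"
    using mle_expansion[OF as] by blast
  have [measurable]: "a n \<in> borel_measurable M" "s n \<in> borel_measurable M" for n
    using as by (auto simp: asymptotic_frechet_mle_def)
  show "small_o_p M (\<lambda>n w. Z n w - M_mat \<alpha>\<^sub>0 *v G n w)"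
    unfolding small_o_p_def
  proof (intro allI impI)
    fix e :: real assume e: "0 < e"
    have "(\<lambda>n. 1 - prob (E n)) \<longlonglongrightarrow> 1 - 1" by (intro tendsto_intros E)
    then have l: "(\<lambda>n. 1 - prob (E n)) \<longlonglongrightarrow> 0" by simp
    show "(\<lambda>n. prob {w\<in>space M. e < norm (Z n w - M_mat \<alpha>\<^sub>0 *v G n w)}) \<longlonglongrightarrow> 0"
    proof (rule Lim_null_comparison[OF _ l])
      have "0 < e / 2" using e by simp
      from E(3)[OF this] show "\<forall>\<^sub>F n in sequentially. norm (prob {w\<in>space M. e < norm (Z n w - M_mat \<alpha>\<^sub>0 *v G n w)}) \<le> 1 - prob (E n)"
      proof eventually_elim
        case (elim n)
        have "\<not> e < norm (Z n w - M_mat \<alpha>\<^sub>0 *v G n w)" if "w \<in> E n" for w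
        proof -
          have "norm (Z n w - M_mat \<alpha>\<^sub>0 *v G n w) \<le> \<bar>(Z n w - M_mat \<alpha>\<^sub>0 *v G n w) $ 1\<bar> + \<bar>(Z n w - M_mat \<alpha>\<^sub>0 *v G n w) $ 2\<bar>"
            using norm_le_l1_cart[of "Z n w - M_mat \<alpha>\<^sub>0 *v G n w"] by (simp add: sum_2)
          also have "\<dots> < e / 2 + e / 2" using elim that by (intro add_strict_mono) (auto simp: Z_def)
          finally show ?thesis by simp
        qed
        then have "{w\<in>space M. e < norm (Z n w - M_mat \<alpha>\<^sub>0 *v G n w)} \<subseteq> space M - E n" by auto
        then have "prob {w\<in>space M. e < norm (Z n w - M_mat \<alpha>\<^sub>0 *v G n w)} \<le> prob (space M - E n)"
          by (rule finite_measure_mono) (use E(1) in auto)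
        then show ?case using prob_compl[OF E(1)[of n]] by simp
      qed
    qed
  qed
  have Zm [measurable]: "Z n \<in> borel_measurable M" for n unfolding Z_def by measurable
  let ?h = "((1 - euler_mascheroni)^2 + pi^2 / 6) / \<alpha>\<^sub>0^2 :: real"
  have pos: "0 < 6 / pi^2 * ?h"
    using \<alpha>0_pos by (intro mult_pos_pos divide_pos_pos add_nonneg_pos) auto
  have det: "0 < (6 / pi^2 * \<alpha>\<^sub>0^2) * (6 / pi^2 * ?h) - (6 / pi^2 * (euler_mascheroni - 1))^2"
  proof -
    have "(6 / pi^2 * \<alpha>\<^sub>0^2) * (6 / pi^2 * ?h) = (6 / pi^2)^2 * ((1 - euler_mascheroni)^2 + pi^2 / 6)"
      using \<alpha>0_pos by (simp add: power2_eq_square)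
    moreover have "(6 / pi^2 * (euler_mascheroni - 1))^2 = (6 / pi^2)^2 * (1 - euler_mascheroni)^2"
      by (simp only: power_mult_distrib power2_commute)
    moreover have "0 < (6 / pi^2)^2 * (pi^2 / 6)" by simp
    ultimately show ?thesis by (simp only: distrib_left)
  qed
  note N = normal_law_real2[OF pos det, folded I_inv_eq]
  show "weak_conv_bounded (\<lambda>n. distr M borel (Z n))
            (normal_law (M_mat \<alpha>\<^sub>0 *v vector [B (f1 \<alpha>\<^sub>0), B (f2 \<alpha>\<^sub>0), B f3]) (I_inv \<alpha>\<^sub>0))"
  proof (rule weak_conv_bounded_real2I)
    show "prob_space (distr M borel (Z n))" for n by (rule prob_space_distr) measurable
    fix u v :: real
    define U where "U n w = u * (sqrt (real (k n)) * (a n w - \<alpha>\<^sub>0)) + v * (sqrt (real (k n)) * (s n w / \<sigma> (r n) - 1))" for n w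
    have [measurable]: "U n \<in> borel_measurable M" for n unfolding U_def[abs_def] by measurable
    have "(\<lambda>n. expectation (\<lambda>w. iexp (U n w))) \<longlonglongrightarrow> iexp (cf1 u v * (B (f1 \<alpha>\<^sub>0) - B f3) + cf2 u v * B (f2 \<alpha>\<^sub>0)) * exp (- lim_var (direction u v) / 2)"
    proof (rule iexp_expectation_perturb[OF _ _ E(1,2) _ direction_char])
      show "emp_proc \<xi> r k \<sigma> \<alpha>\<^sub>0 c n (direction u v) \<in> borel_measurable M" for n
        by (rule emp_proc_measurable) (use admissible_direction[of u v] in \<open>simp add: admissible_def\<close>)
      fix e :: real assume e: "0 < e"
      define d where "d = e / (\<bar>u\<bar> + \<bar>v\<bar> + 1)"
      have d: "0 < d" "(\<bar>u\<bar> + \<bar>v\<bar>) * d \<le> e" using e by (simp_all add: d_def field_simps add_nonneg_pos)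
      show "\<forall>\<^sub>F n in sequentially. \<forall>w\<in>E n. \<bar>U n w - emp_proc \<xi> r k \<sigma> \<alpha>\<^sub>0 c n (direction u v) w\<bar> \<le> e"
        using E(3)[OF d(1)]
      proof eventually_elim
        case (elim n)
        show ?case
        proof
          fix w assume w: "w \<in> E n"
          define x y where "x = sqrt (real (k n)) * (a n w - \<alpha>\<^sub>0) - (M_mat \<alpha>\<^sub>0 *v G n w) $ 1"
            and "y = sqrt (real (k n)) * (s n w / \<sigma> (r n) - 1) - (M_mat \<alpha>\<^sub>0 *v G n w) $ 2"
          have xy: "\<bar>x\<bar> < d" "\<bar>y\<bar> < d" using elim w unfolding x_def y_def by auto
          have "U n w - emp_proc \<xi> r k \<sigma> \<alpha>\<^sub>0 c n (direction u v) w = u * x + v * y"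
            unfolding emp_proc_direction U_def x_def y_def by (simp add: right_diff_distrib)
          also have "\<bar>\<dots>\<bar> \<le> \<bar>u\<bar> * \<bar>x\<bar> + \<bar>v\<bar> * \<bar>y\<bar>" using abs_triangle_ineq[of "u * x" "v * y"] by (simp add: abs_mult)
          also have "\<dots> \<le> \<bar>u\<bar> * d + \<bar>v\<bar> * d" using xy by (intro add_mono mult_left_mono) auto
          also have "\<dots> \<le> e" using d(2) by (simp add: distrib_right)
          finally show "\<bar>U n w - emp_proc \<xi> r k \<sigma> \<alpha>\<^sub>0 c n (direction u v) w\<bar> \<le> e" .
        qed
      qed
    qed measurable
    moreover have "(\<integral>x. iexp (u * x $ 1 + v * x $ 2) \<partial>distr M borel (Z n)) = expectation (\<lambda>w. iexp (U n w))" for n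
      by (subst integral_distr) (auto simp: Z_def U_def)
    ultimately show "(\<lambda>n. \<integral>x. iexp (u * x $ 1 + v * x $ 2) \<partial>distr M borel (Z n))
      \<longlonglongrightarrow> (\<integral>x. iexp (u * x $ 1 + v * x $ 2) \<partial>normal_law (M_mat \<alpha>\<^sub>0 *v vector [B (f1 \<alpha>\<^sub>0), B (f2 \<alpha>\<^sub>0), B f3]) (I_inv \<alpha>\<^sub>0))"
      unfolding N(3) rows_direction lim_var_direction by simp
  qed (simp_all add: N)
qed

end

theorem theorem3p6:
  fixes M :: "'a measure" and \<xi> :: "int \<Rightarrow> 'a \<Rightarrow> real"
    and r k :: "nat \<Rightarrow> nat" and \<sigma> :: "nat \<Rightarrow> real"
    and \<alpha>\<^sub>0 \<omega> \<nu> c :: real and B :: "(real \<Rightarrow> real) \<Rightarrow> real"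
  assumes prob: "prob_space M"
    and rv: "\<And>t. \<xi> t \<in> borel_measurable M"
    and stat: "strictly_stationary M \<xi>"
    and r_pos: "\<And>n. n \<ge> 1 \<Longrightarrow> r n > 0"
    and k_def: "\<And>n. k n = n div r n"
    and r_lim: "filterlim r at_top sequentially"
    and k_lim: "filterlim k at_top sequentially"
    \<comment> \<open>(a) domain of attraction\<close>
    and \<sigma>_pos: "\<And>n. n \<ge> 1 \<Longrightarrow> \<sigma> n > 0"
    and \<sigma>_lim: "filterlim \<sigma> at_top sequentially"
    and \<alpha>0_pos: "\<alpha>\<^sub>0 > 0"
    and doa: "weak_conv_m (\<lambda>n. distr M borel (\<lambda>w. block_max \<xi> n 1 w / \<sigma> n)) (frechet \<alpha>\<^sub>0 1)"
    and \<sigma>_reg: "\<And>m :: nat \<Rightarrow> nat. (\<lambda>n. real (m n) / real n) \<longlonglongrightarrow> 1 \<Longrightarrow>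
                  (\<lambda>n. \<sigma> (m n) / \<sigma> n) \<longlonglongrightarrow> 1"
    \<comment> \<open>(b) all block maxima diverge\<close>
    and diverge: "\<And>b. b > 0 \<Longrightarrow>
      (\<lambda>n. measure M {w \<in> space M. Min ((\<lambda>i. block_max \<xi> (r n) i w) ` {1..k n}) \<le> b})
        \<longlonglongrightarrow> 0"
    \<comment> \<open>(c) mixing with rate\<close>
    and mixing: "mixing_coeff M \<xi> \<longlonglongrightarrow> 0"
    and \<omega>_pos: "\<omega> > 0"
    and mixing_rate: "(\<lambda>n. real (k n) powr (1 + \<omega>) * mixing_coeff M \<xi> (r n)) \<longlonglongrightarrow> 0"
    \<comment> \<open>(d) moments\<close>
    and \<nu>_gt: "\<nu> > 2 / \<omega>"
    and moments: "limsup (\<lambda>n. \<integral>\<^sup>+ w. ennreal (g_mom \<nu> \<alpha>\<^sub>0 (max (block_max \<xi> n 1 w) 1 / \<sigma> n)) \<partial>M) < \<infinity>"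
    \<comment> \<open>(e) bias\<close>
    and c_pos: "c > 0"
    and bias: "\<And>f. f \<in> {f1 \<alpha>\<^sub>0, f2 \<alpha>\<^sub>0, f3} \<Longrightarrow>
      (\<lambda>n. sqrt (real (k n)) *
             ((\<integral>w. f (max (block_max \<xi> (r n) 1 w) c / \<sigma> (r n)) \<partial>M) - frechet_integral \<alpha>\<^sub>0 f))
        \<longlonglongrightarrow> B f"
  shows "(\<exists>a s. asymptotic_frechet_mle M k (\<lambda>n. block_max \<xi> (r n)) a s) \<and>
    (\<forall>a s. asymptotic_frechet_mle M k (\<lambda>n. block_max \<xi> (r n)) a s \<longrightarrow>
      (let Z = (\<lambda>n w. vector [sqrt (real (k n)) * (a n w - \<alpha>\<^sub>0),
                              sqrt (real (k n)) * (s n w / \<sigma> (r n) - 1)] :: real^2);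
           G = (\<lambda>n w. vector [emp_proc \<xi> r k \<sigma> \<alpha>\<^sub>0 c n (f1 \<alpha>\<^sub>0) w,
                              emp_proc \<xi> r k \<sigma> \<alpha>\<^sub>0 c n (f2 \<alpha>\<^sub>0) w,
                              emp_proc \<xi> r k \<sigma> \<alpha>\<^sub>0 c n f3 w] :: real^3)
       in small_o_p M (\<lambda>n w. Z n w - M_mat \<alpha>\<^sub>0 *v G n w) \<and>
          weak_conv_bounded (\<lambda>n. distr M borel (Z n))
            (normal_law (M_mat \<alpha>\<^sub>0 *v vector [B (f1 \<alpha>\<^sub>0), B (f2 \<alpha>\<^sub>0), B f3]) (I_inv \<alpha>\<^sub>0))))"
proof -
  interpret frechet_mle M \<xi> r k \<sigma> \<alpha>\<^sub>0 \<omega> \<nu> c B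
    by (intro frechet_mle.intro frechet_block_maxima.intro frechet_block_maxima_axioms.intro frechet_mle_axioms.intro)
      (fact prob rv stat r_pos r_lim k_lim \<sigma>_pos \<sigma>_lim \<alpha>0_pos doa mixing \<omega>_pos mixing_rate \<nu>_gt moments c_pos diverge bias)+
  show ?thesis
    using mle_exists mle_limit[unfolded G_def[abs_def]] unfolding Let_def by blast
qed

end
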